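(* Let $\Omega\subset\mathbb{R}^n$ be an open set. Assume that $W\in C^\infty(GL(\mathbb{R}^n),\mathbb{R})$ satisfies $W(RX)=W(X)$ for all $X\in GL(\mathbb{R}^n)$ and all $R\in O(\mathbb{R}^n)$, and let $T(X)=X^\ast DW(X)-W(X)I$ be the associated energy-momentum mapping. Then for every $\phi\in W^{1,\infty}(\Omega,\mathbb{R}^n)$ such that $D\phi(x)\in \operatorname{int}\operatorname{co} O(\mathbb{R}^n)$ for almost every $x\in\Omega$, the Dirichlet problem $$\operatorname{div} T(Du(x))=0 \ \text{ in } \Omega,\qquad u(x)=\phi(x)\ \text{ for } x\in\partial\Omega,$$ has infinitely many solutions $u\in W^{1,\infty}(\Omega,\mathbb{R}^n)$, which can be taken to be nowhere $C^1$.
   Context: $\mathcal{L}(\mathbb{R}^n)$ is the space of linear maps $\mathbb{R}^n\to\mathbb{R}^n$ with inner product $\langle X,Y\rangle=\operatorname{tr}(X^\ast Y)$, $X^\ast$ is the transpose of $X$, $I$ is the identity map, $GL(\mathbb{R}^n)=\{X\in\mathcal{L}(\mathbb{R}^n):\det X\neq 0\}$, and $O(\mathbb{R}^n)=\{X\in\mathcal{L}(\mathbb{R}^n): X^\ast X=I\}$. $DW(X)\in\mathcal{L}(\mathbb{R}^n)$ is the gradient of $W$ at $X$ with respect to this inner product. $\operatorname{co}$ denotes the convex hull and $\operatorname{int}$ the interior in $\mathcal{L}(\mathbb{R}^n)$; $\operatorname{co}O(\mathbb{R}^n)=\{X\in\mathcal{L}(\mathbb{R}^n):X^\ast X\le I\}$.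 The equation $\operatorname{div}T(Du)=0$ (the energy-momentum equations) is understood in the weak sense: $Du(x)\in GL(\mathbb{R}^n)$ for a.e. $x\in\Omega$ (so that $T(Du(x))$ is defined a.e.) and $\int_\Omega\langle T(Du(x)),D\lambda(x)\rangle\,dx=0$ for all $\lambda\in C_0^\infty(\Omega,\mathbb{R}^n)$. "Nowhere $C^1$" means that there is no nonempty open subset of $\Omega$ on which $u$ is $C^1$. *)

theory Defs
  imports "HOL-Analysis.Analysis"
begin

text \<open>
  Linear maps of \<open>\<real>\<^sup>n\<close> are represented by matrices of type \<open>real ^ 'n ^ 'n\<close>. The inner product that
  HOL-Analysis puts on this type (hence also its norm and topology) is the trace inner product:
\<close>

lemma inner_matrix_eq_trace:
  fixes X Y :: "real ^ 'n ^ 'n"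
  shows "inner X Y = trace (transpose X ** Y)"
proof -
  have "inner X Y = (\<Sum>i\<in>UNIV. \<Sum>j\<in>UNIV. X $ i $ j * Y $ i $ j)"
    by (simp add: inner_vec_def)
  also have "\<dots> = (\<Sum>j\<in>UNIV. \<Sum>i\<in>UNIV. X $ i $ j * Y $ i $ j)"
    by (rule sum.swap)
  also have "\<dots> = trace (transpose X ** Y)"
    by (simp add: trace_def matrix_matrix_mult_def transpose_def)
  finally show ?thesis .
qed

definition GL_maps :: "(real ^ 'n ^ 'n) set"
  where "GL_maps = {X. det X \<noteq> 0}"

definition O_maps :: "(real ^ 'n ^ 'n) set"
  where "O_maps = {X. transpose X ** X = mat 1}"

text \<open>
  Classes \<open>C\<^sup>k\<close> and \<open>C\<^sup>\<infinity>\<close> on a set \<open>S\<close>. Derivatives are two-sided, so these are meant for open \<open>S\<close>;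
  values of \<open>f\<close> outside \<open>S\<close> are irrelevant then.
\<close>

fun Ck_on :: "nat \<Rightarrow> ('a::euclidean_space \<Rightarrow> 'b::real_normed_vector) \<Rightarrow> 'a set \<Rightarrow> bool" where
  "Ck_on 0 f S \<longleftrightarrow> continuous_on S f"
| "Ck_on (Suc k) f S \<longleftrightarrow>
     (\<forall>x\<in>S. f differentiable (at x)) \<and> (\<forall>v. Ck_on k (\<lambda>x. frechet_derivative f (at x) v) S)"

definition Cinfinity_on :: "('a::euclidean_space \<Rightarrow> 'b::real_normed_vector) \<Rightarrow> 'a set \<Rightarrow> bool"
  where "Cinfinity_on f S \<longleftrightarrow> (\<forall>k. Ck_on k f S)"

definition gradient :: "('a::real_inner \<Rightarrow> real) \<Rightarrow> 'a \<Rightarrow> 'a"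
  where "gradient f x = (THE D. GDERIV f x :> D)"

definition energy_momentum :: "(real ^ 'n ^ 'n \<Rightarrow> real) \<Rightarrow> real ^ 'n ^ 'n \<Rightarrow> real ^ 'n ^ 'n"
  where "energy_momentum W X = transpose X ** gradient W X - W X *\<^sub>R mat 1"

text \<open>
  \<open>C\<^sub>0\<^sup>\<infinity>(\<Omega>)\<close>: smooth functions with compact support in \<open>\<Omega>\<close>, extended by zero.
\<close>

definition test_functions ::
    "('a::euclidean_space) set \<Rightarrow> ('a \<Rightarrow> 'b::real_normed_vector) set"
  where "test_functions \<Omega> =
    {f. Cinfinity_on f UNIV \<and> (\<exists>K. compact K \<and> K \<subseteq> \<Omega> \<and> (\<forall>x. x \<notin> K \<longrightarrow> f x = 0))}"

text \<open>
  Elements of \<open>L\<^sup>\<infinity>(\<Omega>)\<close> and \<open>W\<^sup>1\<^sup>,\<^sup>\<infinity>(\<Omega>)\<close> are represented by total functions. Every notion below depends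
  only on the equivalence class of the function modulo equality almost everywhere in \<open>\<Omega>\<close>.
\<close>

definition L_infinity ::
    "('a::euclidean_space) set \<Rightarrow> ('a \<Rightarrow> 'b::euclidean_space) set"
  where "L_infinity \<Omega> =
    {f. f \<in> borel_measurable (lebesgue_on \<Omega>) \<and> (\<exists>C. AE x in lebesgue_on \<Omega>. norm (f x) \<le> C)}"

definition locally_integrable_on ::
    "('a::euclidean_space \<Rightarrow> 'b::euclidean_space) \<Rightarrow> 'a set \<Rightarrow> bool"
  where "locally_integrable_on f \<Omega> \<longleftrightarrow>
    (\<forall>K. compact K \<and> K \<subseteq> \<Omega> \<longrightarrow> f absolutely_integrable_on K)"

text \<open>
  \<open>Du\<close> is the weak derivative of \<open>u\<close>, with \<open>Du x $ i $ j\<close> the weak partial derivative of the \<open>i\<close>-th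
  component in direction \<open>j\<close>.
\<close>

definition weak_derivative ::
    "(real ^ 'n) set \<Rightarrow> (real ^ 'n \<Rightarrow> real ^ 'n) \<Rightarrow> (real ^ 'n \<Rightarrow> real ^ 'n ^ 'n) \<Rightarrow> bool"
  where "weak_derivative \<Omega> u Du \<longleftrightarrow>
    locally_integrable_on u \<Omega> \<and> locally_integrable_on Du \<Omega> \<and>
    (\<forall>\<psi>\<in>test_functions \<Omega>. \<forall>i j.
       (LINT x|lebesgue_on \<Omega>. u x $ i * frechet_derivative \<psi> (at x) (axis j 1)) =
       - (LINT x|lebesgue_on \<Omega>. Du x $ i $ j * \<psi> x))"

definition W1_infinity :: "(real ^ 'n) set \<Rightarrow> (real ^ 'n \<Rightarrow> real ^ 'n) set"
  where "W1_infinity \<Omega> =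
    {u. u \<in> L_infinity \<Omega> \<and> (\<exists>Du. weak_derivative \<Omega> u Du \<and> Du \<in> L_infinity \<Omega>)}"

text \<open>
  Weak solutions of \<open>div T(Du) = 0\<close>. Since \<open>T(Du)\<close> need not be locally bounded, the existence of the
  integrals is part of the requirement, as expressed by \<open>has_bochner_integral\<close>.
\<close>

definition energy_momentum_solution ::
    "(real ^ 'n) set \<Rightarrow> (real ^ 'n ^ 'n \<Rightarrow> real) \<Rightarrow> (real ^ 'n \<Rightarrow> real ^ 'n) \<Rightarrow> bool"
  where "energy_momentum_solution \<Omega> W u \<longleftrightarrow>
    (\<exists>Du. weak_derivative \<Omega> u Du \<and>
       (AE x in lebesgue_on \<Omega>. Du x \<in> GL_maps) \<and>
       (\<forall>\<eta>\<in>test_functions \<Omega>.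
          has_bochner_integral (lebesgue_on \<Omega>)
            (\<lambda>x. inner (energy_momentum W (Du x)) (jacobian \<eta> (at x))) 0))"

text \<open>
  \<open>u = v\<close> on the boundary of \<open>\<Omega>\<close>. For an arbitrary open set, functions in \<open>W\<^sup>1\<^sup>,\<^sup>\<infinity>(\<Omega>)\<close> need not extend
  continuously to the closure, so the condition is that \<open>u - v\<close> has a representative that extends
  continuously by zero to the boundary. If \<open>u\<close> and \<open>v\<close> themselves have continuous extensions to the
  closure, this is the pointwise equality of these extensions on the boundary.
\<close>

definition equal_on_boundary ::
    "(real ^ 'n) set \<Rightarrow> (real ^ 'n \<Rightarrow> real ^ 'n) \<Rightarrow> (real ^ 'n \<Rightarrow> real ^ 'n) \<Rightarrow> bool"
  where "equal_on_boundary \<Omega> u v \<longleftrightarrow>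
    (\<exists>w. continuous_on (closure \<Omega>) w \<and>
       (AE x in lebesgue_on \<Omega>. w x = u x - v x) \<and>
       (\<forall>x\<in>frontier \<Omega>. w x = 0))"

text \<open>
  \<open>u\<close> being \<open>C\<^sup>1\<close> on \<open>V\<close> means having a representative that is \<open>C\<^sup>1\<close> there.
\<close>

definition nowhere_C1 :: "(real ^ 'n) set \<Rightarrow> (real ^ 'n \<Rightarrow> real ^ 'n) \<Rightarrow> bool"
  where "nowhere_C1 \<Omega> u \<longleftrightarrow>
    \<not> (\<exists>V g. open V \<and> V \<noteq> {} \<and> V \<subseteq> \<Omega> \<and> Ck_on 1 g V \<and> (AE x in lebesgue_on V. u x = g x))"

end

theory Submission
  imports Defs
begin

text \<open>
  By frame indifference the energy-momentum mapping \<open>T\<close> is constant on the orthogonal group. A Lipschitz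
  map whose gradient is orthogonal almost everywhere therefore solves the equations, because a constant
  field is divergence free in the weak sense, and it remains to solve \<open>Du \<in> O_maps\<close> with boundary data \<open>\<phi>\<close>.

  The map \<open>\<phi>\<close> is a strict contraction to first order at almost every point. Extending short maps
  from small sets by Kirszbraun's theorem, one approximates \<open>\<phi>\<close>, with an error controlled by
  the distance to the boundary, by a short map that is affine with strictly contractive gradient near almost
  every point. On small polytopes one then adds to an affine piece with gradient \<open>A\<close> a tent in a fixed direction \<open>f\<close>.
  If \<open>e\<close> is a direction of minimal stretch of \<open>A\<close> and \<open>f\<close> is the direction of \<open>A e\<close>, the new gradients
  \<open>A - f \<otimes> c\<close>, with \<open>c\<close> close to a multiple of \<open>e\<close>, stretch \<open>e\<close> almost isometrically. This reduces
  the deficit \<open>n - |A|\<^sup>2\<close> by a fixed factor, and \<open>A\<close> is the mean of the new gradients, so their variance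
  is at most the old deficit. Iterating, the gradients converge in \<open>L\<^sup>1\<close> locally to a gradient with deficit
  zero, which is orthogonal.

  The limit agrees on the boundary of every polytope with the affine piece there, and each polytope of
  one generation contains pieces of the next whose gradients differ by at least \<open>1\<close>; hence the limit is
  nowhere \<open>C\<^sup>1\<close>. Letting the total size of the tents tend to zero yields infinitely many solutions.
\<close>

section \<open>Extension of short maps\<close>

text \<open>Strong convergence of the gradients is the crux: a weak limit would only lie in the
  convex hull of \<open>O_maps\<close>, where all the approximations lie anyway. It rests on |A - f
  c|^2 = |A|^2 - 2 a (e . c) + |c|^2 for the rank one change with slope c. The linear term has mean
  zero over a tent and the new deficits are nonnegative, so the mean of |c|^2 is at most the old
  deficit. The decay factor is 1 - 1/(2n): the least stretch a satisfies n (1 - a^2) \<ge> deficit,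
  so repairing one direction gains at least deficit / n, and half of that is given up to keep the
  new gradients strictly contractive and the base of the tent bounded. Strict contraction is what
  permits the next tent, but no uniform constant is asked for. The data are as weak: strictness
  holds pointwise almost everywhere, for a map that is short only along segments inside \<Omega>.
  Therefore extension theorems are applied on balls only, and all changes are measured against a
  capped distance \<open>bdist\<close> to the complement, which keeps the boundary values for an
  arbitrary open set.\<close>

lemma convex_hull_separation_direction:
  fixes y :: "'b::euclidean_space"
  assumes "finite S" "y \<notin> convex hull S"
  obtains d where "\<And>z. z \<in> S \<Longrightarrow> d \<bullet> (z - y) > 0"
proof -
  have "closed (convex hull S)"
    using assms(1) by (simp add: finite_imp_compact_convex_hull compact_imp_closed)
  then obtain a b where ab: "a \<bullet> y < b" "\<And>x. x \<in> convex hull S \<Longrightarrow> a \<bullet> x > b"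
    using separating_hyperplane_closed_point[of "convex hull S" y] assms(2)
    by (metis convex_convex_hull)
  have "a \<bullet> (z - y) > 0" if "z \<in> S" for z
    using ab(1) ab(2)[OF hull_inc[OF that]] by (simp add: inner_diff_right)
  then show ?thesis using that by blast
qed

text \<open>Minimise over \<open>q\<close> the largest of the differences |q - y_i|^2 - |p - x_i|^2.
  At a minimiser, \<open>q\<close> lies in the convex hull of the active points \<open>y i\<close>,
  since otherwise a separating direction would lower all active terms at once. Summing over pairs of
  active points with the convex weights then forces the minimum to be \<le> 0.\<close>

lemma finite_ball_intersection_transfer:
  fixes x :: "'i \<Rightarrow> 'a::euclidean_space" and y :: "'i \<Rightarrow> 'b::euclidean_space"
  assumes fin: "finite I" and ne: "I \<noteq> {}"
    and short: "\<And>i j. i \<in> I \<Longrightarrow> j \<in> I \<Longrightarrow> norm (y i - y j) \<le> norm (x i - x j)"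
  shows "\<exists>q. \<forall>i\<in>I. norm (q - y i) \<le> norm (p - x i)"
proof -
  define h where "h i z = (norm (z - y i))\<^sup>2 - (norm (p - x i))\<^sup>2" for i z
  define G where "G z = Max ((\<lambda>i. h i z) ` I)" for z
  have hc: "continuous_on UNIV (h i)" for i
    unfolding h_def by (intro continuous_intros)
  have Gle: "h i z \<le> G z" if "i \<in> I" for i z
    unfolding G_def using that fin by auto
  have Gin: "\<exists>i\<in>I. G z = h i z" for z
    using Max_in[of "(\<lambda>i. h i z) ` I"] fin ne unfolding G_def by (metis (no_types, lifting) finite_imageI image_iff image_is_empty)
  obtain k where k: "k \<in> I" using ne by blast
  \<comment> \<open>Outside this ball the single term \<open>h k\<close> already exceeds
    \<open>G (y k)\<close>, so a minimiser over the compact ball is a global one.\<close>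
  define R where "R = sqrt (G (y k) + (norm (p - x k))\<^sup>2)"
  let ?K = "cball (y k) R"
  have R2: "G (y k) + (norm (p - x k))\<^sup>2 \<ge> 0"
    using Gle[OF k, of "y k"] by (simp add: h_def)
  then have "y k \<in> ?K" by (simp add: R_def)
  have Gc: "continuous_on UNIV G"
  proof -
    have "continuous_on UNIV (\<lambda>z. Max ((\<lambda>i. h i z) ` J))" if "finite J" "J \<noteq> {}" for J
      using that
    proof (induction J rule: finite_ne_induct)
      case (insert j J)
      then show ?case
        using hc by (simp add: continuous_on_max)
    qed (use hc in simp)
    then show ?thesis unfolding G_def using fin ne by blast
  qed
  obtain q where q: "q \<in> ?K" "\<And>z. z \<in> ?K \<Longrightarrow> G q \<le> G z"
    using continuous_attains_inf[of ?K G] \<open>y k \<in> ?K\<close> Gc continuous_on_subset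
    by (metis compact_cball empty_iff subset_UNIV)
  have qmin: "G q \<le> G z" for z
  proof (cases "z \<in> ?K")
    case False
    then have "R < norm (z - y k)" by (simp add: dist_norm norm_minus_commute)
    moreover have "0 \<le> R" using R2 by (simp add: R_def)
    ultimately have "R\<^sup>2 < (norm (z - y k))\<^sup>2" by (simp add: power_strict_mono)
    then have "G (y k) < h k z" using R2 by (simp add: R_def h_def)
    then show ?thesis using Gle[OF k, of z] q(2)[OF \<open>y k \<in> ?K\<close>] by linarith
  qed (use q in auto)
  have "G q \<le> 0"
  proof (rule ccontr)
    assume "\<not> G q \<le> 0"
    define J where "J = {i \<in> I. h i q = G q}"
    have J: "finite J" "J \<subseteq> I" using fin by (auto simp: J_def)
    have hull: "q \<in> convex hull (y ` J)"
    proof (rule ccontr)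
      assume "q \<notin> convex hull (y ` J)"
      then obtain d where d: "\<And>z. z \<in> y ` J \<Longrightarrow> d \<bullet> (z - q) > 0"
        using convex_hull_separation_direction[of "y ` J" q] J(1) by blast
      \<comment> \<open>Active terms have the negative slope -2 d . (y_i - q) along
        \<open>d\<close>; inactive ones stay below \<open>G q\<close> by continuity.\<close>
      have ev: "\<forall>\<^sub>F t in at_right 0. h i (q + t *\<^sub>R d) < G q" if i: "i \<in> I" for i
      proof (cases "i \<in> J")
        case True
        let ?c = "d \<bullet> (y i - q)"
        have c: "?c > 0" using d True by blast
        have hh: "h i (q + t *\<^sub>R d) = G q - t * (2 * ?c - t * (d \<bullet> d))" for t
        proof -
          have "h i q = G q" using True by (simp add: J_def)
          then have "G q = (norm (q - y i))\<^sup>2 - (norm (p - x i))\<^sup>2" by (simp add: h_def)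
          moreover have "(norm ((q - y i) + t *\<^sub>R d))\<^sup>2 =
              (norm (q - y i))\<^sup>2 + 2 * t * (d \<bullet> (q - y i)) + t * t * (d \<bullet> d)"
            unfolding power2_norm_eq_inner
            by (simp add: inner_add_left inner_add_right inner_commute algebra_simps)
          moreover have "(q - y i) + t *\<^sub>R d = q + t *\<^sub>R d - y i"
            "d \<bullet> (q - y i) = - ?c" by (auto simp: inner_diff_right)
          ultimately show ?thesis unfolding h_def by (simp add: right_diff_distrib)
        qed
        have "((\<lambda>t. 2 * ?c - t * (d \<bullet> d)) \<longlongrightarrow> 2 * ?c - 0 * (d \<bullet> d)) (at_right 0)"
          by (intro tendsto_intros)
        from order_tendstoD(1)[OF this, of 0] have "\<forall>\<^sub>F t in at_right 0. 0 < 2 * ?c - t * (d \<bullet> d)"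
          using c by simp
        then show ?thesis
          using eventually_at_right_less[of 0]
        proof eventually_elim
          case (elim t)
          then have "0 < t * (2 * ?c - t * (d \<bullet> d))" by (intro mult_pos_pos)
          then show ?case using hh[of t] by linarith
        qed
      next
        case False
        then have less: "h i q < G q" using Gle[OF i, of q] i by (auto simp: J_def)
        have "((\<lambda>t. h i (q + t *\<^sub>R d)) \<longlongrightarrow> h i (q + 0 *\<^sub>R d)) (at_right 0)"
          unfolding h_def by (intro tendsto_intros)
        from order_tendstoD(2)[OF this, of "G q"] show ?thesis using less by simp
      qed
      then have "\<forall>\<^sub>F t in at_right 0. \<forall>i\<in>I. h i (q + t *\<^sub>R d) < G q"
        using fin by (simp add: eventually_ball_finite_distrib)
      then obtain t where "\<forall>i\<in>I. h i (q + t *\<^sub>R d) < G q"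
        using eventually_happens'[OF trivial_limit_at_right_real] by blast
      then have "G (q + t *\<^sub>R d) < G q" using Gin[of "q + t *\<^sub>R d"] by auto
      then show False using qmin[of "q + t *\<^sub>R d"] by linarith
    qed
    define Z where "Z = y ` J"
    obtain l where l: "\<And>z. z \<in> Z \<Longrightarrow> 0 \<le> l z" "sum l Z = 1" "(\<Sum>z\<in>Z. l z *\<^sub>R z) = q"
      using hull J(1) by (auto simp: convex_hull_finite Z_def)
    have "\<forall>z\<in>Z. \<exists>i. i \<in> J \<and> y i = z" by (auto simp: Z_def)
    then obtain k where k: "\<And>z. z \<in> Z \<Longrightarrow> k z \<in> J \<and> y (k z) = z" by metis
    define u where "u z = z - q" for z
    define v where "v z = x (k z) - p" for z
    have uz: "(\<Sum>z\<in>Z. l z *\<^sub>R u z) = 0"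
      using l by (simp add: u_def scaleR_diff_right sum_subtractf flip: scaleR_sum_left)
    \<comment> \<open>At active indices |u z|^2 - |v z|^2 equals \<open>G q\<close>. Expanding |u z
      - u w| \<le> |v z - v w| therefore leaves a bound on the mixed products alone.\<close>
    have ineq: "u z \<bullet> u w \<ge> G q + v z \<bullet> v w" if "z \<in> Z" "w \<in> Z" for z w
    proof -
      have 1: "u z \<bullet> u z - v z \<bullet> v z = G q" if "z \<in> Z" for z
      proof -
        have "h (k z) q = G q" "y (k z) = z" using k[OF that] by (auto simp: J_def)
        then show ?thesis
          by (simp add: h_def u_def v_def norm_minus_commute flip: power2_norm_eq_inner)
      qed
      have "norm (u z - u w) \<le> norm (v z - v w)"
        using short[of "k z" "k w"] k[OF that(1)] k[OF that(2)] J(2) by (auto simp: u_def v_def)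
      then have "(norm (u z - u w))\<^sup>2 \<le> (norm (v z - v w))\<^sup>2" by (simp add: power_mono)
      then show ?thesis using 1[OF that(1)] 1[OF that(2)]
        by (simp add: power2_norm_eq_inner inner_diff_left inner_diff_right inner_commute)
    qed
    have sq: "(\<Sum>z\<in>Z. l z *\<^sub>R w z) \<bullet> (\<Sum>z\<in>Z. l z *\<^sub>R w z) = (\<Sum>z\<in>Z. \<Sum>z'\<in>Z. l z * l z' * (w z \<bullet> w z'))"
      for w :: "'b \<Rightarrow> 'c::euclidean_space"
      by (simp add: inner_sum_left inner_sum_right sum_distrib_left inner_commute mult.left_commute mult.assoc)
    \<comment> \<open>The weights sum to 1, so \<open>G q\<close> can be spread over all pairs; the
      added square is nonnegative, and the corresponding square for \<open>u\<close> vanishes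
      because \<open>q\<close> is the barycentre.\<close>
    have "G q \<le> (\<Sum>z\<in>Z. l z) * (\<Sum>w\<in>Z. l w) * G q + (\<Sum>z\<in>Z. l z *\<^sub>R v z) \<bullet> (\<Sum>w\<in>Z. l w *\<^sub>R v w)"
      using l(2) by simp
    also have "\<dots> = (\<Sum>z\<in>Z. \<Sum>w\<in>Z. l z * l w * G q) + (\<Sum>z\<in>Z. \<Sum>w\<in>Z. l z * l w * (v z \<bullet> v w))"
      unfolding sq sum_product by (simp only: sum_distrib_right)
    also have "\<dots> = (\<Sum>z\<in>Z. \<Sum>w\<in>Z. l z * l w * (G q + v z \<bullet> v w))"
      by (simp add: distrib_left sum.distrib)
    also have "\<dots> \<le> (\<Sum>z\<in>Z. \<Sum>w\<in>Z. l z * l w * (u z \<bullet> u w))"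
      using l(1) ineq by (intro sum_mono mult_left_mono) auto
    also have "\<dots> = 0" using sq[of u] uz by simp
    finally show False using \<open>\<not> G q \<le> 0\<close> by simp
  qed
  then have "norm (q - y i) \<le> norm (p - x i)" if "i \<in> I" for i
  proof -
    have "(norm (q - y i))\<^sup>2 \<le> (norm (p - x i))\<^sup>2"
      using Gle[OF that, of q] \<open>G q \<le> 0\<close> unfolding h_def by linarith
    then show ?thesis by (rule power2_le_imp_le) simp
  qed
  then show ?thesis by blast
qed

text \<open>Closed balls are compact, so the finite case passes to arbitrary \<open>S\<close> by the
  finite intersection property. The ball belonging to \<open>s\<close> is kept in every intersection
  to supply a compact set.\<close>

lemma short_extension_point:
  fixes f :: "'a::euclidean_space \<Rightarrow> 'b::euclidean_space"
  assumes short: "\<And>x y. x \<in> S \<Longrightarrow> y \<in> S \<Longrightarrow> norm (f x - f y) \<le> norm (x - y)"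
  shows "\<exists>q. \<forall>x\<in>S. norm (q - f x) \<le> norm (p - x)"
proof (cases "S = {}")
  case False
  then obtain s where s: "s \<in> S" by blast
  let ?B = "\<lambda>x. cball (f x) (norm (p - x))"
  have "?B s \<inter> (\<Inter>x\<in>S. ?B x) \<noteq> {}"
  proof (rule compact_imp_fip_image)
    fix I assume I: "finite I" "I \<subseteq> S"
    obtain q where "\<forall>i\<in>insert s I. norm (q - f i) \<le> norm (p - i)"
      using finite_ball_intersection_transfer[of "insert s I" f id p] short I s by auto
    then have "q \<in> ?B s \<inter> (\<Inter>x\<in>I. ?B x)"
      by (auto simp: dist_norm norm_minus_commute)
    then show "?B s \<inter> (\<Inter>x\<in>I. ?B x) \<noteq> {}" by blast
  qed auto
  then obtain q where "\<forall>x\<in>S. q \<in> ?B x" by blast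
  then show ?thesis by (auto simp: dist_norm norm_minus_commute intro!: exI[of _ q])
qed auto

text \<open>Zorn's lemma on short extensions, encoded as sets of pairs: unions of chains are then
  immediate, and the inequality itself makes such a relation single valued. A maximal one is total
  because \<open>short_extension_point\<close> can adjoin any further point.\<close>

theorem Kirszbraun:
  fixes f :: "'a::euclidean_space \<Rightarrow> 'b::euclidean_space"
  assumes short: "\<And>x y. x \<in> S \<Longrightarrow> y \<in> S \<Longrightarrow> norm (f x - f y) \<le> norm (x - y)"
  obtains g where "\<And>x. x \<in> S \<Longrightarrow> g x = f x" "\<And>x y. norm (g x - g y) \<le> norm (x - y)"
proof -
  define P where "P r \<longleftrightarrow> (\<forall>a\<in>r. \<forall>b\<in>r. norm (snd a - snd b) \<le> norm (fst a - fst b))"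
    for r :: "('a \<times> 'b) set"
  define r0 where "r0 = (\<lambda>x. (x, f x)) ` S"
  have "\<exists>M\<in>{r. r0 \<subseteq> r \<and> P r}. \<forall>X\<in>{r. r0 \<subseteq> r \<and> P r}. M \<subseteq> X \<longrightarrow> X = M"
  proof (rule subset_Zorn_nonempty)
    have "r0 \<in> {r. r0 \<subseteq> r \<and> P r}" using short by (auto simp: r0_def P_def)
    then show "{r. r0 \<subseteq> r \<and> P r} \<noteq> {}" by blast
  next
    fix C assume C: "C \<noteq> {}" "subset.chain {r. r0 \<subseteq> r \<and> P r} C"
    have "norm (snd a - snd b) \<le> norm (fst a - fst b)" if ab: "a \<in> \<Union>C" "b \<in> \<Union>C" for a b
    proof -
      obtain r1 r2 where r: "a \<in> r1" "b \<in> r2" "r1 \<in> C" "r2 \<in> C" using ab by blast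
      then have "r1 \<subseteq> r2 \<or> r2 \<subseteq> r1" "P r1" "P r2"
        using C(2) by (auto simp: subset_chain_def)
      then show ?thesis using r by (auto simp: P_def)
    qed
    moreover obtain r where "r \<in> C" using C(1) by blast
    with C(2) have "r0 \<subseteq> \<Union>C" unfolding subset_chain_def by (metis (mono_tags, lifting) Union_upper mem_Collect_eq order.trans subsetD)
    ultimately show "\<Union>C \<in> {r. r0 \<subseteq> r \<and> P r}" by (simp add: P_def)
  qed
  then obtain M where M0: "M \<in> {r. r0 \<subseteq> r \<and> P r}"
      "\<forall>X\<in>{r. r0 \<subseteq> r \<and> P r}. M \<subseteq> X \<longrightarrow> X = M"
    by (rule bexE)
  then have M: "r0 \<subseteq> M" "P M" by simp_all
  have Mmax: "X = M" if "r0 \<subseteq> X" "P X" "M \<subseteq> X" for X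
    using that M0(2) by simp
  have uniq: "y = z" if "(x, y) \<in> M" "(x, z) \<in> M" for x y z
    using M(2) that by (force simp: P_def)
  define g where "g x = (THE y. (x, y) \<in> M)" for x
  have g: "g x = y" if "(x, y) \<in> M" for x y
    unfolding g_def using that uniq by blast
  have ex: "\<exists>y. (p, y) \<in> M" for p
  proof -
    have "norm (g x - g y) \<le> norm (x - y)" if "x \<in> fst ` M" "y \<in> fst ` M" for x y
      using that g M(2) by (force simp: P_def)
    then obtain q where q: "\<forall>x\<in>fst ` M. norm (q - g x) \<le> norm (p - x)"
      using short_extension_point by metis
    have *: "norm (q - b) \<le> norm (p - a)" if "(a, b) \<in> M" for a b
      using q g that by force
    have "P (insert (p, q) M)"
      using M(2) * by (auto simp: P_def norm_minus_commute)
    then have "insert (p, q) M = M" using M0(1) by (intro Mmax) auto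
    then show ?thesis by blast
  qed
  show ?thesis
  proof
    show "g x = f x" if "x \<in> S" for x using that M(1) g by (auto simp: r0_def)
    show "norm (g x - g y) \<le> norm (x - y)" for x y
    proof -
      obtain a b where ab: "(x, a) \<in> M" "(y, b) \<in> M" using ex by metis
      then show ?thesis using g M(2) by (force simp: P_def)
    qed
  qed
qed

section \<open>Smooth bump functions\<close>

text \<open>The exponent \<open>m\<close> makes the family closed under differentiation up to linear
  combinations, so smoothness at 0 needs only the single limit
  \<open>flat_tendsto_0\<close>.\<close>

definition flat :: "nat \<Rightarrow> real \<Rightarrow> real"
  where "flat m t = (if t > 0 then exp (- 1 / t) / t ^ m else 0)"

lemma flat_nonneg: "flat m t \<ge> 0"
  by (simp add: flat_def)

lemma flat_pos: "t > 0 \<Longrightarrow> flat m t > 0"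
  by (simp add: flat_def)

lemma flat_tendsto_0: "(flat m \<longlongrightarrow> 0) (at 0)"
proof -
  have "((\<lambda>t. (inverse t) ^ m / exp (inverse t)) \<longlongrightarrow> 0) (at_right (0::real))"
    by (rule filterlim_compose[OF tendsto_power_div_exp_0 filterlim_inverse_at_top_right])
  then have "(flat m \<longlongrightarrow> 0) (at_right 0)"
    by (rule Lim_transform_eventually)
       (use eventually_at_right_less[of "0::real"] in
         \<open>eventually_elim; simp add: flat_def exp_minus divide_simps power_inverse\<close>)
  moreover have "(flat m \<longlongrightarrow> 0) (at_left 0)"
    by (rule Lim_transform_eventually[OF tendsto_const])
       (auto simp: flat_def eventually_at_filter)
  ultimately show ?thesis by (simp add: filterlim_split_at_real)
qed

lemma flat_has_derivative:
  "(flat m has_real_derivative flat (m + 2) t - m * flat (m + 1) t) (at t)"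
proof -
  consider "t > 0" | "t < 0" | "t = 0" by linarith
  then show ?thesis
  proof cases
    case 1
    have "((\<lambda>t. exp (- 1 / t) / t ^ m) has_real_derivative flat (m + 2) t - m * flat (m + 1) t) (at t)"
    proof -
      have "((\<lambda>t. exp (- 1 / t)) has_real_derivative exp (- 1 / t) / t\<^sup>2) (at t)"
        using 1 by (auto intro!: derivative_eq_intros simp: power2_eq_square)
      from DERIV_divide[OF this DERIV_pow[of m t]] 1
      have "((\<lambda>t. exp (- 1 / t) / t ^ m) has_real_derivative
        (exp (- 1 / t) / t\<^sup>2 * t ^ m - exp (- 1 / t) * (real m * t ^ (m - Suc 0))) / (t ^ m * t ^ m)) (at t)"
        by simp
      moreover have "(exp (- 1 / t) / t\<^sup>2 * t ^ m - exp (- 1 / t) * (real m * t ^ (m - Suc 0))) / (t ^ m * t ^ m)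
          = flat (m + 2) t - m * flat (m + 1) t"
      proof -
        have "real m * t ^ (m - Suc 0) = real m * (t ^ m / t)" using 1 by (cases m) auto
        moreover have "(E / t\<^sup>2 * P - E * (c * (P / t))) / (P * P) = E / (P * t\<^sup>2) - c * (E / (P * t))"
          if "P \<noteq> 0" for E P c :: real
          using that 1 by (simp add: field_simps power2_eq_square)
        ultimately show ?thesis
          using 1 by (simp only: flat_def if_True power_add power2_eq_square power_one_right DERIV_pow) (simp add: power2_eq_square)
      qed
      ultimately show ?thesis by simp
    qed
    then show ?thesis
      by (rule has_field_derivative_transform_within_open[where S = "{0<..}"])
         (use 1 in \<open>auto simp: flat_def\<close>)
  next
    case 2
    have "((\<lambda>t. 0) has_real_derivative 0) (at t)" by simp
    then have "(flat m has_real_derivative 0) (at t)"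
      by (rule has_field_derivative_transform_within_open[where S = "{..<0}"])
         (use 2 in \<open>auto simp: flat_def\<close>)
    then show ?thesis using 2 by (simp add: flat_def)
  next
    case 3
    have "((\<lambda>y. (flat m y - flat m 0) / (y - 0)) \<longlongrightarrow> 0) (at 0)"
      by (rule Lim_transform_eventually[OF flat_tendsto_0[of "m + 1"]])
         (auto simp: flat_def eventually_at_filter)
    then show ?thesis using 3 by (simp add: has_field_derivative_iff flat_def)
  qed
qed

text \<open>A class of functions on the whole space that is closed under directional derivatives;
  smoothness of bumps is then an induction in which no higher derivative is computed.\<close>

inductive_set flat_algebra :: "('a::euclidean_space \<Rightarrow> real) set" where
  const: "(\<lambda>x. c) \<in> flat_algebra"
| inner: "(\<lambda>x. x \<bullet> v) \<in> flat_algebra"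
| flat: "(\<lambda>x. flat m (1 - s * ((x - a) \<bullet> (x - a)))) \<in> flat_algebra"
| add: "f \<in> flat_algebra \<Longrightarrow> g \<in> flat_algebra \<Longrightarrow> (\<lambda>x. f x + g x) \<in> flat_algebra"
| mult: "f \<in> flat_algebra \<Longrightarrow> g \<in> flat_algebra \<Longrightarrow> (\<lambda>x. f x * g x) \<in> flat_algebra"

lemma flat_algebra_derivative:
  assumes "f \<in> flat_algebra"
  shows "\<exists>f'. (\<forall>x. (f has_derivative f' x) (at x)) \<and> (\<forall>v. (\<lambda>x. f' x v) \<in> flat_algebra)"
  using assms
proof induction
  case (const c)
  show ?case by (rule exI[of _ "\<lambda>x v. 0"]) (auto intro: flat_algebra.intros)
next
  case (inner w)
  have "((\<lambda>x. x \<bullet> w) has_derivative (\<lambda>v. v \<bullet> w)) (at x)" for x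
    by (auto intro!: derivative_eq_intros)
  then show ?case
    by (intro exI[of _ "\<lambda>x v. v \<bullet> w"]) (auto intro: flat_algebra.intros)
next
  case (flat m s a)
  let ?q = "\<lambda>x. 1 - s * ((x - a) \<bullet> (x - a))"
  let ?D = "\<lambda>x v. (flat (m + 2) (?q x) + (- real m) * flat (m + 1) (?q x)) * (x \<bullet> ((- 2 * s) *\<^sub>R v) + 2 * s * (a \<bullet> v))"
  have "((\<lambda>x. flat m (?q x)) has_derivative ?D x) (at x)" for x
  proof -
    have q: "(?q has_derivative (\<lambda>v. x \<bullet> ((- 2 * s) *\<^sub>R v) + 2 * s * (a \<bullet> v))) (at x)"
      by (auto intro!: derivative_eq_intros simp: inner_commute inner_diff_left inner_diff_right right_diff_distrib left_diff_distrib)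
    show ?thesis
      using has_derivative_compose[OF q has_field_derivative_imp_has_derivative[OF flat_has_derivative[of m "?q x"]]]
      by simp
  qed
  moreover have "(\<lambda>x. ?D x v) \<in> flat_algebra" for v
    by (intro flat_algebra.intros)
  ultimately show ?case by (intro exI[of _ ?D]) blast
next
  case (add f g)
  then obtain f' g' where "\<forall>x. (f has_derivative f' x) (at x)" "\<forall>v. (\<lambda>x. f' x v) \<in> flat_algebra"
     "\<forall>x. (g has_derivative g' x) (at x)" "\<forall>v. (\<lambda>x. g' x v) \<in> flat_algebra" by blast
  then show ?case
    by (intro exI[of _ "\<lambda>x v. f' x v + g' x v"]) (auto intro: flat_algebra.intros has_derivative_add)
next
  case (mult f g)
  then obtain f' g' where "\<forall>x. (f has_derivative f' x) (at x)" "\<forall>v. (\<lambda>x. f' x v) \<in> flat_algebra"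
     "\<forall>x. (g has_derivative g' x) (at x)" "\<forall>v. (\<lambda>x. g' x v) \<in> flat_algebra" by blast
  then show ?case using mult.hyps
    by (intro exI[of _ "\<lambda>x v. f x * g' x v + f' x v * g x"]) (auto intro!: flat_algebra.add flat_algebra.mult intro: has_derivative_mult)
qed

lemma flat_algebra_continuous: "f \<in> flat_algebra \<Longrightarrow> continuous_on S f"
  using flat_algebra_derivative[of f] by (blast intro: continuous_at_imp_continuous_on has_derivative_continuous)

lemma flat_algebra_Ck_on: "f \<in> flat_algebra \<Longrightarrow> Ck_on k f UNIV"
proof (induction k arbitrary: f)
  case 0
  then show ?case by (simp add: flat_algebra_continuous)
next
  case (Suc k)
  then obtain f' where f': "\<forall>x. (f has_derivative f' x) (at x)" "\<forall>v. (\<lambda>x. f' x v) \<in> flat_algebra"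
    using flat_algebra_derivative by blast
  then have "frechet_derivative f (at x) = f' x" for x
    by (metis frechet_derivative_at)
  then show ?case using f' Suc.IH by (auto simp: differentiable_def)
qed

text \<open>The standard mollifier exp (-1 / (1 - |x - a|^2 / r^2)), left unnormalised and written
  through \<open>flat\<close> so that it belongs to \<open>flat_algebra\<close>.\<close>

definition bump :: "'a::euclidean_space \<Rightarrow> real \<Rightarrow> 'a \<Rightarrow> real"
  where "bump a r x = flat 0 (1 - (1 / r\<^sup>2) * ((x - a) \<bullet> (x - a)))"

lemma bump_in_flat_algebra: "bump a r \<in> flat_algebra"
  unfolding bump_def by (rule flat_algebra.flat)

lemma bump_nonneg: "bump a r x \<ge> 0"
  by (simp add: bump_def flat_nonneg)

lemma bump_pos_iff: "r > 0 \<Longrightarrow> bump a r x > 0 \<longleftrightarrow> norm (x - a) < r"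
proof -
  assume "r > 0"
  then have "1 - (1 / r\<^sup>2) * ((x - a) \<bullet> (x - a)) > 0 \<longleftrightarrow> (norm (x - a))\<^sup>2 < r\<^sup>2"
    by (simp add: power2_norm_eq_inner pos_divide_less_eq)
  also have "\<dots> \<longleftrightarrow> norm (x - a) < r"
    using power_strict_mono[of "norm (x - a)" r 2] power2_less_imp_less[of "norm (x - a)" r] \<open>r > 0\<close>
    by (metis less_imp_le norm_ge_zero zero_less_numeral)
  finally show ?thesis by (auto simp: bump_def flat_def)
qed

lemma bump_eq_0_iff: "r > 0 \<Longrightarrow> bump a r x = 0 \<longleftrightarrow> norm (x - a) \<ge> r"
  using bump_pos_iff[of r a x] bump_nonneg[of a r x] by linarith

lemma bump_le_1: "bump a r x \<le> 1"
  by (simp add: bump_def flat_def)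

lemma bump_shift: "bump a r (x + b) = bump (a - b) r x"
  by (simp add: bump_def algebra_simps)

lemma continuous_bump: "continuous_on S (bump a r)"
  by (rule flat_algebra_continuous[OF bump_in_flat_algebra])

lemma bump_Cinfinity: "Cinfinity_on (bump a r) UNIV"
  by (simp add: Cinfinity_on_def flat_algebra_Ck_on bump_in_flat_algebra)

lemma bump_test_function:
  assumes "r > 0" "cball a r \<subseteq> \<Omega>"
  shows "bump a r \<in> test_functions \<Omega>"
  using assms bump_Cinfinity bump_eq_0_iff[OF assms(1), of a]
  by (auto simp: test_functions_def dist_norm norm_minus_commute intro!: exI[of _ "cball a r"])

section \<open>Short maps and packings\<close>

text \<open>Only points joined by a segment inside \<open>S\<close> are compared: on a nonconvex
  open set a gradient bound by 1 yields no more, and this is the property that gluing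
  preserves.\<close>

definition short_on :: "'a::euclidean_space set \<Rightarrow> ('a \<Rightarrow> 'b::euclidean_space) \<Rightarrow> bool"
  where "short_on S u \<longleftrightarrow> (\<forall>x y. closed_segment x y \<subseteq> S \<longrightarrow> norm (u x - u y) \<le> norm (x - y))"

lemma short_onD: "short_on S u \<Longrightarrow> closed_segment x y \<subseteq> S \<Longrightarrow> norm (u x - u y) \<le> norm (x - y)"
  by (simp add: short_on_def)

lemma short_on_subset: "short_on S u \<Longrightarrow> T \<subseteq> S \<Longrightarrow> short_on T u"
  by (meson short_on_def subset_trans)

lemma short_on_convex:
  "convex S \<Longrightarrow> short_on S u \<longleftrightarrow> (\<forall>x\<in>S. \<forall>y\<in>S. norm (u x - u y) \<le> norm (x - y))"
  by (auto simp: short_on_def closed_segment_subset)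

lemma norm_closed_segment_split:
  fixes x y p :: "'a::euclidean_space"
  assumes "p \<in> closed_segment x y"
  shows "norm (x - y) = norm (x - p) + norm (p - y)"
  using assms unfolding between_mem_segment[symmetric] between by (simp add: dist_norm)

lemma closed_segment_split_subset:
  fixes x y p :: "'a::euclidean_space"
  assumes "p \<in> closed_segment x y"
  shows "closed_segment x p \<subseteq> closed_segment x y" "closed_segment p y \<subseteq> closed_segment x y"
  using assms by (auto simp: subset_closed_segment)

lemma segment_exit_point:
  fixes x y :: "'a::euclidean_space"
  assumes "closed C" "x \<in> C" "y \<notin> C"
  obtains p where "p \<in> closed_segment x y" "p \<in> C" "p \<in> frontier C"
proof -
  have "closed_segment x y \<inter> frontier C \<noteq> {}"
    by (rule connected_Int_frontier) (use assms in auto)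
  then show ?thesis using that assms(1) by (metis Int_iff equals0I frontier_subset_closed subsetD)
qed

text \<open>The segment from \<open>x\<close> to \<open>y\<close> is cut at a point \<open>p\<close>
  where it leaves the piece containing \<open>x\<close>, and the part from \<open>y\<close> to
  \<open>p\<close> at a point \<open>q\<close> where it leaves the piece containing
  \<open>y\<close>. Near the ends \<open>u\<close> is short by assumption, between \<open>q\<close>
  and \<open>p\<close> only values of \<phi> enter, and the three lengths add up. Infinitely many
  accumulating pieces do no harm, since at most two of them are looked at.\<close>

lemma short_on_glue:
  fixes u \<phi> :: "'a::euclidean_space \<Rightarrow> 'b::euclidean_space"
  assumes \<phi>: "short_on S \<phi>"
    and cl: "\<And>C. C \<in> \<C> \<Longrightarrow> closed C"
    and disj: "\<And>C D. C \<in> \<C> \<Longrightarrow> D \<in> \<C> \<Longrightarrow> C \<noteq> D \<Longrightarrow> C \<inter> D = {}"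
    and short: "\<And>C x y. C \<in> \<C> \<Longrightarrow> x \<in> C \<Longrightarrow> y \<in> C \<Longrightarrow> norm (u x - u y) \<le> norm (x - y)"
    and fr: "\<And>C x. C \<in> \<C> \<Longrightarrow> x \<in> frontier C \<Longrightarrow> u x = \<phi> x"
    and off: "\<And>x. x \<notin> \<Union>\<C> \<Longrightarrow> u x = \<phi> x"
  shows "short_on S u"
  unfolding short_on_def
proof (intro allI impI)
  fix x y assume seg: "closed_segment x y \<subseteq> S"
  show "norm (u x - u y) \<le> norm (x - y)"
  proof (cases "\<exists>C\<in>\<C>. x \<in> C \<and> y \<in> C")
    case False
    have exit: "\<exists>p\<in>closed_segment x y. norm (u x - \<phi> p) \<le> norm (x - p) \<and> (x \<in> \<Union>\<C> \<longrightarrow> (\<exists>C\<in>\<C>. x \<in> C \<and> p \<in> C)) \<and> (x \<notin> \<Union>\<C> \<longrightarrow> p = x)"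
      if "\<not> (\<exists>C\<in>\<C>. x \<in> C \<and> y \<in> C)" for x y
    proof (cases "x \<in> \<Union>\<C>")
      case True
      then obtain C where C: "C \<in> \<C>" "x \<in> C" by blast
      then have "y \<notin> C" using that by blast
      then obtain p where p: "p \<in> closed_segment x y" "p \<in> C" "p \<in> frontier C"
        using segment_exit_point cl[OF C(1)] C(2) by blast
      have "norm (u x - \<phi> p) \<le> norm (x - p)"
        using short[OF C(1) C(2) p(2)] fr[OF C(1) p(3)] by simp
      then show ?thesis using p C True by blast
    next
      case False
      then show ?thesis using off[OF False] by (intro bexI[of _ x]) auto
    qed
    obtain p where p: "p \<in> closed_segment x y" "norm (u x - \<phi> p) \<le> norm (x - p)"
      "x \<in> \<Union>\<C> \<Longrightarrow> \<exists>C\<in>\<C>. x \<in> C \<and> p \<in> C" "x \<notin> \<Union>\<C> \<Longrightarrow> p = x"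
      using exit[OF False] by blast
    \<comment> \<open>A piece containing both \<open>y\<close> and \<open>p\<close> would by
      disjointness be the piece of \<open>x\<close>, or would contain \<open>x\<close> =
      \<open>p\<close>; both are excluded. Hence the exit argument applies again, from
      \<open>y\<close> towards \<open>p\<close>.\<close>
    have "\<not> (\<exists>C\<in>\<C>. y \<in> C \<and> p \<in> C)"
    proof
      assume "\<exists>C\<in>\<C>. y \<in> C \<and> p \<in> C"
      then obtain C where C: "C \<in> \<C>" "y \<in> C" "p \<in> C" by blast
      show False
      proof (cases "x \<in> \<Union>\<C>")
        case True
        then obtain D where D: "D \<in> \<C>" "x \<in> D" "p \<in> D" using p(3) by blast
        then have "C = D" using disj[of C D] C by blast
        then show False using False C D by blast
      next
        case False
        then show False using p(4) C by blast
      qed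
    qed
    from exit[OF this] obtain q where q: "q \<in> closed_segment y p" "norm (u y - \<phi> q) \<le> norm (y - q)"
      by blast
    have "closed_segment q p \<subseteq> S"
      using closed_segment_split_subset[OF p(1)] closed_segment_split_subset[OF q(1)] seg
      by (metis closed_segment_commute order.trans)
    then have pq: "norm (\<phi> q - \<phi> p) \<le> norm (q - p)" using short_onD[OF \<phi>] by blast
    have "u x - u y = (u x - \<phi> p) - (u y - \<phi> q) - (\<phi> q - \<phi> p)" by simp
    then have "norm (u x - u y) \<le> norm (u x - \<phi> p) + norm (u y - \<phi> q) + norm (\<phi> q - \<phi> p)"
      by (metis (no_types, lifting) add_mono_thms_linordered_semiring(3) norm_triangle_ineq4 order.trans)
    also have "\<dots> \<le> norm (x - p) + norm (y - q) + norm (q - p)"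
      using p(2) q(2) pq by linarith
    also have "\<dots> = norm (x - y)"
      using norm_closed_segment_split[OF p(1)] norm_closed_segment_split[OF q(1)]
      by (simp add: norm_minus_commute)
    finally show ?thesis .
  qed (use short in blast)
qed

section \<open>Homothetic cells and packings of open sets\<close>

definition cell :: "'a set \<Rightarrow> 'a \<times> real \<Rightarrow> 'a::real_vector set"
  where "cell K p = (\<lambda>x. snd p *\<^sub>R x + fst p) ` K"

lemma cell_cball: "r > 0 \<Longrightarrow> cell (cball 0 1) (a, r) = cball (a::'a::euclidean_space) r"
proof -
  assume "r > 0"
  have "y \<in> cell (cball 0 1) (a, r)" if "norm (y - a) \<le> r" for y
    using that \<open>r > 0\<close> unfolding cell_def
    by (intro image_eqI[of _ _ "(1 / r) *\<^sub>R (y - a)"]) (auto simp: divide_simps)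
  moreover have "norm (y - a) \<le> r" if "y \<in> cell (cball 0 1) (a, r)" for y
    using that \<open>r > 0\<close> by (auto simp: cell_def mult_left_le)
  ultimately show ?thesis by (auto simp: dist_norm norm_minus_commute)
qed

lemma compact_cell: "compact K \<Longrightarrow> compact (cell K (p :: 'a::euclidean_space \<times> real))"
  unfolding cell_def by (intro compact_continuous_image continuous_intros)

lemma measure_cell: "measure lebesgue (cell K p) = \<bar>snd p\<bar> ^ DIM('a) * measure lebesgue K"
  for p :: "'a::euclidean_space \<times> real"
  unfolding cell_def by (rule measure_lebesgue_affine)

lemma measure_disjoint_finite_UN:
  assumes "finite F" "\<And>p. p \<in> F \<Longrightarrow> f p \<in> lmeasurable"
    and "\<And>p q. p \<in> F \<Longrightarrow> q \<in> F \<Longrightarrow> p \<noteq> q \<Longrightarrow> f p \<inter> f q = {}"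
  shows "measure lebesgue (\<Union>p\<in>F. f p) = (\<Sum>p\<in>F. measure lebesgue (f p :: 'a::euclidean_space set))"
proof (rule measure_negligible_finite_Union_image[OF assms(1,2)])
  show "pairwise (\<lambda>x y. negligible (f x \<inter> f y)) F"
    using assms(3) by (auto simp: pairwise_def)
qed

lemma open_ball_packing:
  fixes H :: "'a::euclidean_space set"
  assumes "open H" and \<rho>: "\<And>x. x \<in> H \<Longrightarrow> \<rho> x > 0"
  obtains C where "countable C" "\<And>a r. (a, r) \<in> C \<Longrightarrow> 0 < r \<and> r < \<rho> a \<and> a \<in> H \<and> cball a r \<subseteq> H"
    "\<And>p q. p \<in> C \<Longrightarrow> q \<in> C \<Longrightarrow> p \<noteq> q \<Longrightarrow> cball (fst p) (snd p) \<inter> cball (fst q) (snd q) = {}"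
    "negligible (H - (\<Union>p\<in>C. cball (fst p) (snd p)))"
proof -
  define K where "K = {(a, r). 0 < r \<and> r < \<rho> a \<and> a \<in> H \<and> cball a r \<subseteq> H}"
  have 1: "\<exists>i. i \<in> K \<and> x \<in> cball (fst i) (snd i) \<and> snd i < d" if "x \<in> H" "d > 0" for x d
  proof -
    obtain e where e: "e > 0" "cball x e \<subseteq> H" using assms(1) \<open>x \<in> H\<close> by (meson open_contains_cball)
    define r where "r = min e (min (d/2) (\<rho> x / 2))"
    have "r > 0" "r < d" "r < \<rho> x" "r \<le> e" using e \<rho>[OF \<open>x \<in> H\<close>] \<open>d > 0\<close> by (auto simp: r_def min_def)
    moreover have "cball x r \<subseteq> H" using \<open>r \<le> e\<close> e(2) by force
    ultimately show ?thesis using \<open>x \<in> H\<close> by (intro exI[of _ "(x, r)"]) (auto simp: K_def)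
  qed
  have 2: "\<And>i. i \<in> K \<Longrightarrow> 0 < snd i" by (auto simp: K_def)
  obtain C where C: "countable C" "C \<subseteq> K"
     "pairwise (\<lambda>i j. disjnt (cball (fst i) (snd i)) (cball (fst j) (snd j))) C"
     "negligible (H - (\<Union>i \<in> C. cball (fst i) (snd i)))"
    by (rule Vitali_covering_theorem_cballs[of K snd H fst, OF 2 1]) (assumption | rule that)+
  show ?thesis
    by (rule that[OF C(1) _ _ C(4)]) (use C(2,3) in \<open>auto simp: K_def pairwise_def disjnt_def\<close>)
qed

text \<open>Giving up a fraction 1 - c of the measure makes the family finite. Its union is then
  closed, so the remainder is open again and the packing can be iterated.\<close>

lemma finite_ball_packing:
  fixes H :: "'a::euclidean_space set"
  assumes "open H" "bounded H" and \<rho>: "\<And>x. x \<in> H \<Longrightarrow> \<rho> x > 0" and c: "0 \<le> c" "c < 1"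
  obtains F where "finite F" "\<And>a r. (a, r) \<in> F \<Longrightarrow> 0 < r \<and> r < \<rho> a \<and> a \<in> H \<and> cball a r \<subseteq> H"
    "\<And>p q. p \<in> F \<Longrightarrow> q \<in> F \<Longrightarrow> p \<noteq> q \<Longrightarrow> cball (fst p) (snd p) \<inter> cball (fst q) (snd q) = {}"
    "c * measure lebesgue H \<le> (\<Sum>p\<in>F. measure lebesgue (cball (fst p) (snd p)))"
proof (cases "measure lebesgue H = 0")
  case True
  then show ?thesis by (intro that[of "{}"]) auto
next
  case False
  then have pos: "measure lebesgue H > 0" by (simp add: zero_less_measure_iff)
  have Hm: "H \<in> lmeasurable" using assms by (simp add: lmeasurable_open)
  obtain C where C: "countable C" "\<And>a r. (a, r) \<in> C \<Longrightarrow> 0 < r \<and> r < \<rho> a \<and> a \<in> H \<and> cball a r \<subseteq> H"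
    "\<And>p q. p \<in> C \<Longrightarrow> q \<in> C \<Longrightarrow> p \<noteq> q \<Longrightarrow> cball (fst p) (snd p) \<inter> cball (fst q) (snd q) = {}"
    "negligible (H - (\<Union>p\<in>C. cball (fst p) (snd p)))"
    by (rule open_ball_packing[OF assms(1) \<rho>]) (assumption | rule that)+
  let ?b = "\<lambda>p::'a \<times> real. cball (fst p) (snd p)"
  have sub: "?b p \<subseteq> H" if "p \<in> C" for p using C(2)[of "fst p" "snd p"] that by simp
  have "\<Union>(?b ` C) \<subseteq> H" using sub by blast
  have meq: "measure lebesgue (\<Union>(?b ` C)) = measure lebesgue H"
  proof (rule measure_negligible_symdiff)
    show "H \<in> lmeasurable" by (rule Hm)
    show "negligible (H - \<Union> (?b ` C) \<union> (\<Union> (?b ` C) - H))"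
      using C(4) by (rule negligible_subset) (use \<open>\<Union>(?b ` C) \<subseteq> H\<close> in blast)
  qed
  have c1: "countable (?b ` C)" using C(1) by simp
  have c2: "(1 - c) * measure lebesgue H > 0" using pos c by simp
  have c3: "d \<in> lmeasurable" if "d \<in> ?b ` C" for d using that by auto
  have c4: "measure lebesgue (\<Union> D') \<le> measure lebesgue H" if "D' \<subseteq> ?b ` C" "finite D'" for D'
  proof (rule measure_mono_fmeasurable[OF _ _ Hm])
    show "\<Union>D' \<subseteq> H" using that sub by blast
    show "\<Union>D' \<in> sets lebesgue" using that by (intro sets.finite_Union) auto
  qed
  obtain D' where D': "D' \<subseteq> ?b ` C" "finite D'"
    "measure lebesgue (\<Union>(?b ` C)) - (1 - c) * measure lebesgue H < measure lebesgue (\<Union>D')"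
    by (rule measure_countable_Union_approachable[OF c1 c2 c3 c4]) (assumption | rule that)+
  then have D'3: "c * measure lebesgue H < measure lebesgue (\<Union>D')"
    unfolding meq by (simp add: algebra_simps)
  obtain F where F: "F \<subseteq> C" "finite F" "D' = ?b ` F"
    using finite_subset_image[OF D'(2,1)] by blast
  have "measure lebesgue (\<Union>D') = (\<Sum>p\<in>F. measure lebesgue (?b p))"
    unfolding F(3)
  proof (rule measure_disjoint_finite_UN[OF F(2)])
    show "?b p \<inter> ?b q = {}" if "p \<in> F" "q \<in> F" "p \<noteq> q" for p q
      using C(3) F(1) that by blast
  qed simp
  with D'3 have cF: "c * measure lebesgue H \<le> (\<Sum>p\<in>F. measure lebesgue (?b p))" by linarith
  show ?thesis
  proof (rule that[OF F(2)])
    show "0 < r \<and> r < \<rho> a \<and> a \<in> H \<and> cball a r \<subseteq> H" if "(a, r) \<in> F" for a r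
      using C(2) F(1) that by blast
    show "?b p \<inter> ?b q = {}" if "p \<in> F" "q \<in> F" "p \<noteq> q" for p q
      using C(3) F(1) that by blast
  qed (rule cF)
qed

text \<open>Dependent choice with geometric decay of the measure of a remainder. The relation
  \<open>R\<close> also sees the step number, which allows tolerances that shrink with
  \<open>n\<close>.\<close>

lemma exhaustion:
  fixes H :: "'s \<Rightarrow> 'a::euclidean_space set"
  assumes "Inv s0" and c: "0 \<le> c" "c < 1"
    and step: "\<And>n s. Inv s \<Longrightarrow> \<exists>t. Inv t \<and> R n s t \<and> measure lebesgue (H t) \<le> c * measure lebesgue (H s)"
  obtains f where "f 0 = s0" "\<And>n::nat. Inv (f n)" "\<And>n. R n (f n) (f (Suc n))"
    "(\<lambda>n. measure lebesgue (H (f n))) \<longlonglongrightarrow> 0"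
proof -
  have "\<exists>f. \<forall>n. (Inv (f n) \<and> (n = 0 \<longrightarrow> f n = s0)) \<and>
     (R n (f n) (f (Suc n)) \<and> measure lebesgue (H (f (Suc n))) \<le> c * measure lebesgue (H (f n)))"
    by (rule dependent_nat_choice) (use assms in auto)
  then obtain f where f: "\<And>n. Inv (f n)" "f 0 = s0" "\<And>n. R n (f n) (f (Suc n))"
    "\<And>n. measure lebesgue (H (f (Suc n))) \<le> c * measure lebesgue (H (f n))" by blast
  have le: "measure lebesgue (H (f n)) \<le> c ^ n * measure lebesgue (H s0)" for n
  proof (induction n)
    case (Suc n)
    then show ?case using f(4)[of n] mult_left_mono[OF Suc c(1)] by (simp add: mult.assoc)
  qed (simp add: f)
  have "(\<lambda>n. c ^ n * measure lebesgue (H s0)) \<longlonglongrightarrow> 0"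
    using c by (intro tendsto_mult_left_zero LIMSEQ_power_zero) auto
  then have "(\<lambda>n. measure lebesgue (H (f n))) \<longlonglongrightarrow> 0"
    by (rule tendsto_sandwich[OF _ _ tendsto_const, rotated 2]) (use le in auto)
  then show ?thesis using that f by blast
qed

lemma negligible_INT_if_measure_tendsto_0:
  fixes H :: "nat \<Rightarrow> 'a::euclidean_space set"
  assumes "\<And>n. H n \<in> lmeasurable" "(\<lambda>n. measure lebesgue (H n)) \<longlonglongrightarrow> 0"
  shows "negligible (\<Inter>n. H n)"
proof (rule negligible_outer_le[THEN iffD2], intro allI impI)
  fix e :: real assume "e > 0"
  then have "\<forall>\<^sub>F n in sequentially. measure lebesgue (H n) < e"
    using assms(2) by (simp add: order_tendstoD(2))
  then obtain n where "measure lebesgue (H n) < e" by (meson eventually_happens trivial_limit_sequentially)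
  then show "\<exists>T. (\<Inter>n. H n) \<subseteq> T \<and> T \<in> lmeasurable \<and> measure lebesgue T \<le> e"
    using assms(1) by (intro exI[of _ "H n"]) auto
qed

text \<open>Inside each ball of a packing sits a scaled copy of \<open>K\<close> that fills a fixed
  fraction \<open>k\<close> of the ball. As half of the remainder is packed by balls at every step,
  its measure shrinks by the factor 1 - k/2.\<close>

lemma cell_packing:
  fixes H :: "'a::euclidean_space set"
  assumes "open H" "bounded H" "compact K" "measure lebesgue K > 0" "\<epsilon> > 0"
  obtains C where "countable C" "\<And>a r. (a, r) \<in> C \<Longrightarrow> 0 < r \<and> r < \<epsilon> \<and> cell K (a, r) \<subseteq> H"
    "\<And>p q. p \<in> C \<Longrightarrow> q \<in> C \<Longrightarrow> p \<noteq> q \<Longrightarrow> cell K p \<inter> cell K q = {}"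
    "negligible (H - (\<Union>p\<in>C. cell K p))"
proof -
  obtain B where "B > 0" "\<forall>x\<in>K. norm x \<le> B"
    using compact_imp_bounded[OF assms(3)] unfolding bounded_pos by blast
  then have B: "B > 0" "K \<subseteq> cball 0 B" by auto
  define V where "V = measure lebesgue (cball (0::'a) 1)"
  have V: "V > 0" by (simp add: V_def content_cball)
  \<comment> \<open>The fraction of a ball of radius r that is filled by
    \<open>cell K (a, r / B)\<close>; it is the same for all r.\<close>
  define k where "k = measure lebesgue K / (B ^ DIM('a) * V)"
  have ball_meas: "measure lebesgue (cball a r) = r ^ DIM('a) * V" if "r > 0" for a :: 'a and r
    using measure_cell[of "cball 0 1" "(a, r)"] that by (simp add: cell_cball V_def)
  have k: "0 < k" "k \<le> 1"
  proof -
    show "0 < k" using assms(4) B V by (simp add: k_def)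
    have "measure lebesgue K \<le> measure lebesgue (cball (0::'a) B)"
      using B assms(3) by (intro measure_mono_fmeasurable) (auto simp: lmeasurable_compact fmeasurableD)
    then show "k \<le> 1" using B V ball_meas[OF B(1), of 0] by (simp add: k_def)
  qed
  define Rem where "Rem F = H - (\<Union>p\<in>F. cell K p)" for F
  define Inv where "Inv F \<longleftrightarrow> finite F \<and> (\<forall>(a, r)\<in>F. 0 < r \<and> r < \<epsilon> \<and> cell K (a, r) \<subseteq> H) \<and>
     (\<forall>p\<in>F. \<forall>q\<in>F. p \<noteq> q \<longrightarrow> cell K p \<inter> cell K q = {})" for F
  have Rem: "open (Rem F)" "bounded (Rem F)" if "Inv F" for F
  proof -
    have "closed (\<Union>p\<in>F. cell K p)"
      using that assms(3) by (auto simp: Inv_def intro!: closed_UN compact_imp_closed compact_cell)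
    then show "open (Rem F)" using assms(1) by (simp add: Rem_def open_Diff)
    show "bounded (Rem F)" using assms(2) by (auto simp: Rem_def intro: bounded_subset)
  qed
  have step: "\<exists>G. Inv G \<and> F \<subseteq> G \<and> measure lebesgue (Rem G) \<le> (1 - k / 2) * measure lebesgue (Rem F)"
    if F: "Inv F" for F
  proof -
    have half: "0 \<le> (1/2::real)" "(1/2::real) < 1" and \<epsilon>B: "\<And>x. x \<in> Rem F \<Longrightarrow> \<epsilon> * B > 0"
      using assms(5) B by simp_all
    obtain P where P: "finite P" "\<And>a r. (a, r) \<in> P \<Longrightarrow> 0 < r \<and> r < \<epsilon> * B \<and> a \<in> Rem F \<and> cball a r \<subseteq> Rem F"
      "\<And>p q. p \<in> P \<Longrightarrow> q \<in> P \<Longrightarrow> p \<noteq> q \<Longrightarrow> cball (fst p) (snd p) \<inter> cball (fst q) (snd q) = {}"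
      "1/2 * measure lebesgue (Rem F) \<le> (\<Sum>p\<in>P. measure lebesgue (cball (fst p) (snd p)))"
      by (rule finite_ball_packing[OF Rem[OF F] \<epsilon>B half]) (assumption | rule that)+
    define g where "g p = (fst p, snd p / B)" for p :: "'a \<times> real"
    have sub: "cell K (g p) \<subseteq> cball (fst p) (snd p)" if "p \<in> P" for p
    proof -
      have "0 < snd p" using P(2)[of "fst p" "snd p"] that by simp
      then have "norm (snd p / B * x1) \<le> snd p" if "0 \<le> x1" "x1 \<le> B" for x1
        using that B(1) by (simp add: divide_simps mult_left_mono)
      then show ?thesis
        using B \<open>0 < snd p\<close>
        by (auto simp: cell_def g_def dist_norm subset_eq mult_left_mono divide_simps)
    qed
    have gdisj: "cell K (g p) \<inter> cell K (g q) = {}" if "p \<in> P" "q \<in> P" "p \<noteq> q" for p q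
      using sub[OF that(1)] sub[OF that(2)] P(3)[OF that] by blast
    have subR: "cell K (g p) \<subseteq> Rem F" if "p \<in> P" for p
      using sub[OF that] P(2)[of "fst p" "snd p"] that by auto
    define G where "G = F \<union> g ` P"
    have snd_g: "0 < snd (g p) \<and> snd (g p) < \<epsilon>" if "p \<in> P" for p
      using P(2)[of "fst p" "snd p"] that B(1) by (simp add: g_def divide_simps)
    have "0 < snd p \<and> snd p < \<epsilon> \<and> cell K p \<subseteq> H" if "p \<in> G" for p
    proof (cases "p \<in> F")
      case True
      then have "case p of (a, r) \<Rightarrow> 0 < r \<and> r < \<epsilon> \<and> cell K (a, r) \<subseteq> H" using F unfolding Inv_def by (elim conjE bspec)
      then show ?thesis by (cases p) simp
    next
      case False
      then obtain q where "q \<in> P" "p = g q" using \<open>p \<in> G\<close> by (auto simp: G_def)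
      moreover have "Rem F \<subseteq> H" by (auto simp: Rem_def)
      ultimately show ?thesis using snd_g[of q] subR[of q] by blast
    qed
    then have 1: "\<forall>(a, r)\<in>G. 0 < r \<and> r < \<epsilon> \<and> cell K (a, r) \<subseteq> H" by auto
    have 2: "cell K p \<inter> cell K q = {}" if pq: "p \<in> G" "q \<in> G" "p \<noteq> q" for p q
    proof -
      have FR: "cell K p \<inter> Rem F = {}" if "p \<in> F" for p using that by (auto simp: Rem_def)
      consider "p \<in> F" "q \<in> F" | "p \<in> F" "q \<in> g ` P" | "p \<in> g ` P" "q \<in> F" | "p \<in> g ` P" "q \<in> g ` P"
        using pq by (auto simp: G_def)
      then show ?thesis
      proof cases
        case 1 then show ?thesis using F pq by (simp add: Inv_def)
      next
        case 2 then show ?thesis using FR[of p] subR by blast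
      next
        case 3 then show ?thesis using FR[of q] subR by blast
      next
        case 4 then show ?thesis using gdisj pq by blast
      qed
    qed
    have G: "Inv G" using F P(1) 1 2 by (simp add: Inv_def G_def)
    let ?U = "\<Union>p\<in>P. cell K (g p)"
    have RG: "Rem G = Rem F - ?U" by (auto simp: Rem_def G_def)
    have "k * (1/2 * measure lebesgue (Rem F)) \<le> k * (\<Sum>p\<in>P. measure lebesgue (cball (fst p) (snd p)))"
      using P(4) k by (intro mult_left_mono) auto
    also have "\<dots> = (\<Sum>p\<in>P. measure lebesgue (cell K (g p)))"
      unfolding sum_distrib_left
    proof (rule sum.cong)
      fix p assume p: "p \<in> P"
      then have "snd p > 0" using P(2)[of "fst p" "snd p"] by simp
      then show "k * measure lebesgue (cball (fst p) (snd p)) = measure lebesgue (cell K (g p))"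
        unfolding ball_meas[OF \<open>snd p > 0\<close>] using B V \<open>snd p > 0\<close> by (simp add: measure_cell g_def k_def power_divide)
    qed simp
    also have "\<dots> = measure lebesgue ?U"
      using P(1) gdisj assms(3) by (intro measure_disjoint_finite_UN[symmetric]) (auto intro: lmeasurable_compact compact_cell)
    finally have U: "k / 2 * measure lebesgue (Rem F) \<le> measure lebesgue ?U" by simp
    have "measure lebesgue (Rem G) = measure lebesgue (Rem F) - measure lebesgue ?U"
      unfolding RG
    proof (rule measurable_measure_Diff)
      show "Rem F \<in> lmeasurable" using Rem[OF F] by (simp add: lmeasurable_open)
      show "?U \<in> sets lebesgue"
        using P(1) assms(3) by (intro sets.finite_UN) (auto intro!: fmeasurableD lmeasurable_compact compact_cell)
      show "?U \<subseteq> Rem F" using subR by blast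
    qed
    then have "measure lebesgue (Rem G) \<le> (1 - k / 2) * measure lebesgue (Rem F)"
      using U by (simp add: algebra_simps)
    then show ?thesis using G by (auto simp: G_def)
  qed
  obtain f where f: "f 0 = {}" "\<And>n::nat. Inv (f n)" "\<And>n. f n \<subseteq> f (Suc n)"
    "(\<lambda>n. measure lebesgue (Rem (f n))) \<longlonglongrightarrow> 0"
    by (rule exhaustion[of Inv "{}" "1 - k / 2" "\<lambda>n F G. F \<subseteq> G" Rem])
       (use k step in \<open>auto simp: Inv_def\<close>)
  have mono: "f m \<subseteq> f n" if "m \<le> n" for m n using lift_Suc_mono_le[of f, OF f(3) that] .
  show ?thesis
  proof (rule that[of "\<Union>n. f n"])
    show "countable (\<Union>n. f n)" using f(2) by (auto simp: Inv_def intro: countable_finite)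
    show "0 < r \<and> r < \<epsilon> \<and> cell K (a, r) \<subseteq> H" if "(a, r) \<in> (\<Union>n. f n)" for a r
      using that f(2) unfolding Inv_def by blast
    show "cell K p \<inter> cell K q = {}" if "p \<in> (\<Union>n. f n)" "q \<in> (\<Union>n. f n)" "p \<noteq> q" for p q
    proof -
      obtain m n where "p \<in> f m" "q \<in> f n" using \<open>p \<in> (\<Union>n. f n)\<close> \<open>q \<in> (\<Union>n. f n)\<close> by blast
      then have "p \<in> f (max m n)" "q \<in> f (max m n)" using mono[of m "max m n"] mono[of n "max m n"] by auto
      then show ?thesis using f(2)[of "max m n"] \<open>p \<noteq> q\<close> unfolding Inv_def by blast
    qed
    have "negligible (\<Inter>n. Rem (f n))"
      using f(2,4) Rem by (intro negligible_INT_if_measure_tendsto_0) (auto simp: lmeasurable_open)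
    then show "negligible (H - (\<Union>p\<in>(\<Union>n. f n). cell K p))"
      by (rule negligible_subset) (auto simp: Rem_def)
  qed
qed

section \<open>Lebesgue points\<close>

text \<open>Vitali covering argument. The bad points are covered, up to a null set, by disjoint
  balls inside an open set \<open>U\<close> for which \<open>U - S\<close> has measure below c * e.
  Each ball has more than the fraction \<open>c\<close> of its volume outside \<open>S\<close>, so
  all balls together have measure at most \<open>e\<close>.\<close>

lemma lebesgue_density_points_bounded:
  fixes S :: "'a::euclidean_space set"
  assumes S: "S \<in> sets lebesgue" and c: "c > 0"
  shows "negligible {x \<in> S \<inter> ball 0 m. \<forall>e>0. \<exists>d>0. d < e \<and> measure lebesgue (ball x d - S) > c * measure lebesgue (ball x d)}"
    (is "negligible ?N")
proof (rule negligible_outer_le[THEN iffD2], intro allI impI)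
  fix e :: real assume e: "e > 0"
  have S': "S \<inter> ball 0 m \<in> sets lebesgue" using S by auto
  have "c * e > 0" using c e by simp
  then obtain T where T: "open T" "S \<inter> ball 0 m \<subseteq> T" "T - S \<inter> ball 0 m \<in> lmeasurable"
    "emeasure lebesgue (T - S \<inter> ball 0 m) < ennreal (c * e)"
    by (rule sets_lebesgue_outer_open[OF S'])
  define U where "U = T \<inter> ball 0 m"
  have U: "open U" "?N \<subseteq> U" using T by (auto simp: U_def)
  have Um: "U - S \<in> lmeasurable"
    using S T(1) by (auto simp: U_def intro!: fmeasurable.Diff bounded_set_imp_lmeasurable sets.Diff)
  have "U - S \<subseteq> T - S \<inter> ball 0 m" by (auto simp: U_def)
  then have "measure lebesgue (U - S) \<le> measure lebesgue (T - S \<inter> ball 0 m)"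
    using T(3) Um by (intro measure_mono_fmeasurable) auto
  also have "\<dots> < c * e"
    using T(3,4) e c by (simp add: emeasure_eq_measure2 fmeasurableD2 ennreal_less_iff)
  finally have US: "measure lebesgue (U - S) < c * e" .
  define K where "K = {(x, d). x \<in> ?N \<and> 0 < d \<and> ball x d \<subseteq> U \<and> measure lebesgue (ball x d - S) > c * measure lebesgue (ball x d)}"
  have cover: "\<exists>i. i \<in> K \<and> x \<in> ball (fst i) (snd i) \<and> snd i < d" if x: "x \<in> ?N" and d: "0 < d" for x d
  proof -
    obtain r where r: "r > 0" "ball x r \<subseteq> U" using U x by (meson open_contains_ball subsetD)
    have "min d r > 0" using d r by simp
    then obtain t where t: "t > 0" "t < min d r" "measure lebesgue (ball x t - S) > c * measure lebesgue (ball x t)"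
      using x by blast
    then have "ball x t \<subseteq> U" using r by (meson min_less_iff_conj less_imp_le subset_ball order.trans)
    then show ?thesis using t x by (intro exI[of _ "(x, t)"]) (auto simp: K_def)
  qed
  obtain C where C: "countable C" "C \<subseteq> K"
     "pairwise (\<lambda>i j. disjnt (ball (fst i) (snd i)) (ball (fst j) (snd j))) C"
     "negligible (?N - (\<Union>i \<in> C. ball (fst i) (snd i)))"
    by (rule Vitali_covering_theorem_balls[of ?N K fst snd, OF cover]) (assumption | rule that)+
  let ?B = "\<lambda>i::'a \<times> real. ball (fst i) (snd i)"
  have bound: "measure lebesgue (\<Union>i\<in>I. ?B i) \<le> e" if I: "I \<subseteq> C" "finite I" for I
  proof -
    have IK: "?B i \<subseteq> U" "c * measure lebesgue (?B i) \<le> measure lebesgue (?B i - S)" if "i \<in> I" for i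
    proof -
      have "i \<in> K" using that I(1) C(2) by blast
      then have "ball (fst i) (snd i) \<subseteq> U \<and> c * measure lebesgue (?B i) < measure lebesgue (?B i - S)"
        unfolding K_def by (simp only: mem_Collect_eq split_beta)
      then show "?B i \<subseteq> U" "c * measure lebesgue (?B i) \<le> measure lebesgue (?B i - S)" by auto
    qed
    have disj: "?B i \<inter> ?B j = {}" if "i \<in> I" "j \<in> I" "i \<noteq> j" for i j
      using C(3) that I(1) unfolding pairwise_def disjnt_def by blast
    have "c * measure lebesgue (\<Union>i\<in>I. ?B i) = (\<Sum>i\<in>I. c * measure lebesgue (?B i))"
      unfolding sum_distrib_left[symmetric]
      using measure_disjoint_finite_UN[OF I(2), of ?B] disj by simp
    also have "\<dots> \<le> (\<Sum>i\<in>I. measure lebesgue (?B i - S))"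
      using IK(2) by (intro sum_mono)
    also have "\<dots> = measure lebesgue (\<Union>i\<in>I. ?B i - S)"
    proof (rule measure_disjoint_finite_UN[symmetric, OF I(2)])
      show "?B i - S \<in> lmeasurable" for i
        using S by (auto intro!: fmeasurable.Diff bounded_set_imp_lmeasurable sets.Diff)
      show "(?B i - S) \<inter> (?B j - S) = {}" if "i \<in> I" "j \<in> I" "i \<noteq> j" for i j
        using disj that by blast
    qed
    also have "\<dots> \<le> measure lebesgue (U - S)"
    proof (rule measure_mono_fmeasurable[OF _ _ Um])
      show "(\<Union>i\<in>I. ?B i - S) \<subseteq> U - S" using IK(1) by blast
      show "(\<Union>i\<in>I. ?B i - S) \<in> sets lebesgue"
        using S I(2) by (intro sets.finite_UN sets.Diff) auto
    qed
    also have "\<dots> < c * e" by (rule US)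
    finally show ?thesis using c by simp
  qed
  have Bm: "?B i \<in> lmeasurable" for i by simp
  have "(\<Union>i\<in>C. ?B i) \<in> lmeasurable" "measure lebesgue (\<Union>i\<in>C. ?B i) \<le> e"
    using fmeasurable_UN_bound[OF C(1) Bm bound] measure_UN_bound[OF C(1) Bm bound] by auto
  moreover have "\<exists>T. N \<subseteq> T \<and> T \<in> lmeasurable \<and> measure lebesgue T \<le> e"
    if "negligible (N - B)" "B \<in> lmeasurable" "measure lebesgue B \<le> e" for N B :: "'a set"
  proof (intro exI conjI)
    show "(N - B) \<union> B \<in> lmeasurable"
      by (rule fmeasurable.Un[OF negligible_imp_measurable[OF that(1)] that(2)])
    have "measure lebesgue ((N - B) \<union> B) \<le> measure lebesgue (N - B) + measure lebesgue B"
      by (rule measure_Un_le[OF negligible_imp_sets[OF that(1)] fmeasurableD[OF that(2)]])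
    then show "measure lebesgue ((N - B) \<union> B) \<le> e"
      using that(3) negligible_imp_measure0[OF that(1)] by linarith
  qed auto
  ultimately show "\<exists>T. ?N \<subseteq> T \<and> T \<in> lmeasurable \<and> measure lebesgue T \<le> e"
    using C(4) by blast
qed

lemma AE_lebesgue_density:
  fixes S :: "'a::euclidean_space set"
  assumes S: "S \<in> sets lebesgue"
  shows "AE x in lebesgue. x \<in> S \<longrightarrow>
    (\<forall>c>0. \<exists>e>0. \<forall>d. 0 < d \<and> d < e \<longrightarrow> measure lebesgue (ball x d - S) \<le> c * measure lebesgue (ball x d))"
proof -
  let ?N = "\<lambda>k m. {x \<in> S \<inter> ball 0 (real m). \<forall>e>0. \<exists>d>0. d < e \<and>
    measure lebesgue (ball x d - S) > 1 / real (Suc k) * measure lebesgue (ball x d)}"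
  have neg: "negligible (\<Union>k m. ?N k m)"
    by (intro negligible_Union_nat lebesgue_density_points_bounded[OF S]) simp
  have "\<forall>c>0. \<exists>e>0. \<forall>d. 0 < d \<and> d < e \<longrightarrow> measure lebesgue (ball x d - S) \<le> c * measure lebesgue (ball x d)"
    if x: "x \<in> S" "x \<notin> (\<Union>k m. ?N k m)" for x
  proof (intro allI impI)
    fix c :: real assume "c > 0"
    then obtain k where k: "1 / real (Suc k) < c" by (rule nat_approx_posE)
    obtain m where "norm x < real m" using reals_Archimedean2 by blast
    then have "x \<notin> ?N k m" "x \<in> S \<inter> ball 0 (real m)" using x by auto
    then have "\<not> (\<forall>e>0. \<exists>d>0. d < e \<and> measure lebesgue (ball x d - S) > 1 / real (Suc k) * measure lebesgue (ball x d))"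
      by blast
    then obtain e where e: "e > 0"
      "\<not> (\<exists>d>0. d < e \<and> measure lebesgue (ball x d - S) > 1 / real (Suc k) * measure lebesgue (ball x d))"
      by blast
    have e2: "measure lebesgue (ball x d - S) \<le> 1 / real (Suc k) * measure lebesgue (ball x d)"
      if "0 < d" "d < e" for d
      using e(2) that by (meson not_le)
    have "measure lebesgue (ball x d - S) \<le> c * measure lebesgue (ball x d)" if "0 < d" "d < e" for d
      using e2[OF that] k by (meson less_imp_le measure_nonneg mult_right_mono order.trans)
    then show "\<exists>e>0. \<forall>d. 0 < d \<and> d < e \<longrightarrow> measure lebesgue (ball x d - S) \<le> c * measure lebesgue (ball x d)"
      using e(1) by blast
  qed
  then have "{x. \<not> (x \<in> S \<longrightarrow> (\<forall>c>0. \<exists>e>0. \<forall>d. 0 < d \<and> d < e \<longrightarrow> measure lebesgue (ball x d - S) \<le> c * measure lebesgue (ball x d)))}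
     \<subseteq> (\<Union>k m. ?N k m)" by blast
  then show ?thesis
    using neg by (subst eventually_ae_filter_negligible) blast
qed

text \<open>Stated for arbitrary kernels bounded by the indicator of \<open>ball x d\<close>,
  because later the mollifier is centred at points other than \<open>x\<close>. The good points are
  density points of all the countably many sets, containing them, on which \<open>f\<close> is
  within 1/(n+1) of a member \<open>q\<close> of a countable dense set.\<close>

lemma AE_lebesgue_point:
  fixes f :: "'a::euclidean_space \<Rightarrow> 'b::euclidean_space"
  assumes f: "f \<in> borel_measurable lebesgue" and K: "\<And>x. norm (f x) \<le> K"
  shows "AE x in lebesgue. \<forall>e>0. \<exists>s>0. \<forall>d k. 0 < d \<and> d < s \<and> k \<in> borel_measurable lebesgue \<and>
    (\<forall>y. \<bar>k y\<bar> \<le> indicator (ball x d) y) \<longrightarrow>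
    norm (\<integral>y. k y *\<^sub>R (f y - f x) \<partial>lebesgue) \<le> e * measure lebesgue (ball x d)"
proof -
  obtain Q :: "'b set" where Q: "countable Q" "\<And>U. open U \<Longrightarrow> U \<noteq> {} \<Longrightarrow> \<exists>q\<in>Q. q \<in> U"
    using countable_dense_exists[where 'a='b] by blast
  let ?A = "\<lambda>q n. {x. norm (f x - q) < 1 / real (Suc n)}"
  have A: "?A q n \<in> sets lebesgue" for q n
  proof -
    have "(\<lambda>x. norm (f x - q)) \<in> borel_measurable lebesgue" using f by measurable
    then show ?thesis by (simp add: borel_measurable_iff_less)
  qed
  have "AE x in lebesgue. \<forall>q\<in>Q. \<forall>n. x \<in> ?A q n \<longrightarrow> (\<forall>c>0. \<exists>e>0. \<forall>d. 0 < d \<and> d < e \<longrightarrow>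
      measure lebesgue (ball x d - ?A q n) \<le> c * measure lebesgue (ball x d))"
    using Q(1) AE_lebesgue_density[OF A] by (simp add: AE_ball_countable AE_all_countable)
  then show ?thesis
  proof (rule AE_mp, intro AE_I2 impI allI)
    fix x :: 'a and e :: real
    assume D: "\<forall>q\<in>Q. \<forall>n. x \<in> ?A q n \<longrightarrow> (\<forall>c>0. \<exists>e>0. \<forall>d. 0 < d \<and> d < e \<longrightarrow>
      measure lebesgue (ball x d - ?A q n) \<le> c * measure lebesgue (ball x d))" and e: "e > 0"
    obtain n where n: "1 / real (Suc n) < e / 4" using e nat_approx_posE[of "e / 4"] by auto
    have "ball (f x) (1 / real (Suc n)) \<noteq> {}" by simp
    then obtain q where q: "q \<in> Q" "q \<in> ball (f x) (1 / real (Suc n))" using Q(2) by blast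
    then have xA: "x \<in> ?A q n" by (simp add: dist_norm)
    have K0: "K \<ge> 0" using K[of x] norm_ge_zero order.trans by blast
    have "e / (4 * (K + 1)) > 0" using e K0 by simp
    then obtain s where s: "s > 0" "\<And>d. 0 < d \<Longrightarrow> d < s \<Longrightarrow>
      measure lebesgue (ball x d - ?A q n) \<le> e / (4 * (K + 1)) * measure lebesgue (ball x d)"
      using D[rule_format, OF q(1) xA] by blast
    have "norm (\<integral>y. k y *\<^sub>R (f y - f x) \<partial>lebesgue) \<le> e * measure lebesgue (ball x d)"
      if d: "0 < d" "d < s" and k: "k \<in> borel_measurable lebesgue" "\<forall>y. \<bar>k y\<bar> \<le> indicator (ball x d) y" for d k
    proof -
      \<comment> \<open>On the good set both \<open>f y\<close> and \<open>f x\<close> are within e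
        / 4 of \<open>q\<close>; off it the crude bound 2 * K is compensated by the small
        density.\<close>
      let ?g = "\<lambda>y. (e / 2) * indicator (ball x d) y + (2 * K) * indicator (ball x d - ?A q n) y :: real"
      have Bm: "ball x d - ?A q n \<in> lmeasurable"
        using A by (auto intro!: fmeasurable.Diff bounded_set_imp_lmeasurable sets.Diff)
      have gi: "integrable lebesgue ?g"
        using Bm by (intro Bochner_Integration.integrable_add integrable_mult_right) (simp_all flip: lmeasurable_iff_integrable)
      have bd: "norm (k y *\<^sub>R (f y - f x)) \<le> ?g y" for y
      proof (cases "y \<in> ball x d")
        case False
        then show ?thesis using k(2)[rule_format, of y] by simp
      next
        case True
        then have "norm (k y *\<^sub>R (f y - f x)) \<le> 1 * norm (f y - f x)"
          using k(2)[rule_format, of y] by (simp add: mult_left_le_one_le)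
        moreover have "norm (f y - f x) \<le> ?g y"
        proof (cases "y \<in> ?A q n")
          case A: True
          have "norm (f y - f x) \<le> norm (f y - q) + norm (f x - q)"
            by (metis dist_norm dist_triangle2)
          also have "\<dots> < e / 2" using A xA n by simp
          finally show ?thesis using True K0 by (simp add: indicator_def)
        next
          case False
          have "norm (f y - f x) \<le> K + K"
            using norm_triangle_ineq4[of "f y" "f x"] K[of y] K[of x] by linarith
          then show ?thesis using True False e by simp
        qed
        ultimately show ?thesis by simp
      qed
      have "integrable lebesgue (\<lambda>y. k y *\<^sub>R (f y - f x))"
      proof (rule Bochner_Integration.integrable_bound[OF gi])
        show "(\<lambda>y. k y *\<^sub>R (f y - f x)) \<in> borel_measurable lebesgue" using k(1) f by measurable
        show "AE y in lebesgue. norm (k y *\<^sub>R (f y - f x)) \<le> norm (?g y)"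
          by (intro AE_I2 order_trans[OF bd]) simp
      qed
      then have "norm (\<integral>y. k y *\<^sub>R (f y - f x) \<partial>lebesgue) \<le> (\<integral>y. ?g y \<partial>lebesgue)"
        by (rule Bochner_Integration.integral_norm_bound_integral[OF _ gi bd])
      also have "\<dots> = e / 2 * measure lebesgue (ball x d) + 2 * K * measure lebesgue (ball x d - ?A q n)"
        using Bm by (subst Bochner_Integration.integral_add) (simp_all flip: lmeasurable_iff_integrable)
      also have "\<dots> \<le> e / 2 * measure lebesgue (ball x d) + 2 * K * (e / (4 * (K + 1)) * measure lebesgue (ball x d))"
        using s(2)[OF d] K0 by (intro add_left_mono mult_left_mono) auto
      also have "\<dots> = (e / 2 + e / 2 * (K / (K + 1))) * measure lebesgue (ball x d)"
      proof -
        have "2 * K * (e / (4 * (K + 1))) = e / 2 * (K / (K + 1))" using K0 by (simp add: field_simps)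
        then have "2 * K * (e / (4 * (K + 1)) * V) = e / 2 * (K / (K + 1)) * V" for V
          by (metis mult.assoc)
        then show ?thesis by (simp only: distrib_right)
      qed
      also have "\<dots> \<le> e * measure lebesgue (ball x d)"
      proof (rule mult_right_mono)
        have "K / (K + 1) \<le> 1" using K0 by simp
        then have "e / 2 * (K / (K + 1)) \<le> e / 2 * 1" using e by (intro mult_left_mono) auto
        then show "e / 2 + e / 2 * (K / (K + 1)) \<le> e" by linarith
      qed simp
      finally show ?thesis .
    qed
    then show "\<exists>s>0. \<forall>d k. 0 < d \<and> d < s \<and> k \<in> borel_measurable lebesgue \<and>
      (\<forall>y. \<bar>k y\<bar> \<le> indicator (ball x d) y) \<longrightarrow>
      norm (\<integral>y. k y *\<^sub>R (f y - f x) \<partial>lebesgue) \<le> e * measure lebesgue (ball x d)"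
      using s(1) by blast
  qed
qed

section \<open>Mollification\<close>

lemma distr_lebesgue_translation:
  "distr lebesgue lebesgue (\<lambda>x. a + x) = (lebesgue :: 'a::euclidean_space measure)"
  and measurable_lebesgue_translation: "(\<lambda>x. a + x) \<in> lebesgue \<rightarrow>\<^sub>M (lebesgue :: 'a measure)"
proof -
  have T: "(\<lambda>x. a + (\<Sum>j\<in>Basis. (1 * (x \<bullet> j)) *\<^sub>R j)) = (\<lambda>x. a + x)"
    by (simp add: euclidean_representation)
  have one: "\<And>j::'a. j \<in> Basis \<Longrightarrow> (1::real) \<noteq> 0" by simp
  have "density (distr lebesgue lebesgue (\<lambda>x. a + x)) (\<lambda>_. 1) = (lebesgue :: 'a measure)"
    using lebesgue_affine_euclidean[of "\<lambda>_. 1" a] unfolding T by simp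
  then show "distr lebesgue lebesgue (\<lambda>x. a + x) = (lebesgue :: 'a measure)"
    by (simp add: density_1)
  show "(\<lambda>x. a + x) \<in> lebesgue \<rightarrow>\<^sub>M (lebesgue :: 'a measure)"
    using lebesgue_affine_measurable[of "\<lambda>_. 1" a] unfolding T by simp
qed

lemma integral_lebesgue_translation:
  fixes f :: "'a::euclidean_space \<Rightarrow> 'b::{banach, second_countable_topology}"
  assumes "f \<in> borel_measurable lebesgue"
  shows "(\<integral>x. f (a + x) \<partial>lebesgue) = (\<integral>x. f x \<partial>lebesgue)"
  using integral_distr[OF measurable_lebesgue_translation assms, of a]
  by (simp add: distr_lebesgue_translation)

lemma continuous_imp_borel_measurable_lebesgue:
  fixes f :: "'a::euclidean_space \<Rightarrow> 'b::{second_countable_topology, real_normed_vector}"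
  assumes "continuous_on UNIV f"
  shows "f \<in> borel_measurable lebesgue"
proof -
  have "f \<in> borel_measurable lborel" using borel_measurable_continuous_onI[OF assms] by simp
  then show ?thesis by (rule measurable_completion)
qed

lemma bump_measurable: "bump a r \<in> borel_measurable lebesgue"
  by (rule continuous_imp_borel_measurable_lebesgue[OF continuous_bump])

lemma kernel_integral:
  fixes f :: "'a::euclidean_space \<Rightarrow> 'b::{banach, second_countable_topology}"
  assumes "k \<in> borel_measurable lebesgue" "f \<in> borel_measurable lebesgue" "S \<in> lmeasurable"
    and "\<And>y. \<bar>k y\<bar> \<le> c * indicator S y" "\<And>y. y \<in> S \<Longrightarrow> norm (f y) \<le> K" "0 \<le> c"
  shows "integrable lebesgue (\<lambda>y. k y *\<^sub>R f y)"
    and "norm (\<integral>y. k y *\<^sub>R f y \<partial>lebesgue) \<le> c * K * measure lebesgue S"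
proof -
  let ?g = "\<lambda>y. (c * K) * indicator S y :: real"
  have gi: "integrable lebesgue ?g"
    using assms(3) by (intro integrable_mult_right) (simp_all flip: lmeasurable_iff_integrable)
  have bd: "norm (k y *\<^sub>R f y) \<le> ?g y" for y
  proof (cases "y \<in> S")
    case True
    then show ?thesis using assms(4)[of y] assms(5)[of y] assms(6) by (auto intro!: mult_mono)
  next
    case False
    then show ?thesis using assms(4)[of y] by simp
  qed
  show int: "integrable lebesgue (\<lambda>y. k y *\<^sub>R f y)"
  proof (rule Bochner_Integration.integrable_bound[OF gi])
    show "(\<lambda>y. k y *\<^sub>R f y) \<in> borel_measurable lebesgue" using assms(1,2) by measurable
    show "AE y in lebesgue. norm (k y *\<^sub>R f y) \<le> norm (?g y)"
      by (intro AE_I2 order_trans[OF bd]) simp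
  qed
  have "norm (\<integral>y. k y *\<^sub>R f y \<partial>lebesgue) \<le> (\<integral>y. ?g y \<partial>lebesgue)"
    by (rule Bochner_Integration.integral_norm_bound_integral[OF int gi bd])
  then show "norm (\<integral>y. k y *\<^sub>R f y \<partial>lebesgue) \<le> c * K * measure lebesgue S"
    using assms(3) by simp
qed

lemma bump_le_indicator: "r > 0 \<Longrightarrow> \<bar>bump a r y\<bar> \<le> indicator (ball a r) y"
  using bump_eq_0_iff[of r a y] bump_nonneg[of a r y] bump_le_1[of a r y]
  by (auto simp: indicator_def dist_norm norm_minus_commute)

lemma bump_le_indicator': "r > 0 \<Longrightarrow> \<bar>bump a r y\<bar> \<le> 1 * indicator (ball a r) y"
  using bump_le_indicator by simp

text \<open>The dummy type argument fixes the space, which \<open>r\<close> alone does not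
  determine; that the centre is immaterial is \<open>integral_bump\<close>.\<close>

definition bump_mass :: "'a::euclidean_space itself \<Rightarrow> real \<Rightarrow> real"
  where "bump_mass _ r = (\<integral>x. bump (0::'a) r x \<partial>lebesgue)"

lemma integral_bump:
  fixes a :: "'a::euclidean_space"
  shows "(\<integral>x. bump a r x \<partial>lebesgue) = bump_mass TYPE('a) r"
  using integral_lebesgue_translation[OF bump_measurable[of a r], of a] bump_shift[of a r _ a]
  by (simp add: bump_mass_def add.commute)

lemma integrable_bump:
  assumes "r > 0"
  shows "integrable lebesgue (bump a r)"
proof -
  have "integrable lebesgue (\<lambda>y. bump a r y *\<^sub>R (1::real))"
    by (rule kernel_integral(1)[OF bump_measurable _ _ bump_le_indicator'[OF assms]]) auto
  then show ?thesis by simp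
qed

lemma integrable_bump_scaleR:
  fixes f :: "'a::euclidean_space \<Rightarrow> 'b::euclidean_space"
  assumes "r > 0" "f \<in> borel_measurable lebesgue" "\<And>y. norm (f y) \<le> K"
  shows "integrable lebesgue (\<lambda>y. bump x r y *\<^sub>R f y)"
  by (rule kernel_integral(1)[OF bump_measurable assms(2) _ bump_le_indicator'[OF assms(1)] assms(3)]) auto

text \<open>On the ball of half the radius the bump is at least \<open>flat 0 (3/4)\<close>, as 1 -
  (1/2)^2 = 3/4. This converts estimates by ball volumes, as in \<open>AE_lebesgue_point\<close>,
  into estimates for normalised averages.\<close>

lemma bump_mass_ge:
  fixes x :: "'a::euclidean_space"
  assumes "r > 0"
  shows "bump_mass TYPE('a) r \<ge> flat 0 (3/4) / 2 ^ DIM('a) * measure lebesgue (ball x r)"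
proof -
  have bm: "measure lebesgue (ball (y::'a) s) = s ^ DIM('a) * measure lebesgue (ball (0::'a) 1)" if "s > 0" for y s
    using content_ball_conv_unit_ball[of s y] that by simp
  have le: "flat 0 (3/4) * indicator (ball (0::'a) (r/2)) y \<le> bump 0 r y" for y
  proof (cases "norm y < r / 2")
    case True
    have "(norm y)\<^sup>2 \<le> (r/2)\<^sup>2" using True by (intro power_mono) auto
    then have "1 - (1 / r\<^sup>2) * (y \<bullet> y) \<ge> 3/4"
      using assms by (simp add: field_simps flip: power2_norm_eq_inner)
    moreover have "flat 0 (3/4) \<le> flat 0 u" if "u \<ge> 3/4" for u
      using that frac_le[of 1 1 "3/4" u] by (simp add: flat_def)
    ultimately show ?thesis using True unfolding bump_def by simp
  next
    case False
    then show ?thesis using bump_nonneg[of 0 r y] by simp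
  qed
  have "flat 0 (3/4) * measure lebesgue (ball (0::'a) (r/2)) = (\<integral>y. flat 0 (3/4) * indicator (ball (0::'a) (r/2)) y \<partial>lebesgue)"
    by simp
  also have "\<dots> \<le> bump_mass TYPE('a) r"
    unfolding bump_mass_def using le integrable_bump[OF assms, of 0]
    by (intro integral_mono) (simp_all flip: lmeasurable_iff_integrable)
  finally have "flat 0 (3/4) * ((r/2) ^ DIM('a) * measure lebesgue (ball (0::'a) 1)) \<le> bump_mass TYPE('a) r"
    using bm[of "r/2" 0] assms by simp
  then show ?thesis using bm[of r x] assms by (simp add: power_divide)
qed

lemma bump_mass_pos: "r > 0 \<Longrightarrow> bump_mass TYPE('a::euclidean_space) r > 0"
proof -
  assume "r > 0"
  then have "0 < flat 0 (3/4) / 2 ^ DIM('a) * measure lebesgue (ball (0::'a) r)"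
    using flat_pos[of "3/4" 0] content_ball_pos[of r "0::'a"] by simp
  then show ?thesis using bump_mass_ge[OF \<open>r > 0\<close>, of "0::'a"] by linarith
qed

definition moll :: "real \<Rightarrow> ('a::euclidean_space \<Rightarrow> 'b::euclidean_space) \<Rightarrow> 'a \<Rightarrow> 'b"
  where "moll r f x = (1 / bump_mass TYPE('a) r) *\<^sub>R (\<integral>y. bump x r y *\<^sub>R f y \<partial>lebesgue)"

lemma moll_diff_const:
  fixes f :: "'a::euclidean_space \<Rightarrow> 'b::euclidean_space"
  assumes "r > 0" "f \<in> borel_measurable lebesgue" "\<And>y. norm (f y) \<le> K"
  shows "moll r f x - c = (1 / bump_mass TYPE('a) r) *\<^sub>R (\<integral>y. bump x r y *\<^sub>R (f y - c) \<partial>lebesgue)"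
proof -
  have "(\<integral>y. bump x r y *\<^sub>R (f y - c) \<partial>lebesgue) = (\<integral>y. bump x r y *\<^sub>R f y \<partial>lebesgue) - (\<integral>y. bump x r y *\<^sub>R c \<partial>lebesgue)"
    unfolding scaleR_diff_right
    using integrable_bump_scaleR[OF assms] integrable_bump[OF assms(1), of x]
    by (intro Bochner_Integration.integral_diff) auto
  also have "(\<integral>y. bump x r y *\<^sub>R c \<partial>lebesgue) = bump_mass TYPE('a) r *\<^sub>R c"
    using integrable_bump[OF assms(1), of x] by (simp add: integral_bump)
  finally show ?thesis
    using bump_mass_pos[OF assms(1), where 'a = 'a] by (simp add: moll_def scaleR_diff_right)
qed

lemma norm_bump_average_le:
  fixes g :: "'a::euclidean_space \<Rightarrow> 'b::euclidean_space"
  assumes r: "r > 0" and g: "\<And>y. norm (y - x) < r \<Longrightarrow> norm (g y) \<le> e"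
  shows "norm ((1 / bump_mass TYPE('a) r) *\<^sub>R (\<integral>y. bump x r y *\<^sub>R g y \<partial>lebesgue)) \<le> e"
proof -
  have bd: "norm (bump x r y *\<^sub>R g y) \<le> bump x r y * e" for y
    using g[of y] bump_nonneg[of x r y] bump_eq_0_iff[OF r, of x y]
    by (cases "norm (y - x) < r") (auto intro: mult_left_mono)
  have pos: "bump_mass TYPE('a) r > 0" by (rule bump_mass_pos[OF r])
  have e: "e \<ge> 0" using g[of x] r order_trans[OF norm_ge_zero[of "g x"]] by simp
  have "norm (\<integral>y. bump x r y *\<^sub>R g y \<partial>lebesgue) \<le> (\<integral>y. bump x r y * e \<partial>lebesgue)"
  proof (cases "integrable lebesgue (\<lambda>y. bump x r y *\<^sub>R g y)")
    case True
    show ?thesis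
      by (rule Bochner_Integration.integral_norm_bound_integral[OF True _ bd])
         (use integrable_bump[OF r, of x] in auto)
  next
    case False
    \<comment> \<open>A nonintegrable function has Bochner integral 0, so the bound also holds then
      and integrability need not be checked when the lemma is applied.\<close>
    then show ?thesis using e bump_nonneg[of x r] by (simp add: not_integrable_integral_eq)
  qed
  also have "\<dots> = bump_mass TYPE('a) r * e" by (simp add: integral_bump)
  finally show ?thesis using pos by (simp add: divide_simps mult.commute)
qed

lemma moll_near:
  fixes f :: "'a::euclidean_space \<Rightarrow> 'b::euclidean_space"
  assumes "r > 0" "f \<in> borel_measurable lebesgue" "\<And>y. norm (f y) \<le> K"
    and "\<And>y. norm (y - x) < r \<Longrightarrow> norm (f y - c) \<le> e"
  shows "norm (moll r f x - c) \<le> e"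
  unfolding moll_diff_const[OF assms(1-3)] using norm_bump_average_le[OF assms(1), of x "\<lambda>y. f y - c" e] assms(4) by blast

text \<open>After a translation both averages use the kernel centred at 0, so their difference is an
  average of increments of \<open>f\<close>.\<close>

lemma moll_lipschitz:
  fixes f :: "'a::euclidean_space \<Rightarrow> 'b::euclidean_space"
  assumes r: "r > 0" and K: "\<And>y. norm (f y) \<le> K" and f: "\<And>x y. norm (f x - f y) \<le> norm (x - y)"
  shows "norm (moll r f x - moll r f z) \<le> norm (x - z)"
proof -
  have "1-lipschitz_on UNIV f" using f by (intro lipschitz_onI) (auto simp: dist_norm)
  then have cont: "continuous_on UNIV f" by (rule lipschitz_on_continuous_on)
  have m: "f \<in> borel_measurable lebesgue" by (rule continuous_imp_borel_measurable_lebesgue[OF cont])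
  have mx: "(\<lambda>y. f (x + y)) \<in> borel_measurable lebesgue" for x
    by (intro continuous_imp_borel_measurable_lebesgue continuous_on_compose2[OF cont] continuous_intros) auto
  have shift: "moll r f x = (1 / bump_mass TYPE('a) r) *\<^sub>R (\<integral>y. bump 0 r y *\<^sub>R f (x + y) \<partial>lebesgue)" for x
  proof -
    have mb: "(\<lambda>y. bump x r y *\<^sub>R f y) \<in> borel_measurable lebesgue" using m bump_measurable[of x r] by measurable
    have "bump x r (x + y) = bump 0 r y" for y using bump_shift[of x r y x] by (simp add: add.commute)
    then show ?thesis
      unfolding moll_def using integral_lebesgue_translation[OF mb, of x] by simp
  qed
  have "moll r f x - moll r f z = (1 / bump_mass TYPE('a) r) *\<^sub>R (\<integral>y. bump 0 r y *\<^sub>R (f (x + y) - f (z + y)) \<partial>lebesgue)"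
    unfolding shift scaleR_diff_right
    using integrable_bump_scaleR[OF r mx, of x K 0] integrable_bump_scaleR[OF r mx, of z K 0] K
    by (simp add: scaleR_diff_right)
  moreover have "norm (f (x + y) - f (z + y)) \<le> norm (x - z)" for y using f[of "x + y" "z + y"] by simp
  ultimately show ?thesis
    using norm_bump_average_le[OF r, of 0 "\<lambda>y. f (x + y) - f (z + y)" "norm (x - z)"] by simp
qed

section \<open>Second order expansion of mollified maps\<close>

lemma linear_bound_Basis:
  fixes L :: "'a::euclidean_space \<Rightarrow> real"
  assumes "linear L" "\<And>b. b \<in> Basis \<Longrightarrow> \<bar>L b\<bar> \<le> B b"
  shows "\<bar>L h\<bar> \<le> (\<Sum>b\<in>Basis. B b) * norm h"
proof -
  have "L h = (\<Sum>b\<in>Basis. (h \<bullet> b) * L b)"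
    using linear_sum[OF assms(1), of "\<lambda>b. (h \<bullet> b) *\<^sub>R b" Basis] linear_scale[OF assms(1)]
    by (simp add: euclidean_representation)
  then have "\<bar>L h\<bar> \<le> (\<Sum>b\<in>Basis. \<bar>h \<bullet> b\<bar> * \<bar>L b\<bar>)"
    by (simp add: abs_mult[symmetric] sum_abs)
  also have "\<dots> \<le> (\<Sum>b\<in>Basis. norm h * B b)"
    using assms(2) by (intro sum_mono mult_mono) (auto simp: Basis_le_norm)
  finally show ?thesis unfolding sum_distrib_right by (simp add: mult.commute)
qed

lemma has_derivative_zero_off_compact_support:
  fixes \<psi> :: "'a::euclidean_space \<Rightarrow> 'b::euclidean_space"
  assumes "compact K" "\<And>x. x \<notin> K \<Longrightarrow> \<psi> x = 0" "(\<psi> has_derivative D) (at x)" "x \<notin> K"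
  shows "D = (\<lambda>v. 0)"
proof -
  have "open (- K)" using assms(1) by (simp add: compact_imp_closed open_Compl)
  then have "(\<psi> has_derivative (\<lambda>v. 0)) (at x)"
    using assms by (intro has_derivative_transform_within_open[OF has_derivative_const[of 0]]) auto
  then show ?thesis using has_derivative_unique[OF assms(3)] by blast
qed

lemma C1_compact_support_lipschitz:
  fixes f :: "'a::euclidean_space \<Rightarrow> real"
  assumes f': "\<And>x. (f has_derivative f' x) (at x)" and cont: "\<And>v. continuous_on UNIV (\<lambda>x. f' x v)"
    and K: "compact K" "\<And>x. x \<notin> K \<Longrightarrow> f x = 0"
  obtains L where "L \<ge> 0" "\<And>x y. \<bar>f x - f y\<bar> \<le> L * norm (x - y)"
proof -
  have f'0: "f' x = (\<lambda>v. 0)" if "x \<notin> K" for x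
    by (rule has_derivative_zero_off_compact_support[OF K f' that])
  have "\<exists>B. \<forall>x. \<bar>f' x v\<bar> \<le> B" for v
  proof -
    have "compact ((\<lambda>x. f' x v) ` K)"
      using K(1) cont continuous_on_subset by (intro compact_continuous_image) blast+
    then obtain B where B: "\<forall>y\<in>(\<lambda>x. f' x v) ` K. norm y \<le> B"
      using compact_imp_bounded bounded_iff by blast
    have "\<bar>f' x v\<bar> \<le> max B 0" for x
    proof (cases "x \<in> K")
      case True
      then have "norm (f' x v) \<le> B" using B by blast
      then show ?thesis by simp
    qed (simp add: f'0)
    then show ?thesis by blast
  qed
  then obtain B where B: "\<And>v x. \<bar>f' x v\<bar> \<le> B v" by metis
  define L where "L = (\<Sum>b\<in>Basis. B b)"
  have L: "\<bar>f' x h\<bar> \<le> L * norm h" for x h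
    unfolding L_def using has_derivative_linear[OF f'] B by (intro linear_bound_Basis) auto
  have "0 \<le> B v" for v using B[of 0 v] by linarith
  then have "L \<ge> 0" unfolding L_def by (intro sum_nonneg) auto
  moreover have "\<bar>f x - f y\<bar> \<le> L * norm (x - y)" for x y
  proof -
    have "norm (f x - f y) \<le> L * norm (x - y)"
    proof (rule differentiable_bound[OF convex_UNIV])
      show "(f has_derivative f' x) (at x within UNIV)" for x using f' by simp
      show "onorm (f' x) \<le> L" for x using L by (intro onorm_le) simp
    qed auto
    then show ?thesis by simp
  qed
  ultimately show ?thesis using that by blast
qed

lemma flat_algebra_lipschitz:
  fixes f :: "'a::euclidean_space \<Rightarrow> real"
  assumes "f \<in> flat_algebra" "\<And>x. x \<notin> cball 0 r \<Longrightarrow> f x = 0"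
  obtains L where "L \<ge> 0" "\<And>x y. \<bar>f x - f y\<bar> \<le> L * norm (x - y)"
proof -
  obtain f' where f': "\<And>x. (f has_derivative f' x) (at x)" "\<And>v. (\<lambda>x. f' x v) \<in> flat_algebra"
    using flat_algebra_derivative[OF assms(1)] by blast
  show ?thesis
    by (rule C1_compact_support_lipschitz[OF f'(1) flat_algebra_continuous[OF f'(2)] compact_cball assms(2)])
      (assumption | rule that)+
qed

definition bump_deriv :: "real \<Rightarrow> 'a::euclidean_space \<Rightarrow> 'a \<Rightarrow> real"
  where "bump_deriv r z = frechet_derivative (bump 0 r) (at z)"

lemma bump_has_derivative: "(bump 0 r has_derivative bump_deriv r z) (at z)"
  using flat_algebra_derivative[OF bump_in_flat_algebra, of 0 r] unfolding bump_deriv_def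
  by (metis frechet_derivative_at)

lemma bump_has_derivative': "(bump x r has_derivative bump_deriv r (z - x)) (at z)"
proof -
  have e: "bump x r = (\<lambda>y. bump 0 r (y - x))" using bump_shift[of 0 r _ "- x"] by auto
  have "((\<lambda>y. y - x) has_derivative (\<lambda>h. h)) (at z)" by (auto intro!: derivative_eq_intros)
  from has_derivative_compose[OF this bump_has_derivative[of r "z - x"]]
  show ?thesis unfolding e by simp
qed

lemma bump_deriv_flat_algebra:
  fixes v :: "'a::euclidean_space"
  shows "(\<lambda>z. bump_deriv r z v) \<in> flat_algebra"
proof -
  obtain f' :: "'a \<Rightarrow> 'a \<Rightarrow> real" where f': "\<And>x. (bump 0 r has_derivative f' x) (at x)" "\<And>v. (\<lambda>x. f' x v) \<in> flat_algebra"
    using flat_algebra_derivative[OF bump_in_flat_algebra, of 0 r] by blast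
  have e: "f' = bump_deriv r"
    using has_derivative_unique[OF f'(1) bump_has_derivative] by (intro ext) simp
  show ?thesis using f'(2)[of v] unfolding e .
qed

lemma bump_zero_outside: "r > 0 \<Longrightarrow> x \<notin> cball 0 r \<Longrightarrow> bump 0 r x = 0"
  using bump_eq_0_iff[of r 0 x] by simp

lemma bump_deriv_zero_outside: "r > 0 \<Longrightarrow> x \<notin> cball 0 r \<Longrightarrow> bump_deriv r x = (\<lambda>v. 0)"
  by (rule has_derivative_zero_off_compact_support[OF compact_cball bump_zero_outside bump_has_derivative])

text \<open>The directional derivatives of the bump belong to \<open>flat_algebra\<close> and have
  compact support, hence are Lipschitz. The constant is uniform in \<open>z\<close>, so the
  expansion can be integrated against a bounded function.\<close>

lemma bump_taylor:
  assumes r: "r > 0"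
  obtains C where "C \<ge> 0" "\<And>z h::'a::euclidean_space. \<bar>bump 0 r (z + h) - bump 0 r z - bump_deriv r z h\<bar> \<le> C * (norm h)\<^sup>2"
proof -
  have "\<exists>L\<ge>0. \<forall>x y::'a. \<bar>bump_deriv r x v - bump_deriv r y v\<bar> \<le> L * norm (x - y)" for v
    by (rule flat_algebra_lipschitz[OF bump_deriv_flat_algebra[of r v], of r])
       (auto simp: bump_deriv_zero_outside[OF r])
  then obtain L where L: "\<And>v. L v \<ge> 0" "\<And>v x y::'a. \<bar>bump_deriv r x v - bump_deriv r y v\<bar> \<le> L v * norm (x - y)"
    by metis
  define C where "C = (\<Sum>b\<in>Basis. L (b::'a))"
  have C: "C \<ge> 0" unfolding C_def using L(1) by (intro sum_nonneg) auto
  have lin: "linear (bump_deriv r x)" for x :: 'a by (rule has_derivative_linear[OF bump_has_derivative])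
  have on: "\<bar>bump_deriv r x h - bump_deriv r y h\<bar> \<le> (C * norm (x - y)) * norm h" for x y h :: 'a
  proof -
    have "linear (\<lambda>h. bump_deriv r x h - bump_deriv r y h)" by (intro linear_compose_sub lin)
    from linear_bound_Basis[OF this, of "\<lambda>b. L b * norm (x - y)"] L(2)
    show ?thesis by (simp add: C_def sum_distrib_right)
  qed
  have "\<bar>bump 0 r (z + h) - bump 0 r z - bump_deriv r z h\<bar> \<le> C * (norm h)\<^sup>2" for z h :: 'a
  proof -
    \<comment> \<open>Mean value inequality for the bump minus its linear part at \<open>z\<close>;
      the derivative of this difference is at most C * |h| on the ball of radius |h|.\<close>
    let ?g = "\<lambda>x. bump 0 r x - bump_deriv r z x"
    have g: "(?g has_derivative (\<lambda>k. bump_deriv r x k - bump_deriv r z k)) (at x within cball z (norm h))" for x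
      by (intro has_derivative_diff has_derivative_at_withinI[OF bump_has_derivative]
           bounded_linear_imp_has_derivative linear_conv_bounded_linear[THEN iffD1] lin)
    have "norm (?g (z + h) - ?g z) \<le> (C * norm h) * norm (z + h - z)"
    proof (rule differentiable_bound[OF convex_cball g])
      fix x assume "x \<in> cball z (norm h)"
      then have "C * norm (x - z) \<le> C * norm h"
        using C by (intro mult_left_mono) (auto simp: dist_norm norm_minus_commute)
      then show "onorm (\<lambda>k. bump_deriv r x k - bump_deriv r z k) \<le> C * norm h"
        using on[of x _ z] by (intro onorm_le) (smt (verit) mult_right_mono norm_ge_zero real_norm_def)
    qed (auto simp: dist_norm)
    then show ?thesis
      using linear_add[OF lin, of z z h] by (simp add: power2_eq_square algebra_simps)
  qed
  then show ?thesis using that C by blast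
qed

text \<open>The minus sign comes from differentiating the kernel with respect to its centre, as
  \<open>bump x r y\<close> depends on y - x.\<close>

definition moll_deriv :: "real \<Rightarrow> ('a::euclidean_space \<Rightarrow> 'b::euclidean_space) \<Rightarrow> 'a \<Rightarrow> 'a \<Rightarrow> 'b"
  where "moll_deriv r f x h = - (1 / bump_mass TYPE('a) r) *\<^sub>R (\<integral>y. bump_deriv r (y - x) h *\<^sub>R f y \<partial>lebesgue)"

lemma integrable_bump_deriv_scaleR:
  fixes f :: "'a::euclidean_space \<Rightarrow> 'b::euclidean_space"
  assumes r: "r > 0" and f: "f \<in> borel_measurable lebesgue" and K: "\<And>y. norm (f y) \<le> K"
  shows "integrable lebesgue (\<lambda>y. bump_deriv r (y - x) h *\<^sub>R f y)"
proof -
  have cont: "continuous_on UNIV (\<lambda>y. bump_deriv r (y - x) h)"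
    by (rule continuous_on_compose2[OF flat_algebra_continuous[OF bump_deriv_flat_algebra, of UNIV]])
       (auto intro: continuous_intros)
  have "compact ((\<lambda>z. bump_deriv r z h) ` cball (0::'a) r)"
    by (intro compact_continuous_image flat_algebra_continuous bump_deriv_flat_algebra) simp
  then obtain B where B: "\<forall>y\<in>(\<lambda>z. bump_deriv r z h) ` cball (0::'a) r. norm y \<le> B"
    using compact_imp_bounded bounded_iff by blast
  have bd: "\<bar>bump_deriv r (y - x) h\<bar> \<le> max B 0 * indicator (cball x r) y" for y
  proof (cases "y \<in> cball x r")
    case True
    then have "y - x \<in> cball 0 r" by (simp add: dist_norm norm_minus_commute)
    then have "norm (bump_deriv r (y - x) h) \<le> B" using B by blast
    then show ?thesis using True by simp
  next
    case False
    then have "y - x \<notin> cball 0 r" by (simp add: dist_norm norm_minus_commute)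
    then show ?thesis using False by (simp add: bump_deriv_zero_outside[OF r])
  qed
  show ?thesis
    by (rule kernel_integral(1)[OF continuous_imp_borel_measurable_lebesgue[OF cont] f _ bd K]) auto
qed

lemma linear_moll_deriv:
  fixes f :: "'a::euclidean_space \<Rightarrow> 'b::euclidean_space"
  assumes "r > 0" "f \<in> borel_measurable lebesgue" "\<And>y. norm (f y) \<le> K"
  shows "linear (moll_deriv r f x)"
proof -
  note int = integrable_bump_deriv_scaleR[OF assms]
  have lin: "linear (bump_deriv r z)" for z :: 'a by (rule has_derivative_linear[OF bump_has_derivative])
  show ?thesis
  proof (rule linearI)
    show "moll_deriv r f x (h + k) = moll_deriv r f x h + moll_deriv r f x k" for h k
      using int[of x h] int[of x k]
      by (simp add: moll_deriv_def linear_add[OF lin] scaleR_add_left scaleR_add_right)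
    show "moll_deriv r f x (c *\<^sub>R h) = c *\<^sub>R moll_deriv r f x h" for c h
      by (simp add: moll_deriv_def linear_scale[OF lin] scaleR_left_commute flip: scaleR_scaleR)
  qed
qed

text \<open>Differentiation under the integral with an explicit remainder whose constant does not
  depend on \<open>x\<close>. This uniformity later controls affine approximation on all small balls
  at once.\<close>

lemma moll_taylor:
  fixes f :: "'a::euclidean_space \<Rightarrow> 'b::euclidean_space"
  assumes r: "r > 0" and f: "f \<in> borel_measurable lebesgue" and K: "\<And>y. norm (f y) \<le> K"
  obtains C where "C \<ge> 0" "\<And>x h. norm h \<le> 1 \<Longrightarrow>
    norm (moll r f (x + h) - moll r f x - moll_deriv r f x h) \<le> C * (norm h)\<^sup>2"
proof -
  obtain C where C: "C \<ge> 0" "\<And>z h::'a. \<bar>bump 0 r (z + h) - bump 0 r z - bump_deriv r z h\<bar> \<le> C * (norm h)\<^sup>2"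
    using bump_taylor[OF r] by blast
  have lin: "linear (bump_deriv r z)" for z :: 'a by (rule has_derivative_linear[OF bump_has_derivative])
  let ?m = "bump_mass TYPE('a) r" and ?V = "measure lebesgue (cball (0::'a) (r + 1))"
  have m: "?m > 0" by (rule bump_mass_pos[OF r])
  have be: "bump x r y = bump 0 r (y - x)" for x y :: 'a using bump_shift[of 0 r y "- x"] by auto
  have K0: "K \<ge> 0" using K norm_ge_zero order_trans by blast
  have "norm (moll r f (x + h) - moll r f x - moll_deriv r f x h) \<le> (1 / ?m * (C * K * ?V)) * (norm h)\<^sup>2"
    if h: "norm h \<le> 1" for x h
  proof -
    let ?k = "\<lambda>y. bump (x + h) r y - bump x r y + bump_deriv r (y - x) h"
    \<comment> \<open>For |h| \<le> 1 all three kernels vanish outside radius r + 1, so the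
      quadratic bound is integrated over a ball of fixed volume.\<close>
    have bd: "\<bar>?k y\<bar> \<le> (C * (norm h)\<^sup>2) * indicator (cball x (r + 1)) y" for y
    proof (cases "y \<in> cball x (r + 1)")
      case True
      have "\<bar>bump 0 r ((y - x) + (- h)) - bump 0 r (y - x) - bump_deriv r (y - x) (- h)\<bar> \<le> C * (norm (- h))\<^sup>2"
        by (rule C(2))
      moreover have "bump (x + h) r y = bump 0 r ((y - x) + (- h))"
        unfolding be[of "x + h" y] by (simp add: algebra_simps)
      ultimately show ?thesis using True by (simp add: be[of x y] linear_neg[OF lin])
    next
      case False
      then have n: "norm (y - x) > r + 1" by (simp add: dist_norm norm_minus_commute)
      have "norm (y - x) \<le> norm (y - (x + h)) + norm h"
        using norm_triangle_ineq[of "y - (x + h)" h] by simp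
      then have "norm (y - (x + h)) > r" "norm (y - x) > r" using n h r by linarith+
      then have "bump (x + h) r y = 0" "bump x r y = 0" "bump_deriv r (y - x) h = 0"
        using bump_eq_0_iff[OF r, of "x + h" y] bump_eq_0_iff[OF r, of x y] bump_deriv_zero_outside[OF r, of "y - x"] by auto
      then show ?thesis using False by simp
    qed
    have cont: "continuous_on UNIV ?k"
      by (intro continuous_on_add continuous_on_diff continuous_bump
          continuous_on_compose2[OF flat_algebra_continuous[OF bump_deriv_flat_algebra, of UNIV]]) (auto intro: continuous_intros)
    have est: "norm (\<integral>y. ?k y *\<^sub>R f y \<partial>lebesgue) \<le> C * (norm h)\<^sup>2 * K * measure lebesgue (cball x (r + 1))"
      using C(1) by (intro kernel_integral(2)[OF continuous_imp_borel_measurable_lebesgue[OF cont] f _ bd K]) auto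
    have V: "measure lebesgue (cball x (r + 1)) = ?V"
      using content_cball[of "r + 1" x] content_cball[of "r + 1" "0::'a"] r by simp
    have "moll r f (x + h) - moll r f x - moll_deriv r f x h = (1 / ?m) *\<^sub>R (\<integral>y. ?k y *\<^sub>R f y \<partial>lebesgue)"
      using integrable_bump_scaleR[OF r f K, of "x + h"] integrable_bump_scaleR[OF r f K, of x]
        integrable_bump_deriv_scaleR[OF r f K, of x h]
      by (simp add: moll_def moll_deriv_def scaleR_add_left scaleR_diff_left scaleR_diff_right scaleR_add_right)
    then have "norm (moll r f (x + h) - moll r f x - moll_deriv r f x h) = (1 / ?m) * norm (\<integral>y. ?k y *\<^sub>R f y \<partial>lebesgue)"
      using m by simp
    also have "\<dots> \<le> (1 / ?m) * (C * (norm h)\<^sup>2 * K * ?V)"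
      using est m unfolding V by (intro mult_left_mono) auto
    finally show ?thesis by (simp add: algebra_simps)
  qed
  then show ?thesis using that[of "1 / ?m * (C * K * ?V)"] C(1) K0 m by simp
qed

lemma has_derivative_if_quadratic:
  assumes "linear L" and "\<And>h. norm h \<le> 1 \<Longrightarrow> norm (g (x + h) - g x - L h) \<le> C * (norm h)\<^sup>2" "C \<ge> 0"
  shows "(g has_derivative L) (at (x::'a::euclidean_space))"
  unfolding has_derivative_at_alt
proof (intro conjI allI impI)
  show "bounded_linear L" using assms(1) by (simp add: linear_conv_bounded_linear)
  fix e :: real assume e: "e > 0"
  show "\<exists>d>0. \<forall>y. norm (y - x) < d \<longrightarrow> norm (g y - g x - L (y - x)) \<le> e * norm (y - x)"
  proof (intro exI conjI allI impI)
    show "min 1 (e / (C + 1)) > 0" using e assms(3) by simp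
    fix y assume y: "norm (y - x) < min 1 (e / (C + 1))"
    then have "norm (g y - g x - L (y - x)) \<le> C * (norm (y - x))\<^sup>2" using assms(2)[of "y - x"] by simp
    also have "\<dots> = (C * norm (y - x)) * norm (y - x)" by (simp add: power2_eq_square)
    also have "\<dots> \<le> e * norm (y - x)"
    proof (rule mult_right_mono)
      have "C * norm (y - x) \<le> (C + 1) * (e / (C + 1))" using y assms(3) by (intro mult_mono) auto
      then show "C * norm (y - x) \<le> e" using assms(3) by simp
    qed simp
    finally show "norm (g y - g x - L (y - x)) \<le> e * norm (y - x)" .
  qed
qed

lemma moll_has_derivative:
  fixes f :: "'a::euclidean_space \<Rightarrow> 'b::euclidean_space"
  assumes "r > 0" "f \<in> borel_measurable lebesgue" "\<And>y. norm (f y) \<le> K"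
  shows "(moll r f has_derivative moll_deriv r f x) (at x)"
proof -
  obtain C where "C \<ge> 0" "\<And>x h. norm h \<le> 1 \<Longrightarrow>
    norm (moll r f (x + h) - moll r f x - moll_deriv r f x h) \<le> C * (norm h)\<^sup>2"
    using moll_taylor[OF assms] by blast
  then show ?thesis by (intro has_derivative_if_quadratic[OF linear_moll_deriv[OF assms]])
qed

section \<open>Weak contractions\<close>

text \<open>One of the two points compared is always \<open>x\<close>. A Lebesgue point of a
  strictly contractive weak gradient provides this, with \<open>c\<close> and \<open>s\<close>
  depending on the point.\<close>

definition strict_at :: "('a::euclidean_space \<Rightarrow> 'b::euclidean_space) \<Rightarrow> 'a \<Rightarrow> bool"
  where "strict_at u x \<longleftrightarrow> (\<exists>c<1. \<exists>s>0. \<forall>y. norm (y - x) < s \<longrightarrow> norm (u y - u x) \<le> c * norm (y - x))"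

lemma norm_matrix_vector_le:
  fixes A :: "real ^ 'n ^ 'm"
  shows "norm (A *v x) \<le> norm A * norm x"
proof -
  have "norm (A *v x) = L2_set (\<lambda>i. norm (A $ i \<bullet> x)) UNIV"
    by (simp add: norm_vec_def matrix_vector_mul_component)
  also have "\<dots> \<le> L2_set (\<lambda>i. norm (A $ i) * norm x) UNIV"
    by (intro L2_set_mono) (auto simp: Cauchy_Schwarz_ineq2)
  also have "\<dots> = norm A * norm x"
    by (simp add: norm_vec_def[of A] L2_set_left_distrib)
  finally show ?thesis .
qed

lemma linear_matrix_vector_left: "linear (\<lambda>A :: real ^ 'n ^ 'm. A *v x)"
  by (rule linearI) (simp_all add: matrix_vector_mult_add_rdistrib flip: scaleR_matrix_vector_assoc)

lemma bounded_linear_matrix_vector_left: "bounded_linear (\<lambda>A :: real ^ 'n ^ 'm. A *v x)"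
  using linear_matrix_vector_left by (simp add: linear_conv_bounded_linear)

lemma closed_contractions: "closed {A :: real ^ 'n ^ 'm. \<forall>h. norm (A *v h) \<le> norm h}"
  by (intro closed_Collect_all closed_Collect_le continuous_intros
      linear_continuous_on bounded_linear_matrix_vector_left)

lemma locally_integrable_measurable:
  fixes f :: "'a::euclidean_space \<Rightarrow> 'b::euclidean_space"
  assumes "locally_integrable_on f \<Omega>" "open \<Omega>"
  shows "(\<lambda>x. if x \<in> \<Omega> then f x else 0) \<in> borel_measurable lebesgue"
proof -
  obtain C where C: "\<And>n::nat. compact (C n)" "\<And>n. C n \<subseteq> \<Omega>" "\<And>n. C n \<subseteq> interior (C (Suc n))" "\<Union>(range C) = \<Omega>"
    by (rule open_Union_compact_subsets[OF assms(2)]) (rule that)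
  have m: "(\<lambda>x. if x \<in> C n then f x else 0) \<in> borel_measurable lebesgue" for n
  proof (rule borel_measurable_if_I)
    show "C n \<in> sets lebesgue" using C(1) lmeasurable_compact by blast
    then show "f \<in> borel_measurable (lebesgue_on (C n))"
      using assms(1) C(1,2) absolutely_integrable_measurable[of "C n" f]
      by (auto simp: locally_integrable_on_def)
  qed
  show ?thesis
  proof (rule borel_measurable_LIMSEQ_metric[OF m])
    fix x :: 'a
    show "(\<lambda>n. if x \<in> C n then f x else 0) \<longlonglongrightarrow> (if x \<in> \<Omega> then f x else 0)"
    proof (cases "x \<in> \<Omega>")
      case True
      then obtain N where N: "x \<in> C N" using C(4) by blast
      have "mono C" by (rule mono_iff_le_Suc[THEN iffD2]) (use C(3) interior_subset in blast)
      then have "x \<in> C n" if "n \<ge> N" for n using that N by (auto dest: monoD)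
      then have "\<forall>\<^sub>F n in sequentially. (if x \<in> \<Omega> then f x else 0) = (if x \<in> C n then f x else 0)"
        using True by (auto simp: eventually_sequentially)
      then show ?thesis by (rule Lim_transform_eventually[OF tendsto_const])
    next
      case False
      then have "x \<notin> C n" for n using C(2) by blast
      then show ?thesis using False by simp
    qed
  qed
qed

lemma AE_lebesgue_on_iff:
  "\<Omega> \<in> sets lebesgue \<Longrightarrow> (AE x in lebesgue_on \<Omega>. P x) \<longleftrightarrow> (AE x in lebesgue. x \<in> \<Omega> \<longrightarrow> P x)"
  by (simp add: AE_restrict_space_iff)

lemma sets_lebesgue_open: "open S \<Longrightarrow> S \<in> sets lebesgue"
  by auto

lemma AE_imp_ball_witness:
  assumes "AE x in lebesgue. P (x::'a::euclidean_space)" "r > 0"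
  obtains z where "norm (z - x) < r" "P z"
proof -
  obtain N where N: "negligible N" "{x. \<not> P x} \<subseteq> N"
    using assms(1) by (auto simp: eventually_ae_filter_negligible)
  have "\<not> negligible (ball x r)" using assms(2) by (intro open_not_negligible) auto
  then have "\<not> ball x r \<subseteq> N" using N(1) negligible_subset by blast
  then obtain z where "z \<in> ball x r" "z \<notin> N" by blast
  then show ?thesis using N(2) that[of z] by (auto simp: dist_norm norm_minus_commute)
qed

lemma borel_measurable_vec_component:
  fixes f :: "'a \<Rightarrow> 'b::euclidean_space ^ 'n"
  assumes "f \<in> borel_measurable M"
  shows "(\<lambda>x. f x $ i) \<in> borel_measurable M"
  by (rule measurable_compose[OF assms borel_measurable_continuous_onI])
     (intro continuous_intros linear_continuous_on bounded_linear_vec_nth)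

text \<open>The weak derivative is tested with the bump itself, and the sign in
  \<open>moll_deriv\<close> cancels the one from integration by parts. \<open>f\<close> and
  \<open>F\<close> stand for bounded versions of \<phi> and its weak gradient, extended by
  0.\<close>

lemma moll_deriv_eq_moll_weak:
  fixes \<phi> :: "real ^ 'n \<Rightarrow> real ^ 'n" and f :: "real ^ 'n \<Rightarrow> real ^ 'n" and F :: "real ^ 'n \<Rightarrow> real ^ 'n ^ 'n"
  assumes w: "weak_derivative \<Omega> \<phi> D\<phi>" and op: "open \<Omega>"
    and f: "f \<in> borel_measurable lebesgue" "\<And>y. norm (f y) \<le> K" "\<And>y. y \<notin> \<Omega> \<Longrightarrow> f y = 0"
    and F: "F \<in> borel_measurable lebesgue" "\<And>y. norm (F y) \<le> L" "\<And>y. y \<notin> \<Omega> \<Longrightarrow> F y = 0"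
    and ae: "AE y in lebesgue. y \<in> \<Omega> \<longrightarrow> f y = \<phi> y \<and> F y = D\<phi> y"
    and r: "r > 0" "cball x r \<subseteq> \<Omega>"
  shows "moll_deriv r f x h = moll r F x *v h"
proof -
  have S: "\<Omega> \<in> sets lebesgue" using op by auto
  have ae': "AE y in lebesgue_on \<Omega>. f y = \<phi> y \<and> F y = D\<phi> y" using ae unfolding AE_lebesgue_on_iff[OF S] .
  have m\<phi>: "\<phi> \<in> borel_measurable (lebesgue_on \<Omega>)" "D\<phi> \<in> borel_measurable (lebesgue_on \<Omega>)"
    using w op S locally_integrable_measurable[of \<phi> \<Omega>] locally_integrable_measurable[of D\<phi> \<Omega>]
    by (auto simp: weak_derivative_def borel_measurable_if)
  have mf: "f \<in> borel_measurable (lebesgue_on \<Omega>)" "F \<in> borel_measurable (lebesgue_on \<Omega>)"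
    using f(1) F(1) by (auto intro: measurable_restrict_space1)
  have ae1: "AE y in lebesgue_on \<Omega>. f y = \<phi> y" and ae2: "AE y in lebesgue_on \<Omega>. F y = D\<phi> y"
    using ae' by (eventually_elim, simp)+
  have comp: "moll_deriv r f x (axis j 1) $ i = moll r F x $ i $ j" for i j
  proof -
    let ?b = "\<lambda>y. bump_deriv r (y - x) (axis j 1)"
    have bm: "?b \<in> borel_measurable lebesgue"
      by (intro continuous_imp_borel_measurable_lebesgue
          continuous_on_compose2[OF flat_algebra_continuous[OF bump_deriv_flat_algebra, of UNIV]])
         (auto intro: continuous_intros)
    then have bm': "?b \<in> borel_measurable (lebesgue_on \<Omega>)" by (rule measurable_restrict_space1)
    have um': "bump x r \<in> borel_measurable (lebesgue_on \<Omega>)"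
      by (intro measurable_restrict_space1 bump_measurable)
    have fd: "frechet_derivative (bump x r) (at y) = bump_deriv r (y - x)" for y
      using frechet_derivative_at[OF bump_has_derivative'] by metis
    have "(LINT y|lebesgue_on \<Omega>. \<phi> y $ i * ?b y) = - (LINT y|lebesgue_on \<Omega>. D\<phi> y $ i $ j * bump x r y)"
      using w bump_test_function[OF r] fd by (auto simp: weak_derivative_def)
    moreover have "(LINT y|lebesgue_on \<Omega>. \<phi> y $ i * ?b y) = (LINT y|lebesgue_on \<Omega>. ?b y * f y $ i)"
      by (rule integral_cong_AE)
         (use mf m\<phi> bm' ae1 in \<open>auto intro!: borel_measurable_times borel_measurable_vec_component elim!: eventually_mono\<close>)
    moreover have "(LINT y|lebesgue_on \<Omega>. D\<phi> y $ i $ j * bump x r y) = (LINT y|lebesgue_on \<Omega>. bump x r y * F y $ i $ j)"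
      by (rule integral_cong_AE)
         (use mf m\<phi> um' ae2 in \<open>auto intro!: borel_measurable_times borel_measurable_vec_component elim!: eventually_mono\<close>)
    moreover have "(LINT y|lebesgue_on \<Omega>. ?b y * f y $ i) = (LINT y|lebesgue. ?b y * f y $ i)"
    proof -
      have "indicator \<Omega> y *\<^sub>R (?b y * f y $ i) = ?b y * f y $ i" for y
        using f(3)[of y] by (cases "y \<in> \<Omega>") auto
      moreover have "(LINT y|lebesgue_on \<Omega>. ?b y * f y $ i) = (LINT y|lebesgue. indicator \<Omega> y *\<^sub>R (?b y * f y $ i))"
        by (rule integral_restrict_space) (use S in simp)
      ultimately show ?thesis by (simp only:)
    qed
    moreover have "(LINT y|lebesgue_on \<Omega>. bump x r y * F y $ i $ j) = (LINT y|lebesgue. bump x r y * F y $ i $ j)"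
    proof -
      have "indicator \<Omega> y *\<^sub>R (bump x r y * F y $ i $ j) = bump x r y * F y $ i $ j" for y
        using F(3)[of y] by (cases "y \<in> \<Omega>") auto
      moreover have "(LINT y|lebesgue_on \<Omega>. bump x r y * F y $ i $ j) = (LINT y|lebesgue. indicator \<Omega> y *\<^sub>R (bump x r y * F y $ i $ j))"
        by (rule integral_restrict_space) (use S in simp)
      ultimately show ?thesis by (simp only:)
    qed
    moreover have "(LINT y|lebesgue. ?b y * f y $ i) = (LINT y|lebesgue. ?b y *\<^sub>R f y) $ i"
      using integral_bounded_linear[OF bounded_linear_vec_nth integrable_bump_deriv_scaleR[OF r(1) f(1,2), of x "axis j 1"], of i]
      by simp
    moreover have "(LINT y|lebesgue. bump x r y * F y $ i $ j) = (LINT y|lebesgue. bump x r y *\<^sub>R F y) $ i $ j"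
      using integral_bounded_linear[OF bounded_linear_compose[OF bounded_linear_vec_nth[of j] bounded_linear_vec_nth[of i]] integrable_bump_scaleR[OF r(1) F(1,2), of x]]
      by simp
    ultimately show ?thesis by (simp add: moll_deriv_def moll_def)
  qed
  have lin: "linear (moll_deriv r f x)" by (rule linear_moll_deriv[OF r(1) f(1,2)])
  have "moll_deriv r f x h = moll_deriv r f x (\<Sum>j\<in>UNIV. h $ j *\<^sub>R axis j 1)"
    using basis_expansion[of h] by (simp add: scalar_mult_eq_scaleR)
  also have "\<dots> = (\<Sum>j\<in>UNIV. h $ j *\<^sub>R moll_deriv r f x (axis j 1))"
    by (simp add: linear_sum[OF lin] linear_scale[OF lin])
  also have "\<dots> = moll r F x *v h"
    by (simp add: vec_eq_iff matrix_vector_mult_def comp mult.commute)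
  finally show ?thesis .
qed

lemma segment_lipschitz_bound:
  fixes g :: "'a::euclidean_space \<Rightarrow> 'b::euclidean_space"
  assumes "\<And>p. p \<in> closed_segment x y \<Longrightarrow> (g has_derivative g' p) (at p)"
    and "\<And>p h. p \<in> closed_segment x y \<Longrightarrow> norm (g' p h) \<le> B * norm h"
  shows "norm (g x - g y) \<le> B * norm (x - y)"
proof (rule differentiable_bound[OF convex_closed_segment])
  show "(g has_derivative g' p) (at p within closed_segment x y)" if "p \<in> closed_segment x y" for p
    by (rule has_derivative_at_withinI[OF assms(1)[OF that]])
  show "onorm (g' p) \<le> B" if "p \<in> closed_segment x y" for p
    by (rule onorm_le[OF assms(2)[OF that]])
qed auto

text \<open>The gradient of a mollification is an average of contractions, so mollifications are
  short along segments away from the boundary, and their limit inherits this. Strictness at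
  \<open>x\<close> comes from Lebesgue points of the weak gradient: along the whole segment from
  \<open>x\<close> to a near point the averaged gradient is close to the gradient at
  \<open>x\<close>.\<close>

theorem weak_contraction_representative:
  fixes \<phi> :: "real ^ 'n \<Rightarrow> real ^ 'n"
  assumes op: "open \<Omega>" and w: "weak_derivative \<Omega> \<phi> D\<phi>" and Linf: "\<phi> \<in> L_infinity \<Omega>"
    and contr: "AE x in lebesgue_on \<Omega>. \<exists>c<1. \<forall>h. norm (D\<phi> x *v h) \<le> c * norm h"
  obtains v K where "short_on \<Omega> v" "\<And>x. x \<in> \<Omega> \<Longrightarrow> norm (v x) \<le> K"
    "AE x in lebesgue_on \<Omega>. v x = \<phi> x" "AE x in lebesgue_on \<Omega>. strict_at v x"
proof -
  have S: "\<Omega> \<in> sets lebesgue" using op by auto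
  obtain K0 where K0: "AE x in lebesgue_on \<Omega>. norm (\<phi> x) \<le> K0" using Linf by (auto simp: L_infinity_def)
  \<comment> \<open>\<open>K0\<close> can be negative when \<Omega> is empty, while \<open>f\<close>
    takes the value 0 and needs a nonnegative bound.\<close>
  define K where "K = max K0 0"
  define f where "f y = (if y \<in> \<Omega> \<and> norm (\<phi> y) \<le> K then \<phi> y else 0)" for y
  \<comment> \<open>Replacing the gradient by 0 where it is not a contraction changes it only on a
    null set and makes \<open>F\<close> bounded everywhere; measurability holds because the
    contractions form a closed set.\<close>
  define F where "F y = (if y \<in> \<Omega> \<and> (\<forall>h. norm (D\<phi> y *v h) \<le> norm h) then D\<phi> y else 0)" for y
  have fm: "f \<in> borel_measurable lebesgue"
  proof -
    let ?g = "\<lambda>x. if x \<in> \<Omega> then \<phi> x else 0"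
    have g: "?g \<in> borel_measurable lebesgue" using w op by (intro locally_integrable_measurable) (auto simp: weak_derivative_def)
    have "f = (\<lambda>y. if norm (?g y) \<le> K then ?g y else 0)" by (auto simp: f_def K_def fun_eq_iff)
    moreover have "(\<lambda>y. if norm (?g y) \<le> K then ?g y else 0) \<in> borel_measurable lebesgue"
      using g by measurable
    ultimately show ?thesis by simp
  qed
  have Fm: "F \<in> borel_measurable lebesgue"
  proof -
    let ?g = "\<lambda>x. if x \<in> \<Omega> then D\<phi> x else 0"
    let ?C = "{A :: real ^ 'n ^ 'n. \<forall>h. norm (A *v h) \<le> norm h}"
    have g: "?g \<in> borel_measurable lebesgue" using w op by (intro locally_integrable_measurable) (auto simp: weak_derivative_def)
    have "?C \<in> sets borel" using closed_contractions by (rule borel_closed)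
    define Good where "Good = {y. ?g y \<in> ?C}"
    have P: "Good \<in> sets lebesgue"
      unfolding Good_def using measurable_sets[OF g \<open>?C \<in> sets borel\<close>] by (simp add: vimage_def)
    have "F = (\<lambda>y. if y \<in> Good then ?g y else 0)" by (auto simp: F_def Good_def fun_eq_iff)
    moreover have "(\<lambda>y. if y \<in> Good then ?g y else 0) \<in> borel_measurable lebesgue"
      using P by (intro measurable_If_set[OF g]) simp_all
    ultimately show ?thesis by simp
  qed
  have fK: "norm (f y) \<le> K" for y by (simp add: f_def K_def)
  have F1: "norm (F y *v h) \<le> norm h" for y h by (simp add: F_def)
  have FL: "norm (F y) \<le> real (CARD('n) * CARD('n))" for y
  proof -
    have e: "\<bar>F y $ i $ j\<bar> \<le> 1" for i j
    proof -
      have "\<bar>(F y *v axis j 1) $ i\<bar> \<le> norm (axis j (1::real))" using F1 component_le_norm_cart order_trans by metis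
      then show ?thesis by (simp add: matrix_vector_mult_basis column_def)
    qed
    have "norm (F y) \<le> (\<Sum>i\<in>UNIV. norm (F y $ i))" unfolding norm_vec_def by (rule L2_set_le_sum) simp
    also have "\<dots> \<le> (\<Sum>i\<in>(UNIV::'n set). \<Sum>j\<in>(UNIV::'n set). 1)"
      using e by (intro sum_mono order_trans[OF norm_le_l1_cart]) auto
    finally show ?thesis by simp
  qed
  have f0: "f y = 0" "F y = 0" if "y \<notin> \<Omega>" for y using that by (auto simp: f_def F_def)
  have c': "AE x in lebesgue. x \<in> \<Omega> \<longrightarrow> (\<exists>c<1. \<forall>h. norm (D\<phi> x *v h) \<le> c * norm h)"
    using contr by (simp add: AE_lebesgue_on_iff S)
  have b': "AE x in lebesgue. x \<in> \<Omega> \<longrightarrow> norm (\<phi> x) \<le> K0"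
    using K0 by (simp add: AE_lebesgue_on_iff S)
  have ae: "AE y in lebesgue. y \<in> \<Omega> \<longrightarrow> f y = \<phi> y \<and> F y = D\<phi> y"
    using c' b'
  proof eventually_elim
    case (elim y)
    have "norm (D\<phi> y *v h) \<le> norm h" if "c < 1" "norm (D\<phi> y *v h) \<le> c * norm h" for c h
      using that mult_right_mono[of c 1 "norm h"] by auto
    then have "y \<in> \<Omega> \<longrightarrow> (\<forall>h. norm (D\<phi> y *v h) \<le> norm h)" using elim(1) by blast
    then show ?case using elim(2) by (auto simp: f_def F_def K_def)
  qed
  have deriv: "(moll r f has_derivative (\<lambda>h. moll r F p *v h)) (at p)" if "r > 0" "cball p r \<subseteq> \<Omega>" for p r
  proof -
    have "moll_deriv r f p = (\<lambda>h. moll r F p *v h)"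
      using moll_deriv_eq_moll_weak[OF w op fm fK f0(1) Fm FL f0(2) ae that] by blast
    then show ?thesis using moll_has_derivative[OF that(1) fm fK, of p] by simp
  qed
  have avg: "norm (moll r F p *v h) \<le> norm h" if "r > 0" for r p h
  proof -
    have "moll r F p *v h = (1 / bump_mass TYPE(real ^ 'n) r) *\<^sub>R (\<integral>y. bump p r y *\<^sub>R (F y *v h) \<partial>lebesgue)"
      using integral_bounded_linear[OF bounded_linear_matrix_vector_left integrable_bump_scaleR[OF that Fm FL, of p], of h]
      by (simp add: moll_def scaleR_matrix_vector_assoc[symmetric])
    then show ?thesis using norm_bump_average_le[OF that, of p "\<lambda>y. F y *v h" "norm h"] F1 by simp
  qed
  have mshort: "norm (moll r f x - moll r f y) \<le> norm (x - y)"
    if "r > 0" "\<And>p. p \<in> closed_segment x y \<Longrightarrow> cball p r \<subseteq> \<Omega>" for r x y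
    using segment_lipschitz_bound[of x y "moll r f" "\<lambda>p h. moll r F p *v h" 1] deriv[OF that(1) that(2)] avg[OF that(1)]
    by simp
  \<comment> \<open>Lower bound for the mass of a bump relative to the volume of its ball, taken
    from \<open>bump_mass_ge\<close>.\<close>
  define \<kappa> where "\<kappa> = flat 0 (3/4) / 2 ^ CARD('n)"
  have \<kappa>: "\<kappa> > 0" by (simp add: \<kappa>_def flat_pos)
  have mass: "bump_mass TYPE(real ^ 'n) r \<ge> \<kappa> * measure lebesgue (ball (x :: real ^ 'n) r)" if "r > 0" for r x
    using bump_mass_ge[OF that, of x] by (simp add: \<kappa>_def)
  have Lf: "AE x in lebesgue. \<forall>e>0. \<exists>s>0. \<forall>r. 0 < r \<and> r < s \<longrightarrow> norm (moll r f x - f x) < e"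
    using AE_lebesgue_point[OF fm fK]
  proof eventually_elim
    case (elim x)
    show ?case
    proof (intro allI impI)
      fix e :: real assume e: "e > 0"
      then have "\<kappa> * e / 2 > 0" using \<kappa> by simp
      then obtain s where s: "s > 0" "\<And>d k. 0 < d \<and> d < s \<and> k \<in> borel_measurable lebesgue \<and>
          (\<forall>y. \<bar>k y\<bar> \<le> indicator (ball x d) y) \<Longrightarrow>
          norm (\<integral>y. k y *\<^sub>R (f y - f x) \<partial>lebesgue) \<le> \<kappa> * e / 2 * measure lebesgue (ball x d)"
        using elim[rule_format, of "\<kappa> * e / 2"] by blast
      have "norm (moll r f x - f x) < e" if r: "0 < r" "r < s" for r
      proof -
        let ?m = "bump_mass TYPE(real ^ 'n) r"
        have m: "?m > 0" by (rule bump_mass_pos[OF r(1)])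
        have "norm (\<integral>y. bump x r y *\<^sub>R (f y - f x) \<partial>lebesgue) \<le> \<kappa> * e / 2 * measure lebesgue (ball x r)"
          using s(2)[of r "bump x r"] r bump_measurable bump_le_indicator[OF r(1)] by blast
        also have "\<dots> \<le> e / 2 * ?m" using mult_left_mono[OF mass[OF r(1), of x], of "e / 2"] e by (simp add: mult.assoc mult.left_commute)
        finally have "norm (moll r f x - f x) \<le> e / 2"
          unfolding moll_diff_const[OF r(1) fm fK] using m by (simp add: divide_simps mult.commute)
        then show ?thesis using e by linarith
      qed
      then show "\<exists>s>0. \<forall>r. 0 < r \<and> r < s \<longrightarrow> norm (moll r f x - f x) < e" using s(1) by blast
    qed
  qed
  define g where "g n = moll (1 / real (Suc n)) f" for n
  have small: "\<forall>\<^sub>F n in sequentially. 1 / real (Suc n) < s" if "s > 0" for s :: real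
    using LIMSEQ_inverse_real_of_nat that by (auto simp: order_tendstoD(2) inverse_eq_divide dest: order_tendstoD(2))
  have Lg: "AE x in lebesgue. (\<lambda>n. g n x) \<longlonglongrightarrow> f x"
    using Lf
  proof eventually_elim
    case (elim x)
    show ?case unfolding tendsto_iff
    proof (intro allI impI)
      fix e :: real assume "e > 0"
      then obtain s where s: "s > 0" "\<And>r. 0 < r \<Longrightarrow> r < s \<Longrightarrow> norm (moll r f x - f x) < e" using elim by blast
      show "\<forall>\<^sub>F n in sequentially. dist (g n x) (f x) < e"
        using small[OF s(1)] by eventually_elim (use s(2) in \<open>simp add: g_def dist_norm\<close>)
    qed
  qed
  have gshort: "\<forall>\<^sub>F n in sequentially. norm (g n x - g n y) \<le> norm (x - y)" if seg: "closed_segment x y \<subseteq> \<Omega>" for x y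
  proof -
    obtain e where e: "e > 0" "(\<Union>p\<in>closed_segment x y. cball p e) \<subseteq> \<Omega>"
      by (rule compact_subset_open_imp_cball_epsilon_subset[OF compact_segment op seg]) (rule that)
    show ?thesis using small[OF e(1)]
    proof eventually_elim
      case (elim n)
      have "cball p (1 / real (Suc n)) \<subseteq> \<Omega>" if "p \<in> closed_segment x y" for p
      proof -
        have "cball p (1 / real (Suc n)) \<subseteq> cball p e" using elim by (intro subset_cball) simp
        then show ?thesis using e(2) that by blast
      qed
      then show ?case unfolding g_def by (intro mshort) auto
    qed
  qed
  \<comment> \<open>The mollifications are known to converge almost everywhere only. A point
    \<open>z\<close> of convergence close to \<open>x\<close>, and shortness between the two, give
    the Cauchy property at every point of \<Omega>.\<close>
  have conv: "convergent (\<lambda>n. g n x)" if x: "x \<in> \<Omega>" for x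
  proof (rule Cauchy_convergent, rule metric_CauchyI)
    fix e :: real assume e: "e > 0"
    obtain r0 where r0: "r0 > 0" "ball x r0 \<subseteq> \<Omega>" using op x by (meson open_contains_ball)
    have "min r0 (e / 4) > 0" using e r0 by simp
    from AE_imp_ball_witness[OF Lg this] obtain z where z: "norm (z - x) < min r0 (e / 4)" "(\<lambda>n. g n z) \<longlonglongrightarrow> f z" by blast
    have "closed_segment x z \<subseteq> ball x r0" using z r0(1) by (intro closed_segment_subset) (auto simp: dist_norm norm_minus_commute)
    then have "closed_segment x z \<subseteq> \<Omega>" using r0 by blast
    from gshort[OF this] have 1: "\<forall>\<^sub>F n in sequentially. norm (g n x - g n z) < e / 4"
      by eventually_elim (use z in \<open>simp add: norm_minus_commute\<close>)
    have 2: "\<forall>\<^sub>F n in sequentially. dist (g n z) (f z) < e / 4" using tendstoD[OF z(2), of "e / 4"] e by simp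
    from 1 2 have "\<forall>\<^sub>F n in sequentially. dist (g n x) (f z) < e / 2"
    proof eventually_elim
      case (elim n)
      then show ?case using dist_triangle[of "g n x" "f z" "g n z"] by (simp add: dist_norm)
    qed
    then obtain M where M: "\<And>n. n \<ge> M \<Longrightarrow> dist (g n x) (f z) < e / 2" by (auto simp: eventually_sequentially)
    have "dist (g m x) (g n x) < e" if "m \<ge> M" "n \<ge> M" for m n
      using M[OF that(1)] M[OF that(2)] dist_triangle2[of "g m x" "g n x" "f z"] by linarith
    then show "\<exists>M. \<forall>m\<ge>M. \<forall>n\<ge>M. dist (g m x) (g n x) < e" by blast
  qed
  define v where "v x = (if x \<in> \<Omega> then lim (\<lambda>n. g n x) else 0)" for x
  have glim: "(\<lambda>n. g n x) \<longlonglongrightarrow> v x" if "x \<in> \<Omega>" for x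
    using conv[OF that] that by (simp add: v_def convergent_LIMSEQ_iff)
  have vf: "AE x in lebesgue. f x = v x"
    using Lg
  proof eventually_elim
    case (elim x)
    then show ?case using glim[of x] f0(1)[of x] LIMSEQ_unique by (cases "x \<in> \<Omega>") (auto simp: v_def)
  qed
  have vm: "v \<in> borel_measurable lebesgue" by (rule borel_measurable_AE[OF fm vf])
  have vK: "norm (v x) \<le> K" for x
  proof (cases "x \<in> \<Omega>")
    case True
    have "norm (g n x) \<le> K" for n
      using moll_near[OF _ fm fK, of "1 / real (Suc n)" x 0 K] fK by (simp add: g_def)
    then show ?thesis using tendsto_norm[OF glim[OF True]] by (intro LIMSEQ_le_const2[of "\<lambda>n. norm (g n x)"]) auto
  qed (simp add: v_def K_def)
  have vshort: "norm (v x - v y) \<le> norm (x - y)" if seg: "closed_segment x y \<subseteq> \<Omega>" for x y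
  proof -
    have "x \<in> \<Omega>" "y \<in> \<Omega>" using seg by auto
    then have "(\<lambda>n. norm (g n x - g n y)) \<longlonglongrightarrow> norm (v x - v y)"
      by (intro tendsto_norm tendsto_diff glim)
    then show ?thesis using gshort[OF seg] by (rule tendsto_upperbound) simp
  qed
  have moll_v: "moll r f x = moll r v x" if "r > 0" for r x
  proof -
    have "(\<integral>y. bump x r y *\<^sub>R f y \<partial>lebesgue) = (\<integral>y. bump x r y *\<^sub>R v y \<partial>lebesgue)"
    proof (rule integral_cong_AE)
      show "(\<lambda>y. bump x r y *\<^sub>R f y) \<in> borel_measurable lebesgue" using bump_measurable[of x r] fm by measurable
      show "(\<lambda>y. bump x r y *\<^sub>R v y) \<in> borel_measurable lebesgue" using bump_measurable[of x r] vm by measurable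
      show "AE y in lebesgue. bump x r y *\<^sub>R f y = bump x r y *\<^sub>R v y" using vf by eventually_elim simp
    qed
    then show ?thesis by (simp add: moll_def)
  qed
  have strict: "strict_at v x"
    if x: "x \<in> \<Omega>" and c: "c < 1" "\<And>h. norm (F x *v h) \<le> c * norm h"
      and L: "\<And>e. e > 0 \<Longrightarrow> \<exists>s>0. \<forall>d k. 0 < d \<and> d < s \<and> k \<in> borel_measurable lebesgue \<and>
        (\<forall>y. \<bar>k y\<bar> \<le> indicator (ball x d) y) \<longrightarrow>
        norm (\<integral>y. k y *\<^sub>R (F y - F x) \<partial>lebesgue) \<le> e * measure lebesgue (ball x d)" for x c
  proof -
    define \<eta> where "\<eta> = min ((1 - c) / 2) 1"
    have \<eta>: "\<eta> > 0" "\<eta> \<le> 1" "c + \<eta> < 1" using c(1) by (auto simp: \<eta>_def min_def field_simps)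
    \<comment> \<open>The mollification radius will be \<theta> times |z - x|. Replacing
      \<open>v\<close> by its mollification at both ends then costs 2 * \<theta> = \<eta> / 2 of
      that distance, and the deviation of the gradient costs the other \<eta> / 2.\<close>
    define \<theta> where "\<theta> = \<eta> / 4"
    have \<theta>: "\<theta> > 0" "\<theta> < 1" using \<eta> by (auto simp: \<theta>_def)
    let ?n = "CARD('n)"
    \<comment> \<open>Chosen so that \<open>e\<close> times the volume of a ball of radius 2 *
      \<rho> equals \<eta> / 2 * \<kappa> times the volume of a ball of radius \<theta> *
      \<rho>.\<close>
    define e where "e = \<eta> / 2 * \<kappa> * (\<theta> / 2) ^ ?n"
    have e: "e > 0" using \<eta> \<kappa> \<theta> by (simp add: e_def)
    obtain s where s: "s > 0" "\<And>d k. 0 < d \<and> d < s \<and> k \<in> borel_measurable lebesgue \<and>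
        (\<forall>y. \<bar>k y\<bar> \<le> indicator (ball x d) y) \<Longrightarrow>
        norm (\<integral>y. k y *\<^sub>R (F y - F x) \<partial>lebesgue) \<le> e * measure lebesgue (ball x d)"
      using L[OF e] by blast
    obtain r0 where r0: "r0 > 0" "ball x r0 \<subseteq> \<Omega>" using op x by (meson open_contains_ball)
    have main: "norm (v z - v x) \<le> (c + \<eta>) * norm (z - x)" if z: "norm (z - x) < min (s / 2) (r0 / 2)" for z
    proof (cases "z = x")
      case False
      define \<rho> where "\<rho> = norm (z - x)"
      have \<rho>: "\<rho> > 0" "2 * \<rho> < s" "2 * \<rho> < r0" using z False by (auto simp: \<rho>_def)
      define r where "r = \<theta> * \<rho>"
      have r: "r > 0" "r < \<rho>" using \<rho> \<theta> by (auto simp: r_def)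
      have seg: "norm (p - x) \<le> \<rho>" if "p \<in> closed_segment z x" for p
        using norm_closed_segment_split[OF that] norm_ge_zero[of "z - p"] by (simp add: \<rho>_def)
      have sub: "ball p r \<subseteq> ball x (2 * \<rho>)" if "p \<in> closed_segment z x" for p
      proof
        fix y assume "y \<in> ball p r"
        then have "norm (y - p) < r" by (simp add: dist_norm norm_minus_commute)
        then show "y \<in> ball x (2 * \<rho>)"
          using seg[OF that] r norm_triangle_ineq[of "y - p" "p - x"] by (simp add: dist_norm norm_minus_commute)
      qed
      have csub: "cball p r \<subseteq> \<Omega>" if "p \<in> closed_segment z x" for p
      proof
        fix y assume "y \<in> cball p r"
        then have "norm (y - p) \<le> r" by (simp add: dist_norm norm_minus_commute)
        then have "y \<in> ball x r0"
          using seg[OF that] r \<rho> norm_triangle_ineq[of "y - p" "p - x"] by (simp add: dist_norm norm_minus_commute)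
        then show "y \<in> \<Omega>" using r0 by blast
      qed
      have close: "norm (moll r F p - F x) \<le> \<eta> / 2" if p: "p \<in> closed_segment z x" for p
      proof -
        let ?m = "bump_mass TYPE(real ^ 'n) r"
        have m: "?m > 0" by (rule bump_mass_pos[OF r(1)])
        have "\<bar>bump p r y\<bar> \<le> indicator (ball x (2 * \<rho>)) y" for y
          by (rule order_trans[OF bump_le_indicator[OF r(1)]])
             (use sub[OF p] in \<open>auto simp add: indicator_def simp del: mem_ball\<close>)
        then have "norm (\<integral>y. bump p r y *\<^sub>R (F y - F x) \<partial>lebesgue) \<le> e * measure lebesgue (ball x (2 * \<rho>))"
          using s(2)[of "2 * \<rho>" "bump p r"] \<rho> bump_measurable[of p r] by simp
        also have "\<dots> = \<eta> / 2 * (\<kappa> * measure lebesgue (ball p r))"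
        proof -
          have rn: "(\<theta> / 2) ^ ?n * (2 * \<rho>) ^ ?n = r ^ ?n"
            unfolding power_mult_distrib[symmetric] r_def by simp
          let ?c = "measure lebesgue (ball (0 :: real ^ 'n) 1)"
          have b: "measure lebesgue (ball x (2 * \<rho>)) = (2 * \<rho>) ^ ?n * ?c" "measure lebesgue (ball p r) = r ^ ?n * ?c"
            using content_ball_conv_unit_ball[of "2 * \<rho>" x] content_ball_conv_unit_ball[of r p] r \<rho> by simp_all
          have "e * ((2 * \<rho>) ^ ?n * ?c) = \<eta> / 2 * (\<kappa> * (((\<theta> / 2) ^ ?n * (2 * \<rho>) ^ ?n) * ?c))"
            unfolding e_def by (simp only: mult.assoc)
          then show ?thesis unfolding b rn .
        qed
        also have "\<dots> \<le> \<eta> / 2 * ?m" using mass[OF r(1), of p] \<eta> by (intro mult_left_mono) auto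
        finally show ?thesis unfolding moll_diff_const[OF r(1) Fm FL] using m by (simp add: divide_simps mult.commute)
      qed
      let ?G = "\<lambda>p. moll r f p - F x *v p"
      have "norm (?G z - ?G x) \<le> (\<eta> / 2) * norm (z - x)"
      proof (rule segment_lipschitz_bound)
        fix p assume p: "p \<in> closed_segment z x"
        show "(?G has_derivative (\<lambda>h. moll r F p *v h - F x *v h)) (at p)"
          by (intro has_derivative_diff deriv[OF r(1) csub[OF p]] bounded_linear_imp_has_derivative matrix_vector_mul_bounded_linear)
        fix h
        have "norm (moll r F p *v h - F x *v h) = norm ((moll r F p - F x) *v h)"
          by (simp add: matrix_vector_mult_diff_rdistrib)
        also have "\<dots> \<le> norm (moll r F p - F x) * norm h" by (rule norm_matrix_vector_le)
        also have "\<dots> \<le> \<eta> / 2 * norm h" using close[OF p] by (intro mult_right_mono) auto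
        finally show "norm (moll r F p *v h - F x *v h) \<le> \<eta> / 2 * norm h" .
      qed
      then have 1: "norm (?G z - ?G x) \<le> \<eta> / 2 * \<rho>" by (simp add: \<rho>_def)
      have near: "norm (moll r f p - v p) \<le> r" if "p \<in> closed_segment z x" for p
        unfolding moll_v[OF r(1)]
      proof (rule moll_near[OF r(1) vm vK])
        fix y assume y: "norm (y - p) < r"
        have "closed_segment y p \<subseteq> cball p r" using y r by (intro closed_segment_subset) (auto simp: dist_norm norm_minus_commute)
        then have "norm (v y - v p) \<le> norm (y - p)" using csub[OF that] by (intro vshort) blast
        then show "norm (v y - v p) \<le> r" using y by linarith
      qed
      have e1: "v z - v x = (?G z - ?G x) - (moll r f z - v z) + (moll r f x - v x) + F x *v (z - x)"
        by (simp add: matrix_vector_mult_diff_distrib)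
      have "norm (v z - v x) \<le> norm (?G z - ?G x) + norm (moll r f z - v z) + norm (moll r f x - v x) + norm (F x *v (z - x))"
        unfolding e1 by (intro order_trans[OF norm_triangle_ineq] add_mono order_trans[OF norm_triangle_ineq4] order_refl)
      also have "\<dots> \<le> \<eta> / 2 * \<rho> + r + r + c * \<rho>"
        using 1 near[of z] near[of x] c(2)[of "z - x"] by (auto simp: \<rho>_def intro!: add_mono)
      also have "\<dots> = (c + \<eta>) * \<rho>" by (simp add: r_def \<theta>_def algebra_simps)
      finally show ?thesis by (simp add: \<rho>_def)
    qed simp
    have "min (s / 2) (r0 / 2) > 0" using s(1) r0(1) by simp
    then show ?thesis unfolding strict_at_def using main \<eta>(3) by blast
  qed
  have "AE x in lebesgue. x \<in> \<Omega> \<longrightarrow> strict_at v x"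
    using AE_lebesgue_point[OF Fm FL] ae c'
  proof eventually_elim
    case (elim x)
    show ?case
    proof
      assume x: "x \<in> \<Omega>"
      then obtain c where c: "c < 1" "\<forall>h. norm (F x *v h) \<le> c * norm h" using elim(2,3) by auto
      show "strict_at v x" using strict[OF x c(1)] c(2) elim(1) by blast
    qed
  qed
  moreover have "AE x in lebesgue. x \<in> \<Omega> \<longrightarrow> v x = \<phi> x"
    using vf ae by eventually_elim auto
  ultimately show ?thesis
    using vshort vK by (intro that[of v K]) (auto simp: short_on_def AE_lebesgue_on_iff S)
qed

section \<open>Strict improvement on balls\<close>

lemma short_on_UNIV: "short_on UNIV u \<longleftrightarrow> (\<forall>x y. norm (u x - u y) \<le> norm (x - y))"
  by (simp add: short_on_def)

lemma short_on_UNIV_D: "short_on UNIV u \<Longrightarrow> norm (u x - u y) \<le> norm (x - y)"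
  by (simp add: short_on_UNIV)

lemma continuous_on_short:
  fixes u :: "'a::euclidean_space \<Rightarrow> 'b::euclidean_space"
  assumes "short_on UNIV u"
  shows "continuous_on S u"
proof -
  have "1-lipschitz_on S u" using assms by (intro lipschitz_onI) (auto simp: short_on_UNIV dist_norm)
  then show ?thesis by (rule lipschitz_on_continuous_on)
qed

lemma strict_at_cong:
  assumes "strict_at u x" "open S" "x \<in> S" "\<And>y. y \<in> S \<Longrightarrow> u y = v y"
  shows "strict_at v x"
proof -
  obtain c s where cs: "c < 1" "s > 0" "\<And>y. norm (y - x) < s \<Longrightarrow> norm (u y - u x) \<le> c * norm (y - x)"
    using assms(1) unfolding strict_at_def by blast
  obtain r where r: "r > 0" "ball x r \<subseteq> S" using assms(2,3) by (meson open_contains_ball)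
  have "norm (v y - v x) \<le> c * norm (y - x)" if "norm (y - x) < min s r" for y
  proof -
    have "y \<in> S" using r(2) that by (auto simp: dist_norm norm_minus_commute)
    then show ?thesis using cs(3)[of y] that assms(3,4) by simp
  qed
  moreover have "min s r > 0" using cs r by simp
  ultimately show ?thesis unfolding strict_at_def using cs(1) by blast
qed

lemma strict_at_convex_combination:
  assumes "short_on UNIV v" "strict_at u x" "0 < s" "s \<le> 1"
  shows "strict_at (\<lambda>y. (1 - s) *\<^sub>R v y + s *\<^sub>R u y) x"
proof -
  obtain c d where cd: "c < 1" "d > 0" "\<And>y. norm (y - x) < d \<Longrightarrow> norm (u y - u x) \<le> c * norm (y - x)"
    using assms(2) unfolding strict_at_def by blast
  have "norm (((1 - s) *\<^sub>R v y + s *\<^sub>R u y) - ((1 - s) *\<^sub>R v x + s *\<^sub>R u x)) \<le> ((1 - s) + s * c) * norm (y - x)"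
    if "norm (y - x) < d" for y
  proof -
    have "((1 - s) *\<^sub>R v y + s *\<^sub>R u y) - ((1 - s) *\<^sub>R v x + s *\<^sub>R u x) = (1 - s) *\<^sub>R (v y - v x) + s *\<^sub>R (u y - u x)"
      by (simp add: scaleR_diff_right)
    also have "norm \<dots> \<le> (1 - s) * norm (v y - v x) + s * norm (u y - u x)"
      using assms(3,4) by (intro order_trans[OF norm_triangle_ineq]) simp
    also have "\<dots> \<le> (1 - s) * norm (y - x) + s * (c * norm (y - x))"
      using assms cd(3)[OF that] short_on_UNIV_D[OF assms(1), of y x] by (intro add_mono mult_left_mono) auto
    finally show ?thesis by (simp add: algebra_simps)
  qed
  moreover have "(1 - s) + s * c < 1" using assms(3) cd(1) by (simp add: mult_less_cancel_left2)
  ultimately show ?thesis unfolding strict_at_def using cd(2) by blast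
qed

text \<open>A factor \<open>c\<close> < 1 is gained on a short initial piece of the segment, and
  shortness on the rest cannot lose it again.\<close>

lemma strict_at_not_rigid:
  assumes u: "short_on UNIV u" and st: "strict_at u x" and ne: "y \<noteq> x"
  shows "norm (u x - u y) < norm (x - y)"
proof -
  obtain c s where cs: "c < 1" "s > 0" "\<And>z. norm (z - x) < s \<Longrightarrow> norm (u z - u x) \<le> c * norm (z - x)"
    using st unfolding strict_at_def by blast
  define d where "d = norm (y - x)"
  have d: "d > 0" using ne by (simp add: d_def)
  define t where "t = min 1 (s / (2 * d))"
  have t: "0 < t" "t \<le> 1" "t * d < s"
    using d cs(2) by (auto simp: t_def min_def field_simps)
  define z where "z = x + t *\<^sub>R (y - x)"
  have zx: "norm (z - x) = t * d" and yz: "norm (y - z) = (1 - t) * d"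
  proof -
    show "norm (z - x) = t * d" using t by (simp add: z_def d_def)
    have "y - z = (1 - t) *\<^sub>R (y - x)" by (simp add: z_def algebra_simps)
    then show "norm (y - z) = (1 - t) * d" using t by (simp add: d_def)
  qed
  have "norm (u x - u y) \<le> norm (u z - u x) + norm (u y - u z)"
    by (metis norm_minus_commute norm_diff_triangle_ineq add.commute diff_add_cancel norm_triangle_ineq add_diff_eq)
  also have "\<dots> \<le> c * (t * d) + (1 - t) * d"
    using cs(3)[of z] zx yz t(3) short_on_UNIV_D[OF u, of y z] by simp
  also have "\<dots> < t * d + (1 - t) * d" using cs(1) t(1) d by simp
  also have "\<dots> = norm (x - y)" by (simp add: d_def algebra_simps norm_minus_commute)
  finally show ?thesis .
qed

text \<open>At a strict point \<open>x\<close> the loss |x - y| - |\<phi> x - \<phi> y| is positive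
  for each \<open>y\<close> on the compact sphere, hence bounded away from 0. The sets where the
  loss exceeds 1/(k+1) for all such \<open>y\<close> are open and increase to almost the whole ball,
  so one of them has half its measure.\<close>

lemma sphere_margin:
  fixes \<phi> :: "'a::euclidean_space \<Rightarrow> 'b::euclidean_space"
  assumes \<phi>: "short_on UNIV \<phi>" and R: "R > 0"
    and st: "AE x in lebesgue. x \<in> ball a R \<longrightarrow> strict_at \<phi> x"
  obtains U \<mu> where "open U" "U \<subseteq> ball a R" "\<mu> > 0"
    "measure lebesgue U \<ge> 1/2 * measure lebesgue (ball a R)"
    "\<And>x y. x \<in> U \<Longrightarrow> y \<in> sphere a R \<Longrightarrow> norm (\<phi> x - \<phi> y) \<le> norm (x - y) - \<mu>"
proof -
  define E where "E \<mu> = {x. \<exists>y. y \<in> sphere a R \<and> (y, x) \<in> {(y, x). norm (x - y) - norm (\<phi> x - \<phi> y) \<le> \<mu>}}" for \<mu> :: real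
  have cE: "closed (E \<mu>)" for \<mu>
  proof -
    have "closed {p :: 'a \<times> 'a. norm (snd p - fst p) - norm (\<phi> (snd p) - \<phi> (fst p)) \<le> \<mu>}"
      by (intro closed_Collect_le continuous_intros continuous_on_compose2[OF continuous_on_short[OF \<phi>, of UNIV]]) auto
    then have "closed {(y, x). norm (x - y) - norm (\<phi> x - \<phi> y) \<le> \<mu>}"
      by (simp add: case_prod_beta')
    then show ?thesis unfolding E_def by (intro closed_compact_projection compact_sphere)
  qed
  define U where "U k = ball a R - E (1 / real (Suc k))" for k
  have oU: "open (U k)" for k unfolding U_def using cE by (intro open_Diff) auto
  have mono: "incseq U"
  proof (rule incseq_SucI)
    fix k
    have "1 / real (Suc (Suc k)) \<le> 1 / real (Suc k)" by (simp add: frac_le)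
    then show "U k \<subseteq> U (Suc k)" unfolding U_def E_def by (auto intro: order_trans)
  qed
  have sub: "x \<in> (\<Union>k. U k)" if x: "x \<in> ball a R" "strict_at \<phi> x" for x
  proof -
    have "continuous_on (sphere a R) (\<lambda>y. norm (x - y) - norm (\<phi> x - \<phi> y))"
      by (intro continuous_intros continuous_on_short[OF \<phi>])
    moreover have "sphere a R \<noteq> {}" using R by simp
    ultimately obtain y0 where y0: "y0 \<in> sphere a R"
      "\<And>y. y \<in> sphere a R \<Longrightarrow> norm (x - y0) - norm (\<phi> x - \<phi> y0) \<le> norm (x - y) - norm (\<phi> x - \<phi> y)"
      using continuous_attains_inf[OF compact_sphere, of a R] by blast
    have "y0 \<noteq> x" using x(1) y0(1) by auto
    then have "0 < norm (x - y0) - norm (\<phi> x - \<phi> y0)" using strict_at_not_rigid[OF \<phi> x(2)] by simp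
    then obtain k where k: "1 / real (Suc k) < norm (x - y0) - norm (\<phi> x - \<phi> y0)" by (rule nat_approx_posE)
    have "x \<notin> E (1 / real (Suc k))"
    proof
      assume "x \<in> E (1 / real (Suc k))"
      then obtain y where "y \<in> sphere a R" "norm (x - y) - norm (\<phi> x - \<phi> y) \<le> 1 / real (Suc k)"
        unfolding E_def by blast
      then show False using y0(2)[of y] k by linarith
    qed
    then show ?thesis using x(1) by (auto simp: U_def)
  qed
  have ball: "ball a R \<in> lmeasurable" by simp
  have Usub: "U k \<subseteq> ball a R" for k by (auto simp: U_def)
  have Um: "U k \<in> lmeasurable" for k
    using oU Usub by (meson bounded_ball bounded_subset lmeasurable_open)
  have UUm: "(\<Union>k. U k) \<in> sets lebesgue" using Um by (intro sets.countable_UN) auto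
  have eq: "measure lebesgue (\<Union>k. U k) = measure lebesgue (ball a R)"
  proof (rule measure_negligible_symdiff[OF ball])
    obtain N where N: "negligible N" "{x. \<not> (x \<in> ball a R \<longrightarrow> strict_at \<phi> x)} \<subseteq> N"
      using st by (auto simp: eventually_ae_filter_negligible)
    show "negligible (ball a R - (\<Union>k. U k) \<union> ((\<Union>k. U k) - ball a R))"
      by (rule negligible_subset[OF N(1)]) (use N(2) sub Usub in blast)
  qed
  have "(\<lambda>k. measure lebesgue (U k)) \<longlonglongrightarrow> measure lebesgue (\<Union>k. U k)"
  proof (rule Lim_measure_incseq[OF _ mono])
    show "range U \<subseteq> sets lebesgue" using Um by auto
    have "emeasure lebesgue (\<Union>k. U k) \<le> emeasure lebesgue (ball a R)"
      using Usub by (intro emeasure_mono) auto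
    also have "\<dots> < \<infinity>" using fmeasurableD2[OF ball] by (simp add: top.not_eq_extremum)
    finally show "emeasure lebesgue (\<Union>k. U k) \<noteq> \<infinity>" by simp
  qed
  moreover have "measure lebesgue (ball a R) > 0" using R by simp
  then have "1/2 * measure lebesgue (ball a R) < measure lebesgue (ball a R)" by linarith
  ultimately have "\<forall>\<^sub>F k in sequentially. 1/2 * measure lebesgue (ball a R) < measure lebesgue (U k)"
    unfolding eq by (rule order_tendstoD(1))
  then obtain k where k: "1/2 * measure lebesgue (ball a R) < measure lebesgue (U k)"
    by (meson eventually_happens trivial_limit_sequentially)
  show ?thesis
  proof (rule that[of "U k" "1 / real (Suc k)"])
    show "norm (\<phi> x - \<phi> y) \<le> norm (x - y) - 1 / real (Suc k)" if "x \<in> U k" "y \<in> sphere a R" for x y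
    proof -
      have "\<not> norm (x - y) - norm (\<phi> x - \<phi> y) \<le> 1 / real (Suc k)"
        using that unfolding U_def E_def by blast
      then show ?thesis by linarith
    qed
  qed (use oU Usub k in auto)
qed

text \<open>A quadratic error disappears under scaling: the local bound is applied to small
  multiples of a unit vector.\<close>

lemma linear_bound_if_local:
  fixes L :: "'a::euclidean_space \<Rightarrow> 'b::euclidean_space"
  assumes L: "linear L" and C: "C \<ge> 0" and loc: "\<And>h. norm h \<le> 1 \<Longrightarrow> norm (L h) \<le> t * norm h + C * (norm h)\<^sup>2"
  shows "norm (L h) \<le> t * norm h"
proof (cases "h = 0")
  case True
  then show ?thesis using linear_0[OF L] by simp
next
  case False
  have unit: "norm (L u) \<le> t" if u: "norm u = 1" for u
  proof (rule field_le_epsilon)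
    fix e :: real assume e: "e > 0"
    define s where "s = min 1 (e / (C + 1))"
    have s: "0 < s" "s \<le> 1" "C * s \<le> e"
    proof -
      show "0 < s" "s \<le> 1" using e C by (auto simp: s_def)
      have "C * s \<le> (C + 1) * (e / (C + 1))" using C e by (intro mult_mono) (auto simp: s_def)
      then show "C * s \<le> e" using C by simp
    qed
    have "s * norm (L u) = norm (L (s *\<^sub>R u))" using s by (simp add: linear_scale[OF L])
    also have "\<dots> \<le> t * s + C * s\<^sup>2" using loc[of "s *\<^sub>R u"] s u by simp
    also have "\<dots> = s * (t + C * s)" by (simp add: power2_eq_square algebra_simps)
    finally have "norm (L u) \<le> t + C * s" using s(1) by simp
    then show "norm (L u) \<le> t + e" using s(3) by linarith
  qed
  have "L h = norm h *\<^sub>R L ((1 / norm h) *\<^sub>R h)" using False by (simp add: linear_scale[OF L])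
  then have "norm (L h) = norm h * norm (L ((1 / norm h) *\<^sub>R h))" by (metis abs_norm_cancel norm_scaleR)
  also have "\<dots> \<le> norm h * t" using unit[of "(1 / norm h) *\<^sub>R h"] False by (intro mult_left_mono) auto
  finally show ?thesis by (simp add: mult.commute)
qed

text \<open>Clamping \<phi> by the projection onto a larger ball makes it bounded and keeps it
  short; it is then mollified and multiplied by a factor \<open>t\<close> < 1. The factor supplies a
  uniform contraction, the mollification a uniform second order remainder.\<close>

lemma smooth_strict_approximation:
  fixes \<phi> :: "'a::euclidean_space \<Rightarrow> 'b::euclidean_space"
  assumes \<phi>: "short_on UNIV \<phi>" and R: "R > 0" and \<mu>: "\<mu> > 0"
  obtains t g M C where "0 \<le> t" "t < 1" "C \<ge> 0" "\<And>x y. norm (g x - g y) \<le> t * norm (x - y)"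
    "\<And>x. x \<in> cball a R \<Longrightarrow> norm (g x - \<phi> x) \<le> \<mu>"
    "\<And>x. linear (M x)" "\<And>x h. norm (M x h) \<le> t * norm h"
    "\<And>x h. norm h \<le> 1 \<Longrightarrow> norm (g (x + h) - g x - M x h) \<le> C * (norm h)\<^sup>2"
proof -
  let ?B = "cball a (R + 1)"
  define \<psi> where "\<psi> = \<phi> \<circ> closest_point ?B"
  have B: "convex ?B" "closed ?B" "?B \<noteq> {}" using R by auto
  have \<psi>s: "norm (\<psi> x - \<psi> y) \<le> norm (x - y)" for x y
  proof -
    have "norm (\<psi> x - \<psi> y) \<le> norm (closest_point ?B x - closest_point ?B y)"
      unfolding \<psi>_def o_def by (rule short_on_UNIV_D[OF \<phi>])
    also have "\<dots> \<le> norm (x - y)" using closest_point_lipschitz[OF B, of x y] by (simp add: dist_norm)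
    finally show ?thesis .
  qed
  have \<psi>\<phi>: "\<psi> x = \<phi> x" if "x \<in> ?B" for x using that by (simp add: \<psi>_def closest_point_self)
  define K where "K = norm (\<phi> a) + (R + 1)"
  have K: "norm (\<psi> x) \<le> K" for x
  proof -
    have "closest_point ?B x \<in> ?B" using B by (intro closest_point_in_set)
    then have "norm (\<psi> x - \<phi> a) \<le> R + 1"
      using short_on_UNIV_D[OF \<phi>, of "closest_point ?B x" a] by (simp add: \<psi>_def dist_norm norm_minus_commute)
    then show ?thesis using norm_triangle_ineq2[of "\<psi> x" "\<phi> a"] by (simp add: K_def)
  qed
  have K0: "K \<ge> 0" using R by (simp add: K_def)
  have \<psi>m: "\<psi> \<in> borel_measurable lebesgue"
    using \<psi>s by (intro continuous_imp_borel_measurable_lebesgue continuous_on_short) (simp add: short_on_UNIV)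
  define \<rho> where "\<rho> = \<mu> / 2"
  have \<rho>: "\<rho> > 0" using \<mu> by (simp add: \<rho>_def)
  \<comment> \<open>Shrinking by \<open>t\<close> moves values by at most (1 - t) * K \<le> \<mu> /
    2; the mollification radius \<mu> / 2 accounts for the other half of the error.\<close>
  define t where "t = 1 - min 1 (\<mu> / (2 * (K + 1)))"
  have t: "0 \<le> t" "t < 1" "(1 - t) * K \<le> \<mu> / 2"
  proof -
    show "0 \<le> t" "t < 1" using \<mu> K0 by (auto simp: t_def)
    have "(1 - t) * K \<le> (\<mu> / (2 * (K + 1))) * (K + 1)" using \<mu> K0 by (intro mult_mono) (auto simp: t_def)
    also have "\<dots> = \<mu> / 2" using K0 by (simp add: field_simps)
    finally show "(1 - t) * K \<le> \<mu> / 2" .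
  qed
  obtain C where C: "C \<ge> 0" "\<And>x h. norm h \<le> 1 \<Longrightarrow>
    norm (moll \<rho> \<psi> (x + h) - moll \<rho> \<psi> x - moll_deriv \<rho> \<psi> x h) \<le> C * (norm h)\<^sup>2"
    using moll_taylor[OF \<rho> \<psi>m K] by blast
  define g where "g x = t *\<^sub>R moll \<rho> \<psi> x" for x
  define M where "M x h = t *\<^sub>R moll_deriv \<rho> \<psi> x h" for x h
  have lip: "norm (g x - g y) \<le> t * norm (x - y)" for x y
    using moll_lipschitz[OF \<rho> K \<psi>s, of x y] t by (auto simp: g_def mult_left_mono simp flip: scaleR_diff_right)
  have lin: "linear (M x)" for x
    unfolding M_def by (intro linear_compose_scale_right linear_moll_deriv[OF \<rho> \<psi>m K])
  have tay: "norm (g (x + h) - g x - M x h) \<le> C * (norm h)\<^sup>2" if "norm h \<le> 1" for x h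
  proof -
    have "norm (g (x + h) - g x - M x h) = t * norm (moll \<rho> \<psi> (x + h) - moll \<rho> \<psi> x - moll_deriv \<rho> \<psi> x h)"
      using t by (simp add: g_def M_def flip: scaleR_diff_right)
    also have "\<dots> \<le> 1 * (C * (norm h)\<^sup>2)" using t C that by (intro mult_mono) auto
    finally show ?thesis by simp
  qed
  have Mb: "norm (M x h) \<le> t * norm h" for x h
  proof (rule linear_bound_if_local[OF lin C(1)])
    fix h :: 'a assume h: "norm h \<le> 1"
    have "norm (M x h) \<le> norm (g (x + h) - g x) + norm (g (x + h) - g x - M x h)"
      using norm_triangle_ineq4[of "g (x + h) - g x" "g (x + h) - g x - M x h"] by simp
    then show "norm (M x h) \<le> t * norm h + C * (norm h)\<^sup>2"
      using tay[OF h, of x] lip[of "x + h" x] by simp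
  qed
  have near: "norm (g x - \<phi> x) \<le> \<mu>" if x: "x \<in> cball a R" for x
  proof -
    have "norm (moll \<rho> \<psi> x - \<psi> x) \<le> \<rho>"
    proof (rule moll_near[OF \<rho> \<psi>m K])
      show "norm (\<psi> y - \<psi> x) \<le> \<rho>" if "norm (y - x) < \<rho>" for y using \<psi>s[of y x] that by linarith
    qed
    moreover have "\<psi> x = \<phi> x" using x by (intro \<psi>\<phi>) auto
    moreover have "g x - \<psi> x = t *\<^sub>R (moll \<rho> \<psi> x - \<psi> x) - (1 - t) *\<^sub>R \<psi> x"
      by (simp add: g_def algebra_simps)
    moreover have "norm (t *\<^sub>R (moll \<rho> \<psi> x - \<psi> x) - (1 - t) *\<^sub>R \<psi> x) \<le> 1 * norm (moll \<rho> \<psi> x - \<psi> x) + (1 - t) * K"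
      using t K[of x] by (intro order_trans[OF norm_triangle_ineq4] add_mono) (auto intro!: mult_left_mono mult_left_le_one_le)
    ultimately show ?thesis using t(3) by (simp add: \<rho>_def)
  qed
  show ?thesis by (rule that[OF t(1,2) C(1) lip near lin Mb tay])
qed

section \<open>Affine pieces on disjoint balls\<close>

lemma disjoint_cballs_dist:
  fixes x y :: "'a::euclidean_space"
  assumes "cball x r \<inter> cball y s = {}" "r > 0" "s > 0"
  shows "norm (x - y) > r + s"
proof (rule ccontr)
  assume "\<not> ?thesis"
  then have le: "norm (x - y) \<le> r + s" by simp
  define z where "z = x + (r / (r + s)) *\<^sub>R (y - x)"
  have "norm (z - x) \<le> r"
  proof -
    have "norm (z - x) = r / (r + s) * norm (x - y)" using assms by (simp add: z_def norm_minus_commute)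
    also have "\<dots> \<le> r / (r + s) * (r + s)" using le assms by (intro mult_left_mono) auto
    finally show ?thesis using assms by simp
  qed
  moreover have "norm (z - y) \<le> s"
  proof -
    have "z - y = (1 - r / (r + s)) *\<^sub>R (x - y)" by (simp add: z_def algebra_simps)
    also have "1 - r / (r + s) = s / (r + s)" using assms by (simp add: field_simps)
    finally have "norm (z - y) = s / (r + s) * norm (x - y)" using assms by simp
    also have "\<dots> \<le> s / (r + s) * (r + s)" using le assms by (intro mult_left_mono) auto
    finally show ?thesis using assms by simp
  qed
  ultimately have "z \<in> cball x r \<inter> cball y s" by (simp add: dist_norm norm_minus_commute)
  then show False using assms(1) by blast
qed

definition affine_ball :: "('a::euclidean_space \<Rightarrow> 'b::euclidean_space) \<Rightarrow> 'a \<times> real \<Rightarrow> bool"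
  where "affine_ball u p \<longleftrightarrow> (\<exists>L c. linear L \<and> c < 1 \<and> (\<forall>h. norm (L h) \<le> c * norm h) \<and>
    (\<forall>y\<in>cball (fst p) (snd p). u y = u (fst p) + L (y - fst p)))"

definition disjoint_balls :: "('a::euclidean_space \<times> real) set \<Rightarrow> bool"
  where "disjoint_balls F \<longleftrightarrow> (\<forall>p\<in>F. snd p > 0) \<and>
    (\<forall>p\<in>F. \<forall>q\<in>F. p \<noteq> q \<longrightarrow> cball (fst p) (snd p) \<inter> cball (fst q) (snd q) = {})"

lemma disjoint_balls_shrink:
  assumes "disjoint_balls F" "0 < c" "c \<le> 1"
  shows "disjoint_balls ((\<lambda>p. (fst p, c * snd p)) ` F)"
proof -
  have "cball (fst p) (c * snd p) \<subseteq> cball (fst p) (snd p)" if "p \<in> F" for p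
    using assms that by (intro subset_cball) (auto simp: disjoint_balls_def mult_left_le_one_le less_imp_le)
  then have 1: "cball (fst p) (c * snd p) \<inter> cball (fst q) (c * snd q) = {}" if "p \<in> F" "q \<in> F" "p \<noteq> q" for p q
    using assms(1) that unfolding disjoint_balls_def by blast
  have 2: "c * snd p > 0" if "p \<in> F" for p using assms that by (simp add: disjoint_balls_def)
  show ?thesis unfolding disjoint_balls_def
  proof (intro conjI ballI impI)
    fix p' assume "p' \<in> (\<lambda>p. (fst p, c * snd p)) ` F"
    then obtain p where p: "p \<in> F" "p' = (fst p, c * snd p)" by blast
    then show "snd p' > 0" using 2 by simp
    fix q' assume "q' \<in> (\<lambda>p. (fst p, c * snd p)) ` F" and ne: "p' \<noteq> q'"
    then obtain q where q: "q \<in> F" "q' = (fst q, c * snd q)" by blast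
    have "p \<noteq> q" using ne p q by blast
    then show "cball (fst p') (snd p') \<inter> cball (fst q') (snd q') = {}" using 1[OF p(1) q(1)] p(2) q(2) by simp
  qed
qed

lemma finite_lower_radius:
  assumes "finite F" "\<And>p. p \<in> F \<Longrightarrow> snd p > (0::real)"
  obtains m where "m > 0" "\<And>p. p \<in> F \<Longrightarrow> m \<le> snd p"
proof (cases "F = {}")
  case False
  then have "Min (snd ` F) > 0" "\<And>p. p \<in> F \<Longrightarrow> Min (snd ` F) \<le> snd p" using assms by auto
  then show ?thesis using that by blast
qed (use that[of 1] in auto)

lemma AE_not_in_negligible:
  "negligible N \<Longrightarrow> AE x in lebesgue. x \<notin> N"
  by (auto simp: eventually_ae_filter_negligible)

text \<open>A smooth strictly contractive approximation is replaced by its first order Taylor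
  polynomials on small disjoint balls. Together with \<phi> on the sphere this is short, and
  Kirszbraun's theorem fills the gaps. The filling need not be strict, so a small share of \<phi> is
  mixed in, and a cutoff removes that share on inner balls to keep the map affine there.\<close>

lemma strict_improvement_on_ball:
  fixes \<phi> :: "'a::euclidean_space \<Rightarrow> 'b::euclidean_space"
  assumes \<phi>: "short_on UNIV \<phi>" and R: "R > 0"
    and st: "AE x in lebesgue. x \<in> ball a R \<longrightarrow> strict_at \<phi> x"
  obtains w F where "short_on UNIV w" "\<And>x. x \<notin> ball a R \<Longrightarrow> w x = \<phi> x"
    "AE x in lebesgue. x \<in> ball a R \<longrightarrow> strict_at w x"
    "finite F" "disjoint_balls F" "\<And>p. p \<in> F \<Longrightarrow> cball (fst p) (snd p) \<subseteq> ball a R"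
    "\<And>p. p \<in> F \<Longrightarrow> affine_ball w p"
    "(\<Sum>p\<in>F. measure lebesgue (cball (fst p) (snd p))) \<ge> (1/2) ^ DIM('a) / 4 * measure lebesgue (ball a R)"
proof -
  obtain U \<mu> where U: "open U" "U \<subseteq> ball a R" "\<mu> > 0"
    "measure lebesgue U \<ge> 1/2 * measure lebesgue (ball a R)"
    "\<And>x y. x \<in> U \<Longrightarrow> y \<in> sphere a R \<Longrightarrow> norm (\<phi> x - \<phi> y) \<le> norm (x - y) - \<mu>"
    by (rule sphere_margin[OF \<phi> R st]) (assumption | rule that)+
  have "\<mu> / 2 > 0" using U(3) by simp
  then obtain t g M C where t: "0 \<le> t" "t < 1" and C: "C \<ge> 0"
    and g: "\<And>x y. norm (g x - g y) \<le> t * norm (x - y)"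
    "\<And>x. x \<in> cball a R \<Longrightarrow> norm (g x - \<phi> x) \<le> \<mu> / 2"
    and M: "\<And>x. linear (M x)" "\<And>x h. norm (M x h) \<le> t * norm h"
    and tay: "\<And>x h. norm h \<le> 1 \<Longrightarrow> norm (g (x + h) - g x - M x h) \<le> C * (norm h)\<^sup>2"
    using smooth_strict_approximation[OF \<phi> R, of "\<mu> / 2"] by metis
  \<comment> \<open>For radii r below \<open>r0\<close> the Taylor error C * r^2 is at most (1 - t)
    / 4 * r, to be paid by the gaps between the balls, and at most \<mu> / 2, to be paid by the
    margin at the sphere.\<close>
  define r0 where "r0 = min 1 (min ((1 - t) / (4 * (C + 1))) (\<mu> / (2 * (C + 1))))"
  have r0: "r0 > 0" "r0 \<le> 1" "C * r0 \<le> (1 - t) / 4" "C * r0 \<le> \<mu> / 2"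
  proof -
    show "r0 > 0" "r0 \<le> 1" using t C U(3) by (auto simp: r0_def)
    have "C * r0 \<le> (C + 1) * ((1 - t) / (4 * (C + 1)))" using t C \<open>r0 > 0\<close> by (intro mult_mono) (auto simp: r0_def)
    also have "\<dots> = (1 - t) / 4" using C by (simp add: field_simps)
    finally show "C * r0 \<le> (1 - t) / 4" .
    have "C * r0 \<le> (C + 1) * (\<mu> / (2 * (C + 1)))" using U(3) C \<open>r0 > 0\<close> by (intro mult_mono) (auto simp: r0_def)
    also have "\<dots> = \<mu> / 2" using C by (simp add: field_simps)
    finally show "C * r0 \<le> \<mu> / 2" .
  qed
  have bU: "bounded U" using U(2) by (meson bounded_ball bounded_subset)
  have half: "0 \<le> (1/2::real)" "(1/2::real) < 1" and r0': "\<And>x. x \<in> U \<Longrightarrow> r0 > 0" using r0 by simp_all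
  obtain P where P: "finite P" "\<And>x r. (x, r) \<in> P \<Longrightarrow> 0 < r \<and> r < r0 \<and> x \<in> U \<and> cball x r \<subseteq> U"
    "\<And>p q. p \<in> P \<Longrightarrow> q \<in> P \<Longrightarrow> p \<noteq> q \<Longrightarrow> cball (fst p) (snd p) \<inter> cball (fst q) (snd q) = {}"
    "1/2 * measure lebesgue U \<le> (\<Sum>p\<in>P. measure lebesgue (cball (fst p) (snd p)))"
    by (rule finite_ball_packing[OF U(1) bU r0' half]) (assumption | rule that)+
  have Pp: "0 < snd p" "snd p < r0" "cball (fst p) (snd p) \<subseteq> U" if "p \<in> P" for p
    using P(2)[of "fst p" "snd p"] that by auto
  have Pd: "disjoint_balls P" using Pp(1) P(3) by (simp add: disjoint_balls_def)
  obtain m where m: "m > 0" "\<And>p. p \<in> P \<Longrightarrow> m \<le> snd p"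
    by (rule finite_lower_radius[OF P(1) Pp(1)]) (assumption | rule that)+
  \<comment> \<open>Mixing raises the contraction factor \<open>t\<close> by at most s * (2 + 4 *
    \<mu> / m), where 4 / m bounds the slope of the cutoff on balls of radius at least
    \<open>m\<close>. Half of 1 - t is available for this.\<close>
  define s where "s = min (1/2) ((1 - t) / 2 / (2 + 4 * \<mu> / m))"
  have dpos: "2 + 4 * \<mu> / m > 0" using U(3) m(1) by (simp add: add_pos_pos)
  have s: "0 < s" "s \<le> 1" "s * (2 + 4 * \<mu> / m) \<le> (1 - t) / 2"
  proof -
    show "0 < s" using t(2) dpos by (simp add: s_def)
    show "s \<le> 1" by (simp add: s_def)
    have "s * (2 + 4 * \<mu> / m) \<le> ((1 - t) / 2 / (2 + 4 * \<mu> / m)) * (2 + 4 * \<mu> / m)"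
      using dpos by (intro mult_right_mono) (auto simp: s_def)
    also have "\<dots> = (1 - t) / 2" using nonzero_eq_divide_eq[of "2 + 4 * \<mu> / m" "(1 - t) / 2 / (2 + 4 * \<mu> / m)" "(1 - t) / 2"] dpos by linarith
    finally show "s * (2 + 4 * \<mu> / m) \<le> (1 - t) / 2" .
  qed
  define L where "L p y = g (fst p) + M (fst p) (y - fst p)" for p :: "'a \<times> real" and y
  \<comment> \<open>Three quarters of the radius: points of two different balls \<open>I p\<close>
    then keep a distance of at least a quarter of the sum of the radii.\<close>
  define I where "I p = cball (fst p) (3/4 * snd p)" for p :: "'a \<times> real"
  have Isub: "I p \<subseteq> cball (fst p) (snd p)" if "p \<in> P" for p
    unfolding I_def using Pp(1)[OF that] by (intro subset_cball) simp
  have IU: "I p \<subseteq> U" if "p \<in> P" for p using Isub[OF that] Pp(3)[OF that] by blast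
  have Idisj: "I p \<inter> I q = {}" if "p \<in> P" "q \<in> P" "p \<noteq> q" for p q
    using Isub[OF that(1)] Isub[OF that(2)] P(3)[OF that] by blast
  have Lg: "norm (L p y - g y) \<le> (1 - t) / 4 * snd p" "norm (L p y - g y) \<le> \<mu> / 2" if p: "p \<in> P" "y \<in> I p" for p y
  proof -
    have d: "norm (y - fst p) \<le> snd p" using Isub[OF p(1)] p(2) by (auto simp: dist_norm norm_minus_commute)
    have "norm (L p y - g y) = norm (g (fst p + (y - fst p)) - g (fst p) - M (fst p) (y - fst p))"
      by (simp add: L_def norm_minus_commute algebra_simps)
    also have "\<dots> \<le> C * (norm (y - fst p))\<^sup>2" using d Pp(2)[OF p(1)] r0(2) by (intro tay) simp
    also have "\<dots> \<le> C * (snd p)\<^sup>2" using d C by (intro mult_left_mono power_mono) auto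
    also have "\<dots> \<le> (C * r0) * snd p"
      using Pp(1,2)[OF p(1)] C by (simp add: power2_eq_square mult.assoc mult_left_mono mult_right_mono)
    finally have *: "norm (L p y - g y) \<le> (C * r0) * snd p" .
    also have "\<dots> \<le> (1 - t) / 4 * snd p" using r0(3) Pp(1)[OF p(1)] by (intro mult_right_mono) auto
    finally show "norm (L p y - g y) \<le> (1 - t) / 4 * snd p" .
    have "(C * r0) * snd p \<le> (\<mu> / 2) * 1" using r0 C Pp(1,2)[OF p(1)] U(3) by (intro mult_mono) auto
    then show "norm (L p y - g y) \<le> \<mu> / 2" using * by simp
  qed
  have Llip: "norm (L p x - L p y) \<le> t * norm (x - y)" for p x y
  proof -
    have "L p x - L p y = M (fst p) (x - y)"
      using linear_diff[OF M(1)[of "fst p"], of "x - fst p" "y - fst p"] by (simp add: L_def)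
    then show ?thesis using M(2) by simp
  qed
  have L\<phi>: "norm (\<phi> y - L p y) \<le> \<mu>" if p: "p \<in> P" "y \<in> I p" for p y
  proof -
    have "y \<in> cball a R" using IU[OF p(1)] p(2) U(2) ball_subset_cball by blast
    then have "norm (g y - \<phi> y) \<le> \<mu> / 2" by (rule g(2))
    then show ?thesis using Lg(2)[OF p] norm_triangle_ineq[of "L p y - g y" "g y - \<phi> y"]
      by (simp add: norm_minus_commute)
  qed
  define D where "D = sphere a R \<union> (\<Union>p\<in>P. I p)"
  define f where "f x = (if x \<in> sphere a R then \<phi> x else L (SOME p. p \<in> P \<and> x \<in> I p) x)" for x
  have fsph: "f x = \<phi> x" if "x \<in> sphere a R" for x using that by (simp add: f_def)
  have fI: "f x = L p x" if p: "p \<in> P" "x \<in> I p" for p x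
  proof -
    have "x \<notin> sphere a R" using IU[OF p(1)] p(2) U(2) by (auto simp: dist_norm)
    moreover have "(SOME p. p \<in> P \<and> x \<in> I p) = p"
    proof (rule some_equality)
      show "q = p" if "q \<in> P \<and> x \<in> I q" for q using Idisj[of q p] that p by blast
    qed (use p in simp)
    ultimately show ?thesis by (simp add: f_def)
  qed
  \<comment> \<open>\<phi> differs from the Taylor polynomial by at most \<mu>, and just \<mu> is
    saved between a point of \<open>U\<close> and a point of the sphere.\<close>
  have mixed: "norm (L p x - \<phi> y) \<le> norm (x - y)" if p: "p \<in> P" "x \<in> I p" and y: "y \<in> sphere a R" for p x y
  proof -
    have "norm (L p x - \<phi> y) \<le> norm (\<phi> x - L p x) + norm (\<phi> x - \<phi> y)"
      using norm_triangle_ineq4[of "\<phi> x - \<phi> y" "\<phi> x - L p x"] by simp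
    also have "\<dots> \<le> \<mu> + (norm (x - y) - \<mu>)"
      using L\<phi>[OF p] U(5)[OF _ y, of x] IU[OF p(1)] p(2) by (intro add_mono) auto
    finally show ?thesis by simp
  qed
  have pairs: "norm (L p x - L q y) \<le> norm (x - y)" if p: "p \<in> P" "x \<in> I p" and q: "q \<in> P" "y \<in> I q" for p q x y
  proof (cases "p = q")
    case True
    then show ?thesis using Llip[of p x y] t mult_right_mono[of t 1 "norm (x - y)"] by simp
  next
    case False
    have "snd p + snd q < norm (fst p - fst q)"
      using P(3)[OF p(1) q(1) False] Pp(1)[OF p(1)] Pp(1)[OF q(1)] by (intro disjoint_cballs_dist)
    moreover have "norm (fst p - fst q) \<le> norm (fst p - x) + norm (x - y) + norm (y - fst q)"
      using norm_triangle_ineq[of "fst p - x" "(x - y) + (y - fst q)"] norm_triangle_ineq[of "x - y" "y - fst q"] by simp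
    moreover have "norm (fst p - x) \<le> 3/4 * snd p" "norm (y - fst q) \<le> 3/4 * snd q"
      using p(2) q(2) by (auto simp: I_def dist_norm norm_minus_commute)
    moreover have "(A + B) / 4 \<le> d" if "A + B < N" "N \<le> X + d + Y" "X \<le> 3/4 * A" "Y \<le> 3/4 * B"
      for A B N X Y d :: real using that by argo
    ultimately have gap: "(snd p + snd q) / 4 \<le> norm (x - y)" by blast
    have "norm (L p x - L q y) \<le> norm (L p x - g x) + norm (g x - g y) + norm (L q y - g y)"
      using norm_triangle_ineq[of "L p x - g x" "g x - g y"] norm_triangle_ineq4[of "L p x - g y" "L q y - g y"] by simp
    also have "\<dots> \<le> (1 - t) / 4 * snd p + t * norm (x - y) + (1 - t) / 4 * snd q"
      using Lg(1)[OF p] Lg(1)[OF q] g(1)[of x y] by linarith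
    \<comment> \<open>The gap converts both Taylor errors into a multiple 1 - t of the distance,
      which raises the factor \<open>t\<close> of \<open>g\<close> to 1.\<close>
    also have "\<dots> = (1 - t) * ((snd p + snd q) / 4) + t * norm (x - y)" by (simp add: field_simps)
    also have "\<dots> \<le> (1 - t) * norm (x - y) + t * norm (x - y)"
      using gap t by (intro add_mono mult_left_mono) auto
    finally show ?thesis by (simp add: algebra_simps)
  qed
  have fshort: "norm (f x - f y) \<le> norm (x - y)" if xy: "x \<in> D" "y \<in> D" for x y
  proof -
    consider "x \<in> sphere a R" "y \<in> sphere a R" | p where "x \<in> sphere a R" "p \<in> P" "y \<in> I p"
      | p where "y \<in> sphere a R" "p \<in> P" "x \<in> I p" | p q where "p \<in> P" "q \<in> P" "x \<in> I p" "y \<in> I q"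
      using xy unfolding D_def by blast
    then show ?thesis
    proof cases
      case 1
      then show ?thesis using fsph short_on_UNIV_D[OF \<phi>] by simp
    next
      case 2
      then show ?thesis using fsph[OF 2(1)] fI[OF 2(2,3)] mixed[OF 2(2,3,1)] by (simp add: norm_minus_commute)
    next
      case 3
      then show ?thesis using fsph[OF 3(1)] fI[OF 3(2,3)] mixed[OF 3(2,3,1)] by simp
    next
      case 4
      then show ?thesis using fI[OF 4(1,3)] fI[OF 4(2,4)] pairs[OF 4(1,3,2,4)] by simp
    qed
  qed
  obtain v where v: "\<And>x. x \<in> D \<Longrightarrow> v x = f x" "\<And>x y. norm (v x - v y) \<le> norm (x - y)"
    by (rule Kirszbraun[OF fshort]) (assumption | rule that)+
  have vs: "short_on UNIV v" using v(2) by (simp add: short_on_UNIV)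
  \<comment> \<open>The extension \<open>v\<close> may be isometric in places; the share
    \<open>s\<close> of \<phi> restores strictness almost everywhere. On the sphere both maps equal
    \<phi>.\<close>
  define w1 where "w1 x = (if x \<in> cball a R then (1 - s) *\<^sub>R v x + s *\<^sub>R \<phi> x else \<phi> x)" for x
  have comb: "norm (((1 - s) *\<^sub>R v x + s *\<^sub>R \<phi> x) - ((1 - s) *\<^sub>R v y + s *\<^sub>R \<phi> y)) \<le> norm (x - y)" for x y
  proof -
    have "((1 - s) *\<^sub>R v x + s *\<^sub>R \<phi> x) - ((1 - s) *\<^sub>R v y + s *\<^sub>R \<phi> y) = (1 - s) *\<^sub>R (v x - v y) + s *\<^sub>R (\<phi> x - \<phi> y)"
      by (simp add: algebra_simps)
    also have "norm \<dots> \<le> (1 - s) * norm (v x - v y) + s * norm (\<phi> x - \<phi> y)"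
      using s by (intro order_trans[OF norm_triangle_ineq]) simp
    also have "\<dots> \<le> (1 - s) * norm (x - y) + s * norm (x - y)"
      using s v(2) short_on_UNIV_D[OF \<phi>] by (intro add_mono mult_left_mono) auto
    finally show ?thesis by (simp add: algebra_simps)
  qed
  have w1sph: "w1 x = \<phi> x" if "x \<in> sphere a R" for x
    using that v(1)[of x] fsph[OF that] by (simp add: w1_def D_def algebra_simps)
  have w1s: "short_on UNIV w1"
  proof (rule short_on_glue[OF \<phi>, of "{cball a R}"])
    show "norm (w1 x - w1 y) \<le> norm (x - y)" if "S \<in> {cball a R}" "x \<in> S" "y \<in> S" for S x y
      using that comb[of x y] by (simp add: w1_def)
    show "w1 x = \<phi> x" if "S \<in> {cball a R}" "x \<in> frontier S" for S x using that w1sph by simp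
  qed (auto simp: w1_def)
  \<comment> \<open>Cutoff with value 0 on the half ball and 1 from three quarters of the radius on.
    Thus \<open>h\<close> passes from the affine map to (1 - s) L + s \<phi>, which is
    \<open>w1\<close> on the frontier of \<open>I p\<close>.\<close>
  define q where "q p x = min 1 (max 0 ((norm (x - fst p) - snd p / 2) * (4 / snd p)))" for p :: "'a \<times> real" and x
  define h where "h p x = L p x + (s * q p x) *\<^sub>R (\<phi> x - L p x)" for p x
  define w where "w x = (if \<exists>p\<in>P. x \<in> I p then h (SOME p. p \<in> P \<and> x \<in> I p) x else w1 x)" for x
  have wI: "w x = h p x" if p: "p \<in> P" "x \<in> I p" for p x
  proof -
    have "(SOME p. p \<in> P \<and> x \<in> I p) = p"
    proof (rule some_equality)
      show "q = p" if "q \<in> P \<and> x \<in> I q" for q using Idisj[of q p] that p by blast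
    qed (use p in simp)
    then show ?thesis using p by (auto simp: w_def)
  qed
  have woff: "w x = w1 x" if "\<And>p. p \<in> P \<Longrightarrow> x \<notin> I p" for x using that by (auto simp: w_def)
  have q01: "0 \<le> q p x" "q p x \<le> 1" for p x by (auto simp: q_def)
  have qlip: "\<bar>q p x - q p y\<bar> \<le> 4 / snd p * norm (x - y)" if "snd p > 0" for p x y
  proof -
    have "\<bar>q p x - q p y\<bar> \<le> \<bar>(norm (x - fst p) - snd p / 2) * (4 / snd p) - (norm (y - fst p) - snd p / 2) * (4 / snd p)\<bar>"
      unfolding q_def by (auto simp: min_def max_def)
    also have "\<dots> = \<bar>norm (x - fst p) - norm (y - fst p)\<bar> * (4 / snd p)"
    proof -
      have e: "(X - k) * m' - (Y - k) * m' = (X - Y) * m'" for X Y k m' :: real by (simp add: algebra_simps)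
      show ?thesis unfolding e abs_mult using that by simp
    qed
    also have "\<dots> \<le> norm (x - y) * (4 / snd p)"
      using norm_triangle_ineq3[of "x - fst p" "y - fst p"] that by (intro mult_right_mono) auto
    finally show ?thesis by (simp add: mult.commute)
  qed
  define c where "c = (1 + t) / 2"
  have c: "c < 1" using t by (simp add: c_def)
  have hlip: "norm (h p x - h p y) \<le> c * norm (x - y)" if p: "p \<in> P" "x \<in> I p" "y \<in> I p" for p x y
  proof -
    let ?X = "\<phi> x - L p x" and ?Y = "\<phi> y - L p y"
    have XY: "norm (?X - ?Y) \<le> 2 * norm (x - y)"
    proof -
      have "?X - ?Y = (\<phi> x - \<phi> y) - (L p x - L p y)" by simp
      then have "norm (?X - ?Y) \<le> norm (\<phi> x - \<phi> y) + norm (L p x - L p y)" using norm_triangle_ineq4 by metis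
      then show ?thesis using short_on_UNIV_D[OF \<phi>, of x y] pairs[OF p(1,2,1,3)] by linarith
    qed
    have e: "h p x - h p y = (L p x - L p y) + (s * q p x) *\<^sub>R (?X - ?Y) + (s * (q p x - q p y)) *\<^sub>R ?Y"
      by (simp add: h_def algebra_simps)
    have "norm (h p x - h p y) \<le> norm (L p x - L p y) + s * q p x * norm (?X - ?Y) + s * \<bar>q p x - q p y\<bar> * norm ?Y"
      unfolding e using s q01[of p x]
      by (intro order_trans[OF norm_triangle_ineq] add_mono order_trans[OF norm_triangle_ineq]) (auto simp: abs_mult)
    also have "\<dots> \<le> t * norm (x - y) + s * 1 * (2 * norm (x - y)) + s * (4 / m * norm (x - y)) * \<mu>"
    proof -
      have "4 / snd p \<le> 4 / m" using m(1) m(2)[OF p(1)] by (intro divide_left_mono mult_pos_pos) auto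
      then have "4 / snd p * norm (x - y) \<le> 4 / m * norm (x - y)" by (rule mult_right_mono) simp
      then have dq: "\<bar>q p x - q p y\<bar> \<le> 4 / m * norm (x - y)"
        using qlip[OF Pp(1)[OF p(1)], of x y] by linarith
      have "s * q p x * norm (?X - ?Y) \<le> s * 1 * (2 * norm (x - y))"
        using XY q01 s by (intro mult_mono) auto
      moreover have "s * \<bar>q p x - q p y\<bar> * norm ?Y \<le> s * (4 / m * norm (x - y)) * \<mu>"
        using dq L\<phi>[OF p(1,3)] s m(1) by (intro mult_mono mult_left_mono) auto
      ultimately show ?thesis using Llip[of p x y] by linarith
    qed
    also have "\<dots> = (t + s * (2 + 4 * \<mu> / m)) * norm (x - y)" by (simp add: algebra_simps)
    also have "\<dots> \<le> c * norm (x - y)" using s(3) by (intro mult_right_mono) (auto simp: c_def field_simps)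
    finally show ?thesis .
  qed
  have ws: "short_on UNIV w"
  proof (rule short_on_glue[OF w1s, of "I ` P"])
    show "closed S" if "S \<in> I ` P" for S using that by (auto simp: I_def)
    show "S \<inter> T = {}" if "S \<in> I ` P" "T \<in> I ` P" "S \<noteq> T" for S T using that Idisj by blast
    show "norm (w x - w y) \<le> norm (x - y)" if S: "S \<in> I ` P" "x \<in> S" "y \<in> S" for S x y
    proof -
      obtain p where p: "p \<in> P" "S = I p" using S(1) by blast
      then have "norm (w x - w y) \<le> c * norm (x - y)" using hlip[OF p(1)] wI[OF p(1)] S by simp
      then show ?thesis using c mult_right_mono[of c 1 "norm (x - y)"] by simp
    qed
    show "w x = w1 x" if S: "S \<in> I ` P" "x \<in> frontier S" for S x
    proof -
      obtain p where p: "p \<in> P" "S = I p" using S(1) by blast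
      then have xs: "norm (x - fst p) = 3/4 * snd p" using S(2) by (auto simp: I_def dist_norm norm_minus_commute)
      then have xI: "x \<in> I p" by (simp add: I_def dist_norm norm_minus_commute)
      have "x \<in> cball a R" using IU[OF p(1)] xI U(2) ball_subset_cball by blast
      moreover have "v x = L p x" using v(1)[of x] fI[OF p(1) xI] p(1) xI by (auto simp: D_def)
      moreover have "q p x = 1" using xs Pp(1)[OF p(1)] by (simp add: q_def field_simps)
      ultimately show ?thesis using wI[OF p(1) xI] by (simp add: h_def w1_def algebra_simps)
    qed
    show "w x = w1 x" if "x \<notin> \<Union> (I ` P)" for x using that by (intro woff) blast
  qed
  have wout: "w x = \<phi> x" if "x \<notin> ball a R" for x
  proof -
    have "w x = w1 x" using IU U(2) that by (intro woff) blast
    then show ?thesis using that w1sph[of x] by (cases "x \<in> sphere a R") (auto simp: w1_def)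
  qed
  have wst: "AE x in lebesgue. x \<in> ball a R \<longrightarrow> strict_at w x"
  proof -
    let ?N = "\<Union>p\<in>P. sphere (fst p) (3/4 * snd p)"
    have "negligible ?N" using P(1) by (intro negligible_Union) (auto intro: negligible_sphere)
    from AE_not_in_negligible[OF this] st show ?thesis
    proof eventually_elim
      case (elim x)
      show ?case
      proof
        assume x: "x \<in> ball a R"
        show "strict_at w x"
        proof (cases "\<exists>p\<in>P. x \<in> I p")
          case True
          then obtain p where p: "p \<in> P" "x \<in> I p" by blast
          have "x \<in> ball (fst p) (3/4 * snd p)" using p elim(1) by (auto simp: I_def)
          then obtain e where e: "e > 0" "ball x e \<subseteq> ball (fst p) (3/4 * snd p)"
            by (meson open_ball open_contains_ball)
          have "norm (w y - w x) \<le> c * norm (y - x)" if "norm (y - x) < e" for y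
          proof -
            have "y \<in> I p" using that e(2) by (auto simp: I_def dist_norm norm_minus_commute)
            then show ?thesis using hlip[OF p(1) _ p(2)] wI[OF p(1)] p(2) by simp
          qed
          then show ?thesis unfolding strict_at_def using c e(1) by blast
        next
          case False
          let ?O = "ball a R - (\<Union>p\<in>P. I p)"
          have "open ?O" using P(1) by (intro open_Diff closed_UN) (auto simp: I_def)
          moreover have "x \<in> ?O" using x False by blast
          moreover have "(1 - s) *\<^sub>R v y + s *\<^sub>R \<phi> y = w y" if "y \<in> ?O" for y
            using that woff[of y] ball_subset_cball by (auto simp: w1_def)
          moreover have "strict_at (\<lambda>y. (1 - s) *\<^sub>R v y + s *\<^sub>R \<phi> y) x"
            using elim(2) x s by (intro strict_at_convex_combination[OF vs]) auto
          ultimately show ?thesis by (rule strict_at_cong[rotated])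
        qed
      qed
    qed
  qed
  define F where "F = (\<lambda>p. (fst p, 1/2 * snd p)) ` P"
  have Fd: "disjoint_balls F" unfolding F_def using Pd by (intro disjoint_balls_shrink) auto
  have Faff: "affine_ball w p'" if p': "p' \<in> F" for p'
  proof -
    obtain p where p: "p \<in> P" "p' = (fst p, 1/2 * snd p)" using p' by (auto simp: F_def)
    have wL: "w y = L p y" if "y \<in> cball (fst p) (1/2 * snd p)" for y
    proof -
      have "norm (y - fst p) \<le> 1/2 * snd p" using that by (simp add: dist_norm norm_minus_commute)
      then have "(norm (y - fst p) - snd p / 2) * (4 / snd p) \<le> 0"
        by (intro mult_nonpos_nonneg) (use Pp(1)[OF p(1)] in simp_all)
      moreover have "y \<in> I p"
        using \<open>norm (y - fst p) \<le> 1/2 * snd p\<close> Pp(1)[OF p(1)] by (simp add: I_def dist_norm norm_minus_commute)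
      moreover from calculation(1) have "q p y = 0" unfolding q_def by (subst max_absorb1) auto
      ultimately show ?thesis using wI[OF p(1)] by (simp add: h_def)
    qed
    have "w y = w (fst p) + M (fst p) (y - fst p)" if "y \<in> cball (fst p) (1/2 * snd p)" for y
      using wL[OF that] wL[of "fst p"] Pp(1)[OF p(1)] linear_0[OF M(1)] by (simp add: L_def)
    then show ?thesis unfolding affine_ball_def p(2) using M t by (intro exI[of _ "M (fst p)"] exI[of _ t]) auto
  qed
  have Fsub: "cball (fst p') (snd p') \<subseteq> ball a R" if p': "p' \<in> F" for p'
  proof -
    obtain p where p: "p \<in> P" "p' = (fst p, 1/2 * snd p)" using p' by (auto simp: F_def)
    have "cball (fst p) (1/2 * snd p) \<subseteq> cball (fst p) (snd p)" using Pp(1)[OF p(1)] by (intro subset_cball) simp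
    then show ?thesis using Pp(3)[OF p(1)] U(2) p(2) by simp
  qed
  \<comment> \<open>The fraction is the product of 1/2 for \<open>U\<close>, 1/2 for the packing and
    (1/2)^n for halving the radii.\<close>
  have Fmeas: "(\<Sum>p\<in>F. measure lebesgue (cball (fst p) (snd p))) \<ge> (1/2) ^ DIM('a) / 4 * measure lebesgue (ball a R)"
  proof -
    have "inj_on (\<lambda>p. (fst p, 1/2 * snd p)) P" by (auto simp: inj_on_def prod_eq_iff)
    then have "(\<Sum>p\<in>F. measure lebesgue (cball (fst p) (snd p))) = (\<Sum>p\<in>P. measure lebesgue (cball (fst p) (1/2 * snd p)))"
      unfolding F_def by (subst sum.reindex) auto
    also have "\<dots> = (\<Sum>p\<in>P. (1/2) ^ DIM('a) * measure lebesgue (cball (fst p) (snd p)))"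
    proof (rule sum.cong)
      fix p assume "p \<in> P"
      then show "measure lebesgue (cball (fst p) (1/2 * snd p)) = (1/2) ^ DIM('a) * measure lebesgue (cball (fst p) (snd p))"
        using Pp(1)[of p] content_cball[of "1/2 * snd p" "fst p"] content_cball[of "snd p" "fst p"]
        by (simp add: power_divide)
    qed simp
    also have "\<dots> = (1/2) ^ DIM('a) * (\<Sum>p\<in>P. measure lebesgue (cball (fst p) (snd p)))"
      by (simp add: sum_distrib_left)
    finally have eq: "(\<Sum>p\<in>F. measure lebesgue (cball (fst p) (snd p))) =
      (1/2) ^ DIM('a) * (\<Sum>p\<in>P. measure lebesgue (cball (fst p) (snd p)))" .
    have "1/2 * (1/2 * measure lebesgue (ball a R)) \<le> (\<Sum>p\<in>P. measure lebesgue (cball (fst p) (snd p)))"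
      using P(4) U(4) by linarith
    then have "(1/2) ^ DIM('a) * (1/2 * (1/2 * measure lebesgue (ball a R))) \<le>
      (1/2) ^ DIM('a) * (\<Sum>p\<in>P. measure lebesgue (cball (fst p) (snd p)))"
      by (rule mult_left_mono) simp
    then show ?thesis unfolding eq by simp
  qed
  have "finite F" using P(1) by (simp add: F_def)
  from that[OF ws wout wst this Fd Fsub Faff Fmeas] show ?thesis .
qed

section \<open>Locally affine maps and exhaustion of the remainder\<close>

definition strictly_affine_at :: "('a::euclidean_space \<Rightarrow> 'b::euclidean_space) \<Rightarrow> 'a \<Rightarrow> bool"
  where "strictly_affine_at u x \<longleftrightarrow> (\<exists>r>0. \<exists>L c. linear L \<and> c < 1 \<and> (\<forall>h. norm (L h) \<le> c * norm h) \<and>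
    (\<forall>y\<in>ball x r. u y = u x + L (y - x)))"

lemma strictly_affine_at_cong:
  assumes "strictly_affine_at u x" "open S" "x \<in> S" "\<And>y. y \<in> S \<Longrightarrow> u y = v y"
  shows "strictly_affine_at v x"
proof -
  obtain r L c where L: "r > 0" "linear L" "c < 1" "\<forall>h. norm (L h) \<le> c * norm h" "\<forall>y\<in>ball x r. u y = u x + L (y - x)"
    using assms(1) unfolding strictly_affine_at_def by blast
  obtain e where e: "e > 0" "ball x e \<subseteq> S" using assms(2,3) by (meson open_contains_ball)
  have "v y = v x + L (y - x)" if "y \<in> ball x (min r e)" for y
  proof -
    have "y \<in> ball x r" and y: "y \<in> S" using that e by auto
    then have "u y = u x + L (y - x)" using L(5) by blast
    then show ?thesis using assms(4)[OF y] assms(4)[OF assms(3)] by simp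
  qed
  moreover have "min r e > 0" using L e by simp
  ultimately show ?thesis unfolding strictly_affine_at_def using L(2-4) by blast
qed

lemma affine_ball_imp_strictly_affine_at:
  assumes "affine_ball u p" "x \<in> ball (fst p) (snd p)"
  shows "strictly_affine_at u x"
proof -
  obtain L c where L: "linear L" "c < 1" "\<forall>h. norm (L h) \<le> c * norm h"
    "\<forall>y\<in>cball (fst p) (snd p). u y = u (fst p) + L (y - fst p)"
    using assms(1) unfolding affine_ball_def by blast
  obtain r where r: "r > 0" "ball x r \<subseteq> ball (fst p) (snd p)"
    using assms(2) by (meson open_ball open_contains_ball)
  have "u y = u x + L (y - x)" if "y \<in> ball x r" for y
  proof -
    have "y \<in> cball (fst p) (snd p)" "x \<in> cball (fst p) (snd p)"
      using that r(2) assms(2) ball_subset_cball by blast+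
    then have "u y = u (fst p) + L (y - fst p)" "u x = u (fst p) + L (x - fst p)" using L(4) by blast+
    then show ?thesis using linear_diff[OF L(1), of "y - fst p" "x - fst p"] by simp
  qed
  then show ?thesis unfolding strictly_affine_at_def using r(1) L(1-3) by blast
qed

lemma affine_ball_cong:
  "affine_ball u p \<Longrightarrow> snd p > 0 \<Longrightarrow> (\<And>y. y \<in> cball (fst p) (snd p) \<Longrightarrow> v y = u y) \<Longrightarrow> affine_ball v p"
  unfolding affine_ball_def by auto

lemma short_equal_outside_ball:
  fixes u v :: "'a::euclidean_space \<Rightarrow> 'b::euclidean_space"
  assumes "short_on UNIV u" "short_on UNIV v" "R > 0" "\<And>x. x \<notin> ball a R \<Longrightarrow> u x = v x"
  shows "norm (u x - v x) \<le> 4 * R"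
proof (cases "x \<in> ball a R")
  case True
  have "sphere a R \<noteq> {}" using assms(3) by simp
  then obtain y where "y \<in> sphere a R" by blast
  then have y: "norm (a - y) = R" by (simp add: dist_norm)
  then have "u y = v y" using assms(4)[of y] by (simp add: dist_norm)
  then have "norm (u x - v x) \<le> norm (u x - u y) + norm (v x - v y)"
    using norm_triangle_ineq4[of "u x - u y" "v x - v y"] by simp
  also have "\<dots> \<le> 2 * norm (x - y)"
    using short_on_UNIV_D[OF assms(1), of x y] short_on_UNIV_D[OF assms(2), of x y] by simp
  also have "norm (x - y) \<le> norm (x - a) + norm (a - y)" by (rule norm_diff_triangle_ineq[of x a a y, simplified])
  also have "norm (x - a) + norm (a - y) \<le> 2 * R" using True y by (simp add: dist_norm norm_minus_commute)
  finally show ?thesis by simp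
qed (use assms in simp)

text \<open>The improvement is made on finitely many disjoint balls packing half of
  \<open>H\<close>, which costs one more factor 1/2 in the affine fraction. Short maps that agree
  off a ball of radius R differ by at most 4 * R, whence the radii below e / 4.\<close>

lemma strict_exhaustion_step:
  fixes u :: "'a::euclidean_space \<Rightarrow> 'b::euclidean_space"
  assumes u: "short_on UNIV u" and H: "open H" "bounded H" and e: "e > 0"
    and st: "AE x in lebesgue. x \<in> H \<longrightarrow> strict_at u x"
  obtains u' F where "short_on UNIV u'" "\<And>x. x \<notin> H \<Longrightarrow> u' x = u x" "\<And>x. norm (u' x - u x) \<le> e"
    "AE x in lebesgue. x \<in> H \<longrightarrow> strict_at u' x"
    "finite F" "\<And>p. p \<in> F \<Longrightarrow> snd p > 0 \<and> affine_ball u' p \<and> cball (fst p) (snd p) \<subseteq> H"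
    "measure lebesgue (H - (\<Union>p\<in>F. cball (fst p) (snd p))) \<le> (1 - (1/2) ^ DIM('a) / 8) * measure lebesgue H"
proof -
  let ?b = "\<lambda>p::'a \<times> real. ball (fst p) (snd p)" and ?c = "\<lambda>p::'a \<times> real. cball (fst p) (snd p)"
  have half: "0 \<le> (1/2::real)" "(1/2::real) < 1" and e4: "\<And>x. x \<in> H \<Longrightarrow> e / 4 > 0" using e by simp_all
  obtain B where B: "finite B" "\<And>x r. (x, r) \<in> B \<Longrightarrow> 0 < r \<and> r < e / 4 \<and> x \<in> H \<and> cball x r \<subseteq> H"
    "\<And>p q. p \<in> B \<Longrightarrow> q \<in> B \<Longrightarrow> p \<noteq> q \<Longrightarrow> ?c p \<inter> ?c q = {}"
    "1/2 * measure lebesgue H \<le> (\<Sum>p\<in>B. measure lebesgue (?c p))"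
    by (rule finite_ball_packing[OF H e4 half]) (assumption | rule that)+
  have Bp: "0 < snd p" "snd p < e / 4" "?c p \<subseteq> H" if "p \<in> B" for p
    using B(2)[of "fst p" "snd p"] that by auto
  define Q where "Q p w F \<longleftrightarrow> short_on UNIV w \<and> (\<forall>x. x \<notin> ?b p \<longrightarrow> w x = u x) \<and>
     (AE x in lebesgue. x \<in> ?b p \<longrightarrow> strict_at w x) \<and> finite F \<and> disjoint_balls F \<and> (\<forall>q\<in>F. ?c q \<subseteq> ?b p) \<and>
     (\<forall>q\<in>F. affine_ball w q) \<and> (\<Sum>q\<in>F. measure lebesgue (?c q)) \<ge> (1/2) ^ DIM('a) / 4 * measure lebesgue (?b p)"
    for p w F
  have "\<exists>w F. Q p w F" if p: "p \<in> B" for p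
  proof -
    have "AE x in lebesgue. x \<in> ?b p \<longrightarrow> strict_at u x"
      using st by eventually_elim (use Bp(3)[OF p] ball_subset_cball in blast)
    then show ?thesis
    proof (rule strict_improvement_on_ball[OF u Bp(1)[OF p]])
      fix w F
      assume a: "short_on UNIV w" "\<And>x. x \<notin> ?b p \<Longrightarrow> w x = u x" "AE x in lebesgue. x \<in> ?b p \<longrightarrow> strict_at w x"
        "finite F" "disjoint_balls F" "\<And>q. q \<in> F \<Longrightarrow> ?c q \<subseteq> ?b p" "\<And>q. q \<in> F \<Longrightarrow> affine_ball w q"
        "(1/2) ^ DIM('a) / 4 * measure lebesgue (?b p) \<le> (\<Sum>q\<in>F. measure lebesgue (?c q))"
      show ?thesis unfolding Q_def by (intro exI[of _ w] exI[of _ F] conjI allI ballI impI a)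
    qed
  qed
  then obtain w FF where Q: "\<And>p. p \<in> B \<Longrightarrow> Q p (w p) (FF p)" by metis
  have wF: "\<And>p. p \<in> B \<Longrightarrow> short_on UNIV (w p)" "\<And>p x. p \<in> B \<Longrightarrow> x \<notin> ?b p \<Longrightarrow> w p x = u x"
    "\<And>p. p \<in> B \<Longrightarrow> AE x in lebesgue. x \<in> ?b p \<longrightarrow> strict_at (w p) x" "\<And>p. p \<in> B \<Longrightarrow> finite (FF p)"
    "\<And>p. p \<in> B \<Longrightarrow> disjoint_balls (FF p)" "\<And>p q. p \<in> B \<Longrightarrow> q \<in> FF p \<Longrightarrow> ?c q \<subseteq> ?b p"
    "\<And>p q. p \<in> B \<Longrightarrow> q \<in> FF p \<Longrightarrow> affine_ball (w p) q"
    "\<And>p. p \<in> B \<Longrightarrow> (\<Sum>q\<in>FF p. measure lebesgue (?c q)) \<ge> (1/2) ^ DIM('a) / 4 * measure lebesgue (?b p)"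
    using Q unfolding Q_def by blast+
  define u' where "u' x = (if \<exists>p\<in>B. x \<in> ?c p then w (SOME p. p \<in> B \<and> x \<in> ?c p) x else u x)" for x
  have u'in: "u' x = w p x" if p: "p \<in> B" "x \<in> ?c p" for p x
  proof -
    have "(SOME p. p \<in> B \<and> x \<in> ?c p) = p"
    proof (rule some_equality)
      show "q = p" if "q \<in> B \<and> x \<in> ?c q" for q using B(3)[of q p] that p by blast
    qed (use p in simp)
    then show ?thesis using p by (auto simp: u'_def)
  qed
  have u'off: "u' x = u x" if "\<And>p. p \<in> B \<Longrightarrow> x \<notin> ?c p" for x using that by (auto simp: u'_def)
  have u's: "short_on UNIV u'"
  proof (rule short_on_glue[OF u, of "?c ` B"])
    show "closed S" if "S \<in> ?c ` B" for S using that by auto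
    show "S \<inter> T = {}" if "S \<in> ?c ` B" "T \<in> ?c ` B" "S \<noteq> T" for S T using that B(3) by blast
    show "norm (u' x - u' y) \<le> norm (x - y)" if S: "S \<in> ?c ` B" "x \<in> S" "y \<in> S" for S x y
    proof -
      obtain p where p: "p \<in> B" "S = ?c p" using S(1) by blast
      then show ?thesis using u'in[OF p(1)] S short_on_UNIV_D[OF wF(1)[OF p(1)], of x y] by simp
    qed
    show "u' x = u x" if S: "S \<in> ?c ` B" "x \<in> frontier S" for S x
    proof -
      obtain p where p: "p \<in> B" "S = ?c p" using S(1) by blast
      then have "x \<in> sphere (fst p) (snd p)" using S(2) by simp
      then have "x \<in> ?c p" "x \<notin> ?b p" by auto
      then show ?thesis using u'in[OF p(1)] wF(2)[OF p(1)] by simp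
    qed
    show "u' x = u x" if "x \<notin> \<Union> (?c ` B)" for x using that by (intro u'off) blast
  qed
  have out: "u' x = u x" if "x \<notin> H" for x using that Bp(3) by (intro u'off) blast
  have close: "norm (u' x - u x) \<le> e" for x
  proof (cases "\<exists>p\<in>B. x \<in> ?c p")
    case True
    then obtain p where p: "p \<in> B" "x \<in> ?c p" by blast
    have "norm (w p x - u x) \<le> 4 * snd p"
      by (rule short_equal_outside_ball[OF wF(1)[OF p(1)] u Bp(1)[OF p(1)] wF(2)[OF p(1)]])
    then show ?thesis using u'in[OF p] Bp(2)[OF p(1)] by simp
  next
    case False
    then show ?thesis using u'off[of x] e by auto
  qed
  have st': "AE x in lebesgue. x \<in> H \<longrightarrow> strict_at u' x"
  proof -
    have "negligible (\<Union>p\<in>B. sphere (fst p) (snd p))"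
      using B(1) by (intro negligible_Union) (auto intro: negligible_sphere)
    from AE_not_in_negligible[OF this]
    have 1: "AE x in lebesgue. x \<notin> (\<Union>p\<in>B. sphere (fst p) (snd p))" .
    have 2: "AE x in lebesgue. \<forall>p\<in>B. x \<in> ?b p \<longrightarrow> strict_at (w p) x"
      using B(1) wF(3) by (simp add: AE_ball_countable countable_finite)
    show ?thesis using 1 2 st
    proof eventually_elim
      case (elim x)
      show ?case
      proof
        assume x: "x \<in> H"
        show "strict_at u' x"
        proof (cases "\<exists>p\<in>B. x \<in> ?c p")
          case True
          then obtain p where p: "p \<in> B" "x \<in> ?c p" by blast
          then have "x \<in> ?b p" using elim(1) by (auto simp: less_le)
          moreover have "strict_at (w p) x" using elim(2) p(1) \<open>x \<in> ?b p\<close> by blast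
          ultimately show ?thesis using u'in[OF p(1)] by (intro strict_at_cong[of "w p" x "?b p" u']) auto
        next
          case False
          let ?O = "- (\<Union>p\<in>B. ?c p)"
          have "open ?O" using B(1) by (intro open_Compl closed_UN) auto
          moreover have "x \<in> ?O" using False by blast
          moreover have "u y = u' y" if "y \<in> ?O" for y using that u'off[of y] by auto
          moreover have "strict_at u x" using elim(3) x by blast
          ultimately show ?thesis by (intro strict_at_cong[of u x ?O u'])
        qed
      qed
    qed
  qed
  define F where "F = (\<Union>p\<in>B. FF p)"
  have finF: "finite F" using B(1) wF(4) by (auto simp: F_def)
  have Fprop: "snd q > 0 \<and> affine_ball u' q \<and> ?c q \<subseteq> H" if q: "q \<in> F" for q
  proof -
    obtain p where p: "p \<in> B" "q \<in> FF p" using q by (auto simp: F_def)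
    have 1: "snd q > 0" using wF(5)[OF p(1)] p(2) by (simp add: disjoint_balls_def)
    have sub: "?c q \<subseteq> ?c p" using wF(6)[OF p] ball_subset_cball by blast
    then have "affine_ball u' q" using wF(7)[OF p] 1 u'in[OF p(1)] by (intro affine_ball_cong[of "w p" q u']) auto
    then show ?thesis using 1 sub Bp(3)[OF p(1)] by blast
  qed
  let ?U = "\<Union>q\<in>F. ?c q"
  have Hm: "H \<in> lmeasurable" using H by (simp add: lmeasurable_open)
  have "(1/2) ^ DIM('a) / 4 * (1/2 * measure lebesgue H) \<le> (1/2) ^ DIM('a) / 4 * (\<Sum>p\<in>B. measure lebesgue (?c p))"
    using B(4) by (intro mult_left_mono) auto
  also have "\<dots> = (\<Sum>p\<in>B. (1/2) ^ DIM('a) / 4 * measure lebesgue (?b p))"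
    unfolding sum_distrib_left
  proof (rule sum.cong)
    fix p assume "p \<in> B"
    then show "(1/2) ^ DIM('a) / 4 * measure lebesgue (?c p) = (1/2) ^ DIM('a) / 4 * measure lebesgue (?b p)"
      using Bp(1)[of p] content_cball[of "snd p" "fst p"] content_ball[of "snd p" "fst p"] by simp
  qed simp
  also have "\<dots> \<le> (\<Sum>p\<in>B. \<Sum>q\<in>FF p. measure lebesgue (?c q))"
    using wF(8) by (intro sum_mono)
  also have "\<dots> = (\<Sum>p\<in>B. measure lebesgue (\<Union>q\<in>FF p. ?c q))"
  proof (rule sum.cong)
    fix p assume p: "p \<in> B"
    show "(\<Sum>q\<in>FF p. measure lebesgue (?c q)) = measure lebesgue (\<Union>q\<in>FF p. ?c q)"
      using wF(5)[OF p] by (intro measure_disjoint_finite_UN[symmetric] wF(4)[OF p]) (auto simp: disjoint_balls_def)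
  qed simp
  also have "\<dots> = measure lebesgue (\<Union>p\<in>B. \<Union>q\<in>FF p. ?c q)"
  proof (rule measure_disjoint_finite_UN[symmetric, OF B(1)])
    show "(\<Union>q\<in>FF p. ?c q) \<in> lmeasurable" if "p \<in> B" for p
      using wF(4)[OF that] by (intro fmeasurable.finite_UN) auto
    show "(\<Union>q\<in>FF p. ?c q) \<inter> (\<Union>q\<in>FF p'. ?c q) = {}" if "p \<in> B" "p' \<in> B" "p \<noteq> p'" for p p'
    proof -
      have "(\<Union>q\<in>FF p. ?c q) \<subseteq> ?c p" "(\<Union>q\<in>FF p'. ?c q) \<subseteq> ?c p'"
        using wF(6)[OF that(1)] wF(6)[OF that(2)] ball_subset_cball by blast+
      then show ?thesis using B(3)[OF that] by blast
    qed
  qed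
  also have "(\<Union>p\<in>B. \<Union>q\<in>FF p. ?c q) = ?U" by (auto simp: F_def)
  finally have U: "(1/2) ^ DIM('a) / 8 * measure lebesgue H \<le> measure lebesgue ?U" by simp
  have "measure lebesgue (H - ?U) = measure lebesgue H - measure lebesgue ?U"
  proof (rule measurable_measure_Diff[OF Hm])
    show "?U \<in> sets lebesgue" using finF by (intro sets.finite_UN) auto
    show "?U \<subseteq> H" using Fprop by blast
  qed
  then have "measure lebesgue (H - ?U) \<le> (1 - (1/2) ^ DIM('a) / 8) * measure lebesgue H"
    using U by (simp add: algebra_simps)
  then show ?thesis using that[OF u's out close st' finF Fprop] by blast
qed

section \<open>Approximation by strictly affine maps\<close>

text \<open>The improvement is iterated on the open remainder \<open>H\<close>, whose measure decays
  geometrically. Off \<open>H\<close> the map is not touched again, so the limit is affine near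
  almost every point; on the null set that is left, the tolerances (1/2)^n give convergence.\<close>

lemma ball_exhaustion:
  fixes \<phi> :: "'a::euclidean_space \<Rightarrow> 'b::euclidean_space"
  assumes \<phi>: "short_on UNIV \<phi>" and R: "R > 0"
    and st: "AE x in lebesgue. x \<in> ball a R \<longrightarrow> strict_at \<phi> x"
  obtains v where "short_on UNIV v" "\<And>x. x \<notin> ball a R \<Longrightarrow> v x = \<phi> x"
    "AE x in lebesgue. x \<in> ball a R \<longrightarrow> strictly_affine_at v x"
proof -
  \<comment> \<open>Membership in the interior of the complement of \<open>H\<close> is recorded
    because local affinity survives later steps only if a whole neighbourhood is left alone.\<close>
  define Inv where "Inv s \<longleftrightarrow> (case s of (u, H) \<Rightarrow> short_on UNIV u \<and> open H \<and> H \<subseteq> ball a R \<and>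
     (\<forall>x. x \<notin> ball a R \<longrightarrow> u x = \<phi> x) \<and> (AE x in lebesgue. x \<in> H \<longrightarrow> strict_at u x) \<and>
     (AE x in lebesgue. x \<in> ball a R - H \<longrightarrow> x \<in> interior (- H) \<and> strictly_affine_at u x))"
    for s :: "('a \<Rightarrow> 'b) \<times> 'a set"
  define Rel where "Rel n s s' \<longleftrightarrow> (case s of (u, H) \<Rightarrow> case s' of (u', H') \<Rightarrow> H' \<subseteq> H \<and> (\<forall>x. x \<notin> H \<longrightarrow> u' x = u x) \<and>
     (\<forall>x. norm (u' x - u x) \<le> (1/2) ^ n))" for n :: nat and s s' :: "('a \<Rightarrow> 'b) \<times> 'a set"
  define c where "c = 1 - (1/2) ^ DIM('a) / (8 :: real)"
  have c: "0 \<le> c" "c < 1"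
  proof -
    have "(1/2 :: real) ^ DIM('a) \<le> 1" by (rule power_le_one) auto
    then show "0 \<le> c" by (simp add: c_def)
    show "c < 1" by (simp add: c_def)
  qed
  have "Inv (\<phi>, ball a R)" using \<phi> st by (simp add: Inv_def)
  moreover have "\<exists>t. Inv t \<and> Rel n s t \<and> measure lebesgue (snd t) \<le> c * measure lebesgue (snd s)"
    if s: "Inv s" for n s
  proof -
    obtain u H where sH: "s = (u, H)" by (cases s)
    have u: "short_on UNIV u" "open H" "H \<subseteq> ball a R" "\<And>x. x \<notin> ball a R \<Longrightarrow> u x = \<phi> x"
      "AE x in lebesgue. x \<in> H \<longrightarrow> strict_at u x"
      "AE x in lebesgue. x \<in> ball a R - H \<longrightarrow> x \<in> interior (- H) \<and> strictly_affine_at u x"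
      using s unfolding sH Inv_def by auto
    have bH: "bounded H" using u(3) by (meson bounded_ball bounded_subset)
    have "(1/2 :: real) ^ n > 0" by simp
    then obtain u' F where u': "short_on UNIV u'" "\<And>x. x \<notin> H \<Longrightarrow> u' x = u x" "\<And>x. norm (u' x - u x) \<le> (1/2) ^ n"
      "AE x in lebesgue. x \<in> H \<longrightarrow> strict_at u' x" "finite F"
      "\<And>p. p \<in> F \<Longrightarrow> snd p > 0 \<and> affine_ball u' p \<and> cball (fst p) (snd p) \<subseteq> H"
      "measure lebesgue (H - (\<Union>p\<in>F. cball (fst p) (snd p))) \<le> (1 - (1/2) ^ DIM('a) / 8) * measure lebesgue H"
      by (rule strict_exhaustion_step[OF u(1,2) bH _ u(5)]) (assumption | rule that)+
    define H' where "H' = H - (\<Union>p\<in>F. cball (fst p) (snd p))"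
    have oH': "open H'" unfolding H'_def using u'(5) by (intro open_Diff u(2) closed_UN) auto
    have "negligible (\<Union>p\<in>F. sphere (fst p) (snd p))"
      using u'(5) by (intro negligible_Union) (auto intro: negligible_sphere)
    from AE_not_in_negligible[OF this] u(6)
    have aff: "AE x in lebesgue. x \<in> ball a R - H' \<longrightarrow> x \<in> interior (- H') \<and> strictly_affine_at u' x"
    proof eventually_elim
      case (elim x)
      show ?case
      proof
        assume x: "x \<in> ball a R - H'"
        show "x \<in> interior (- H') \<and> strictly_affine_at u' x"
        proof (cases "x \<in> H")
          case True
          then obtain p where p: "p \<in> F" "x \<in> cball (fst p) (snd p)" using x by (auto simp: H'_def)
          then have xb: "x \<in> ball (fst p) (snd p)" using elim(1) by (auto simp: less_le)
          have "ball (fst p) (snd p) \<subseteq> - H'" using p(1) ball_subset_cball unfolding H'_def by blast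
          then have "x \<in> interior (- H')" using xb by (meson interiorI open_ball)
          then show ?thesis using affine_ball_imp_strictly_affine_at[OF _ xb, of u'] u'(6)[OF p(1)] by blast
        next
          case False
          then have *: "x \<in> interior (- H)" "strictly_affine_at u x" using elim(2) x by auto
          have "strictly_affine_at u' x"
          proof (rule strictly_affine_at_cong[OF *(2) open_interior *(1)])
            show "u y = u' y" if "y \<in> interior (- H)" for y using that interior_subset u'(2)[of y] by fastforce
          qed
          moreover have "interior (- H) \<subseteq> interior (- H')" by (intro interior_mono) (auto simp: H'_def)
          ultimately show ?thesis using *(1) by blast
        qed
      qed
    qed
    have st': "AE x in lebesgue. x \<in> H' \<longrightarrow> strict_at u' x"
      using u'(4) by eventually_elim (simp add: H'_def)
    have "u' x = \<phi> x" if "x \<notin> ball a R" for x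
    proof -
      have "x \<notin> H" using u(3) that by blast
      then show ?thesis using u'(2)[of x] u(4)[OF that] by simp
    qed
    then have "Inv (u', H')" using u'(1) oH' u(3) st' aff by (auto simp: Inv_def H'_def)
    moreover have "Rel n s (u', H')" using u'(2,3) by (auto simp: Rel_def sH H'_def)
    moreover have "measure lebesgue H' \<le> c * measure lebesgue H" using u'(7) by (simp add: c_def H'_def)
    ultimately show ?thesis by (intro exI[of _ "(u', H')"]) (simp add: sH)
  qed
  ultimately obtain f where f: "f 0 = (\<phi>, ball a R)" "\<And>n::nat. Inv (f n)" "\<And>n. Rel n (f n) (f (Suc n))"
    "(\<lambda>n. measure lebesgue (snd (f n))) \<longlonglongrightarrow> 0"
    by (rule exhaustion[of Inv "(\<phi>, ball a R)" c Rel snd, OF _ c]) (assumption | rule that)+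
  define u where "u n = fst (f n)" for n
  define H where "H n = snd (f n)" for n
  have fe: "f n = (u n, H n)" for n by (simp add: u_def H_def)
  have I: "short_on UNIV (u n)" "open (H n)" "H n \<subseteq> ball a R" "\<And>x. x \<notin> ball a R \<Longrightarrow> u n x = \<phi> x"
    "AE x in lebesgue. x \<in> ball a R - H n \<longrightarrow> x \<in> interior (- H n) \<and> strictly_affine_at (u n) x" for n
    using f(2)[of n] unfolding fe Inv_def by auto
  have Rn: "H (Suc n) \<subseteq> H n" "\<And>x. x \<notin> H n \<Longrightarrow> u (Suc n) x = u n x" "\<And>x. norm (u (Suc n) x - u n x) \<le> (1/2) ^ n" for n
    using f(3)[of n] unfolding fe Rel_def by auto
  have summ: "summable (\<lambda>n. u (Suc n) x - u n x)" for x
    by (rule summable_comparison_test'[of "\<lambda>n. (1/2) ^ n" 0]) (use Rn(3) in \<open>auto intro: summable_geometric\<close>)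
  have "convergent (\<lambda>n. u n x)" for x
  proof -
    have "(\<lambda>n. \<Sum>k<n. u (Suc k) x - u k x) = (\<lambda>n. u n x - u 0 x)"
      using sum_lessThan_telescope[of "\<lambda>k. u k x"] by (intro ext) simp
    then have "convergent (\<lambda>n. u n x - u 0 x)" using summ[of x] by (simp add: summable_iff_convergent)
    then have "convergent (\<lambda>n. (u n x - u 0 x) + u 0 x)" by (intro convergent_add convergent_const)
    then show ?thesis by simp
  qed
  then have lim: "(\<lambda>n. u n x) \<longlonglongrightarrow> lim (\<lambda>n. u n x)" for x by (simp add: convergent_LIMSEQ_iff)
  define v where "v x = lim (\<lambda>n. u n x)" for x
  have vlim: "(\<lambda>n. u n x) \<longlonglongrightarrow> v x" for x using lim by (simp add: v_def)
  have vs: "short_on UNIV v" unfolding short_on_UNIV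
  proof (intro allI)
    fix x y
    have "(\<lambda>n. norm (u n x - u n y)) \<longlonglongrightarrow> norm (v x - v y)" by (intro tendsto_norm tendsto_diff vlim)
    then show "norm (v x - v y) \<le> norm (x - y)"
      using short_on_UNIV_D[OF I(1)] by (intro LIMSEQ_le_const2) auto
  qed
  have stay: "v x = u n x" if x: "x \<notin> H n" for x n
  proof -
    have "x \<notin> H (n + k) \<and> u (n + k) x = u n x" for k
      by (induction k) (use x Rn in auto)
    then have "(\<lambda>k. u (k + n) x) \<longlonglongrightarrow> u n x" by (simp add: add.commute)
    then have "(\<lambda>k. u k x) \<longlonglongrightarrow> u n x" by (rule LIMSEQ_offset)
    then show ?thesis using vlim LIMSEQ_unique by blast
  qed
  have out: "v x = \<phi> x" if "x \<notin> ball a R" for x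
  proof -
    have "x \<notin> H 0" using I(3)[of 0] that by blast
    then show ?thesis using stay[of x 0] I(4)[OF that, of 0] by simp
  qed
  have "negligible (\<Inter>n. H n)"
  proof (rule negligible_INT_if_measure_tendsto_0)
    show "H n \<in> lmeasurable" for n using I(2,3)[of n] by (meson bounded_ball bounded_subset lmeasurable_open)
    show "(\<lambda>n. measure lebesgue (H n)) \<longlonglongrightarrow> 0" using f(4) by (simp add: H_def)
  qed
  from AE_not_in_negligible[OF this]
  have 1: "AE x in lebesgue. x \<notin> (\<Inter>n. H n)" .
  have 2: "AE x in lebesgue. \<forall>n. x \<in> ball a R - H n \<longrightarrow> x \<in> interior (- H n) \<and> strictly_affine_at (u n) x"
    unfolding AE_all_countable using I(5) by blast
  have "AE x in lebesgue. x \<in> ball a R \<longrightarrow> strictly_affine_at v x"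
    using 1 2
  proof eventually_elim
    case (elim x)
    show ?case
    proof
      assume x: "x \<in> ball a R"
      obtain n where "x \<notin> H n" using elim(1) by blast
      then have *: "x \<in> interior (- H n)" "strictly_affine_at (u n) x" using elim(2) x by auto
      show "strictly_affine_at v x"
      proof (rule strictly_affine_at_cong[OF *(2) open_interior *(1)])
        show "u n y = v y" if "y \<in> interior (- H n)" for y using that interior_subset stay[of y n] by fastforce
      qed
    qed
  qed
  then show ?thesis using that vs out by blast
qed

text \<open>The cap 1 makes bounds by \<open>bdist\<close> uniform as well. The whole space is
  treated separately because \<open>infdist\<close> to the empty set is 0.\<close>

definition bdist :: "'a::euclidean_space set \<Rightarrow> 'a \<Rightarrow> real"
  where "bdist \<Omega> x = (if \<Omega> = UNIV then 1 else min 1 (infdist x (- \<Omega>)))"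

lemma bdist_nonneg: "bdist \<Omega> x \<ge> 0"
  by (simp add: bdist_def infdist_nonneg)

lemma bdist_le_1: "bdist \<Omega> x \<le> 1"
  by (simp add: bdist_def)

lemma bdist_pos: "open \<Omega> \<Longrightarrow> x \<in> \<Omega> \<Longrightarrow> bdist \<Omega> x > 0"
proof (cases "\<Omega> = UNIV")
  case False
  assume "open \<Omega>" "x \<in> \<Omega>"
  then have "infdist x (- \<Omega>) \<noteq> 0"
    using False in_closed_iff_infdist_zero[of "- \<Omega>" x] by auto
  then have "infdist x (- \<Omega>) > 0" using infdist_nonneg[of x "- \<Omega>"] by simp
  then show ?thesis using False by (simp add: bdist_def)
qed (simp add: bdist_def)

lemma bdist_lipschitz: "\<bar>bdist \<Omega> x - bdist \<Omega> y\<bar> \<le> norm (x - y)"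
proof -
  have "\<bar>infdist x (- \<Omega>) - infdist y (- \<Omega>)\<bar> \<le> dist x y"
    by (rule infdist_triangle_abs)
  then show ?thesis by (auto simp: bdist_def dist_norm min_def)
qed

lemma continuous_on_bdist: "continuous_on S (bdist \<Omega>)"
proof -
  have "1-lipschitz_on S (bdist \<Omega>)"
    by (intro lipschitz_onI) (auto simp: dist_real_def dist_norm bdist_lipschitz)
  then show ?thesis by (rule lipschitz_on_continuous_on)
qed

lemma bdist_outside: "x \<notin> \<Omega> \<Longrightarrow> bdist \<Omega> x = 0"
  by (auto simp: bdist_def)

lemma short_on_cball_extension:
  fixes u :: "'a::euclidean_space \<Rightarrow> 'b::euclidean_space"
  assumes "short_on S u" "cball a r \<subseteq> S" "r > 0"
  obtains v where "short_on UNIV v" "\<And>x. x \<in> cball a r \<Longrightarrow> v x = u x"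
proof -
  let ?p = "closest_point (cball a r)"
  have B: "convex (cball a r)" "closed (cball a r)" "cball a r \<noteq> {}" using assms(3) by auto
  have in_B: "?p x \<in> cball a r" for x using B by (intro closest_point_in_set)
  have "norm (u (?p x) - u (?p y)) \<le> norm (x - y)" for x y
  proof -
    have "closed_segment (?p x) (?p y) \<subseteq> cball a r" using in_B by (intro closed_segment_subset) auto
    then have "norm (u (?p x) - u (?p y)) \<le> norm (?p x - ?p y)" using assms(2) by (intro short_onD[OF assms(1)]) blast
    also have "\<dots> \<le> norm (x - y)" using closest_point_lipschitz[OF B, of x y] by (simp add: dist_norm)
    finally show ?thesis .
  qed
  then show ?thesis using that[of "u \<circ> ?p"] by (simp add: short_on_UNIV closest_point_self)
qed

text \<open>\<Omega> is packed by balls of radius below e / 8 times \<open>bdist\<close> at the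
  centre. On each ball the map is first extended to the whole space and then changed by
  \<open>ball_exhaustion\<close>, which keeps the values on the sphere; the deviation of at most
  four radii is thereby controlled by the distance to the boundary.\<close>

theorem strictly_affine_approximation:
  fixes \<phi> :: "'a::euclidean_space \<Rightarrow> 'b::euclidean_space"
  assumes op: "open \<Omega>" and \<phi>: "short_on \<Omega> \<phi>" and e: "0 < e" "e \<le> 1"
    and st: "AE x in lebesgue. x \<in> \<Omega> \<longrightarrow> strict_at \<phi> x"
  obtains v where "short_on \<Omega> v" "\<And>x. x \<in> \<Omega> \<Longrightarrow> norm (v x - \<phi> x) \<le> e * bdist \<Omega> x"
    "AE x in lebesgue. x \<in> \<Omega> \<longrightarrow> strictly_affine_at v x"
proof -
  let ?b = "\<lambda>p::'a \<times> real. ball (fst p) (snd p)" and ?c = "\<lambda>p::'a \<times> real. cball (fst p) (snd p)"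
  have \<rho>: "e * bdist \<Omega> x / 8 > 0" if "x \<in> \<Omega>" for x using bdist_pos[OF op that] e by simp
  obtain B where B: "countable B" "\<And>x r. (x, r) \<in> B \<Longrightarrow> 0 < r \<and> r < e * bdist \<Omega> x / 8 \<and> x \<in> \<Omega> \<and> cball x r \<subseteq> \<Omega>"
    "\<And>p q. p \<in> B \<Longrightarrow> q \<in> B \<Longrightarrow> p \<noteq> q \<Longrightarrow> ?c p \<inter> ?c q = {}" "negligible (\<Omega> - (\<Union>p\<in>B. ?c p))"
    by (rule open_ball_packing[OF op \<rho>]) (assumption | rule that)+
  have Bp: "0 < snd p" "snd p < e * bdist \<Omega> (fst p) / 8" "?c p \<subseteq> \<Omega>" if "p \<in> B" for p
    using B(2)[of "fst p" "snd p"] that by auto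
  define Q where "Q p w \<longleftrightarrow> short_on UNIV w \<and> (\<forall>x\<in>sphere (fst p) (snd p). w x = \<phi> x) \<and>
     (\<forall>x\<in>?c p. norm (w x - \<phi> x) \<le> 4 * snd p) \<and> (AE x in lebesgue. x \<in> ?b p \<longrightarrow> strictly_affine_at w x)" for p w
  have "\<exists>w. Q p w" if p: "p \<in> B" for p
  proof -
    obtain \<psi> where \<psi>: "short_on UNIV \<psi>" "\<And>x. x \<in> ?c p \<Longrightarrow> \<psi> x = \<phi> x"
      by (rule short_on_cball_extension[OF \<phi> Bp(3,1)[OF p]]) (assumption | rule that)+
    have "AE x in lebesgue. x \<in> ?b p \<longrightarrow> strict_at \<psi> x"
      using st
    proof eventually_elim
      case (elim x)
      show ?case
      proof
        assume x: "x \<in> ?b p"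
        then have "strict_at \<phi> x" using elim Bp(3)[OF p] ball_subset_cball by blast
        then show "strict_at \<psi> x"
          using \<psi>(2) x ball_subset_cball by (intro strict_at_cong[of \<phi> x "?b p" \<psi>]) auto
      qed
    qed
    then obtain w where w: "short_on UNIV w" "\<And>x. x \<notin> ?b p \<Longrightarrow> w x = \<psi> x"
      "AE x in lebesgue. x \<in> ?b p \<longrightarrow> strictly_affine_at w x"
      by (rule ball_exhaustion[OF \<psi>(1) Bp(1)[OF p]]) (assumption | rule that)+
    have "norm (w x - \<phi> x) \<le> 4 * snd p" if "x \<in> ?c p" for x
    proof -
      have "norm (w x - \<psi> x) \<le> 4 * snd p"
        by (rule short_equal_outside_ball[OF w(1) \<psi>(1) Bp(1)[OF p] w(2)])
      then show ?thesis using \<psi>(2)[OF that] by simp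
    qed
    moreover have "w x = \<phi> x" if "x \<in> sphere (fst p) (snd p)" for x
      using w(2)[of x] \<psi>(2)[of x] that by simp
    ultimately show ?thesis unfolding Q_def using w(1,3) by blast
  qed
  then obtain w where Q: "\<And>p. p \<in> B \<Longrightarrow> Q p (w p)" by metis
  have w: "\<And>p. p \<in> B \<Longrightarrow> short_on UNIV (w p)" "\<And>p x. p \<in> B \<Longrightarrow> x \<in> sphere (fst p) (snd p) \<Longrightarrow> w p x = \<phi> x"
    "\<And>p x. p \<in> B \<Longrightarrow> x \<in> ?c p \<Longrightarrow> norm (w p x - \<phi> x) \<le> 4 * snd p"
    "\<And>p. p \<in> B \<Longrightarrow> AE x in lebesgue. x \<in> ?b p \<longrightarrow> strictly_affine_at (w p) x"
    using Q unfolding Q_def by blast+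
  define v where "v x = (if \<exists>p\<in>B. x \<in> ?c p then w (SOME p. p \<in> B \<and> x \<in> ?c p) x else \<phi> x)" for x
  have vin: "v x = w p x" if p: "p \<in> B" "x \<in> ?c p" for p x
  proof -
    have "(SOME p. p \<in> B \<and> x \<in> ?c p) = p"
    proof (rule some_equality)
      show "q = p" if "q \<in> B \<and> x \<in> ?c q" for q using B(3)[of q p] that p by blast
    qed (use p in simp)
    then show ?thesis using p by (auto simp: v_def)
  qed
  have voff: "v x = \<phi> x" if "\<And>p. p \<in> B \<Longrightarrow> x \<notin> ?c p" for x using that by (auto simp: v_def)
  have vs: "short_on \<Omega> v"
  proof (rule short_on_glue[OF \<phi>, of "?c ` B"])
    show "closed S" if "S \<in> ?c ` B" for S using that by auto
    show "S \<inter> T = {}" if "S \<in> ?c ` B" "T \<in> ?c ` B" "S \<noteq> T" for S T using that B(3) by blast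
    show "norm (v x - v y) \<le> norm (x - y)" if S: "S \<in> ?c ` B" "x \<in> S" "y \<in> S" for S x y
    proof -
      obtain p where p: "p \<in> B" "S = ?c p" using S(1) by blast
      then show ?thesis using vin[OF p(1)] S short_on_UNIV_D[OF w(1)[OF p(1)], of x y] by simp
    qed
    show "v x = \<phi> x" if S: "S \<in> ?c ` B" "x \<in> frontier S" for S x
    proof -
      obtain p where p: "p \<in> B" "S = ?c p" using S(1) by blast
      then have "x \<in> sphere (fst p) (snd p)" using S(2) by simp
      then show ?thesis using vin[OF p(1), of x] w(2)[OF p(1), of x] by simp
    qed
    show "v x = \<phi> x" if "x \<notin> \<Union> (?c ` B)" for x using that by (intro voff) blast
  qed
  have close: "norm (v x - \<phi> x) \<le> e * bdist \<Omega> x" if "x \<in> \<Omega>" for x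
  proof (cases "\<exists>p\<in>B. x \<in> ?c p")
    case True
    then obtain p where p: "p \<in> B" "x \<in> ?c p" by blast
    have "norm (v x - \<phi> x) \<le> 4 * snd p" using vin[OF p] w(3)[OF p] by simp
    also have "\<dots> \<le> e * (bdist \<Omega> (fst p) / 2)" using Bp(2)[OF p(1)] by simp
    also have "\<dots> \<le> e * bdist \<Omega> x"
    \<comment> \<open>\<open>bdist\<close> is Lipschitz and the radius is below an eighth of its
      value at the centre, so at least half of that value is left everywhere in the ball.\<close>
    proof (rule mult_left_mono)
      have "bdist \<Omega> (fst p) - bdist \<Omega> x \<le> snd p"
        using bdist_lipschitz[of \<Omega> "fst p" x] p(2) by (simp add: dist_norm)
      moreover have "e * bdist \<Omega> (fst p) \<le> bdist \<Omega> (fst p)" using e bdist_nonneg[of \<Omega> "fst p"] by (simp add: mult_left_le_one_le)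
      ultimately show "bdist \<Omega> (fst p) / 2 \<le> bdist \<Omega> x" using Bp(2)[OF p(1)] bdist_nonneg[of \<Omega> "fst p"] by linarith
    qed (use e in simp)
    finally show ?thesis .
  next
    case False
    then show ?thesis using voff[of x] e bdist_nonneg[of \<Omega> x] by auto
  qed
  have "negligible (\<Union>p\<in>B. sphere (fst p) (snd p))"
    using B(1) by (intro negligible_countable_Union) (auto intro: negligible_sphere)
  from AE_not_in_negligible[OF this]
  have 1: "AE x in lebesgue. x \<notin> (\<Union>p\<in>B. sphere (fst p) (snd p))" .
  have 2: "AE x in lebesgue. \<forall>p\<in>B. x \<in> ?b p \<longrightarrow> strictly_affine_at (w p) x"
    using B(1) w(4) by (simp add: AE_ball_countable)
  from AE_not_in_negligible[OF B(4)] 1 2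
  have "AE x in lebesgue. x \<in> \<Omega> \<longrightarrow> strictly_affine_at v x"
  proof eventually_elim
    case (elim x)
    show ?case
    proof
      assume "x \<in> \<Omega>"
      then obtain p where p: "p \<in> B" "x \<in> ?c p" using elim(1) by blast
      then have xb: "x \<in> ?b p" using elim(2) by (auto simp: less_le)
      moreover have "strictly_affine_at (w p) x" using elim(3) p(1) xb by blast
      ultimately show "strictly_affine_at v x"
        using vin[OF p(1)] by (intro strictly_affine_at_cong[of "w p" x "?b p" v]) auto
    qed
  qed
  then show ?thesis using that vs close by blast
qed

section \<open>Tents\<close>

definition outer :: "real ^ 'm \<Rightarrow> real ^ 'n \<Rightarrow> real ^ 'n ^ 'm"
  where "outer f c = (\<chi> i j. f $ i * c $ j)"

lemma outer_mult_vec: "outer f c *v h = (c \<bullet> h) *\<^sub>R f"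
  by (simp add: vec_eq_iff outer_def matrix_vector_mult_def inner_vec_def sum_distrib_left mult_ac)

lemma norm_outer: "norm (outer f c) = norm f * norm c"
proof -
  have "(norm (outer f c))\<^sup>2 = (\<Sum>i\<in>UNIV. \<Sum>j\<in>UNIV. (f $ i * c $ j) * (f $ i * c $ j))"
    by (simp add: power2_norm_eq_inner inner_vec_def outer_def)
  also have "\<dots> = (\<Sum>i\<in>UNIV. f $ i * f $ i) * (\<Sum>j\<in>UNIV. c $ j * c $ j)"
    unfolding sum_product by (intro sum.cong refl) (simp add: mult_ac)
  also have "\<dots> = (norm f * norm c)\<^sup>2"
    by (simp add: power_mult_distrib power2_norm_eq_inner inner_vec_def)
  finally show ?thesis by (simp add: power2_eq_iff_nonneg)
qed

lemma inner_outer: "A \<bullet> outer f c = f \<bullet> (A *v c)"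
  by (simp add: inner_vec_def outer_def matrix_vector_mult_def sum_distrib_left mult_ac)

lemma norm_diff_outer:
  "(norm (A - outer f c))\<^sup>2 = (norm A)\<^sup>2 - 2 * (f \<bullet> (A *v c)) + (norm f * norm c)\<^sup>2"
  unfolding norm_outer[symmetric] inner_outer[symmetric] power2_norm_eq_inner
  by (simp add: inner_diff_left inner_diff_right inner_commute)

text \<open>First order optimality without derivatives: for small \<open>s\<close> of the right sign
  the linear term would dominate.\<close>

lemma linear_coefficient_zero:
  fixes \<alpha> \<beta> :: real
  assumes "\<And>s. 0 \<le> 2 * s * \<alpha> + s\<^sup>2 * \<beta>"
  shows "\<alpha> = 0"
proof (rule ccontr)
  assume "\<alpha> \<noteq> 0"
  define k where "k = \<bar>\<beta>\<bar> + 1"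
  have k: "k > 0" "\<beta> < k" by (auto simp: k_def)
  have "0 \<le> 2 * (- \<alpha> / k) * \<alpha> + (- \<alpha> / k)\<^sup>2 * \<beta>" by (rule assms)
  also have "\<dots> \<le> 2 * (- \<alpha> / k) * \<alpha> + (- \<alpha> / k)\<^sup>2 * k"
    using k by (intro add_left_mono mult_left_mono) auto
  also have "\<dots> = - (\<alpha>\<^sup>2 / k)" using k by (simp add: power2_eq_square field_simps)
  also have "\<dots> < 0" using k \<open>\<alpha> \<noteq> 0\<close> by simp
  finally show False by simp
qed

text \<open>\<open>e\<close> and \<open>f\<close> are right and left singular vectors for the least
  singular value \<open>a\<close>. The first variation of |A x|^2 - a^2 |x|^2 vanishes at its
  minimiser \<open>e\<close>, so (A e) . (A x) = a^2 (e . x); division by \<open>a\<close> gives the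
  identity for \<open>f\<close>.\<close>

lemma minimal_stretch:
  fixes A :: "real ^ 'n ^ 'n"
  obtains e f a where "norm e = 1" "norm f = 1" "0 \<le> a" "A *v e = a *\<^sub>R f"
    "\<And>x. f \<bullet> (A *v x) = a * (e \<bullet> x)" "\<And>x. a * norm x \<le> norm (A *v x)"
proof -
  have "continuous_on (sphere 0 1) (\<lambda>x. norm (A *v x))"
    by (intro continuous_intros matrix_vector_mult_linear_continuous_on)
  moreover have "sphere (0 :: real ^ 'n) 1 \<noteq> {}" by simp
  ultimately obtain e where e: "e \<in> sphere 0 1" "\<And>x. x \<in> sphere 0 1 \<Longrightarrow> norm (A *v e) \<le> norm (A *v x)"
    using continuous_attains_inf[OF compact_sphere, of 0 1] by blast
  have e1: "norm e = 1" using e(1) by simp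
  define a where "a = norm (A *v e)"
  have min: "a * norm x \<le> norm (A *v x)" for x
  proof (cases "x = 0")
    case False
    have "(1 / norm x) *\<^sub>R x \<in> sphere 0 1" using False by simp
    from e(2)[OF this] have "a \<le> norm (A *v x) / norm x"
      by (simp add: a_def matrix_vector_mult_scaleR)
    then show ?thesis using False by (simp add: field_simps)
  qed simp
  have crit: "(A *v e) \<bullet> (A *v x) = a\<^sup>2 * (e \<bullet> x)" for x
  proof -
    have "(A *v e) \<bullet> (A *v x) - a\<^sup>2 * (e \<bullet> x) = 0"
    proof (rule linear_coefficient_zero)
      fix s :: real
      have "(a * norm (e + s *\<^sub>R x))\<^sup>2 \<le> (norm (A *v (e + s *\<^sub>R x)))\<^sup>2"
        using min by (intro power_mono) (auto simp: a_def)
      moreover have "(norm (e + s *\<^sub>R x))\<^sup>2 = 1 + 2 * s * (e \<bullet> x) + s\<^sup>2 * (x \<bullet> x)"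
        using e1 unfolding power2_norm_eq_inner
        by (simp add: inner_add_left inner_add_right inner_commute power2_eq_square norm_eq_1 algebra_simps)
      moreover have "(norm (A *v (e + s *\<^sub>R x)))\<^sup>2 =
          a\<^sup>2 + 2 * s * ((A *v e) \<bullet> (A *v x)) + s\<^sup>2 * ((A *v x) \<bullet> (A *v x))"
        unfolding a_def power2_norm_eq_inner matrix_vector_right_distrib matrix_vector_mult_scaleR
        by (simp add: inner_add_left inner_add_right inner_commute power2_eq_square algebra_simps)
      ultimately show "0 \<le> 2 * s * ((A *v e) \<bullet> (A *v x) - a\<^sup>2 * (e \<bullet> x)) +
          s\<^sup>2 * ((A *v x) \<bullet> (A *v x) - a\<^sup>2 * (x \<bullet> x))"
        by (simp add: power_mult_distrib algebra_simps)
    qed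
    then show ?thesis by simp
  qed
  have a0: "a \<ge> 0" by (simp add: a_def)
  show ?thesis
  proof (cases "a = 0")
    case False
    define f where "f = (1 / a) *\<^sub>R (A *v e)"
    have "norm f = 1" using False a0 by (simp add: f_def a_def)
    moreover have "A *v e = a *\<^sub>R f" using False by (simp add: f_def)
    moreover have "f \<bullet> (A *v x) = a * (e \<bullet> x)" for x
      using crit[of x] False by (simp add: f_def power2_eq_square)
    ultimately show ?thesis using that[OF e1 _ a0] min by blast
  next
    case True
    \<comment> \<open>If \<open>a\<close> = 0 then A e has no direction; any unit vector orthogonal
      to the range of \<open>A\<close> serves as \<open>f\<close>.\<close>
    then have Ae: "A *v e = 0" by (simp add: a_def)
    have "\<not> inj ((*v) A)"
    proof
      assume "inj ((*v) A)"
      then have "e = 0" using Ae injD[of "(*v) A" e 0] by simp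
      then show False using e1 by simp
    qed
    then have "\<not> surj ((*v) A)"
      using linear_surjective_imp_injective[of "(*v) A"] by auto
    then have "span (range ((*v) A)) \<noteq> UNIV"
      by (simp add: linear_subspace_image span_eq_iff[THEN iffD2])
    then obtain g where g: "g \<noteq> 0" "\<forall>x\<in>span (range ((*v) A)). g \<bullet> x = 0"
      using span_not_UNIV_orthogonal by blast
    define f where "f = (1 / norm g) *\<^sub>R g"
    have "norm f = 1" using g(1) by (simp add: f_def)
    moreover have "f \<bullet> (A *v x) = a * (e \<bullet> x)" for x
      using g(2) True by (simp add: f_def span_base)
    ultimately show ?thesis using that[OF e1 _ a0] min Ae True by simp
  qed
qed

lemma norm_matrix_columns: "(norm A)\<^sup>2 = (\<Sum>j\<in>UNIV. (norm (A *v axis j 1))\<^sup>2)"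
  for A :: "real ^ 'n ^ 'm"
proof -
  have "(norm A)\<^sup>2 = (\<Sum>i\<in>UNIV. \<Sum>j\<in>UNIV. A $ i $ j * A $ i $ j)"
    by (simp add: power2_norm_eq_inner inner_vec_def)
  also have "\<dots> = (\<Sum>j\<in>UNIV. \<Sum>i\<in>UNIV. A $ i $ j * A $ i $ j)" by (rule sum.swap)
  also have "\<dots> = (\<Sum>j\<in>UNIV. (norm (A *v axis j 1))\<^sup>2)"
    by (simp add: power2_norm_eq_inner inner_vec_def matrix_vector_mult_basis column_def)
  finally show ?thesis .
qed

text \<open>
  With \<open>A e = a f\<close> of minimal length, the slopes are \<open>c = s e\<close> with \<open>|a - s|\<close> slightly below \<open>1\<close> for both choices of
  sign, perturbed in all coordinate directions so that the base of the tent becomes bounded.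
\<close>

lemma tent_directions:
  fixes A :: "real ^ 'n ^ 'n"
  assumes \<gamma>: "\<gamma> < 1" "\<And>h. norm (A *v h) \<le> \<gamma> * norm h"
  obtains Cs f e \<gamma>' a where "finite Cs" "Cs \<noteq> {}" "norm f = 1" "norm e = 1" "\<gamma>' < 1"
    "bounded {x. \<forall>c\<in>Cs. c \<bullet> x \<le> 1}"
    "\<And>c h. c \<in> insert 0 Cs \<Longrightarrow> norm (A *v h - (c \<bullet> h) *\<^sub>R f) \<le> \<gamma>' * norm h"
    "\<And>c. c \<in> Cs \<Longrightarrow> real CARD('n) - (norm (A - outer f c))\<^sup>2 \<le> (1 - 1 / (2 * real CARD('n))) * (real CARD('n) - (norm A)\<^sup>2)"
    "\<exists>c1\<in>Cs. \<exists>c2\<in>Cs. (c1 - c2) \<bullet> e \<ge> 5/4"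
    "\<And>c. (norm (A - outer f c))\<^sup>2 = (norm A)\<^sup>2 - 2 * a * (e \<bullet> c) + (norm c)\<^sup>2"
proof -
  obtain e f a where ef: "norm e = 1" "norm f = 1" "0 \<le> a" "A *v e = a *\<^sub>R f"
    "\<And>x. f \<bullet> (A *v x) = a * (e \<bullet> x)" "\<And>x. a * norm x \<le> norm (A *v x)"
    by (rule minimal_stretch[of A]) (assumption | rule that)+
  let ?n = "real CARD('n)"
  have n: "?n \<ge> 1" by simp
  define d where "d = ?n - (norm A)\<^sup>2"
  have \<gamma>0: "0 \<le> \<gamma>"
    using order_trans[OF norm_ge_zero \<gamma>(2)[of e]] ef(1) by simp
  have a\<gamma>: "a \<le> \<gamma>" using \<gamma>(2)[of e] ef by simp
  have dpos: "d > 0"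
  proof -
    have "(norm A)\<^sup>2 \<le> (\<Sum>j\<in>(UNIV::'n set). \<gamma>\<^sup>2)"
      unfolding norm_matrix_columns using \<gamma>(2)[of "axis _ 1"] by (intro sum_mono power_mono) auto
    also have "\<dots> = ?n * \<gamma>\<^sup>2" by simp
    also have "\<dots> < ?n * 1" using \<gamma>(1) \<gamma>0 n by (intro mult_strict_left_mono) (auto simp: power_less_one_iff)
    finally show ?thesis by (simp add: d_def)
  qed
  have da: "d \<le> ?n * (1 - a\<^sup>2)"
  proof -
    have "?n * a\<^sup>2 = (\<Sum>j\<in>(UNIV::'n set). a\<^sup>2)" by simp
    also have "\<dots> \<le> (norm A)\<^sup>2"
      unfolding norm_matrix_columns using ef(6)[of "axis _ 1"] ef(3) by (intro sum_mono power_mono) auto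
    finally show ?thesis by (simp add: d_def algebra_simps)
  qed
  \<comment> \<open>The bounds serve, in this order, the gap 5/4, the inequality \<gamma> \<le> 1 -
    \<tau>, and 4 * \<tau> \<le> d / (2 n), which keeps half of the gain d / n.\<close>
  define \<tau> where "\<tau> = min (1/8) (min ((1 - \<gamma>) / 2) (d / (8 * ?n)))"
  have "(1 - \<gamma>) / 2 > 0" "d / (8 * ?n) > 0" using \<gamma>(1) dpos n by auto
  then have \<tau>: "\<tau> > 0" "\<tau> \<le> 1/8" "\<tau> \<le> (1 - \<gamma>) / 2" "\<tau> \<le> d / (8 * ?n)"
    unfolding \<tau>_def by linarith+
  define \<delta> where "\<delta> = \<tau> / 2"
  have \<delta>: "\<delta> > 0" "\<delta> \<le> 1/16" "\<delta> < \<tau>" using \<tau> by (auto simp: \<delta>_def)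
  \<comment> \<open>\<open>- p\<close> \<le> 0 < \<open>q\<close> are the two solutions s of |a - s|
    = 1 - \<tau>.\<close>
  define p where "p = 1 - \<tau> - a"
  define q where "q = 1 - \<tau> + a"
  have g1: "\<gamma> \<le> 1 - \<tau>" using \<tau> \<gamma>(1) by (simp add: field_simps)
  have pq: "p \<ge> 0" "q > 0" using g1 a\<gamma> ef(3) \<tau> by (auto simp: p_def q_def)
  define Cs where "Cs = (\<lambda>(s, \<eta>, i). s *\<^sub>R e + \<eta> *\<^sub>R axis i (1::real)) ` ({- p, q} \<times> {- \<delta>, \<delta>} \<times> (UNIV :: 'n set))"
  have CsI: "s *\<^sub>R e + \<eta> *\<^sub>R axis i 1 \<in> Cs" if "s \<in> {- p, q}" "\<eta> \<in> {- \<delta>, \<delta>}" for s \<eta> i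
    unfolding Cs_def by (rule image_eqI[of _ _ "(s, \<eta>, i)"]) (use that in auto)
  have CsE: "\<exists>s \<eta> i. s \<in> {- p, q} \<and> \<eta> \<in> {- \<delta>, \<delta>} \<and> c = s *\<^sub>R e + \<eta> *\<^sub>R axis i 1" if "c \<in> Cs" for c
  proof -
    from that obtain z where z: "z \<in> {- p, q} \<times> {- \<delta>, \<delta>} \<times> (UNIV :: 'n set)"
        "c = (case z of (s, \<eta>, i) \<Rightarrow> s *\<^sub>R e + \<eta> *\<^sub>R axis i (1::real))"
      unfolding Cs_def by (rule imageE)
    obtain s \<eta> i where zz: "z = (s, \<eta>, i)" by (rule prod_cases3)
    have "s \<in> {- p, q}" "\<eta> \<in> {- \<delta>, \<delta>}" "c = s *\<^sub>R e + \<eta> *\<^sub>R axis i 1"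
      using z unfolding zz by simp_all
    then show ?thesis by blast
  qed
  have as: "\<bar>a - s\<bar> = 1 - \<tau>" if "s \<in> {- p, q}" for s
  proof -
    have "a - s = 1 - \<tau> \<or> a - s = - (1 - \<tau>)" using that by (auto simp: p_def q_def)
    then show ?thesis using \<tau>(2) by linarith
  qed
  have ai: "\<bar>axis i (1::real) \<bullet> x\<bar> \<le> norm x" for i and x :: "real ^ 'n"
    using Cauchy_Schwarz_ineq2[of "axis i 1" x] by simp
  \<comment> \<open>For given \<open>x\<close> choose the sign of \<eta> after the coordinate and
    \<open>s\<close> so that s * (e . x) \<ge> 0; the constraint for that slope bounds the
    coordinate by 1 / \<delta>. Without the coordinate perturbations the base would be unbounded in
    the directions orthogonal to \<open>e\<close>.\<close>
  have bdd: "bounded {x. \<forall>c\<in>Cs. c \<bullet> x \<le> 1}"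
  proof -
    have "norm x \<le> (\<Sum>i\<in>(UNIV::'n set). 1 / \<delta>)" if x: "\<forall>c\<in>Cs. c \<bullet> x \<le> 1" for x
    proof -
      have "\<bar>x $ i\<bar> \<le> 1 / \<delta>" for i
      proof -
        define \<eta> where "\<eta> = (if x $ i \<ge> 0 then \<delta> else - \<delta>)"
        define s where "s = (if e \<bullet> x \<ge> 0 then q else - p)"
        have "(s *\<^sub>R e + \<eta> *\<^sub>R axis i 1) \<bullet> x \<le> 1" using x by (intro bspec[OF x] CsI) (auto simp: s_def \<eta>_def)
        then have "s * (e \<bullet> x) + \<eta> * x $ i \<le> 1" by (simp add: inner_add_left inner_axis')
        moreover have "s * (e \<bullet> x) \<ge> 0" using pq mult_nonneg_nonneg[of q "e \<bullet> x"] mult_nonpos_nonpos[of "- p" "e \<bullet> x"] by (auto simp: s_def)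
        moreover have "\<eta> * x $ i = \<delta> * \<bar>x $ i\<bar>" by (auto simp: \<eta>_def)
        ultimately have "\<delta> * \<bar>x $ i\<bar> \<le> 1" by linarith
        then show ?thesis using \<delta>(1) by (simp add: field_simps)
      qed
      then show ?thesis by (intro order_trans[OF norm_le_l1_cart] sum_mono)
    qed
    then show ?thesis unfolding bounded_iff by blast
  qed
  have op: "norm (A *v h - (c \<bullet> h) *\<^sub>R f) \<le> (1 - \<tau> + \<delta>) * norm h" if c: "c \<in> insert 0 Cs" for c h
  proof (cases "c = 0")
    case True
    then have "norm (A *v h - (c \<bullet> h) *\<^sub>R f) \<le> \<gamma> * norm h" using \<gamma>(2) by simp
    also have "\<dots> \<le> (1 - \<tau> + \<delta>) * norm h" using g1 \<delta> by (intro mult_right_mono) auto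
    finally show ?thesis .
  next
    case False
    then obtain s \<eta> i where c: "s \<in> {- p, q}" "\<eta> \<in> {- \<delta>, \<delta>}" "c = s *\<^sub>R e + \<eta> *\<^sub>R axis i 1" using c CsE by blast
    \<comment> \<open>On the orthogonal complement of \<open>e\<close> the matrix is unchanged and
      maps into that of \<open>f\<close>, so Pythagoras separates the new stretch |a - s| from the
      old ones.\<close>
    define k where "k = h - (e \<bullet> h) *\<^sub>R e"
    have ek: "e \<bullet> k = 0" using ef(1) by (simp add: k_def inner_diff_right norm_eq_1)
    have hk: "h = (e \<bullet> h) *\<^sub>R e + k" by (simp add: k_def)
    have nh: "(norm h)\<^sup>2 = (e \<bullet> h)\<^sup>2 + (norm k)\<^sup>2"
    proof -
      have "(norm ((e \<bullet> h) *\<^sub>R e + k))\<^sup>2 = (e \<bullet> h)\<^sup>2 + (norm k)\<^sup>2"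
        using ek ef(1) unfolding power2_norm_eq_inner
        by (simp add: inner_add_left inner_add_right inner_commute power2_eq_square norm_eq_1)
      then show ?thesis using hk by simp
    qed
    have fk: "f \<bullet> (A *v k) = 0" using ef(5)[of k] ek by simp
    have "A *v h = (a * (e \<bullet> h)) *\<^sub>R f + A *v k"
      using arg_cong[OF hk, of "(*v) A"] ef(4) by (simp add: matrix_vector_right_distrib matrix_vector_mult_scaleR mult.commute)
    then have e1: "A *v h - (s * (e \<bullet> h)) *\<^sub>R f = ((a - s) * (e \<bullet> h)) *\<^sub>R f + A *v k"
      by (simp add: left_diff_distrib scaleR_diff_left)
    have "(norm (A *v h - (s * (e \<bullet> h)) *\<^sub>R f))\<^sup>2 = (a - s)\<^sup>2 * (e \<bullet> h)\<^sup>2 + (norm (A *v k))\<^sup>2"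
      using fk ef(2) unfolding e1 power2_norm_eq_inner
      by (simp add: inner_add_left inner_add_right inner_commute power2_eq_square norm_eq_1 algebra_simps)
    also have "\<dots> \<le> (1 - \<tau>)\<^sup>2 * (e \<bullet> h)\<^sup>2 + ((1 - \<tau>) * norm k)\<^sup>2"
    proof (intro add_mono power_mono)
      have "(a - s)\<^sup>2 = (1 - \<tau>)\<^sup>2" using as[OF c(1)] by (metis power2_abs)
      then show "(a - s)\<^sup>2 * (e \<bullet> h)\<^sup>2 \<le> (1 - \<tau>)\<^sup>2 * (e \<bullet> h)\<^sup>2" by simp
      show "norm (A *v k) \<le> (1 - \<tau>) * norm k" using \<gamma>(2)[of k] mult_right_mono[OF g1, of "norm k"] by simp
    qed simp
    also have "\<dots> = ((1 - \<tau>) * norm h)\<^sup>2" by (simp add: power_mult_distrib nh distrib_left)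
    finally have main: "norm (A *v h - (s * (e \<bullet> h)) *\<^sub>R f) \<le> (1 - \<tau>) * norm h"
      by (rule power2_le_imp_le) (use \<tau> in simp)
    have "A *v h - (c \<bullet> h) *\<^sub>R f = (A *v h - (s * (e \<bullet> h)) *\<^sub>R f) - (\<eta> * (axis i 1 \<bullet> h)) *\<^sub>R f"
      by (simp add: c(3) inner_add_left scaleR_add_left)
    also have "norm \<dots> \<le> (1 - \<tau>) * norm h + \<delta> * norm h"
    proof (rule order_trans[OF norm_triangle_ineq4 add_mono[OF main]])
      have "\<bar>\<eta>\<bar> = \<delta>" using c(2) \<delta>(1) by auto
      then show "norm ((\<eta> * (axis i 1 \<bullet> h)) *\<^sub>R f) \<le> \<delta> * norm h"
        using ai[of i h] ef(2) \<delta>(1) by (simp add: abs_mult mult_left_mono)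
    qed
    finally show ?thesis by (simp add: algebra_simps)
  qed
  have nf: "(norm (A - outer f c))\<^sup>2 = (norm A)\<^sup>2 - 2 * a * (e \<bullet> c) + (norm c)\<^sup>2" for c
    using norm_diff_outer[of A f c] ef(2,5) by simp
  have ec: "\<bar>e \<bullet> c - s\<bar> \<le> \<delta>" if "\<eta> \<in> {- \<delta>, \<delta>}" "c = s *\<^sub>R e + \<eta> *\<^sub>R axis i 1" for c s \<eta> i
  proof -
    have "e \<bullet> c = s + \<eta> * (axis i 1 \<bullet> e)" using ef(1) by (simp add: that(2) inner_add_right norm_eq_1 inner_commute)
    moreover have "\<bar>\<eta>\<bar> = \<delta>" using that(1) \<delta>(1) by auto
    ultimately show ?thesis using ai[of i e] ef(1) \<delta>(1) by (simp add: abs_mult mult_left_le)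
  qed
  \<comment> \<open>Raising the stretch of \<open>e\<close> from \<open>a\<close> to nearly 1 adds
    about 1 - a^2 to |A|^2. This is at least d / n because \<open>a\<close> is the least stretch,
    and the losses due to \<tau> and \<delta> use up at most half of d / n.\<close>
  have deficit: "?n - (norm (A - outer f c))\<^sup>2 \<le> (1 - 1 / (2 * ?n)) * (?n - (norm A)\<^sup>2)" if c: "c \<in> Cs" for c
  proof -
    obtain s \<eta> i where c: "s \<in> {- p, q}" "\<eta> \<in> {- \<delta>, \<delta>}" "c = s *\<^sub>R e + \<eta> *\<^sub>R axis i 1" using c CsE by blast
    define t where "t = e \<bullet> c"
    have "\<bar>t\<bar> \<le> norm c" unfolding t_def using Cauchy_Schwarz_ineq2[of e c] ef(1) by simp
    then have "t\<^sup>2 \<le> (norm c)\<^sup>2" by (simp add: abs_le_square_iff[symmetric])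
    moreover have "(1 - \<tau> - \<delta>)\<^sup>2 \<le> (t - a)\<^sup>2"
    proof -
      have "1 - \<tau> - \<delta> \<le> \<bar>t - a\<bar>" using ec[OF c(2,3)] as[OF c(1)] unfolding t_def by linarith
      then have "(1 - \<tau> - \<delta>)\<^sup>2 \<le> \<bar>t - a\<bar>\<^sup>2" using \<tau> \<delta> by (intro power_mono) auto
      then show ?thesis by simp
    qed
    moreover have "(t - a)\<^sup>2 = t\<^sup>2 - 2 * a * t + a\<^sup>2" by (simp add: power2_eq_square algebra_simps)
    moreover have "(1 - \<tau> - \<delta>)\<^sup>2 \<ge> 1 - 2 * (\<tau> + \<delta>)"
    proof -
      have "(1 - \<tau> - \<delta>)\<^sup>2 = 1 - 2 * (\<tau> + \<delta>) + (\<tau> + \<delta>)\<^sup>2" by (simp add: power2_eq_square algebra_simps)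
      then show ?thesis by simp
    qed
    ultimately have "(norm (A - outer f c))\<^sup>2 \<ge> (norm A)\<^sup>2 - a\<^sup>2 + (1 - 2 * (\<tau> + \<delta>))"
      unfolding nf t_def[symmetric] by linarith
    then have 1: "?n - (norm (A - outer f c))\<^sup>2 \<le> d - (1 - a\<^sup>2) + 4 * \<tau>" using \<delta>(3) by (simp add: d_def)
    define k where "k = d / ?n"
    have 2: "k \<le> 1 - a\<^sup>2" using da n by (simp add: k_def field_simps)
    have 3: "4 * \<tau> \<le> k / 2" using \<tau>(4) by (simp add: k_def)
    have "(1 - 1 / (2 * ?n)) * d = d - k / 2" using n by (simp add: k_def field_simps)
    then show ?thesis using 1 2 3 unfolding d_def[symmetric] by linarith
  qed
  have "\<exists>c1\<in>Cs. \<exists>c2\<in>Cs. (c1 - c2) \<bullet> e \<ge> 5/4"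
  proof (intro bexI)
    fix i :: 'n
    \<comment> \<open>Both slopes carry the same coordinate perturbation, so they differ by (p + q)
      e with p + q = 2 - 2 * \<tau>.\<close>
    let ?c1 = "q *\<^sub>R e + \<delta> *\<^sub>R axis i 1" and ?c2 = "(- p) *\<^sub>R e + \<delta> *\<^sub>R axis i 1"
    have "(?c1 - ?c2) \<bullet> e = p + q" using ef(1) by (simp add: inner_diff_left inner_add_left norm_eq_1 del: scaleR_minus_left)
    then show "(?c1 - ?c2) \<bullet> e \<ge> 5/4" using \<tau> by (simp add: p_def q_def)
    show "?c1 \<in> Cs" "?c2 \<in> Cs" by (rule CsI; simp)+
  qed
  moreover have "1 - \<tau> + \<delta> < 1" "finite Cs" "Cs \<noteq> {}" using \<delta> by (auto simp: Cs_def)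
  ultimately show ?thesis using that[of Cs f e "1 - \<tau> + \<delta>" a] ef(1,2) bdd op deficit nf by blast
qed

text \<open>A pyramid of height 1 with apex over 0, whose base is the polytope given by c . x \<le>
  1. Where \<open>c\<close> alone attains the maximum inside the base the gradient is -c, hence the
  gradients \<open>A - outer f c\<close>.\<close>

definition tent :: "'a::euclidean_space set \<Rightarrow> 'a \<Rightarrow> real"
  where "tent Cs x = max 0 (1 - Max ((\<lambda>c. c \<bullet> x) ` Cs))"

lemma tent_nonneg: "tent Cs x \<ge> 0"
  by (simp add: tent_def)

lemma tent_upper:
  assumes "finite Cs" "c \<in> Cs" "tent Cs x > 0"
  shows "tent Cs x \<le> 1 - c \<bullet> x"
proof -
  have "c \<bullet> x \<le> Max ((\<lambda>c. c \<bullet> x) ` Cs)" using assms by (intro Max_ge) auto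
  then show ?thesis using assms(3) by (simp add: tent_def max_def split: if_splits)
qed

lemma tent_lower:
  assumes "finite Cs" "Cs \<noteq> {}"
  obtains c where "c \<in> Cs" "tent Cs x \<ge> 1 - c \<bullet> x" "\<And>c'. c' \<in> Cs \<Longrightarrow> c' \<bullet> x \<le> c \<bullet> x"
proof -
  have "Max ((\<lambda>c. c \<bullet> x) ` Cs) \<in> (\<lambda>c. c \<bullet> x) ` Cs" using assms by (intro Max_in) auto
  then obtain c where c: "c \<in> Cs" "Max ((\<lambda>c. c \<bullet> x) ` Cs) = c \<bullet> x" by auto
  have "c' \<bullet> x \<le> c \<bullet> x" if "c' \<in> Cs" for c' using that assms c(2) Max_ge[of "(\<lambda>c. c \<bullet> x) ` Cs" "c' \<bullet> x"] by auto
  then show ?thesis using that[OF c(1)] c(2) by (simp add: tent_def)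
qed

lemma tent_eq_0:
  assumes "finite Cs" "c \<in> Cs" "c \<bullet> x \<ge> 1"
  shows "tent Cs x = 0"
  using tent_upper[OF assms(1,2), of x] tent_nonneg[of Cs x] assms(3) by fastforce

lemma tent_eq:
  assumes "finite Cs" "c \<in> Cs" "\<And>c'. c' \<in> Cs \<Longrightarrow> c' \<bullet> x \<le> c \<bullet> x" "c \<bullet> x \<le> 1"
  shows "tent Cs x = 1 - c \<bullet> x"
proof -
  have "Max ((\<lambda>c. c \<bullet> x) ` Cs) = c \<bullet> x" using assms by (intro Max_eqI) auto
  then show ?thesis using assms(4) by (simp add: tent_def)
qed

text \<open>An increment is bounded by that of a single linear piece; the slope 0 accounts for the
  flat part outside the base.\<close>

lemma tent_increment:
  assumes "finite Cs" "Cs \<noteq> {}"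
  obtains c where "c \<in> insert 0 Cs" "tent Cs x - tent Cs y \<le> - (c \<bullet> (x - y))"
proof (cases "tent Cs x > 0")
  case True
  obtain c where c: "c \<in> Cs" "tent Cs y \<ge> 1 - c \<bullet> y" by (rule tent_lower[OF assms])
  have "tent Cs x \<le> 1 - c \<bullet> x" by (rule tent_upper[OF assms(1) c(1) True])
  then show ?thesis using that[of c] c by (simp add: inner_diff_right)
next
  case False
  then show ?thesis using that[of 0] tent_nonneg[of Cs x] tent_nonneg[of Cs y] by simp
qed

text \<open>The increment of the tent lies between those of two linear pieces, so the increment of
  the whole map is a convex combination of two contractions applied to x - y. The pieces crossed by
  the segment need not be followed.\<close>

lemma tent_affine_lipschitz:
  fixes A :: "'a::euclidean_space \<Rightarrow> 'b::euclidean_space"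
  assumes fin: "finite Cs" "Cs \<noteq> {}" and A: "linear A"
    and b: "\<And>c h. c \<in> insert 0 Cs \<Longrightarrow> norm (A h - (c \<bullet> h) *\<^sub>R f) \<le> \<gamma> * norm h"
  shows "norm ((A x + tent Cs x *\<^sub>R f) - (A y + tent Cs y *\<^sub>R f)) \<le> \<gamma> * norm (x - y)"
proof -
  let ?h = "x - y"
  obtain c1 where c1: "c1 \<in> insert 0 Cs" "tent Cs x - tent Cs y \<le> - (c1 \<bullet> ?h)" by (rule tent_increment[OF fin])
  obtain c2 where c2: "c2 \<in> insert 0 Cs" "tent Cs y - tent Cs x \<le> - (c2 \<bullet> (y - x))" by (rule tent_increment[OF fin])
  define z where "z = tent Cs x - tent Cs y"
  have z: "- (c2 \<bullet> ?h) \<le> z" "z \<le> - (c1 \<bullet> ?h)"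
    using c1(2) c2(2) by (auto simp: z_def inner_diff_right)
  have "z \<in> closed_segment (- (c2 \<bullet> ?h)) (- (c1 \<bullet> ?h))" using z by (simp add: closed_segment_eq_real_ivl)
  then obtain t where t: "0 \<le> t" "t \<le> 1" "z = (1 - t) *\<^sub>R (- (c2 \<bullet> ?h)) + t *\<^sub>R (- (c1 \<bullet> ?h))"
    unfolding closed_segment_def by blast
  have "(A x + tent Cs x *\<^sub>R f) - (A y + tent Cs y *\<^sub>R f) = A ?h + z *\<^sub>R f"
    by (simp add: linear_diff[OF A] z_def algebra_simps)
  also have "\<dots> = (1 - t) *\<^sub>R (A ?h - (c2 \<bullet> ?h) *\<^sub>R f) + t *\<^sub>R (A ?h - (c1 \<bullet> ?h) *\<^sub>R f)"
    unfolding t(3) by (simp add: algebra_simps)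
  also have "norm \<dots> \<le> (1 - t) * norm (A ?h - (c2 \<bullet> ?h) *\<^sub>R f) + t * norm (A ?h - (c1 \<bullet> ?h) *\<^sub>R f)"
    using t by (intro order_trans[OF norm_triangle_ineq]) simp
  also have "\<dots> \<le> (1 - t) * (\<gamma> * norm ?h) + t * (\<gamma> * norm ?h)"
    using t b[OF c1(1)] b[OF c2(1)] by (intro add_mono mult_left_mono) auto
  finally show ?thesis by (simp add: algebra_simps)
qed

section \<open>Piecewise affine gradients\<close>

lemma integrable_bounded_compact_support:
  fixes f :: "'a::euclidean_space \<Rightarrow> real"
  assumes "f \<in> borel_measurable lebesgue" "compact K" "\<And>x. x \<notin> K \<Longrightarrow> f x = 0" "\<And>x. \<bar>f x\<bar> \<le> B"
  shows "integrable lebesgue f"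
proof -
  have K: "K \<in> lmeasurable" using assms(2) by (rule lmeasurable_compact)
  have im: "(indicator K :: 'a \<Rightarrow> real) \<in> borel_measurable lebesgue"
    using K by (intro borel_measurable_indicator fmeasurableD)
  have "integrable lebesgue (\<lambda>y. indicator K y *\<^sub>R f y)"
  proof (rule kernel_integral(1)[OF im assms(1) K])
    show "\<bar>indicat_real K y\<bar> \<le> 1 * indicat_real K y" for y by simp
    show "norm (f y) \<le> B" for y using assms(4) by simp
  qed simp
  moreover have "(\<lambda>y. indicator K y *\<^sub>R f y) = f"
  proof
    fix y show "indicator K y *\<^sub>R f y = f y" using assms(3)[of y] by (cases "y \<in> K") simp_all
  qed
  ultimately show ?thesis by simp
qed

text \<open>Difference quotients have integral 0 by translation invariance, and the bound on
  increments dominates them. Only a right derivative at almost every point is asked for, which suits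
  piecewise affine functions.\<close>

lemma integral_directional_derivative_zero:
  fixes g g' :: "'a::euclidean_space \<Rightarrow> real"
  assumes gm: "g \<in> borel_measurable lebesgue" and K: "bounded K" "\<And>x. x \<notin> K \<Longrightarrow> g x = 0"
    and B: "\<And>x. \<bar>g x\<bar> \<le> B"
    and lip: "\<And>x t. 0 < t \<Longrightarrow> t < \<delta> \<Longrightarrow> \<bar>g (x + t *\<^sub>R e) - g x\<bar> \<le> C * t" and \<delta>: "\<delta> > 0"
    and g'm: "g' \<in> borel_measurable lebesgue"
    and der: "AE x in lebesgue. ((\<lambda>t. (g (x + t *\<^sub>R e) - g x) / t) \<longlongrightarrow> g' x) (at_right 0)"
  shows "integrable lebesgue g'" "(\<integral>x. g' x \<partial>lebesgue) = 0"
proof -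
  obtain R where R: "R > 0" "\<And>x. x \<in> K \<Longrightarrow> norm x \<le> R" using K(1) unfolding bounded_pos by blast
  \<comment> \<open>The shift by 2 keeps every step positive and strictly below \<delta>, where the
    increment bound applies.\<close>
  define t where "t k = \<delta> / real (k + 2)" for k
  have t: "t k > 0" "t k < \<delta>" for k
  proof -
    have "0 < real (k + 2)" "1 < real (k + 2)" by simp_all
    then show "t k > 0" "t k < \<delta>" using \<delta> mult_strict_left_mono[of 1 "real (k + 2)" \<delta>]
      unfolding t_def by (simp_all only: divide_pos_pos pos_divide_less_eq mult_1_right)
  qed
  have t0: "filterlim t (at_right 0) sequentially"
  proof -
    have "(\<lambda>k. \<delta> / real (k + 2)) \<longlonglongrightarrow> 0" by (rule LIMSEQ_ignore_initial_segment[OF lim_const_over_n])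
    moreover have "t = (\<lambda>k. \<delta> / real (k + 2))" by (simp add: t_def fun_eq_iff)
    ultimately have "t \<longlonglongrightarrow> 0" by (simp only:)
    then show ?thesis using t(1) by (simp add: filterlim_at less_imp_neq[THEN not_sym])
  qed
  define s where "s k x = (g (x + t k *\<^sub>R e) - g x) / t k" for k x
  let ?K = "cball (0::'a) (R + \<delta> * norm e)"
  define w where "w x = C * indicator ?K x" for x :: 'a
  have gi: "integrable lebesgue g"
  proof (rule integrable_bounded_compact_support[OF gm compact_cball _ B])
    show "g x = 0" if "x \<notin> cball 0 R" for x using K(2)[of x] R(2)[of x] that by auto
  qed
  have gsm: "(\<lambda>x. g (x + a)) \<in> borel_measurable lebesgue" for a
    using measurable_compose[OF measurable_lebesgue_translation gm, of a] by (simp add: add.commute)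
  have gsi: "integrable lebesgue (\<lambda>x. g (x + a))" for a
    using integrable_distr[OF measurable_lebesgue_translation[of a], of g] gi
    unfolding distr_lebesgue_translation by (simp add: add.commute)
  have s0: "(\<integral>x. s k x \<partial>lebesgue) = 0" for k
  proof -
    have "(\<integral>x. g (x + t k *\<^sub>R e) \<partial>lebesgue) = (\<integral>x. g x \<partial>lebesgue)"
      using integral_lebesgue_translation[OF gm, of "t k *\<^sub>R e"] by (simp add: add.commute)
    then show ?thesis unfolding s_def using gi gsi by simp
  qed
  have sb: "norm (s k x) \<le> w x" for k x
  proof (cases "x \<in> ?K")
    case True
    then show ?thesis using lip[OF t(1)[of k] t(2)[of k], of x] t(1)[of k] by (simp add: w_def s_def field_simps)
  next
    case False
    have "x \<notin> K" using R(2)[of x] False \<delta> by (auto simp: add_nonneg_nonneg intro: order_trans)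
    moreover have "x + t k *\<^sub>R e \<notin> K"
    proof
      assume "x + t k *\<^sub>R e \<in> K"
      then have "norm (x + t k *\<^sub>R e) \<le> R" by (rule R(2))
      moreover have "norm x \<le> norm (x + t k *\<^sub>R e) + norm (t k *\<^sub>R e)"
        using norm_triangle_ineq4[of "x + t k *\<^sub>R e" "t k *\<^sub>R e"] by simp
      moreover have "norm (t k *\<^sub>R e) \<le> \<delta> * norm e" using t[of k] by (simp add: mult_right_mono)
      ultimately show False using False by simp
    qed
    ultimately show ?thesis using K(2) False by (simp add: s_def w_def)
  qed
  have wi: "integrable lebesgue w"
    unfolding w_def by (intro integrable_mult_right) (simp flip: lmeasurable_iff_integrable)
  have sm: "s k \<in> borel_measurable lebesgue" for k unfolding s_def using gsm gm by measurable
  have lim: "AE x in lebesgue. (\<lambda>k. s k x) \<longlonglongrightarrow> g' x"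
    using der unfolding s_def by eventually_elim (rule filterlim_compose[OF _ t0])
  have bd: "AE x in lebesgue. norm (s k x) \<le> w x" for k using sb by (intro AE_I2)
  show "integrable lebesgue g'" by (rule integrable_dominated_convergence[OF g'm sm wi lim bd])
  have "(\<lambda>k. \<integral>x. s k x \<partial>lebesgue) \<longlonglongrightarrow> (\<integral>x. g' x \<partial>lebesgue)"
    by (rule integral_dominated_convergence[OF g'm sm wi lim bd])
  then show "(\<integral>x. g' x \<partial>lebesgue) = 0" unfolding s0 LIMSEQ_const_iff by (rule sym)
qed

lemma directional_limit:
  fixes g :: "'a::euclidean_space \<Rightarrow> real"
  assumes "(g has_derivative D) (at x)"
  shows "((\<lambda>t. (g (x + t *\<^sub>R e) - g x) / t) \<longlongrightarrow> D e) (at_right 0)"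
proof -
  have l: "((\<lambda>t::real. x + t *\<^sub>R e) has_derivative (\<lambda>t. t *\<^sub>R e)) (at 0)" by (auto intro!: derivative_eq_intros)
  have "((\<lambda>t. g (x + t *\<^sub>R e)) has_derivative (\<lambda>t. D (t *\<^sub>R e))) (at 0)"
    using has_derivative_compose[OF l, of g D] assms by simp
  moreover have "(\<lambda>t. D (t *\<^sub>R e)) = (*) (D e)"
    using linear_scale[OF has_derivative_linear[OF assms]] by (auto simp: mult.commute)
  ultimately have "((\<lambda>t. g (x + t *\<^sub>R e)) has_real_derivative D e) (at 0)" by (simp add: has_field_derivative_def)
  then have "((\<lambda>t. (g (x + t *\<^sub>R e) - g x) / t) \<longlongrightarrow> D e) (at 0)" by (simp add: has_field_derivative_iff)
  then show ?thesis by (rule tendsto_mono[rotated]) (simp add: at_le)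
qed

section \<open>Test functions and gradients of locally affine maps\<close>

lemma test_function_props:
  fixes \<psi> :: "'a::euclidean_space \<Rightarrow> 'b::euclidean_space"
  assumes "\<psi> \<in> test_functions \<Omega>"
  obtains K where "compact K" "K \<subseteq> \<Omega>" "\<And>x. x \<notin> K \<Longrightarrow> \<psi> x = 0"
    "\<And>x. (\<psi> has_derivative frechet_derivative \<psi> (at x)) (at x)"
    "\<And>v. continuous_on UNIV (\<lambda>x. frechet_derivative \<psi> (at x) v)"
proof -
  obtain K where K: "compact K" "K \<subseteq> \<Omega>" "\<forall>x. x \<notin> K \<longrightarrow> \<psi> x = 0" and C: "Cinfinity_on \<psi> UNIV"
    using assms by (auto simp: test_functions_def)
  have "Ck_on (Suc 0) \<psi> UNIV" using C unfolding Cinfinity_on_def by blast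
  then have "\<And>x. \<psi> differentiable (at x)" "\<And>v. continuous_on UNIV (\<lambda>x. frechet_derivative \<psi> (at x) v)"
    by auto
  then show ?thesis using that[OF K(1,2)] K(3) frechet_derivative_works by blast
qed

lemma bounded_compact_support:
  fixes f :: "'a::euclidean_space \<Rightarrow> real"
  assumes "compact K" "continuous_on UNIV f" "\<And>x. x \<notin> K \<Longrightarrow> f x = 0"
  obtains B where "B \<ge> 0" "\<And>x. \<bar>f x\<bar> \<le> B"
proof -
  have "compact (f ` K)" using assms(1,2) continuous_on_subset by (intro compact_continuous_image) blast+
  then obtain B where B: "\<forall>y\<in>f ` K. norm y \<le> B" using compact_imp_bounded bounded_iff by blast
  have "\<bar>f x\<bar> \<le> max B 0" for x
  proof (cases "x \<in> K")
    case True
    then have "norm (f x) \<le> B" using B by blast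
    then show ?thesis by simp
  qed (simp add: assms(3))
  then show ?thesis using that[of "max B 0"] by simp
qed

lemma integral_test_derivative_zero:
  fixes \<psi> :: "'a::euclidean_space \<Rightarrow> real"
  assumes K: "compact K" "\<And>x. x \<notin> K \<Longrightarrow> \<psi> x = 0"
    and d: "\<And>x. (\<psi> has_derivative \<psi>' x) (at x)" "\<And>v. continuous_on UNIV (\<lambda>x. \<psi>' x v)"
  shows "integrable lebesgue (\<lambda>x. \<psi>' x v)" "(\<integral>x. \<psi>' x v \<partial>lebesgue) = 0"
proof -
  have c: "continuous_on UNIV \<psi>" using d(1) by (intro continuous_at_imp_continuous_on ballI has_derivative_continuous)
  obtain B where B: "B \<ge> 0" "\<And>x. \<bar>\<psi> x\<bar> \<le> B" by (rule bounded_compact_support[OF K(1) c K(2)]) (assumption | rule that)+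
  obtain L where L: "L \<ge> 0" "\<And>x y. \<bar>\<psi> x - \<psi> y\<bar> \<le> L * norm (x - y)"
    by (rule C1_compact_support_lipschitz[OF d K]) (assumption | rule that)+
  have lip: "\<bar>\<psi> (x + t *\<^sub>R v) - \<psi> x\<bar> \<le> (L * norm v) * t" if "0 < t" "t < 1" for x t
    using L(2)[of "x + t *\<^sub>R v" x] that by (simp add: mult_ac)
  have "AE x in lebesgue. ((\<lambda>t. (\<psi> (x + t *\<^sub>R v) - \<psi> x) / t) \<longlongrightarrow> \<psi>' x v) (at_right 0)"
    by (intro AE_I2 directional_limit d)
  note * = integral_directional_derivative_zero[OF continuous_imp_borel_measurable_lebesgue[OF c]
      compact_imp_bounded[OF K(1)] K(2) B(2) lip zero_less_one continuous_imp_borel_measurable_lebesgue[OF d(2)] this]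
  show "integrable lebesgue (\<lambda>x. \<psi>' x v)" "(\<integral>x. \<psi>' x v \<partial>lebesgue) = 0" using * by auto
qed

text \<open>The value 0 at the remaining points makes \<open>pgrad\<close> a measurable contraction
  everywhere, so no exceptional set has to be carried along.\<close>

definition pgrad :: "(real ^ 'n \<Rightarrow> real ^ 'm) \<Rightarrow> real ^ 'n \<Rightarrow> real ^ 'n ^ 'm"
  where "pgrad u x = (if strictly_affine_at u x then matrix (frechet_derivative u (at x)) else 0)"

lemma has_derivative_affine:
  fixes L :: "'a::euclidean_space \<Rightarrow> 'b::real_normed_vector"
  assumes "linear L"
  shows "((\<lambda>z. a + L (z - x)) has_derivative L) (at y)"
proof -
  have L: "bounded_linear L" using assms by (simp add: linear_conv_bounded_linear)
  have "((\<lambda>z. (a - L x) + L z) has_derivative (\<lambda>h. 0 + L h)) (at y)"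
    by (rule has_derivative_add[OF has_derivative_const bounded_linear_imp_has_derivative[OF L]])
  moreover have "(\<lambda>z. (a - L x) + L z) = (\<lambda>z. a + L (z - x))" by (simp add: linear_diff[OF assms] fun_eq_iff)
  ultimately show ?thesis by simp
qed

lemma strictly_affine_at_pgrad:
  assumes "strictly_affine_at u x"
  obtains r c where "r > 0" "c < 1" "\<And>h. norm (pgrad u x *v h) \<le> c * norm h"
    "\<And>y. y \<in> ball x r \<Longrightarrow> u y = u x + pgrad u x *v (y - x)"
    "\<And>y. y \<in> ball x r \<Longrightarrow> strictly_affine_at u y \<and> pgrad u y = pgrad u x"
proof -
  obtain r L c where L: "r > 0" "linear L" "c < 1" "\<forall>h. norm (L h) \<le> c * norm h" "\<forall>y\<in>ball x r. u y = u x + L (y - x)"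
    using assms unfolding strictly_affine_at_def by blast
  have sa: "strictly_affine_at u y" if y: "y \<in> ball x r" for y
  proof -
    obtain e where e: "e > 0" "ball y e \<subseteq> ball x r" using y by (meson open_ball open_contains_ball)
    have "u z = u y + L (z - y)" if "z \<in> ball y e" for z
    proof -
      have "z \<in> ball x r" using e(2) that by blast
      then have "u z = u x + L (z - x)" "u y = u x + L (y - x)" using L(5) y by blast+
      then show ?thesis using linear_diff[OF L(2), of "z - x" "y - x"] by simp
    qed
    then show ?thesis unfolding strictly_affine_at_def using e(1) L(2-4) by blast
  qed
  have der: "(u has_derivative L) (at y)" if y: "y \<in> ball x r" for y
  proof -
    have "((\<lambda>z. u x + L (z - x)) has_derivative L) (at y)"
      by (rule has_derivative_affine[OF L(2)])
    then show ?thesis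
      by (rule has_derivative_transform_within_open[OF _ open_ball y]) (use L(5) in auto)
  qed
  have pg: "pgrad u y = matrix L" if "y \<in> ball x r" for y
    using frechet_derivative_at[OF der[OF that]] sa[OF that] by (simp add: pgrad_def)
  have mL: "matrix L *v h = L h" for h using L(2) by (simp add: matrix_works)
  have x: "x \<in> ball x r" using L(1) by simp
  show ?thesis
  proof (rule that[OF L(1,3)])
    show "norm (pgrad u x *v h) \<le> c * norm h" for h using L(4) unfolding pg[OF x] mL by blast
    show "u y = u x + pgrad u x *v (y - x)" if "y \<in> ball x r" for y using L(5) that unfolding pg[OF x] mL by blast
    show "strictly_affine_at u y \<and> pgrad u y = pgrad u x" if "y \<in> ball x r" for y
      using sa[OF that] pg[OF that] pg[OF x] by simp
  qed
qed

lemma pgrad_has_derivative: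
  assumes "strictly_affine_at u x"
  shows "(u has_derivative (*v) (pgrad u x)) (at x)"
proof -
  obtain r c where r: "r > 0" "\<And>y. y \<in> ball x r \<Longrightarrow> u y = u x + pgrad u x *v (y - x)"
    by (rule strictly_affine_at_pgrad[OF assms]) (assumption | rule that)+
  have "((\<lambda>z. u x + pgrad u x *v (z - x)) has_derivative (*v) (pgrad u x)) (at x)"
    by (rule has_derivative_affine[OF matrix_vector_mul_linear])
  then show ?thesis
    by (rule has_derivative_transform_within_open[OF _ open_ball centre_in_ball[THEN iffD2, OF r(1)] r(2)[symmetric]])
qed

lemma open_strictly_affine: "open {x. strictly_affine_at u x}" for u :: "real ^ 'n \<Rightarrow> real ^ 'm"
  unfolding open_contains_ball
proof
  fix x assume "x \<in> {x. strictly_affine_at u x}"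
  then obtain r where "r > 0" "\<And>y. y \<in> ball x r \<Longrightarrow> strictly_affine_at u y"
    using strictly_affine_at_pgrad[of u x] by (metis mem_Collect_eq)
  then show "\<exists>e>0. ball x e \<subseteq> {x. strictly_affine_at u x}" by blast
qed

lemma pgrad_contraction: "norm (pgrad u x *v h) \<le> norm h"
proof (cases "strictly_affine_at u x")
  case True
  obtain r :: real and c where "r > 0" and c: "c < 1" "\<And>h. norm (pgrad u x *v h) \<le> c * norm h"
    by (rule strictly_affine_at_pgrad[OF True]) (assumption | rule that)+
  have "c * norm h \<le> 1 * norm h" using c(1) by (intro mult_right_mono) auto
  then show ?thesis using c(2)[of h] by simp
qed (simp add: pgrad_def)

text \<open>The gradient is locally constant on the open set of affine points and 0
  elsewhere.\<close>

lemma pgrad_measurable: "pgrad u \<in> borel_measurable lebesgue"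
proof -
  let ?S = "{x. strictly_affine_at u x}"
  have "continuous_on ?S (pgrad u)"
    unfolding continuous_on_eq_continuous_at[OF open_strictly_affine]
  proof
    fix x assume "x \<in> ?S"
    then obtain r where r: "r > 0" "\<And>y. y \<in> ball x r \<Longrightarrow> pgrad u y = pgrad u x"
      using strictly_affine_at_pgrad[of u x] by (metis mem_Collect_eq)
    have "((\<lambda>y. pgrad u x) \<longlongrightarrow> pgrad u x) (at x)" by simp
    then have "(pgrad u \<longlongrightarrow> pgrad u x) (at x)"
      by (rule Lim_transform_within_open[OF _ open_ball centre_in_ball[THEN iffD2, OF r(1)] r(2)[symmetric]])
    then show "isCont (pgrad u) x" by (simp add: isCont_def)
  qed
  then have "(\<lambda>x. indicator ?S x *\<^sub>R pgrad u x) \<in> borel_measurable borel"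
    by (intro borel_measurable_continuous_on_indicator borel_open open_strictly_affine)
  moreover have "(\<lambda>x. indicator ?S x *\<^sub>R pgrad u x) = pgrad u"
    by (simp add: pgrad_def indicator_def fun_eq_iff)
  ultimately have "pgrad u \<in> borel_measurable lborel" by simp
  then show ?thesis by (rule measurable_completion)
qed

lemma contraction_entry_le:
  fixes A :: "real ^ 'n ^ 'm"
  assumes "\<And>h. norm (A *v h) \<le> norm h"
  shows "\<bar>A $ i $ j\<bar> \<le> 1"
proof -
  have "\<bar>(A *v axis j 1) $ i\<bar> \<le> norm (axis j (1::real))" using assms component_le_norm_cart order_trans by metis
  then show ?thesis by (simp add: matrix_vector_mult_basis column_def)
qed

lemma short_continuous_on:
  assumes "open \<Omega>" "short_on \<Omega> v"
  shows "continuous_on \<Omega> (v :: 'a::euclidean_space \<Rightarrow> 'b::euclidean_space)"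
  unfolding continuous_on_eq_continuous_at[OF assms(1)]
proof
  fix x assume "x \<in> \<Omega>"
  then obtain r where r: "r > 0" "ball x r \<subseteq> \<Omega>" using assms(1) by (meson open_contains_ball)
  have "1-lipschitz_on (ball x r) v"
    using short_on_subset[OF assms(2) r(2)] by (intro lipschitz_onI) (auto simp: short_on_convex dist_norm)
  then have "continuous_on (ball x r) v" by (rule lipschitz_on_continuous_on)
  then show "isCont v x" using r(1) by (simp add: continuous_on_eq_continuous_at)
qed

lemma integral_lebesgue_on:
  fixes f :: "'a::euclidean_space \<Rightarrow> real"
  assumes "open \<Omega>"
  shows "(LINT x|lebesgue_on \<Omega>. f x) = (LINT x|lebesgue. indicator \<Omega> x * f x)"
  using assms integral_restrict_space[of \<Omega> lebesgue f] by simp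

text \<open>The product of a component of \<open>v\<close> with the test function has compact
  support, increments of linear size and a derivative almost everywhere, so its partial derivative
  has integral 0. The product rule splits this integral into the two sides.\<close>

lemma piecewise_affine_integration_by_parts:
  fixes v :: "real ^ 'n \<Rightarrow> real ^ 'm"
  assumes op: "open \<Omega>" and v: "short_on \<Omega> v" and sa: "AE x in lebesgue. x \<in> \<Omega> \<longrightarrow> strictly_affine_at v x"
    and \<psi>: "\<psi> \<in> test_functions \<Omega>"
  shows "(LINT x|lebesgue_on \<Omega>. v x $ i * frechet_derivative \<psi> (at x) (axis j 1)) =
       - (LINT x|lebesgue_on \<Omega>. pgrad v x $ i $ j * \<psi> x)"
proof -
  let ?e = "axis j 1 :: real ^ 'n" and ?d = "\<lambda>x. frechet_derivative \<psi> (at x)"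
  obtain K where K: "compact K" "K \<subseteq> \<Omega>" "\<And>x. x \<notin> K \<Longrightarrow> \<psi> x = 0"
    and d: "\<And>x. (\<psi> has_derivative ?d x) (at x)" "\<And>v. continuous_on UNIV (\<lambda>x. ?d x v)"
    by (rule test_function_props[OF \<psi>]) (rule that)
  have c\<psi>: "continuous_on UNIV \<psi>" using d(1) by (intro continuous_at_imp_continuous_on ballI has_derivative_continuous)
  have d0: "?d x h = 0" if "x \<notin> K" for x h
    using has_derivative_zero_off_compact_support[OF K(1) K(3) d(1) that] by simp
  obtain B where B: "B \<ge> 0" "\<And>x. \<bar>\<psi> x\<bar> \<le> B"
    by (rule bounded_compact_support[OF K(1) c\<psi> K(3)]) (assumption | rule that)+
  obtain Bd where Bd: "Bd \<ge> 0" "\<And>x. \<bar>?d x ?e\<bar> \<le> Bd"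
    by (rule bounded_compact_support[OF K(1) d(2) d0]) (assumption | rule that)+
  obtain L where L: "L \<ge> 0" "\<And>x y. \<bar>\<psi> x - \<psi> y\<bar> \<le> L * norm (x - y)"
    by (rule C1_compact_support_lipschitz[OF d K(1,3)]) (assumption | rule that)+
  \<comment> \<open>Shortness holds only along segments in \<Omega>; a segment of length below
    \<epsilon> with an end in the support of the test function stays inside.\<close>
  obtain \<epsilon> where \<epsilon>: "\<epsilon> > 0" "(\<Union>x\<in>K. cball x \<epsilon>) \<subseteq> \<Omega>"
    by (rule compact_subset_open_imp_cball_epsilon_subset[OF K(1) op K(2)]) (rule that)
  have cv: "continuous_on \<Omega> v" by (rule short_continuous_on[OF op v])
  have "compact (v ` K)" using K(1,2) cv continuous_on_subset by (intro compact_continuous_image) blast+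
  then obtain V where V: "\<And>x. x \<in> K \<Longrightarrow> norm (v x) \<le> V" using compact_imp_bounded bounded_iff by (metis imageI)
  define w where "w x = (if x \<in> \<Omega> then v x $ i else 0)" for x
  have wV: "\<bar>w x\<bar> \<le> V" if "x \<in> K" for x
    using V[OF that] component_le_norm_cart[of "v x" i] K(2) that by (auto simp: w_def)
  have wm: "w \<in> borel_measurable lebesgue"
  proof -
    have "continuous_on \<Omega> (\<lambda>x. v x $ i)" using cv by (intro continuous_intros)
    then have "(\<lambda>x. indicator \<Omega> x *\<^sub>R (v x $ i)) \<in> borel_measurable borel"
      using op by (intro borel_measurable_continuous_on_indicator) auto
    moreover have "(\<lambda>x. indicator \<Omega> x *\<^sub>R (v x $ i)) = w" by (auto simp: w_def indicator_def fun_eq_iff)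
    ultimately have "w \<in> borel_measurable lborel" by simp
    then show ?thesis by (rule measurable_completion)
  qed
  define g where "g x = w x * \<psi> x" for x
  have \<psi>m: "\<psi> \<in> borel_measurable lebesgue" by (rule continuous_imp_borel_measurable_lebesgue[OF c\<psi>])
  have dm: "(\<lambda>x. ?d x ?e) \<in> borel_measurable lebesgue" by (rule continuous_imp_borel_measurable_lebesgue[OF d(2)])
  have gm: "g \<in> borel_measurable lebesgue" unfolding g_def using wm \<psi>m by measurable
  have g0: "g x = 0" if "x \<notin> K" for x using K(3)[OF that] by (simp add: g_def)
  have gB: "\<bar>g x\<bar> \<le> \<bar>V\<bar> * B" for x
  proof (cases "x \<in> K")
    case True
    have "\<bar>w x\<bar> \<le> \<bar>V\<bar>" using wV[OF True] by simp
    then show ?thesis using B(2)[of x] by (auto simp: g_def abs_mult intro: mult_mono)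
  qed (use g0 B in simp)
  have step: "\<bar>w y - w x\<bar> \<le> norm (y - x)" if "closed_segment x y \<subseteq> \<Omega>" for x y
  proof -
    have "\<bar>(v y - v x) $ i\<bar> \<le> norm (y - x)"
      using component_le_norm_cart[of "v y - v x" i] short_onD[OF v that] by (simp add: norm_minus_commute)
    then show ?thesis using that by (auto simp: w_def)
  qed
  have lip: "\<bar>g (x + t *\<^sub>R ?e) - g x\<bar> \<le> (B + (\<bar>V\<bar> + \<epsilon>) * L) * t" if t: "0 < t" "t < \<epsilon>" for x t
  proof (cases "x \<in> K \<or> x + t *\<^sub>R ?e \<in> K")
    case False
    then have "g x = 0" "g (x + t *\<^sub>R ?e) = 0" using g0 by auto
    then show ?thesis using t B L \<epsilon> by simp
  next
    case True
    let ?y = "x + t *\<^sub>R ?e"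
    have nt: "norm (?y - x) = t" using t by simp
    obtain z where z: "z \<in> K" "z = x \<or> z = ?y" using True by blast
    have "x \<in> cball z \<epsilon>" "?y \<in> cball z \<epsilon>" using z(2) t \<epsilon>(1) nt by (auto simp: dist_norm)
    then have "closed_segment x ?y \<subseteq> cball z \<epsilon>" by (intro closed_segment_subset) auto
    then have seg: "closed_segment x ?y \<subseteq> \<Omega>" using \<epsilon>(2) z(1) by blast
    have wx: "\<bar>w x\<bar> \<le> \<bar>V\<bar> + \<epsilon>"
      using z(2) wV[OF z(1)] step[OF seg] nt t by auto
    have "g ?y - g x = (w ?y - w x) * \<psi> ?y + w x * (\<psi> ?y - \<psi> x)" by (simp add: g_def algebra_simps)
    then have "\<bar>g ?y - g x\<bar> \<le> \<bar>w ?y - w x\<bar> * \<bar>\<psi> ?y\<bar> + \<bar>w x\<bar> * \<bar>\<psi> ?y - \<psi> x\<bar>"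
      by (metis abs_mult abs_triangle_ineq)
    also have "\<dots> \<le> t * B + (\<bar>V\<bar> + \<epsilon>) * (L * t)"
      using step[OF seg] nt B(2)[of ?y] L(2)[of ?y x] wx t L(1) \<epsilon>(1) by (intro add_mono mult_mono) auto
    finally show ?thesis by (simp add: algebra_simps)
  qed
  define g' where "g' x = indicator \<Omega> x * (pgrad v x $ i $ j * \<psi> x) + w x * ?d x ?e" for x
  have pm: "(\<lambda>x. pgrad v x $ i $ j) \<in> borel_measurable lebesgue"
    using borel_measurable_vec_component[OF borel_measurable_vec_component[OF pgrad_measurable[of v], of i], of j] .
  have om: "\<Omega> \<in> sets lebesgue" using op by auto
  have m1: "(\<lambda>x. indicator \<Omega> x * (pgrad v x $ i $ j * \<psi> x)) \<in> borel_measurable lebesgue"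
    using pm \<psi>m om by measurable
  have m2: "(\<lambda>x. w x * ?d x ?e) \<in> borel_measurable lebesgue" using wm dm by measurable
  have g'm: "g' \<in> borel_measurable lebesgue" unfolding g'_def using m1 m2 by measurable
  have der: "AE x in lebesgue. ((\<lambda>t. (g (x + t *\<^sub>R ?e) - g x) / t) \<longlongrightarrow> g' x) (at_right 0)"
    using sa
  proof eventually_elim
    case (elim x)
    show ?case
    proof (cases "x \<in> \<Omega>")
      case True
      have "((\<lambda>y. v y $ i) has_derivative (\<lambda>h. (pgrad v x *v h) $ i)) (at x)"
        using pgrad_has_derivative[of v x] elim True
        by (intro bounded_linear.has_derivative[OF bounded_linear_vec_nth]) auto
      then have "((\<lambda>y. v y $ i * \<psi> y) has_derivative (\<lambda>h. v x $ i * ?d x h + (pgrad v x *v h) $ i * \<psi> x)) (at x)"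
        by (rule has_derivative_mult[OF _ d(1)])
      then have "(g has_derivative (\<lambda>h. v x $ i * ?d x h + (pgrad v x *v h) $ i * \<psi> x)) (at x)"
        by (rule has_derivative_transform_within_open[OF _ op True]) (simp add: g_def w_def)
      from directional_limit[OF this, of ?e] show ?thesis
        using True by (simp add: g'_def w_def matrix_vector_mult_basis column_def add.commute)
    next
      case False
      then have x: "x \<notin> K" using K(2) by blast
      have "open (- K)" using K(1) by (simp add: compact_imp_closed open_Compl)
      then have "(g has_derivative (\<lambda>h. 0)) (at x)"
        using x g0 by (intro has_derivative_transform_within_open[OF has_derivative_const[of 0]]) auto
      from directional_limit[OF this, of ?e] show ?thesis using False by (simp add: g'_def w_def)
    qed
  qed
  have int0: "(\<integral>x. g' x \<partial>lebesgue) = 0"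
    by (rule integral_directional_derivative_zero(2)[OF gm compact_imp_bounded[OF K(1)] g0 gB lip \<epsilon>(1) g'm der])
  have i1: "integrable lebesgue (\<lambda>x. indicator \<Omega> x * (pgrad v x $ i $ j * \<psi> x))"
  proof (rule integrable_bounded_compact_support[OF m1 K(1)])
    show "indicator \<Omega> x * (pgrad v x $ i $ j * \<psi> x) = 0" if "x \<notin> K" for x using K(3)[OF that] by simp
    show "\<bar>indicator \<Omega> x * (pgrad v x $ i $ j * \<psi> x)\<bar> \<le> 1 * (1 * B)" for x
      unfolding abs_mult using contraction_entry_le[OF pgrad_contraction, of v x i j] B
      by (intro mult_mono) (auto simp: indicator_def)
  qed
  have i2: "integrable lebesgue (\<lambda>x. w x * ?d x ?e)"
  proof (rule integrable_bounded_compact_support[OF m2 K(1)])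
    show "w x * ?d x ?e = 0" if "x \<notin> K" for x using d0[OF that] by simp
    show "\<bar>w x * ?d x ?e\<bar> \<le> \<bar>V\<bar> * Bd" for x
    proof (cases "x \<in> K")
      case True
      have "\<bar>w x\<bar> \<le> \<bar>V\<bar>" using wV[OF True] by simp
      then show ?thesis unfolding abs_mult using Bd by (intro mult_mono) auto
    qed (use d0 Bd in simp)
  qed
  have "(\<integral>x. indicator \<Omega> x * (pgrad v x $ i $ j * \<psi> x) \<partial>lebesgue) + (\<integral>x. w x * ?d x ?e \<partial>lebesgue) = 0"
    using int0 i1 i2 unfolding g'_def by simp
  moreover have "w x * ?d x ?e = indicator \<Omega> x * (v x $ i * ?d x ?e)" for x
    by (auto simp: w_def indicator_def)
  ultimately show ?thesis by (simp add: integral_lebesgue_on[OF op])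
qed

section \<open>Perturbation by tents\<close>

text \<open>Equal to the sum of 1 - |A e_j|^2 over the coordinate vectors; for a contraction it is
  nonnegative and vanishes only if \<open>A\<close> is orthogonal.\<close>

definition deficit :: "real ^ 'n ^ 'n \<Rightarrow> real"
  where "deficit A = real CARD('n) - (norm A)\<^sup>2"

text \<open>All that the limit needs from one tent: fixed frontier values, shortness, decay of the
  deficit, a bound for the mean change of gradient, and two interior points with clearly different
  new gradients. The parameter \<mu> stays free because its best size, about the square root of the
  deficit, is only fixed by the stage number.\<close>

definition perturbed_cell ::
    "(real ^ 'n \<Rightarrow> real ^ 'n) \<Rightarrow> (real ^ 'n \<Rightarrow> real ^ 'n) \<Rightarrow> (real ^ 'n) set \<Rightarrow> bool"
  where "perturbed_cell v v' C \<longleftrightarrow> compact C \<and> convex C \<and> interior C \<noteq> {} \<and>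
    (\<forall>x\<in>frontier C. v' x = v x) \<and> (\<forall>x\<in>C. \<forall>y\<in>C. norm (v' x - v' y) \<le> norm (x - y)) \<and>
    (\<exists>A. (\<forall>x\<in>C. strictly_affine_at v x \<and> pgrad v x = A \<and> (\<forall>y\<in>C. v x - v y = A *v (x - y))) \<and>
      (AE x in lebesgue. x \<in> C \<longrightarrow> strictly_affine_at v' x \<and>
        deficit (pgrad v' x) \<le> (1 - 1 / (2 * real CARD('n))) * deficit A) \<and>
      (\<forall>\<mu>>0. (\<integral>\<^sup>+x. ennreal (norm (pgrad v' x - A)) * indicator C x \<partial>lebesgue) \<le>
        ennreal (deficit A / (2 * \<mu>) + \<mu> / 2) * emeasure lebesgue C)) \<and>
    (\<exists>x\<in>interior C. \<exists>y\<in>interior C. \<exists>e. norm e = 1 \<and> strictly_affine_at v' x \<and> strictly_affine_at v' y \<and>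
      1 \<le> norm ((pgrad v' x - pgrad v' y) *v e))"

lemma pgrad_eqI:
  fixes u :: "real ^ 'n \<Rightarrow> real ^ 'm"
  assumes "r > 0" "\<gamma> < 1" "\<And>h. norm (M *v h) \<le> \<gamma> * norm h" "\<And>x. x \<in> ball y r \<Longrightarrow> u x = u y + M *v (x - y)"
  shows "strictly_affine_at u y" "pgrad u y = M"
proof -
  show s: "strictly_affine_at u y"
    unfolding strictly_affine_at_def using assms matrix_vector_mul_linear[of M] by blast
  have "(u has_derivative (*v) M) (at y)"
    by (rule has_derivative_transform_within_open[OF has_derivative_affine[OF matrix_vector_mul_linear[of M], of "u y" y y]
          open_ball centre_in_ball[THEN iffD2, OF assms(1)] assms(4)[symmetric]])
  then have "frechet_derivative u (at y) = (*v) M" by (rule frechet_derivative_at[symmetric])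
  then show "pgrad u y = M" using s by (simp add: pgrad_def matrix_of_matrix_vector_mul)
qed

lemma deficit_nonneg:
  fixes A :: "real ^ 'n ^ 'n"
  assumes "\<And>h. norm (A *v h) \<le> norm h"
  shows "0 \<le> deficit A"
proof -
  have "(norm A)\<^sup>2 \<le> (\<Sum>j\<in>(UNIV::'n set). 1\<^sup>2)"
    unfolding norm_matrix_columns using assms[of "axis _ 1"] by (intro sum_mono power_mono) auto
  then show ?thesis by (simp add: deficit_def)
qed

lemma compact_tent_base:
  fixes Cs :: "'a::euclidean_space set"
  assumes "bounded {x. \<forall>c\<in>Cs. c \<bullet> x \<le> 1}"
  shows "compact {x. \<forall>c\<in>Cs. c \<bullet> x \<le> 1}"
proof -
  have "{x. \<forall>c\<in>Cs. c \<bullet> x \<le> 1} = (\<Inter>c\<in>Cs. {x. c \<bullet> x \<le> 1})" by auto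
  then have "closed {x. \<forall>c\<in>Cs. c \<bullet> x \<le> 1}" by (simp add: closed_INT closed_halfspace_le)
  then show ?thesis using assms by (simp add: compact_eq_bounded_closed)
qed

text \<open>One tent with its base scaled by \<open>s\<close> and moved to \<open>b\<close>. Of the
  special choice of \<open>e\<close> and \<open>f\<close>, the expansion \<open>norm_slope\<close>
  retains what the variance estimate uses.\<close>

locale tent_cell =
  fixes A :: "real ^ 'n ^ 'n" and Cs :: "(real ^ 'n) set" and e f :: "real ^ 'n" and \<gamma> a s :: real
    and b :: "real ^ 'n" and v v' :: "real ^ 'n \<Rightarrow> real ^ 'n"
  assumes fin: "finite Cs" "Cs \<noteq> {}" and unit: "norm f = 1" "norm e = 1" and \<gamma>: "\<gamma> < 1"
    and bdd: "bounded {x. \<forall>c\<in>Cs. c \<bullet> x \<le> 1}"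
    and op: "\<And>c h. c \<in> insert 0 Cs \<Longrightarrow> norm (A *v h - (c \<bullet> h) *\<^sub>R f) \<le> \<gamma> * norm h"
    and def_le: "\<And>c. c \<in> Cs \<Longrightarrow> deficit (A - outer f c) \<le> (1 - 1 / (2 * real CARD('n))) * deficit A"
    and gap: "\<exists>c1\<in>Cs. \<exists>c2\<in>Cs. (c1 - c2) \<bullet> e \<ge> 5/4"
    and norm_slope: "\<And>c. (norm (A - outer f c))\<^sup>2 = (norm A)\<^sup>2 - 2 * a * (e \<bullet> c) + (norm c)\<^sup>2"
    and s: "s > 0"
    and v: "\<And>x. x \<in> cell {x. \<forall>c\<in>Cs. c \<bullet> x \<le> 1} (b, s) \<Longrightarrow> strictly_affine_at v x \<and> pgrad v x = A"
      "\<And>x y. x \<in> cell {x. \<forall>c\<in>Cs. c \<bullet> x \<le> 1} (b, s) \<Longrightarrow> y \<in> cell {x. \<forall>c\<in>Cs. c \<bullet> x \<le> 1} (b, s) \<Longrightarrow> v x - v y = A *v (x - y)"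
    and v': "\<And>x. x \<in> cell {x. \<forall>c\<in>Cs. c \<bullet> x \<le> 1} (b, s) \<Longrightarrow> v' x = v x + (s * tent Cs ((1 / s) *\<^sub>R (x - b))) *\<^sub>R f"
begin

definition P where "P = {x. \<forall>c\<in>Cs. c \<bullet> x \<le> 1}"
definition C where "C = cell P (b, s)"
definition U where "U = (\<Inter>c\<in>Cs. {y. c \<bullet> (y - b) < s})"
definition T where "T y = s * tent Cs ((1 / s) *\<^sub>R (y - b))"
definition L where "L = 1 + (\<Sum>c\<in>Cs. norm c)"

lemmas vC = v[folded P_def, folded C_def]
lemmas v'C = v'[folded P_def, folded C_def T_def]

lemma C_iff: "y \<in> C \<longleftrightarrow> (\<forall>c\<in>Cs. c \<bullet> (y - b) \<le> s)"
proof -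
  have "y \<in> C \<longleftrightarrow> (1 / s) *\<^sub>R (y - b) \<in> P"
  proof
    assume "y \<in> C"
    then obtain x where "x \<in> P" "y = s *\<^sub>R x + b" by (auto simp: C_def cell_def)
    then show "(1 / s) *\<^sub>R (y - b) \<in> P" using s by simp
  next
    assume "(1 / s) *\<^sub>R (y - b) \<in> P"
    moreover have "y = s *\<^sub>R ((1 / s) *\<^sub>R (y - b)) + b" using s by simp
    ultimately show "y \<in> C" unfolding C_def cell_def by (metis (no_types, lifting) fst_conv image_eqI snd_conv)
  qed
  also have "\<dots> \<longleftrightarrow> (\<forall>c\<in>Cs. c \<bullet> (y - b) \<le> s)" using s unfolding P_def mem_Collect_eq inner_scaleR_right by (simp add: field_simps)
  finally show ?thesis .
qed

lemma compact_P: "compact P"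
  unfolding P_def by (rule compact_tent_base[OF bdd])

lemma compact_C: "compact C" unfolding C_def by (rule compact_cell[OF compact_P])

lemma convex_C: "convex C"
proof -
  have "C = (\<Inter>c\<in>Cs. {y. c \<bullet> y \<le> s + c \<bullet> b})" using C_iff by (auto simp: inner_diff_right algebra_simps)
  then show ?thesis by (simp add: convex_INT convex_halfspace_le)
qed

lemma U: "open U" "U \<subseteq> C" "U \<subseteq> interior C"
proof -
  show o: "open U" unfolding U_def using fin by (intro open_INT ballI open_Collect_less continuous_intros) auto
  show "U \<subseteq> C" using C_iff by (auto simp: U_def intro: less_imp_le)
  then show "U \<subseteq> interior C" using o by (rule interior_maximal)
qed

lemma T_off:
  assumes "y \<notin> U"
  shows "T y = 0"
proof -
  obtain c where c: "c \<in> Cs" "c \<bullet> (y - b) \<ge> s" using assms by (auto simp: U_def not_less)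
  then have "c \<bullet> ((1 / s) *\<^sub>R (y - b)) \<ge> 1" using s unfolding inner_scaleR_right by (simp add: field_simps)
  then show ?thesis unfolding T_def using tent_eq_0[OF fin(1) c(1)] by simp
qed

lemma T_at:
  assumes "y \<in> C" "c \<in> Cs" "\<And>c'. c' \<in> Cs \<Longrightarrow> c' \<bullet> (y - b) \<le> c \<bullet> (y - b)"
  shows "T y = s - c \<bullet> (y - b)"
proof -
  have "tent Cs ((1 / s) *\<^sub>R (y - b)) = 1 - c \<bullet> ((1 / s) *\<^sub>R (y - b))"
  proof (rule tent_eq[OF fin(1) assms(2)])
    show "c' \<bullet> ((1 / s) *\<^sub>R (y - b)) \<le> c \<bullet> ((1 / s) *\<^sub>R (y - b))" if "c' \<in> Cs" for c'
      using assms(3)[OF that] s unfolding inner_scaleR_right by (intro mult_left_mono) auto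
    show "c \<bullet> ((1 / s) *\<^sub>R (y - b)) \<le> 1" using assms(1,2) C_iff[of y] s unfolding inner_scaleR_right by (simp add: field_simps)
  qed
  then show ?thesis using s unfolding T_def inner_scaleR_right by (simp add: field_simps)
qed

lemma norm_le_L: "c \<in> Cs \<Longrightarrow> norm c \<le> L - 1"
  using member_le_sum[of c Cs norm] fin(1) unfolding L_def by simp

lemma L_ge_1: "L \<ge> 1"
  using sum_nonneg[of Cs norm] unfolding L_def by simp

lemma T_lipschitz: "\<bar>T x - T y\<bar> \<le> L * norm (x - y)"
proof -
  have 1: "T x - T y \<le> L * norm (x - y)" for x y
  proof -
    let ?x = "(1 / s) *\<^sub>R (x - b)" and ?y = "(1 / s) *\<^sub>R (y - b)"
    obtain c where c: "c \<in> insert 0 Cs" "tent Cs ?x - tent Cs ?y \<le> - (c \<bullet> (?x - ?y))" by (rule tent_increment[OF fin])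
    have xy: "?x - ?y = (1 / s) *\<^sub>R (x - y)" by (simp add: algebra_simps)
    have "T x - T y = s * (tent Cs ?x - tent Cs ?y)" by (simp add: T_def algebra_simps)
    also have "\<dots> \<le> s * (- (c \<bullet> (?x - ?y)))" using c(2) s by (intro mult_left_mono) auto
    also have "\<dots> = - (c \<bullet> (x - y))" using s unfolding xy by simp
    also have "\<dots> \<le> norm c * norm (x - y)" using Cauchy_Schwarz_ineq2[of c "x - y"] by linarith
    also have "\<dots> \<le> L * norm (x - y)" using norm_le_L[of c] c(1) L_ge_1 by (intro mult_right_mono) auto
    finally show ?thesis .
  qed
  from 1[of x y] 1[of y x] show ?thesis by (simp add: norm_minus_commute abs_le_iff)
qed

lemma T_continuous: "continuous_on UNIV T"
proof -
  have "L-lipschitz_on UNIV T"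
    using T_lipschitz L_ge_1 by (intro lipschitz_onI) (auto simp: dist_norm)
  then show ?thesis by (rule lipschitz_on_continuous_on)
qed

lemma v'_short: "x \<in> C \<Longrightarrow> y \<in> C \<Longrightarrow> norm (v' x - v' y) \<le> norm (x - y)"
proof -
  assume xy: "x \<in> C" "y \<in> C"
  let ?x = "(1 / s) *\<^sub>R (x - b)" and ?y = "(1 / s) *\<^sub>R (y - b)"
  have d: "?x - ?y = (1 / s) *\<^sub>R (x - y)" by (simp add: algebra_simps)
  have "v' x - v' y = (v x - v y) + (T x - T y) *\<^sub>R f" using v'C xy by (simp add: algebra_simps)
  also have "\<dots> = A *v (x - y) + (T x - T y) *\<^sub>R f" using vC(2)[OF xy] by simp
  also have "\<dots> = s *\<^sub>R ((A *v ?x + tent Cs ?x *\<^sub>R f) - (A *v ?y + tent Cs ?y *\<^sub>R f))"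
  proof -
    have "A *v (x - y) = s *\<^sub>R (A *v ?x - A *v ?y)"
      using s unfolding matrix_vector_mult_diff_distrib[symmetric] d by (simp add: matrix_vector_mult_scaleR)
    then show ?thesis by (simp add: T_def algebra_simps)
  qed
  also have "norm \<dots> \<le> s * (\<gamma> * norm (?x - ?y))"
    using s tent_affine_lipschitz[OF fin matrix_vector_mul_linear[of A] op, of ?x ?y] by simp
  also have "\<dots> = \<gamma> * norm (x - y)" using s unfolding d by simp
  also have "\<dots> \<le> 1 * norm (x - y)" using \<gamma> by (intro mult_right_mono) auto
  finally show ?thesis by simp
qed

lemma slope:
  assumes y: "y \<in> interior C" "c \<in> Cs" "\<And>c'. c' \<in> Cs \<Longrightarrow> c' \<noteq> c \<Longrightarrow> c' \<bullet> (y - b) < c \<bullet> (y - b)"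
  shows "strictly_affine_at v' y" "pgrad v' y = A - outer f c"
proof -
  let ?N = "interior C \<inter> (\<Inter>c'\<in>Cs - {c}. {x. c' \<bullet> (x - b) < c \<bullet> (x - b)})"
  have "open ?N" using fin by (intro open_Int open_interior open_INT ballI open_Collect_less continuous_intros) auto
  moreover have "y \<in> ?N" using y by auto
  ultimately obtain r where r: "r > 0" "ball y r \<subseteq> ?N" by (meson open_contains_ball)
  have T: "T x = s - c \<bullet> (x - b)" if "x \<in> ?N" for x
  proof (rule T_at[OF _ y(2)])
    show "x \<in> C" using that interior_subset by blast
    show "c' \<bullet> (x - b) \<le> c \<bullet> (x - b)" if "c' \<in> Cs" for c'
      using \<open>x \<in> ?N\<close> that by (cases "c' = c") (auto simp: less_imp_le)
  qed
  have m: "(A - outer f c) *v h = A *v h - (c \<bullet> h) *\<^sub>R f" for h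
    by (simp add: matrix_vector_mult_diff_rdistrib outer_mult_vec)
  have b1: "norm ((A - outer f c) *v h) \<le> \<gamma> * norm h" for h unfolding m using op y(2) by blast
  have b2: "v' x = v' y + (A - outer f c) *v (x - y)" if "x \<in> ball y r" for x
  proof -
    have x: "x \<in> ?N" "x \<in> C" "y \<in> C" using that r(2) y(1) interior_subset by blast+
    have Ty: "T y = s - c \<bullet> (y - b)" using T \<open>y \<in> ?N\<close> by blast
    have "v x = v y + A *v (x - y)" using vC(2)[OF x(2,3)] by (simp add: algebra_simps)
    then show ?thesis unfolding v'C[OF x(2)] v'C[OF x(3)] T[OF x(1)] Ty m
      by (simp add: algebra_simps inner_diff_right)
  qed
  show "strictly_affine_at v' y" "pgrad v' y = A - outer f c" using pgrad_eqI[OF r(1) \<gamma> b1 b2] by auto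
qed

text \<open>Exceptional points lie on the frontier of the convex cell or on one of the finitely many
  hyperplanes where two slopes tie.\<close>

lemma AE_slope:
  "AE y in lebesgue. y \<in> C \<longrightarrow> y \<in> interior C \<and> (\<exists>c\<in>Cs. (\<forall>c'\<in>Cs. c' \<bullet> (y - b) \<le> c \<bullet> (y - b)) \<and>
     strictly_affine_at v' y \<and> pgrad v' y = A - outer f c)"
proof -
  define Z where "Z = (\<Union>c\<in>Cs. \<Union>c'\<in>Cs - {c}. {y. (c - c') \<bullet> y = (c - c') \<bullet> b}) \<union> frontier C"
  have "negligible Z" unfolding Z_def
  proof (intro negligible_Un negligible_Union)
    show "finite ((\<lambda>c. \<Union>c'\<in>Cs - {c}. {y. (c - c') \<bullet> y = (c - c') \<bullet> b}) ` Cs)" using fin(1) by simp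
    fix t assume "t \<in> (\<lambda>c. \<Union>c'\<in>Cs - {c}. {y. (c - c') \<bullet> y = (c - c') \<bullet> b}) ` Cs"
    then obtain c where t: "t = (\<Union>c'\<in>Cs - {c}. {y. (c - c') \<bullet> y = (c - c') \<bullet> b})" by (rule imageE)
    show "negligible t" unfolding t
    proof (rule negligible_Union)
      show "finite ((\<lambda>c'. {y. (c - c') \<bullet> y = (c - c') \<bullet> b}) ` (Cs - {c}))" using fin(1) by simp
      fix t assume "t \<in> (\<lambda>c'. {y. (c - c') \<bullet> y = (c - c') \<bullet> b}) ` (Cs - {c})"
      then obtain c' where t: "t = {y. (c - c') \<bullet> y = (c - c') \<bullet> b}" and c': "c' \<in> Cs - {c}" by (rule imageE)
      have "c - c' \<noteq> 0" using c' by auto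
      then show "negligible t" unfolding t by (intro negligible_hyperplane disjI1)
    qed
  qed (rule negligible_convex_frontier[OF convex_C])
  then show ?thesis
  proof (rule AE_mp[OF AE_not_in_negligible AE_I2], intro impI)
    fix y assume y: "y \<notin> Z" "y \<in> C"
    have i: "y \<in> interior C" using y closure_subset[of C] by (auto simp: Z_def frontier_def)
    obtain c where c: "c \<in> Cs" "\<And>c'. c' \<in> Cs \<Longrightarrow> c' \<bullet> (y - b) \<le> c \<bullet> (y - b)"
      by (rule tent_lower[OF fin, of "y - b"]) (rule that)
    have "c' \<bullet> (y - b) < c \<bullet> (y - b)" if c': "c' \<in> Cs" "c' \<noteq> c" for c'
    proof -
      have "(c - c') \<bullet> y \<noteq> (c - c') \<bullet> b" using y(1) c(1) c' by (auto simp: Z_def)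
      then have "c' \<bullet> (y - b) \<noteq> c \<bullet> (y - b)" by (auto simp: inner_diff_left inner_diff_right)
      then show ?thesis using c(2)[OF c'(1)] by simp
    qed
    from slope[OF i c(1) this] show "y \<in> interior C \<and> (\<exists>c\<in>Cs. (\<forall>c'\<in>Cs. c' \<bullet> (y - b) \<le> c \<bullet> (y - b)) \<and>
        strictly_affine_at v' y \<and> pgrad v' y = A - outer f c)"
      using i c by blast
  qed
qed

text \<open>The integrand is the derivative in direction \<open>e\<close> of the scaled tent
  \<open>T\<close>, which has compact support; hence the part of the norm expansion that is linear
  in the slope averages to 0.\<close>

lemma mean_slope:
  defines "g \<equiv> \<lambda>y. indicator C y * (f \<bullet> ((pgrad v' y - A) *v e))"
  shows "integrable lebesgue g" "(\<integral>y. g y \<partial>lebesgue) = 0"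
proof -
  have Toff: "T y = 0" if "y \<notin> C" for y using T_off U(2) that by blast
  obtain B where B: "B \<ge> 0" "\<And>x. \<bar>T x\<bar> \<le> B"
    by (rule bounded_compact_support[OF compact_C T_continuous Toff]) (assumption | rule that)+
  have lip: "\<bar>T (x + t *\<^sub>R e) - T x\<bar> \<le> L * t" if "0 < t" "t < 1" for x t
    using T_lipschitz[of "x + t *\<^sub>R e" x] that unit by simp
  have Cm: "C \<in> sets lebesgue" using compact_C by (simp add: lmeasurable_compact fmeasurableD)
  have gm: "g \<in> borel_measurable lebesgue"
  proof -
    have "continuous_on UNIV (\<lambda>M :: real ^ 'n ^ 'n. f \<bullet> (M *v e - A *v e))"
      by (intro continuous_intros linear_continuous_on bounded_linear_matrix_vector_left)
    then have "(\<lambda>M :: real ^ 'n ^ 'n. f \<bullet> ((M - A) *v e)) \<in> borel_measurable borel"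
      unfolding matrix_vector_mult_diff_rdistrib by (rule borel_measurable_continuous_onI)
    then have "(\<lambda>y. f \<bullet> ((pgrad v' y - A) *v e)) \<in> borel_measurable lebesgue"
      by (rule measurable_compose[OF pgrad_measurable])
    then show ?thesis unfolding g_def by (intro borel_measurable_times borel_measurable_indicator Cm)
  qed
  have der: "AE y in lebesgue. ((\<lambda>t. (T (y + t *\<^sub>R e) - T y) / t) \<longlongrightarrow> g y) (at_right 0)"
    using AE_slope
  proof eventually_elim
    case (elim y)
    show ?case
    proof (cases "y \<in> C")
      case True
      then have y: "y \<in> interior C" "strictly_affine_at v' y" using elim by blast+
      have "((\<lambda>x. f \<bullet> (v' x - v x)) has_derivative (\<lambda>h. f \<bullet> (pgrad v' y *v h - pgrad v y *v h))) (at y)"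
        using vC(1)[OF True] y(2)
        by (intro has_derivative_inner_right has_derivative_diff pgrad_has_derivative) auto
      from has_derivative_transform_within_open[OF this open_interior y(1)]
      have "(T has_derivative (\<lambda>h. f \<bullet> (pgrad v' y *v h - pgrad v y *v h))) (at y)" if "\<And>x. x \<in> interior C \<Longrightarrow> f \<bullet> (v' x - v x) = T x"
        using that by blast
      moreover have "f \<bullet> (v' x - v x) = T x" if "x \<in> interior C" for x
        using v'C[of x] that interior_subset[of C] unit(1) by (auto simp: norm_eq_1)
      ultimately have "(T has_derivative (\<lambda>h. f \<bullet> (pgrad v' y *v h - pgrad v y *v h))) (at y)"
        by blast
      from directional_limit[OF this, of e] show ?thesis
        using True vC(1)[OF True] by (simp add: g_def matrix_vector_mult_diff_rdistrib)
    next
      case False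
      have "open (- C)" using compact_C by (simp add: compact_imp_closed open_Compl)
      then have "(T has_derivative (\<lambda>h. 0)) (at y)"
        using False Toff by (intro has_derivative_transform_within_open[OF has_derivative_const[of 0]]) auto
      from directional_limit[OF this, of e] show ?thesis using False by (simp add: g_def)
    qed
  qed
  note * = integral_directional_derivative_zero[OF continuous_imp_borel_measurable_lebesgue[OF T_continuous]
      compact_imp_bounded[OF compact_C] Toff B(2) lip zero_less_one gm der]
  show "integrable lebesgue g" "(\<integral>y. g y \<partial>lebesgue) = 0" using * by auto
qed

lemma A_contraction: "norm (A *v h) \<le> norm h"
proof -
  have "norm (A *v h) \<le> \<gamma> * norm h" using op[of 0 h] by simp
  also have "\<dots> \<le> 1 * norm h" using \<gamma> by (intro mult_right_mono) auto
  finally show ?thesis by simp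
qed

text \<open>
  The term linear in \<open>c\<close> has mean zero, so after the use of \<open>2 \<mu> |c| \<le> |c|\<^sup>2 + \<mu>\<^sup>2\<close> only the deficit remains in the mean.
\<close>

lemma norm_slope_le: "norm c \<le> (deficit A + 2 * a * (e \<bullet> c)) / (2 * \<mu>) + \<mu> / 2" if "c \<in> Cs" "\<mu> > 0"
proof -
  have "norm ((A - outer f c) *v h) \<le> norm h" for h
  proof -
    have "norm ((A - outer f c) *v h) \<le> \<gamma> * norm h"
      using op[of c h] that(1) by (simp add: matrix_vector_mult_diff_rdistrib outer_mult_vec)
    also have "\<dots> \<le> 1 * norm h" using \<gamma> by (intro mult_right_mono) auto
    finally show ?thesis by simp
  qed
  then have "0 \<le> deficit (A - outer f c)" by (rule deficit_nonneg)
  then have 1: "(norm c)\<^sup>2 \<le> deficit A + 2 * a * (e \<bullet> c)" unfolding deficit_def norm_slope by simp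
  have "0 \<le> (norm c - \<mu>)\<^sup>2" by simp
  then have "2 * \<mu> * norm c \<le> (norm c)\<^sup>2 + \<mu>\<^sup>2" by (simp add: power2_eq_square algebra_simps)
  then have "2 * \<mu> * norm c \<le> deficit A + 2 * a * (e \<bullet> c) + \<mu>\<^sup>2" using 1 by simp
  then show ?thesis using that(2) by (simp add: field_simps power2_eq_square)
qed

lemma slope_change:
  assumes \<mu>: "\<mu> > 0"
  shows "(\<integral>\<^sup>+x. ennreal (norm (pgrad v' x - A)) * indicator C x \<partial>lebesgue) \<le>
        ennreal (deficit A / (2 * \<mu>) + \<mu> / 2) * emeasure lebesgue C"
proof -
  let ?K = "deficit A / (2 * \<mu>) + \<mu> / 2"
  define g where "g y = indicator C y * (f \<bullet> ((pgrad v' y - A) *v e))" for y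
  have g: "integrable lebesgue g" "(\<integral>y. g y \<partial>lebesgue) = 0" using mean_slope unfolding g_def by auto
  have Cl: "C \<in> lmeasurable" using compact_C by (rule lmeasurable_compact)
  \<comment> \<open>The pointwise bound of \<open>norm_slope_le\<close>, rewritten with
    \<open>g\<close> = -(c . e) on the cell so that its integral can be read off.\<close>
  define h where "h y = ?K * indicator C y - (a / \<mu>) * g y" for y
  have ind: "integrable lebesgue (\<lambda>y. indicator C y :: real)" "(\<integral>y. indicator C y \<partial>lebesgue) = measure lebesgue C"
    using Cl by (simp_all flip: lmeasurable_iff_integrable)
  have hi: "integrable lebesgue h" unfolding h_def using ind g by (intro Bochner_Integration.integrable_diff integrable_mult_right) auto
  have "(\<integral>y. h y \<partial>lebesgue) = ?K * measure lebesgue C"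
    unfolding h_def using ind g by simp
  have le: "AE y in lebesgue. norm (pgrad v' y - A) * indicator C y \<le> h y"
    using AE_slope
  proof eventually_elim
    case (elim y)
    show ?case
    proof (cases "y \<in> C")
      case True
      then obtain c where c: "c \<in> Cs" "pgrad v' y = A - outer f c" using elim by blast
      have d: "pgrad v' y - A = - outer f c" using c(2) by simp
      have "(- outer f c) *v e = - ((c \<bullet> e) *\<^sub>R f)"
        using matrix_vector_mult_diff_rdistrib[of 0 "outer f c" e] by (simp add: outer_mult_vec)
      then have "g y = - (c \<bullet> e)" using True unit(1) by (simp add: g_def d norm_eq_1)
      then have "h y = (deficit A + 2 * a * (e \<bullet> c)) / (2 * \<mu>) + \<mu> / 2"
        using True \<mu> by (simp add: h_def field_simps inner_commute)
      moreover have "norm (pgrad v' y - A) = norm c" using unit(1) unfolding d by (simp add: norm_outer)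
      ultimately show ?thesis using norm_slope_le[OF c(1) \<mu>] True by simp
    qed (simp add: h_def g_def)
  qed
  have "(\<integral>\<^sup>+x. ennreal (norm (pgrad v' x - A)) * indicator C x \<partial>lebesgue) \<le> (\<integral>\<^sup>+x. ennreal (h x) \<partial>lebesgue)"
    using le by (intro nn_integral_mono_AE, eventually_elim) (auto simp: indicator_def ennreal_leI split: if_splits)
  also have "\<dots> = ennreal (\<integral>y. h y \<partial>lebesgue)"
  proof (rule nn_integral_eq_integral[OF hi])
    show "AE x in lebesgue. 0 \<le> h x" using le
    proof eventually_elim
      case (elim y)
      have "0 \<le> norm (pgrad v' y - A) * indicat_real C y" by simp
      then show ?case using elim by (rule order_trans)
    qed
  qed
  also have "\<dots> = ennreal (?K * measure lebesgue C)" using \<open>(\<integral>y. h y \<partial>lebesgue) = ?K * measure lebesgue C\<close> by simp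
  also have "\<dots> = ennreal ?K * emeasure lebesgue C"
    using Cl \<mu> deficit_nonneg[OF A_contraction] by (simp add: ennreal_mult emeasure_eq_measure2 fmeasurableD2)
  finally show ?thesis .
qed

text \<open>At the point b + \<sigma> t e the active slope maximises c . (y - b), so it is maximal
  in direction \<sigma> e. Gradients are known only almost everywhere, hence the point is moved
  slightly, and the margin 1/8 pays for the move.\<close>

lemma extreme_slope:
  assumes c0: "c0 \<in> Cs" and \<sigma>: "\<sigma> = 1 \<or> \<sigma> = -1"
  obtains y c where "y \<in> interior C" "c \<in> Cs" "strictly_affine_at v' y" "pgrad v' y = A - outer f c"
    "\<sigma> * ((c - c0) \<bullet> e) \<ge> - (1/8)"
proof -
  \<comment> \<open>\<open>L\<close> is at least 1 and exceeds the norm of every slope. The step s /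
    (4 L) keeps the moved point in the cell, and moving it by less than t / (16 L) changes the
    comparison by at most t / 8.\<close>
  define t where "t = s / (4 * L)"
  have t: "t > 0" "4 * L * t = s" using s L_ge_1 by (auto simp: t_def)
  define \<eta> where "\<eta> = t / (16 * L)"
  have \<eta>: "\<eta> > 0" "16 * L * \<eta> = t" using t L_ge_1 by (auto simp: \<eta>_def)
  have "\<eta> * 1 \<le> \<eta> * (16 * L)" using \<eta>(1) L_ge_1 by (intro mult_left_mono) auto
  then have \<eta>t: "\<eta> \<le> t" using \<eta>(2) by (simp add: mult_ac)
  obtain y where y: "norm (y - (b + (\<sigma> * t) *\<^sub>R e)) < \<eta>" and P: "y \<in> C \<longrightarrow> y \<in> interior C \<and>
      (\<exists>c\<in>Cs. (\<forall>c'\<in>Cs. c' \<bullet> (y - b) \<le> c \<bullet> (y - b)) \<and> strictly_affine_at v' y \<and> pgrad v' y = A - outer f c)"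
    by (rule AE_imp_ball_witness[OF AE_slope \<eta>(1)]) (rule that)
  define \<delta> where "\<delta> = y - (b + (\<sigma> * t) *\<^sub>R e)"
  have \<delta>: "norm \<delta> < \<eta>" "y - b = (\<sigma> * t) *\<^sub>R e + \<delta>" using y by (auto simp: \<delta>_def)
  have nyb: "norm (y - b) \<le> t + \<eta>"
    unfolding \<delta>(2) using \<delta>(1) \<sigma> t(1) unit(2) by (intro order_trans[OF norm_triangle_ineq]) auto
  have "c \<bullet> (y - b) \<le> s" if "c \<in> Cs" for c
  proof -
    have "c \<bullet> (y - b) \<le> norm c * norm (y - b)" by (rule norm_cauchy_schwarz)
    also have "\<dots> \<le> L * (t + t)" using norm_le_L[OF that] nyb \<eta>t L_ge_1 by (intro mult_mono) auto
    also have "\<dots> = 4 * L * t / 2" by simp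
    also have "\<dots> \<le> s" using t(2) s by linarith
    finally show ?thesis .
  qed
  then have "y \<in> C" using C_iff by blast
  then obtain c where c: "y \<in> interior C" "c \<in> Cs" "\<forall>c'\<in>Cs. c' \<bullet> (y - b) \<le> c \<bullet> (y - b)"
      "strictly_affine_at v' y" "pgrad v' y = A - outer f c" using P by blast
  have "0 \<le> (c - c0) \<bullet> (y - b)" using c(3) c0 by (simp add: inner_diff_left)
  then have 1: "0 \<le> t * (\<sigma> * ((c - c0) \<bullet> e)) + (c - c0) \<bullet> \<delta>"
    unfolding \<delta>(2) by (simp add: inner_add_right mult_ac)
  have "(c - c0) \<bullet> \<delta> \<le> norm (c - c0) * norm \<delta>" by (rule norm_cauchy_schwarz)
  also have "\<dots> \<le> (2 * L) * \<eta>"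
    using norm_le_L[OF c(2)] norm_le_L[OF c0] norm_triangle_ineq4[of c c0] \<delta>(1) L_ge_1 by (intro mult_mono) auto
  also have "\<dots> = t * (1/8)" using \<eta>(2) by simp
  finally have "t * (- (1/8)) \<le> t * (\<sigma> * ((c - c0) \<bullet> e))" using 1 by simp
  then have "\<sigma> * ((c - c0) \<bullet> e) \<ge> - (1/8)" by (rule mult_left_le_imp_le[OF _ t(1)])
  then show ?thesis using that c by blast
qed

lemma perturbed: "perturbed_cell v v' C"
proof -
  have fr: "v' x = v x" if "x \<in> frontier C" for x
  proof -
    have x: "x \<in> C" "x \<notin> interior C"
      using that frontier_subset_closed[OF compact_imp_closed[OF compact_C]] by (auto simp: frontier_def)
    then show ?thesis using v'C[OF x(1)] T_off[of x] U(3) by auto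
  qed
  have "b \<in> U" using s by (simp add: U_def)
  then have ne: "interior C \<noteq> {}" using U(3) by blast
  have sa: "AE x in lebesgue. x \<in> C \<longrightarrow> strictly_affine_at v' x \<and>
        deficit (pgrad v' x) \<le> (1 - 1 / (2 * real CARD('n))) * deficit A"
    using AE_slope by eventually_elim (use def_le in auto)
  \<comment> \<open>The slopes found below are at most 1/8 worse in direction \<open>e\<close> than
    \<open>c1\<close> and \<open>c2\<close>, so their gap is at least 5/4 - 1/8 - 1/8 = 1.\<close>
  obtain c1 c2 where c12: "c1 \<in> Cs" "c2 \<in> Cs" "(c1 - c2) \<bullet> e \<ge> 5/4" using gap by blast
  obtain x c where x: "x \<in> interior C" "c \<in> Cs" "strictly_affine_at v' x" "pgrad v' x = A - outer f c"
    "1 * ((c - c1) \<bullet> e) \<ge> - (1/8)" by (rule extreme_slope[OF c12(1)]) (rule disjI1 refl | assumption)+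
  obtain y d where y: "y \<in> interior C" "d \<in> Cs" "strictly_affine_at v' y" "pgrad v' y = A - outer f d"
    "- 1 * ((d - c2) \<bullet> e) \<ge> - (1/8)" by (rule extreme_slope[OF c12(2)]) (rule disjI2 refl | assumption)+
  have "(pgrad v' x - pgrad v' y) *v e = ((d - c) \<bullet> e) *\<^sub>R f"
    unfolding x(4) y(4) by (simp add: matrix_vector_mult_diff_rdistrib outer_mult_vec inner_diff_left scaleR_diff_left)
  moreover have "(c - d) \<bullet> e \<ge> 1" using x(5) y(5) c12(3) by (simp add: inner_diff_left)
  ultimately have "1 \<le> norm ((pgrad v' x - pgrad v' y) *v e)" using unit(1) by (simp add: inner_diff_left)
  then have "\<exists>x\<in>interior C. \<exists>y\<in>interior C. \<exists>e. norm e = 1 \<and> strictly_affine_at v' x \<and> strictly_affine_at v' y \<and>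
      1 \<le> norm ((pgrad v' x - pgrad v' y) *v e)" using x y unit(2) by blast
  moreover have "\<forall>x\<in>C. strictly_affine_at v x \<and> pgrad v x = A \<and> (\<forall>y\<in>C. v x - v y = A *v (x - y))"
    using vC by blast
  ultimately show ?thesis
    unfolding perturbed_cell_def using compact_C convex_C ne fr v'_short sa slope_change by blast
qed

end

text \<open>The new map is prescribed by \<open>w\<close> on the cells only, and the conclusion
  covers every \<open>v'\<close> that agrees with \<open>w\<close> on a cell; cells from many balls
  can therefore be glued into one map.\<close>

lemma perturbed_ball:
  fixes v :: "real ^ 'n \<Rightarrow> real ^ 'n"
  assumes r: "r > 0" and \<gamma>: "\<gamma> < 1" "\<And>h. norm (A *v h) \<le> \<gamma> * norm h"
    and v: "\<And>x. x \<in> ball x0 r \<Longrightarrow> strictly_affine_at v x \<and> pgrad v x = A"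
      "\<And>x y. x \<in> ball x0 r \<Longrightarrow> y \<in> ball x0 r \<Longrightarrow> v x - v y = A *v (x - y)"
  obtains \<C> w where "countable \<C>" "\<And>C. C \<in> \<C> \<Longrightarrow> C \<subseteq> ball x0 r"
    "\<And>C D. C \<in> \<C> \<Longrightarrow> D \<in> \<C> \<Longrightarrow> C \<noteq> D \<Longrightarrow> C \<inter> D = {}" "negligible (ball x0 r - \<Union>\<C>)"
    "\<forall>C\<in>\<C>. \<forall>v'. (\<forall>x\<in>C. v' x = w x) \<longrightarrow> perturbed_cell v v' C"
proof -
  obtain Cs f e \<gamma>' a where Cs: "finite Cs" "Cs \<noteq> {}" "norm f = 1" "norm e = 1" "\<gamma>' < 1"
    "bounded {x. \<forall>c\<in>Cs. c \<bullet> x \<le> 1}"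
    "\<And>c h. c \<in> insert 0 Cs \<Longrightarrow> norm (A *v h - (c \<bullet> h) *\<^sub>R f) \<le> \<gamma>' * norm h"
    "\<And>c. c \<in> Cs \<Longrightarrow> real CARD('n) - (norm (A - outer f c))\<^sup>2 \<le> (1 - 1 / (2 * real CARD('n))) * (real CARD('n) - (norm A)\<^sup>2)"
    "\<exists>c1\<in>Cs. \<exists>c2\<in>Cs. (c1 - c2) \<bullet> e \<ge> 5/4"
    "\<And>c. (norm (A - outer f c))\<^sup>2 = (norm A)\<^sup>2 - 2 * a * (e \<bullet> c) + (norm c)\<^sup>2"
    by (rule tent_directions[OF \<gamma>]) (rule that)
  define P where "P = {x. \<forall>c\<in>Cs. c \<bullet> x \<le> 1}"
  have P: "compact P" unfolding P_def by (rule compact_tent_base[OF Cs(6)])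
  have "measure lebesgue P > 0"
  proof -
    \<comment> \<open>A small ball around 0 satisfies all constraints, so the base has positive
      measure, as the packing requires.\<close>
    define L where "L = 1 + sum norm Cs"
    have L: "L \<ge> 1" using sum_nonneg[of Cs norm] unfolding L_def by simp
    have "ball 0 (1 / L) \<subseteq> P" unfolding P_def
    proof clarify
      fix x c :: "real ^ 'n" assume x: "x \<in> ball 0 (1 / L)" and c: "c \<in> Cs"
      have "norm c \<le> L" using member_le_sum[of c Cs norm] Cs(1) c unfolding L_def by simp
      then have "norm c * norm x \<le> L * (1 / L)" using x L by (intro mult_mono) auto
      then show "c \<bullet> x \<le> 1" using norm_cauchy_schwarz[of c x] L by simp
    qed
    then have "ball 0 (1 / L) \<subseteq> interior P" by (intro interior_maximal open_ball)
    then have "ball 0 (1 / L) \<subseteq> P" using interior_subset by blast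
    moreover have "\<not> negligible (ball (0 :: real ^ 'n) (1 / L))" using L by (intro open_not_negligible) auto
    ultimately have "\<not> negligible P" using negligible_subset by blast
    then have "measure lebesgue P \<noteq> 0" using lmeasurable_compact[OF P] by (simp add: negligible_iff_measure)
    then show ?thesis using measure_nonneg[of lebesgue P] by linarith
  qed
  then obtain D where D: "countable D" "\<And>b s. (b, s) \<in> D \<Longrightarrow> 0 < s \<and> s < 1 \<and> cell P (b, s) \<subseteq> ball x0 r"
    "\<And>p q. p \<in> D \<Longrightarrow> q \<in> D \<Longrightarrow> p \<noteq> q \<Longrightarrow> cell P p \<inter> cell P q = {}"
    "negligible (ball x0 r - (\<Union>p\<in>D. cell P p))"
    by (rule cell_packing[OF open_ball bounded_ball P _ zero_less_one, of x0 r]) (assumption | rule that)+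
  define q where "q x = (SOME p. p \<in> D \<and> x \<in> cell P p)" for x
  have q: "q x = p" if "p \<in> D" "x \<in> cell P p" for p x
    unfolding q_def using that D(3) by (intro some_equality) blast+
  define w where "w x = v x + (snd (q x) * tent Cs ((1 / snd (q x)) *\<^sub>R (x - fst (q x)))) *\<^sub>R f" for x
  show ?thesis
  proof (rule that[of "cell P ` D" w])
    show "countable (cell P ` D)" using D(1) by simp
    show "C \<subseteq> ball x0 r" if C: "C \<in> cell P ` D" for C
    proof -
      obtain p where p: "C = cell P p" "p \<in> D" using C by (rule imageE)
      obtain b s where bs: "p = (b, s)" by (rule prod.exhaust)
      show ?thesis using D(2)[of b s] p unfolding bs by blast
    qed
    show "C \<inter> C' = {}" if "C \<in> cell P ` D" "C' \<in> cell P ` D" "C \<noteq> C'" for C C' using that D(3) by blast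
    show "negligible (ball x0 r - \<Union> (cell P ` D))" by (rule D(4))
    show "\<forall>C\<in>cell P ` D. \<forall>v'. (\<forall>x\<in>C. v' x = w x) \<longrightarrow> perturbed_cell v v' C"
    proof (intro ballI allI impI)
      fix C v' assume "C \<in> cell P ` D" and v': "\<forall>x\<in>C. v' x = w x"
      then obtain b s where p: "(b, s) \<in> D" "C = cell P (b, s)" by auto
      have sub: "cell P (b, s) \<subseteq> ball x0 r" using D(2)[OF p(1)] by blast
      interpret tc: tent_cell A Cs e f \<gamma>' a s b v v'
      proof (unfold_locales, fold P_def deficit_def)
        show "finite Cs" "Cs \<noteq> {}" "norm f = 1" "norm e = 1" "\<gamma>' < 1" by (rule Cs)+
        show "bounded P" unfolding P_def by (rule Cs(6))
        show "norm (A *v h - (c \<bullet> h) *\<^sub>R f) \<le> \<gamma>' * norm h" if "c \<in> insert 0 Cs" for c h by (rule Cs(7)[OF that])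
        show "deficit (A - outer f c) \<le> (1 - 1 / (2 * real CARD('n))) * deficit A" if "c \<in> Cs" for c
          unfolding deficit_def by (rule Cs(8)[OF that])
        show "\<exists>c1\<in>Cs. \<exists>c2\<in>Cs. 5 / 4 \<le> (c1 - c2) \<bullet> e" by (rule Cs(9))
        show "(norm (A - outer f c))\<^sup>2 = (norm A)\<^sup>2 - 2 * a * (e \<bullet> c) + (norm c)\<^sup>2" for c by (rule Cs(10))
        show "0 < s" using D(2)[OF p(1)] by blast
        show "strictly_affine_at v x \<and> pgrad v x = A" if "x \<in> cell P (b, s)" for x using v(1) sub that by blast
        show "v x - v y = A *v (x - y)" if "x \<in> cell P (b, s)" "y \<in> cell P (b, s)" for x y using v(2) sub that by blast
        show "v' x = v x + (s * tent Cs ((1 / s) *\<^sub>R (x - b))) *\<^sub>R f" if "x \<in> cell P (b, s)" for x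
          using v'[unfolded p(2), rule_format, OF that] q[OF p(1) that] by (simp add: w_def)
      qed
      show "perturbed_cell v v' C" using tc.perturbed unfolding p(2) P_def tc.P_def tc.C_def .
    qed
  qed
qed

text \<open>The diameter bound \<sigma> / 2 times \<open>bdist\<close> turns into a bound \<sigma>
  times \<open>bdist\<close> for v' - v, because both maps are short on a cell and agree on its
  frontier.\<close>

definition tent_stage where
  "tent_stage \<Omega> \<sigma> v v' \<C> \<longleftrightarrow> countable \<C> \<and> (\<forall>C\<in>\<C>. \<forall>D\<in>\<C>. C \<noteq> D \<longrightarrow> C \<inter> D = {}) \<and> negligible (\<Omega> - \<Union>\<C>) \<and>
    (\<forall>C\<in>\<C>. C \<subseteq> \<Omega> \<and> perturbed_cell v v' C \<and> (\<forall>x\<in>C. \<forall>y\<in>C. norm (x - y) \<le> \<sigma> / 2 * bdist \<Omega> x)) \<and>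
    (\<forall>x. x \<notin> \<Union>\<C> \<longrightarrow> v' x = v x)"

text \<open>The open set \<open>G\<close> of full measure confines the cells. In the iteration it is
  the union of the interiors of the previous cells, which makes the generations nested.\<close>

lemma tent_stage_exists:
  fixes v :: "real ^ 'n \<Rightarrow> real ^ 'n"
  assumes op: "open \<Omega>" "open G" and G: "G \<subseteq> \<Omega>" "negligible (\<Omega> - G)"
    and sa: "AE x in lebesgue. x \<in> \<Omega> \<longrightarrow> strictly_affine_at v x" and \<sigma>: "0 < \<sigma>" "\<sigma> \<le> 1"
  obtains v' \<C> where "tent_stage \<Omega> \<sigma> v v' \<C>" "\<And>C. C \<in> \<C> \<Longrightarrow> C \<subseteq> G"
proof -
  define H where "H = G \<inter> {x. strictly_affine_at v x}"
  have oH: "open H" unfolding H_def by (intro open_Int op open_strictly_affine)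
  have nH: "negligible (\<Omega> - H)"
  proof -
    obtain N where N: "negligible N" "{x. \<not> (x \<in> \<Omega> \<longrightarrow> strictly_affine_at v x)} \<subseteq> N"
      using sa by (auto simp: eventually_ae_filter_negligible)
    have "\<Omega> - H \<subseteq> (\<Omega> - G) \<union> N" using N(2) by (auto simp: H_def)
    then show ?thesis using negligible_Un[OF G(2) N(1)] negligible_subset by blast
  qed
  define good where "good x r \<longleftrightarrow> (\<forall>y\<in>ball x r. strictly_affine_at v y \<and> pgrad v y = pgrad v x) \<and>
      (\<forall>y\<in>ball x r. v y = v x + pgrad v x *v (y - x))" for x r
  have "\<exists>r. r > 0 \<and> good x r" if "x \<in> H" for x
  proof -
    have "strictly_affine_at v x" using that by (simp add: H_def)
    then obtain r c where "r > 0" "\<And>y. y \<in> ball x r \<Longrightarrow> v y = v x + pgrad v x *v (y - x)"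
      "\<And>y. y \<in> ball x r \<Longrightarrow> strictly_affine_at v y \<and> pgrad v y = pgrad v x"
      by (rule strictly_affine_at_pgrad) (assumption | rule that)+
    then show ?thesis unfolding good_def by blast
  qed
  then obtain \<rho> where \<rho>: "\<And>x. x \<in> H \<Longrightarrow> \<rho> x > 0 \<and> good x (\<rho> x)" by metis
  \<comment> \<open>The factor 1/8 leaves room for the variation of \<open>bdist\<close> over a
    ball, when twice its radius is compared with \<sigma> / 2 times \<open>bdist\<close> at an
    arbitrary point of a cell.\<close>
  define \<rho>' where "\<rho>' x = min (\<rho> x) (\<sigma> * bdist \<Omega> x / 8)" for x
  have \<rho>': "\<rho>' x > 0" if "x \<in> H" for x
    using \<rho>[OF that] bdist_pos[OF op(1), of x] \<sigma> that G(1) unfolding \<rho>'_def H_def by auto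
  obtain B where B: "countable B" "\<And>a r. (a, r) \<in> B \<Longrightarrow> 0 < r \<and> r < \<rho>' a \<and> a \<in> H \<and> cball a r \<subseteq> H"
    "\<And>p q. p \<in> B \<Longrightarrow> q \<in> B \<Longrightarrow> p \<noteq> q \<Longrightarrow> cball (fst p) (snd p) \<inter> cball (fst q) (snd q) = {}"
    "negligible (H - (\<Union>p\<in>B. cball (fst p) (snd p)))"
    by (rule open_ball_packing[OF oH \<rho>']) (assumption | rule that)+
  have Bp: "0 < snd p" "snd p < \<rho>' (fst p)" "fst p \<in> H" "cball (fst p) (snd p) \<subseteq> H" if "p \<in> B" for p
    using B(2)[of "fst p" "snd p"] that by auto
  define Q where "Q p \<C> w \<longleftrightarrow> countable \<C> \<and> (\<forall>C\<in>\<C>. C \<subseteq> ball (fst p) (snd p)) \<and>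
    (\<forall>C\<in>\<C>. \<forall>D\<in>\<C>. C \<noteq> D \<longrightarrow> C \<inter> D = {}) \<and> negligible (ball (fst p) (snd p) - \<Union>\<C>) \<and>
    (\<forall>C\<in>\<C>. \<forall>v'. (\<forall>x\<in>C. v' x = w x) \<longrightarrow> perturbed_cell v v' C)"
    for p :: "(real ^ 'n) \<times> real" and \<C> and w :: "real ^ 'n \<Rightarrow> real ^ 'n"
  have "\<exists>\<C> w. Q p \<C> w" if p: "p \<in> B" for p
  proof -
    let ?x = "fst p" and ?r = "snd p"
    have gx: "good ?x (\<rho> ?x)" using \<rho>[OF Bp(3)[OF p]] by blast
    have sub: "ball ?x ?r \<subseteq> ball ?x (\<rho> ?x)" using Bp(2)[OF p] by (auto simp: \<rho>'_def)
    have "strictly_affine_at v ?x" using Bp(3)[OF p] by (simp add: H_def)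
    then obtain r :: real and c where c: "c < 1" "\<And>h. norm (pgrad v ?x *v h) \<le> c * norm h"
      by (rule strictly_affine_at_pgrad) (assumption | rule that)+
    have 1: "strictly_affine_at v y \<and> pgrad v y = pgrad v ?x" if "y \<in> ball ?x ?r" for y
      using gx sub that unfolding good_def by blast
    have 2: "v y - v z = pgrad v ?x *v (y - z)" if "y \<in> ball ?x ?r" "z \<in> ball ?x ?r" for y z
    proof -
      have "v y = v ?x + pgrad v ?x *v (y - ?x)" "v z = v ?x + pgrad v ?x *v (z - ?x)"
        using gx sub that unfolding good_def by blast+
      then show ?thesis by (simp add: matrix_vector_mult_diff_distrib)
    qed
    obtain \<C> w where w: "countable \<C>" "\<And>C. C \<in> \<C> \<Longrightarrow> C \<subseteq> ball ?x ?r"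
      "\<And>C D. C \<in> \<C> \<Longrightarrow> D \<in> \<C> \<Longrightarrow> C \<noteq> D \<Longrightarrow> C \<inter> D = {}" "negligible (ball ?x ?r - \<Union>\<C>)"
      "\<forall>C\<in>\<C>. \<forall>v'. (\<forall>x\<in>C. v' x = w x) \<longrightarrow> perturbed_cell v v' C"
      by (rule perturbed_ball[OF Bp(1)[OF p] c 1 2]) (assumption | rule that)+
    have "Q p \<C> w" unfolding Q_def by (intro conjI ballI impI w(1,4,5)) (rule w(2,3); assumption)+
    then show ?thesis by blast
  qed
  then have "\<forall>p. \<exists>\<C> w. p \<in> B \<longrightarrow> Q p \<C> w" by blast
  then obtain \<C> w where Q: "\<And>p. p \<in> B \<Longrightarrow> Q p (\<C> p) (w p)" by metis
  define \<D> where "\<D> = (\<Union>p\<in>B. \<C> p)"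
  have in_ball: "x \<in> cball (fst p) (snd p)" if "p \<in> B" "C \<in> \<C> p" "x \<in> C" for p C x
  proof -
    have "\<forall>C\<in>\<C> p. C \<subseteq> ball (fst p) (snd p)" using Q[OF that(1)] unfolding Q_def by (elim conjE)
    then have "x \<in> ball (fst p) (snd p)" using that(2,3) by blast
    then show ?thesis by simp
  qed
  have same: "p = q" if "p \<in> B" "q \<in> B" "C \<in> \<C> p" "D \<in> \<C> q" "x \<in> C" "x \<in> D" for p q C D x
  proof (rule ccontr)
    assume "p \<noteq> q"
    have "x \<in> cball (fst p) (snd p)" "x \<in> cball (fst q) (snd q)"
      using in_ball[OF that(1,3,5)] in_ball[OF that(2,4,6)] .
    then show False using B(3)[OF that(1,2) \<open>p \<noteq> q\<close>] by blast
  qed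
  define v' where "v' x = (if x \<in> \<Union>\<D> then w (SOME p. p \<in> B \<and> x \<in> \<Union>(\<C> p)) x else v x)" for x
  have v': "v' x = w p x" if "p \<in> B" "C \<in> \<C> p" "x \<in> C" for p C x
  proof -
    have "(SOME p. p \<in> B \<and> x \<in> \<Union>(\<C> p)) = p" using that same by (intro some_equality) blast+
    then show ?thesis using that unfolding v'_def \<D>_def by auto
  qed
  have neg: "negligible (\<Omega> - \<Union>\<D>)"
  proof -
    have 1: "negligible (\<Union>p\<in>B. sphere (fst p) (snd p))"
      using B(1) by (intro negligible_countable_Union) (auto intro: negligible_sphere)
    have "negligible (ball (fst p) (snd p) - \<Union>(\<C> p))" if "p \<in> B" for p
      using Q[OF that] unfolding Q_def by (elim conjE)
    then have 2: "negligible (\<Union>p\<in>B. ball (fst p) (snd p) - \<Union>(\<C> p))"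
      using B(1) by (intro negligible_countable_Union) auto
    have "\<Omega> - \<Union>\<D> \<subseteq> (\<Omega> - H) \<union> (H - (\<Union>p\<in>B. cball (fst p) (snd p))) \<union>
        (\<Union>p\<in>B. sphere (fst p) (snd p)) \<union> (\<Union>p\<in>B. ball (fst p) (snd p) - \<Union>(\<C> p))" (is "_ \<subseteq> ?R")
    proof
      fix x assume x: "x \<in> \<Omega> - \<Union>\<D>"
      show "x \<in> ?R"
      proof (cases "\<exists>p\<in>B. x \<in> cball (fst p) (snd p)")
        case True
        then obtain p where p: "p \<in> B" "x \<in> cball (fst p) (snd p)" by blast
        have "x \<notin> \<Union>(\<C> p)" using x p(1) unfolding \<D>_def by blast
        moreover have "x \<in> ball (fst p) (snd p) \<or> x \<in> sphere (fst p) (snd p)" using p(2) by (auto simp: less_le)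
        ultimately show ?thesis using p(1) by blast
      qed (use x in blast)
    qed
    then show ?thesis by (rule negligible_subset[rotated]) (intro negligible_Un nH B(4) 1 2)
  qed
  show ?thesis
  proof (rule that[of v' \<D>])
    have inH: "C \<subseteq> H" if CD: "C \<in> \<D>" for C
    proof
      fix x assume x: "x \<in> C"
      obtain p where p: "p \<in> B" "C \<in> \<C> p" using CD unfolding \<D>_def by (rule UN_E)
      show "x \<in> H" using in_ball[OF p x] Bp(4)[OF p(1)] by (rule subsetD[rotated])
    qed
    show "C \<subseteq> G" if "C \<in> \<D>" for C using inH[OF that] unfolding H_def by simp
    show "tent_stage \<Omega> \<sigma> v v' \<D>"
      unfolding tent_stage_def
    proof (intro conjI ballI allI impI neg)
      show "countable \<D>" unfolding \<D>_def
      proof (rule countable_UN[OF B(1)])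
        show "countable (\<C> p)" if "p \<in> B" for p using Q[OF that] unfolding Q_def by (elim conjE)
      qed
      show "C \<inter> D = {}" if CD: "C \<in> \<D>" "D \<in> \<D>" "C \<noteq> D" for C D
      proof -
        obtain p where pq1: "p \<in> B" "C \<in> \<C> p" using CD(1) unfolding \<D>_def by (rule UN_E)
        obtain q where pq2: "q \<in> B" "D \<in> \<C> q" using CD(2) unfolding \<D>_def by (rule UN_E)
        note pq = pq1 pq2
        show ?thesis
        proof (cases "p = q")
          case True
          have "\<forall>C\<in>\<C> p. \<forall>D\<in>\<C> p. C \<noteq> D \<longrightarrow> C \<inter> D = {}" using Q[OF pq(1)] unfolding Q_def by (elim conjE)
          then show ?thesis using pq CD(3) True by simp
        next
          case False
          show ?thesis
          proof (rule equals0I)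
            fix x assume "x \<in> C \<inter> D"
            then show False using same[OF pq(1,3,2,4), of x] False by simp
          qed
        qed
      qed
      show "v' x = v x" if "x \<notin> \<Union>\<D>" for x using that by (simp add: v'_def)
      fix C assume C: "C \<in> \<D>"
      then obtain p where p: "p \<in> B" "C \<in> \<C> p" unfolding \<D>_def by blast
      show "C \<subseteq> \<Omega>" using inH[OF C] G(1) unfolding H_def by blast
      show "perturbed_cell v v' C"
      proof -
        have "\<forall>C\<in>\<C> p. \<forall>v'. (\<forall>x\<in>C. v' x = w p x) \<longrightarrow> perturbed_cell v v' C" using Q[OF p(1)] unfolding Q_def by (elim conjE)
        then show ?thesis using p(2) v'[OF p] by blast
      qed
      fix x y assume "x \<in> C" "y \<in> C"
      then have xy: "norm (x - fst p) \<le> snd p" "norm (y - fst p) \<le> snd p"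
        using in_ball[OF p, of x] in_ball[OF p, of y] by (auto simp: dist_norm norm_minus_commute)
      have "norm (x - y) \<le> norm (x - fst p) + norm (y - fst p)"
        using norm_triangle_ineq4[of "x - fst p" "y - fst p"] by simp
      then have 1: "norm (x - y) \<le> 2 * snd p" using xy by simp
      have 2: "8 * snd p \<le> \<sigma> * bdist \<Omega> (fst p)" using Bp(2)[OF p(1)] by (simp add: \<rho>'_def)
      have "\<sigma> * bdist \<Omega> (fst p) \<le> \<sigma> * (bdist \<Omega> x + snd p)"
        using bdist_lipschitz[of \<Omega> x "fst p"] xy(1) \<sigma>(1) by (intro mult_left_mono) auto
      also have "\<dots> \<le> \<sigma> * bdist \<Omega> x + 1 * snd p"
        unfolding distrib_left using \<sigma>(2) Bp(1)[OF p(1)] by (intro add_left_mono mult_right_mono) auto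
      finally have "norm (x - y) \<le> (\<sigma> * bdist \<Omega> x) / 2" using 1 2 Bp(1)[OF p(1)] by linarith
      then show "norm (x - y) \<le> \<sigma> / 2 * bdist \<Omega> x" by simp
    qed
  qed
qed

section \<open>Consequences of one stage\<close>

lemma perturbed_cellD:
  assumes "perturbed_cell v v' C"
  shows "compact C" "convex C" "interior C \<noteq> {}" "\<And>x. x \<in> frontier C \<Longrightarrow> v' x = v x"
    "\<And>x y. x \<in> C \<Longrightarrow> y \<in> C \<Longrightarrow> norm (v' x - v' y) \<le> norm (x - y)"
    "\<And>x y. x \<in> C \<Longrightarrow> y \<in> C \<Longrightarrow> norm (v x - v y) \<le> norm (x - y)"
proof -
  show "compact C" "convex C" "interior C \<noteq> {}" "\<And>x. x \<in> frontier C \<Longrightarrow> v' x = v x"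
    "\<And>x y. x \<in> C \<Longrightarrow> y \<in> C \<Longrightarrow> norm (v' x - v' y) \<le> norm (x - y)"
    using assms by (simp_all add: perturbed_cell_def)
  obtain A where "\<forall>x\<in>C. strictly_affine_at v x \<and> pgrad v x = A \<and> (\<forall>y\<in>C. v x - v y = A *v (x - y))"
    using assms unfolding perturbed_cell_def by (elim conjE exE) (rule that)
  then show "norm (v x - v y) \<le> norm (x - y)" if "x \<in> C" "y \<in> C" for x y
    using that pgrad_contraction[of v x "x - y"] by simp
qed

lemma tent_stageD:
  assumes "tent_stage \<Omega> \<sigma> v v' \<C>"
  shows "countable \<C>" "\<And>C D. C \<in> \<C> \<Longrightarrow> D \<in> \<C> \<Longrightarrow> C \<noteq> D \<Longrightarrow> C \<inter> D = {}" "negligible (\<Omega> - \<Union>\<C>)"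
    "\<And>C. C \<in> \<C> \<Longrightarrow> C \<subseteq> \<Omega>" "\<And>C. C \<in> \<C> \<Longrightarrow> perturbed_cell v v' C"
    "\<And>C x y. C \<in> \<C> \<Longrightarrow> x \<in> C \<Longrightarrow> y \<in> C \<Longrightarrow> norm (x - y) \<le> \<sigma> / 2 * bdist \<Omega> x"
    "\<And>x. x \<notin> \<Union>\<C> \<Longrightarrow> v' x = v x"
  using assms by (simp_all add: tent_stage_def)

lemma tent_stage_short:
  assumes "tent_stage \<Omega> \<sigma> v v' \<C>" "short_on \<Omega> v"
  shows "short_on \<Omega> v'"
proof (rule short_on_glue[OF assms(2)])
  fix C assume "C \<in> \<C>"
  note P = perturbed_cellD[OF tent_stageD(5)[OF assms(1) this]]
  show "closed C" using P(1) by (rule compact_imp_closed)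
  show "norm (v' x - v' y) \<le> norm (x - y)" if "x \<in> C" "y \<in> C" for x y using P(5) that .
  show "v' x = v x" if "x \<in> frontier C" for x using P(4) that .
next
  show "C \<inter> D = {}" if "C \<in> \<C>" "D \<in> \<C>" "C \<noteq> D" for C D by (rule tent_stageD(2)[OF assms(1) that])
  show "v' x = v x" if "x \<notin> \<Union>\<C>" for x by (rule tent_stageD(7)[OF assms(1) that])
qed

lemma tent_stage_close:
  assumes st: "tent_stage \<Omega> \<sigma> v v' \<C>" and \<sigma>: "\<sigma> \<ge> 0"
  shows "norm (v' x - v x) \<le> \<sigma> * bdist \<Omega> x"
proof (cases "x \<in> \<Union>\<C>")
  case True
  then obtain C where C: "C \<in> \<C>" "x \<in> C" by blast
  note P = perturbed_cellD[OF tent_stageD(5)[OF st C(1)]]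
  have "C \<noteq> UNIV" using compact_imp_bounded[OF P(1)] not_bounded_UNIV by auto
  then obtain y where "y \<notin> C" by blast
  obtain z where z: "z \<in> C" "z \<in> frontier C"
    by (rule segment_exit_point[OF compact_imp_closed[OF P(1)] C(2) \<open>y \<notin> C\<close>]) (rule that)
  have "norm (v' x - v x) \<le> norm (v' x - v' z) + norm (v z - v x)"
    using P(4)[OF z(2)] norm_triangle_ineq[of "v' x - v' z" "v z - v x"] by simp
  also have "\<dots> \<le> norm (x - z) + norm (z - x)" using P(5,6) C(2) z(1) by (intro add_mono) auto
  also have "\<dots> \<le> \<sigma> * bdist \<Omega> x" using tent_stageD(6)[OF st C z(1)] by (simp add: norm_minus_commute)
  finally show ?thesis .
next
  case False
  then show ?thesis using tent_stageD(7)[OF st False] mult_nonneg_nonneg[OF \<sigma> bdist_nonneg[of \<Omega> x]] by simp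
qed

lemma tent_stage_AE:
  fixes v v' :: "real ^ 'n \<Rightarrow> real ^ 'n"
  assumes st: "tent_stage \<Omega> \<sigma> v v' \<C>"
  shows "AE x in lebesgue. x \<in> \<Omega> \<longrightarrow> strictly_affine_at v' x \<and>
    deficit (pgrad v' x) \<le> (1 - 1 / (2 * real CARD('n))) * deficit (pgrad v x)"
proof -
  let ?Q = "\<lambda>x. strictly_affine_at v' x \<and>
    deficit (pgrad v' x) \<le> (1 - 1 / (2 * real CARD('n))) * deficit (pgrad v x)"
  have "AE x in lebesgue. x \<in> C \<longrightarrow> ?Q x" if C: "C \<in> \<C>" for C
  proof -
    obtain A where A: "\<forall>x\<in>C. strictly_affine_at v x \<and> pgrad v x = A \<and> (\<forall>y\<in>C. v x - v y = A *v (x - y))"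
      "AE x in lebesgue. x \<in> C \<longrightarrow> strictly_affine_at v' x \<and>
        deficit (pgrad v' x) \<le> (1 - 1 / (2 * real CARD('n))) * deficit A"
      using tent_stageD(5)[OF st C] unfolding perturbed_cell_def by blast
    from A(2) show ?thesis by eventually_elim (use A(1) in auto)
  qed
  then have "AE x in lebesgue. \<forall>C\<in>\<C>. x \<in> C \<longrightarrow> ?Q x"
    by (intro AE_ball_countable[OF tent_stageD(1)[OF st], THEN iffD2] ballI)
  moreover have "AE x in lebesgue. x \<notin> \<Omega> - \<Union>\<C>" by (rule AE_not_in_negligible[OF tent_stageD(3)[OF st]])
  ultimately show ?thesis by eventually_elim blast
qed

text \<open>Cells meeting the ball of radius \<open>m\<close> have diameter at most 1, so the cell
  estimates sum up to the volume of the ball of radius m + 1.\<close>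

lemma tent_stage_slope_change:
  fixes v v' :: "real ^ 'n \<Rightarrow> real ^ 'n"
  assumes st: "tent_stage \<Omega> \<sigma> v v' \<C>" and \<sigma>: "\<sigma> \<ge> 0" "\<sigma> \<le> 1"
    and d: "AE x in lebesgue. x \<in> \<Omega> \<longrightarrow> deficit (pgrad v x) \<le> d" and \<mu>: "\<mu> > 0"
  shows "(\<integral>\<^sup>+x. ennreal (norm (pgrad v' x - pgrad v x)) * indicator (\<Omega> \<inter> ball 0 m) x \<partial>lebesgue)
    \<le> ennreal (d / (2 * \<mu>) + \<mu> / 2) * emeasure lebesgue (ball (0 :: real ^ 'n) (m + 1))"
proof -
  let ?h = "\<lambda>x. ennreal (norm (pgrad v' x - pgrad v x))" and ?K = "ennreal (d / (2 * \<mu>) + \<mu> / 2)"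
  define \<D> where "\<D> = {C \<in> \<C>. C \<inter> ball 0 m \<noteq> {}}"
  have cD: "countable \<D>" using tent_stageD(1)[OF st] by (rule countable_subset[rotated]) (auto simp: \<D>_def)
  have hm: "?h \<in> borel_measurable lebesgue"
    using pgrad_measurable[of v] pgrad_measurable[of v'] by measurable
  have Cm: "C \<in> sets lebesgue" if "C \<in> \<D>" for C
    using perturbed_cellD(1)[OF tent_stageD(5)[OF st, of C]] that by (simp add: \<D>_def lmeasurable_compact fmeasurableD)
  have UB: "\<Union>\<D> \<subseteq> ball 0 (m + 1)"
  proof
    fix x assume "x \<in> \<Union>\<D>"
    then obtain C y where C: "C \<in> \<C>" "x \<in> C" "y \<in> C" "norm y < m" unfolding \<D>_def by auto
    have "norm (x - y) \<le> \<sigma> / 2 * bdist \<Omega> x" by (rule tent_stageD(6)[OF st C(1-3)])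
    also have "\<dots> \<le> 1 * 1" using \<sigma> bdist_le_1 bdist_nonneg by (intro mult_mono) auto
    finally have "norm x < m + 1" using C(4) norm_triangle_sub[of x y] by simp
    then show "x \<in> ball 0 (m + 1)" by simp
  qed
  have Um: "\<Union>\<D> \<in> sets lebesgue" using cD Cm by (intro sets.countable_Union) auto
  have cell: "(\<integral>\<^sup>+x. ?h x * indicator C x \<partial>lebesgue) \<le> ?K * emeasure lebesgue C" if "C \<in> \<D>" for C
  proof -
    have "C \<in> \<C>" using that by (simp add: \<D>_def)
    have pc: "perturbed_cell v v' C" by (rule tent_stageD(5)[OF st \<open>C \<in> \<C>\<close>])
    then obtain A where A: "\<forall>x\<in>C. strictly_affine_at v x \<and> pgrad v x = A \<and> (\<forall>y\<in>C. v x - v y = A *v (x - y))"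
      "\<forall>\<mu>>0. (\<integral>\<^sup>+x. ennreal (norm (pgrad v' x - A)) * indicator C x \<partial>lebesgue) \<le>
        ennreal (deficit A / (2 * \<mu>) + \<mu> / 2) * emeasure lebesgue C"
      unfolding perturbed_cell_def by blast
    obtain x where "x \<in> interior C" using perturbed_cellD(3)[OF pc] by blast
    then obtain r where r: "r > 0" "ball x r \<subseteq> interior C" using open_interior by (meson open_contains_ball)
    \<comment> \<open>The almost everywhere bound is transferred to the constant gradient
      \<open>A\<close> of the cell through one good point in its interior.\<close>
    obtain z where z: "norm (z - x) < r" "z \<in> \<Omega> \<longrightarrow> deficit (pgrad v z) \<le> d"
      by (rule AE_imp_ball_witness[OF d r(1)]) (rule that)
    have "z \<in> ball x r" using z(1) by (simp add: dist_norm norm_minus_commute)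
    then have zC: "z \<in> C" using r(2) interior_subset by blast
    then have "z \<in> \<Omega>" using tent_stageD(4)[OF st \<open>C \<in> \<C>\<close>] by blast
    then have dA: "deficit A \<le> d" using z(2) A(1) zC by auto
    have "(\<integral>\<^sup>+x. ?h x * indicator C x \<partial>lebesgue) = (\<integral>\<^sup>+x. ennreal (norm (pgrad v' x - A)) * indicator C x \<partial>lebesgue)"
      using A(1) by (intro nn_integral_cong) (simp add: indicator_def)
    also have "\<dots> \<le> ennreal (deficit A / (2 * \<mu>) + \<mu> / 2) * emeasure lebesgue C" using A(2) \<mu> by blast
    also have "\<dots> \<le> ?K * emeasure lebesgue C"
      using dA \<mu> by (intro mult_right_mono ennreal_leI add_right_mono divide_right_mono) auto
    finally show ?thesis .
  qed
  have dj: "disjoint_family_on (\<lambda>C. C) \<D>"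
    using tent_stageD(2)[OF st] unfolding disjoint_family_on_def \<D>_def by blast
  have "(\<integral>\<^sup>+x. ?h x * indicator (\<Omega> \<inter> ball 0 m) x \<partial>lebesgue) \<le> (\<integral>\<^sup>+x. ?h x * indicator (\<Union>\<D>) x \<partial>lebesgue)"
  proof (rule nn_integral_mono_AE, rule AE_mp[OF AE_not_in_negligible[OF tent_stageD(3)[OF st]] AE_I2], intro impI)
    fix x assume "x \<notin> \<Omega> - \<Union>\<C>"
    then have "x \<in> \<Omega> \<inter> ball 0 m \<Longrightarrow> x \<in> \<Union>\<D>" unfolding \<D>_def by blast
    then show "?h x * indicator (\<Omega> \<inter> ball 0 m) x \<le> ?h x * indicator (\<Union>\<D>) x"
      by (cases "x \<in> \<Omega> \<inter> ball 0 m") simp_all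
  qed
  also have "\<dots> = emeasure (density lebesgue ?h) (\<Union>C\<in>\<D>. C)"
    using emeasure_density[OF hm Um] by simp
  also have "\<dots> = (\<integral>\<^sup>+C. emeasure (density lebesgue ?h) C \<partial>count_space \<D>)"
    using Cm cD dj by (intro emeasure_UN_countable) auto
  also have "\<dots> \<le> (\<integral>\<^sup>+C. ?K * emeasure lebesgue C \<partial>count_space \<D>)"
    using cell Cm by (intro nn_integral_mono) (simp add: emeasure_density[OF hm])
  also have "\<dots> = ?K * (\<integral>\<^sup>+C. emeasure lebesgue C \<partial>count_space \<D>)" by (intro nn_integral_cmult) simp
  also have "(\<integral>\<^sup>+C. emeasure lebesgue C \<partial>count_space \<D>) = emeasure lebesgue (\<Union>C\<in>\<D>. C)"
    using Cm cD dj by (intro emeasure_UN_countable[symmetric]) auto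
  also have "?K * emeasure lebesgue (\<Union>C\<in>\<D>. C) \<le> ?K * emeasure lebesgue (ball (0 :: real ^ 'n) (m + 1))"
    using UB by (intro mult_left_mono emeasure_mono) auto
  finally show ?thesis .
qed

section \<open>The limit of the perturbations\<close>

text \<open>The tolerances \<epsilon> / 2^(k+1) sum to \<epsilon>. Every cell lies in the interiors
  of the previous generation, so values at frontier points of a cell remain fixed from its
  generation on.\<close>

locale tent_sequence =
  fixes \<Omega> :: "(real ^ 'n) set" and \<epsilon> :: real and v :: "nat \<Rightarrow> real ^ 'n \<Rightarrow> real ^ 'n"
    and \<C> :: "nat \<Rightarrow> (real ^ 'n) set set"
  assumes op: "open \<Omega>" and \<epsilon>: "0 < \<epsilon>" "\<epsilon> \<le> 1"
    and short: "\<And>k. short_on \<Omega> (v k)"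
    and sa: "\<And>k. AE x in lebesgue. x \<in> \<Omega> \<longrightarrow> strictly_affine_at (v k) x"
    and stage: "\<And>k. tent_stage \<Omega> (\<epsilon> / 2 ^ Suc k) (v k) (v (Suc k)) (\<C> k)"
    and nested: "\<And>k C. C \<in> \<C> (Suc k) \<Longrightarrow> C \<subseteq> (\<Union>C\<in>\<C> k. interior C)"

lemma tent_sequence_exists:
  fixes v0 :: "real ^ 'n \<Rightarrow> real ^ 'n"
  assumes op: "open \<Omega>" and \<epsilon>: "0 < \<epsilon>" "\<epsilon> \<le> 1"
    and v0: "short_on \<Omega> v0" "AE x in lebesgue. x \<in> \<Omega> \<longrightarrow> strictly_affine_at v0 x"
  obtains v \<C> where "tent_sequence \<Omega> \<epsilon> v \<C>" "v 0 = v0"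
proof -
  \<comment> \<open>Next to the map, the state carries the open set of full measure available for
    the next cells; the clause for \<open>k = 0\<close> ties the sequence to
    \<open>v0\<close>.\<close>
  define P where "P k s \<longleftrightarrow> short_on \<Omega> (fst s) \<and> (AE x in lebesgue. x \<in> \<Omega> \<longrightarrow> strictly_affine_at (fst s) x) \<and>
      open (snd s) \<and> snd s \<subseteq> \<Omega> \<and> negligible (\<Omega> - snd s) \<and> (k = 0 \<longrightarrow> fst s = v0)"
    for k :: nat and s :: "(real ^ 'n \<Rightarrow> real ^ 'n) \<times> (real ^ 'n) set"
  define R where "R k s s' \<longleftrightarrow> (\<exists>\<C>. tent_stage \<Omega> (\<epsilon> / 2 ^ Suc k) (fst s) (fst s') \<C> \<and> (\<forall>C\<in>\<C>. C \<subseteq> snd s) \<and>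
      snd s' = (\<Union>C\<in>\<C>. interior C))"
    for k :: nat and s s' :: "(real ^ 'n \<Rightarrow> real ^ 'n) \<times> (real ^ 'n) set"
  have "\<exists>f. \<forall>k. P k (f k) \<and> R k (f k) (f (Suc k))"
  proof (rule dependent_nat_choice)
    show "\<exists>s. P 0 s" using v0 op by (intro exI[of _ "(v0, \<Omega>)"]) (simp add: P_def)
    fix s k assume Ps: "P k s"
    have "\<epsilon> / 2 ^ Suc k > 0" using \<epsilon> by simp
    moreover have "\<epsilon> / 2 ^ Suc k \<le> 1 / 1" using \<epsilon> by (intro frac_le) (auto intro: order_trans[OF one_le_power[of 2 k]])
    ultimately obtain v' \<C> where st: "tent_stage \<Omega> (\<epsilon> / 2 ^ Suc k) (fst s) v' \<C>" "\<And>C. C \<in> \<C> \<Longrightarrow> C \<subseteq> snd s"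
      using Ps unfolding P_def by (elim conjE) (rule tent_stage_exists[OF op]; (assumption | simp | rule that)+)
    have neg: "negligible (\<Omega> - (\<Union>C\<in>\<C>. interior C))"
    proof -
      have "negligible (\<Union>C\<in>\<C>. frontier C)"
      proof (rule negligible_countable_Union)
        show "countable (frontier ` \<C>)" using tent_stageD(1)[OF st(1)] by simp
        fix t assume "t \<in> frontier ` \<C>"
        then obtain C where "t = frontier C" "C \<in> \<C>" by (rule imageE)
        then show "negligible t" using perturbed_cellD(2)[OF tent_stageD(5)[OF st(1)]] by (simp add: negligible_convex_frontier)
      qed
      moreover have "\<Omega> - (\<Union>C\<in>\<C>. interior C) \<subseteq> (\<Omega> - \<Union>\<C>) \<union> (\<Union>C\<in>\<C>. frontier C)"
      proof
        fix x assume x: "x \<in> \<Omega> - (\<Union>C\<in>\<C>. interior C)"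
        show "x \<in> (\<Omega> - \<Union>\<C>) \<union> (\<Union>C\<in>\<C>. frontier C)"
        proof (cases "x \<in> \<Union>\<C>")
          case True
          then obtain C where C: "C \<in> \<C>" "x \<in> C" by blast
          then have "x \<in> frontier C" using x closure_subset[of C] unfolding frontier_def by blast
          then show ?thesis using C(1) by blast
        qed (use x in blast)
      qed
      ultimately show ?thesis using negligible_Un[OF tent_stageD(3)[OF st(1)]] negligible_subset by blast
    qed
    have "P (Suc k) (v', \<Union>C\<in>\<C>. interior C)"
      unfolding P_def fst_conv snd_conv
    proof (intro conjI neg)
      show "short_on \<Omega> v'" using tent_stage_short[OF st(1)] Ps by (simp add: P_def)
      show "AE x in lebesgue. x \<in> \<Omega> \<longrightarrow> strictly_affine_at v' x"
        using tent_stage_AE[OF st(1)] by eventually_elim simp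
      show "(\<Union>C\<in>\<C>. interior C) \<subseteq> \<Omega>" using tent_stageD(4)[OF st(1)] interior_subset by blast
    qed auto
    moreover have "R k s (v', \<Union>C\<in>\<C>. interior C)" unfolding R_def using st by auto
    ultimately show "\<exists>s'. P (Suc k) s' \<and> R k s s'" by blast
  qed
  then obtain f where f: "\<And>k. P k (f k)" "\<And>k. R k (f k) (f (Suc k))" by blast
  then have "\<forall>k. \<exists>\<C>. tent_stage \<Omega> (\<epsilon> / 2 ^ Suc k) (fst (f k)) (fst (f (Suc k))) \<C> \<and> (\<forall>C\<in>\<C>. C \<subseteq> snd (f k)) \<and>
      snd (f (Suc k)) = (\<Union>C\<in>\<C>. interior C)" unfolding R_def by blast
  then obtain \<C> where \<C>: "\<And>k. tent_stage \<Omega> (\<epsilon> / 2 ^ Suc k) (fst (f k)) (fst (f (Suc k))) (\<C> k)"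
    "\<And>k C. C \<in> \<C> k \<Longrightarrow> C \<subseteq> snd (f k)" "\<And>k. snd (f (Suc k)) = (\<Union>C\<in>\<C> k. interior C)" by metis
  have "tent_sequence \<Omega> \<epsilon> (\<lambda>k. fst (f k)) \<C>"
  proof
    show "short_on \<Omega> (fst (f k))" "AE x in lebesgue. x \<in> \<Omega> \<longrightarrow> strictly_affine_at (fst (f k)) x" for k
      using f(1)[of k] by (simp_all add: P_def)
    show "C \<subseteq> (\<Union>C\<in>\<C> k. interior C)" if "C \<in> \<C> (Suc k)" for k C using \<C>(2)[OF that] \<C>(3)[of k] by simp
  qed (use op \<epsilon> \<C>(1) in auto)
  then show ?thesis using that[of "\<lambda>k. fst (f k)" \<C>] f(1)[of 0] by (simp add: P_def)
qed

text \<open>The squared lengths of the n columns are at most 1 and sum to n, so all equal 1.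
  Contraction on e_i + s e_j for every \<open>s\<close> then makes distinct columns
  orthogonal.\<close>

lemma isometry_of_deficit_0:
  fixes M :: "real ^ 'n ^ 'n"
  assumes c: "\<And>h. norm (M *v h) \<le> norm h" and d: "deficit M = 0"
  shows "M \<in> O_maps"
proof -
  have le: "(norm (M *v axis j 1))\<^sup>2 \<le> 1" for j using c[of "axis j 1"] by (simp add: power_le_one)
  have "(\<Sum>j\<in>(UNIV::'n set). 1 - (norm (M *v axis j 1))\<^sup>2) = 0"
    using d norm_matrix_columns[of M] by (simp add: deficit_def sum_subtractf)
  then have n1: "(norm (M *v axis j 1))\<^sup>2 = 1" for j
    using sum_nonneg_eq_0_iff[of "UNIV :: 'n set" "\<lambda>j. 1 - (norm (M *v axis j 1))\<^sup>2"] le by simp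
  have ort: "(M *v axis i 1) \<bullet> (M *v axis j 1) = 0" if "i \<noteq> j" for i j
  proof -
    have "- ((M *v axis i 1) \<bullet> (M *v axis j 1)) = 0"
    proof (rule linear_coefficient_zero)
      fix s :: real
      have "(norm (M *v (axis i 1 + s *\<^sub>R axis j 1)))\<^sup>2 \<le> (norm (axis i 1 + s *\<^sub>R axis j (1::real)))\<^sup>2"
        using c by (intro power_mono) auto
      moreover have "(norm (axis i 1 + s *\<^sub>R axis j (1::real) :: real ^ 'n))\<^sup>2 = 1 + s\<^sup>2"
        using that unfolding power2_norm_eq_inner
        by (simp add: inner_add_left inner_add_right inner_axis_axis power2_eq_square)
      moreover have "(norm (M *v (axis i 1 + s *\<^sub>R axis j 1)))\<^sup>2 =
          1 + 2 * s * ((M *v axis i 1) \<bullet> (M *v axis j 1)) + s\<^sup>2"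
        using n1[of i] n1[of j] unfolding power2_norm_eq_inner matrix_vector_right_distrib matrix_vector_mult_scaleR
        by (simp add: inner_add_left inner_add_right inner_commute power2_eq_square)
      ultimately show "0 \<le> 2 * s * - ((M *v axis i 1) \<bullet> (M *v axis j 1)) + s\<^sup>2 * 0" by simp
    qed
    then show ?thesis by simp
  qed
  have "(transpose M ** M) $ i $ j = (M *v axis i 1) \<bullet> (M *v axis j 1)" for i j
    by (simp add: matrix_matrix_mult_def transpose_def matrix_vector_mult_basis column_def inner_vec_def)
  then have "transpose M ** M = mat 1"
    using n1 ort by (auto simp: vec_eq_iff mat_def power2_norm_eq_inner)
  then show ?thesis by (simp add: O_maps_def)
qed

lemma closed_O_maps: "closed (O_maps :: (real ^ 'n ^ 'n) set)"
proof -
  have "O_maps = {X :: real ^ 'n ^ 'n. \<forall>i j. (\<Sum>k\<in>UNIV. X $ k $ i * X $ k $ j) = mat 1 $ i $ j}"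
    by (auto simp: O_maps_def vec_eq_iff matrix_matrix_mult_def transpose_def)
  moreover have "closed {X :: real ^ 'n ^ 'n. \<forall>i j. (\<Sum>k\<in>UNIV. X $ k $ i * X $ k $ j) = mat 1 $ i $ j}"
    by (intro closed_Collect_all closed_Collect_eq continuous_intros)
  ultimately show ?thesis by simp
qed

lemma indicator_continuous_measurable:
  fixes f :: "'a::euclidean_space \<Rightarrow> real"
  assumes "open \<Omega>" "continuous_on \<Omega> f"
  shows "(\<lambda>x. indicator \<Omega> x * f x) \<in> borel_measurable lebesgue"
proof -
  have "(\<lambda>x. indicator \<Omega> x *\<^sub>R f x) \<in> borel_measurable borel"
    using assms by (intro borel_measurable_continuous_on_indicator) auto
  then have "(\<lambda>x. indicator \<Omega> x * f x) \<in> borel_measurable lborel" by simp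
  then show ?thesis by (rule measurable_completion)
qed

section \<open>The limit map and its gradient\<close>

context tent_sequence
begin

definition u where "u x = lim (\<lambda>k. v k x)"

text \<open>The exact partial sum of the tolerances is kept on the right so that the induction
  closes.\<close>

lemma cauchy_bound: "norm (v (k + j) x - v k x) \<le> (\<epsilon> / 2 ^ k - \<epsilon> / 2 ^ (k + j)) * bdist \<Omega> x"
proof (induction j)
  case (Suc j)
  have "norm (v (Suc (k + j)) x - v (k + j) x) \<le> \<epsilon> / 2 ^ Suc (k + j) * bdist \<Omega> x"
    using \<epsilon> by (intro tent_stage_close[OF stage]) auto
  then have "norm (v (k + Suc j) x - v k x) \<le> \<epsilon> / 2 ^ Suc (k + j) * bdist \<Omega> x + (\<epsilon> / 2 ^ k - \<epsilon> / 2 ^ (k + j)) * bdist \<Omega> x"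
    using Suc norm_triangle_ineq[of "v (Suc (k + j)) x - v (k + j) x" "v (k + j) x - v k x"] by simp
  also have "\<dots> = (\<epsilon> / 2 ^ k - \<epsilon> / 2 ^ (k + Suc j)) * bdist \<Omega> x" by (simp add: field_simps)
  finally show ?case .
qed simp

lemma cauchy_bound': "norm (v (k + j) x - v k x) \<le> \<epsilon> / 2 ^ k * bdist \<Omega> x"
proof (rule order_trans[OF cauchy_bound mult_right_mono[OF _ bdist_nonneg]])
  have "0 \<le> \<epsilon> / 2 ^ (k + j)" using \<epsilon> by simp
  then show "\<epsilon> / 2 ^ k - \<epsilon> / 2 ^ (k + j) \<le> \<epsilon> / 2 ^ k" by linarith
qed

lemma halving: "(\<lambda>k. \<epsilon> / 2 ^ k) \<longlonglongrightarrow> 0"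
proof -
  have "(\<lambda>k. \<epsilon> * (1 / 2) ^ k) \<longlonglongrightarrow> \<epsilon> * 0" by (intro tendsto_mult tendsto_const LIMSEQ_power_zero) simp
  moreover have "\<epsilon> * (1 / 2) ^ k = \<epsilon> / 2 ^ k" for k :: nat by (simp add: power_divide)
  ultimately show ?thesis by (simp only: mult_zero_right)
qed

lemma v_tendsto: "(\<lambda>k. v k x) \<longlonglongrightarrow> u x"
proof -
  have "Cauchy (\<lambda>k. v k x)"
  proof (rule CauchyI')
    fix e :: real assume e: "e > 0"
    have "\<forall>\<^sub>F k in sequentially. \<epsilon> / 2 ^ k < e" using order_tendstoD(2)[OF halving e] .
    then obtain k where k: "\<And>m. m \<ge> k \<Longrightarrow> \<epsilon> / 2 ^ m < e" unfolding eventually_sequentially by blast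
    show "\<exists>M. \<forall>m\<ge>M. \<forall>n>m. dist (v m x) (v n x) < e"
    proof (intro exI[of _ k] allI impI)
      fix m n assume mn: "m \<ge> k" "n > m"
      have "norm (v n x - v m x) \<le> \<epsilon> / 2 ^ m * bdist \<Omega> x" using cauchy_bound'[of m "n - m" x] mn by simp
      also have "\<dots> \<le> \<epsilon> / 2 ^ m * 1" using \<epsilon> bdist_le_1 by (intro mult_left_mono) auto
      finally show "dist (v m x) (v n x) < e" using k[OF mn(1)] by (simp add: dist_norm norm_minus_commute)
    qed
  qed
  then have "convergent (\<lambda>k. v k x)" by (rule Cauchy_convergent)
  then show ?thesis unfolding u_def by (rule convergent_LIMSEQ_iff[THEN iffD1])
qed

lemma u_close: "norm (u x - v k x) \<le> \<epsilon> / 2 ^ k * bdist \<Omega> x"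
proof (rule tendsto_le[OF sequentially_bot tendsto_const])
  show "(\<lambda>j. norm (v (k + j) x - v k x)) \<longlonglongrightarrow> norm (u x - v k x)"
    using LIMSEQ_ignore_initial_segment[OF v_tendsto[of x], of k] by (intro tendsto_intros) (simp add: add.commute)
qed (intro always_eventually allI cauchy_bound')

lemma u_short: "short_on \<Omega> u"
  unfolding short_on_def
proof (intro allI impI)
  fix x y assume "closed_segment x y \<subseteq> \<Omega>"
  then have "norm (v k x - v k y) \<le> norm (x - y)" for k by (rule short_onD[OF short])
  moreover have "(\<lambda>k. norm (v k x - v k y)) \<longlonglongrightarrow> norm (u x - u y)" by (intro tendsto_intros v_tendsto)
  ultimately show "norm (u x - u y) \<le> norm (x - y)" by (intro LIMSEQ_le_const2) auto
qed

lemma nested_sub: "\<Union>(\<C> (Suc (k + i))) \<subseteq> (\<Union>C\<in>\<C> k. interior C)"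
proof (induction i)
  case 0
  show ?case using nested by auto
next
  case (Suc i)
  have "\<Union>(\<C> (Suc (k + Suc i))) \<subseteq> (\<Union>C\<in>\<C> (Suc (k + i)). interior C)" using nested[of _ "k + Suc i"] by auto
  also have "\<dots> \<subseteq> \<Union>(\<C> (Suc (k + i)))" using interior_subset by blast
  finally show ?case using Suc by blast
qed

text \<open>A frontier point of a cell lies in the interior of no cell of its generation, hence in
  no cell of a later one.\<close>

lemma u_eq_on_frontier:
  assumes C: "C \<in> \<C> k" and x: "x \<in> frontier C"
  shows "u x = v k x"
proof -
  note pc = perturbed_cellD[OF tent_stageD(5)[OF stage C]]
  have xC: "x \<in> C" "x \<notin> interior C"
    using x frontier_subset_closed[OF compact_imp_closed[OF pc(1)]] by (auto simp: frontier_def)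
  have no: "x \<notin> (\<Union>C\<in>\<C> k. interior C)"
  proof
    assume "x \<in> (\<Union>C\<in>\<C> k. interior C)"
    then obtain D where D: "D \<in> \<C> k" "x \<in> interior D" by (rule UN_E)
    then have "D \<noteq> C" "x \<in> D" using xC interior_subset by blast+
    then show False using tent_stageD(2)[OF stage D(1) C] xC(1) by blast
  qed
  have "v (Suc (k + i)) x = v k x" for i
  proof (induction i)
    case 0
    show ?case using pc(4)[OF x] by simp
  next
    case (Suc i)
    have "x \<notin> \<Union>(\<C> (Suc (k + i)))" using nested_sub[of k i] no by blast
    then show ?case using tent_stageD(7)[OF stage] Suc by simp
  qed
  then have "(\<lambda>i. v k x) \<longlonglongrightarrow> u x" using LIMSEQ_ignore_initial_segment[OF v_tendsto[of x], of "Suc k"] by (simp add: add.commute)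
  then show ?thesis by (simp add: LIMSEQ_const_iff)
qed

definition \<theta> :: real where "\<theta> = 1 - 1 / (2 * real CARD('n))"

lemma \<theta>: "0 < \<theta>" "\<theta> < 1"
proof -
  have *: "0 < 1 - 1 / (2 * n) \<and> 1 - 1 / (2 * n) < 1" if "n \<ge> 1" for n :: real using that by (simp add: field_simps)
  have "real CARD('n) \<ge> 1" by simp
  from *[OF this] show "0 < \<theta>" "\<theta> < 1" unfolding \<theta>_def by auto
qed

lemma deficit_decay: "AE x in lebesgue. x \<in> \<Omega> \<longrightarrow> deficit (pgrad (v k) x) \<le> \<theta> ^ k * real CARD('n)"
proof (induction k)
  case 0
  show ?case by (simp add: deficit_def)
next
  case (Suc k)
  from tent_stage_AE[OF stage[of k]] Suc show ?case
  proof eventually_elim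
    case (elim x)
    show ?case
    proof
      assume x: "x \<in> \<Omega>"
      have "deficit (pgrad (v (Suc k)) x) \<le> \<theta> * deficit (pgrad (v k) x)" using elim x by (simp add: \<theta>_def)
      also have "\<dots> \<le> \<theta> * (\<theta> ^ k * real CARD('n))" using elim x \<theta> by (intro mult_left_mono) auto
      finally show "deficit (pgrad (v (Suc k)) x) \<le> \<theta> ^ Suc k * real CARD('n)" by (simp add: mult_ac)
    qed
  qed
qed

text \<open>With \<mu> = q^k and q the square root of \<theta>, both terms of the stage estimate are
  of order q^k. The changes of gradient are therefore summable in L1 on every ball, hence summable
  at almost every point.\<close>

lemma convergent_pgrad: "AE x in lebesgue. x \<in> \<Omega> \<longrightarrow> convergent (\<lambda>k. pgrad (v k) x)"
proof -
  let ?N = "real CARD('n)" and ?h = "\<lambda>k x. ennreal (norm (pgrad (v (Suc k)) x - pgrad (v k) x))"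
  have "AE x in lebesgue. x \<in> \<Omega> \<inter> ball 0 (real m) \<longrightarrow> convergent (\<lambda>k. pgrad (v k) x)" for m
  proof -
    let ?S = "\<Omega> \<inter> ball 0 (real m)" and ?B = "ball (0 :: real ^ 'n) (real m + 1)"
    define q where "q = sqrt \<theta>"
    have q: "0 < q" "q < 1" "q\<^sup>2 = \<theta>" using \<theta> by (auto simp: q_def)
    define c where "c k = (?N + 1) / 2 * q ^ k * measure lebesgue ?B" for k
    have c0: "c k \<ge> 0" for k using q(1) by (simp add: c_def)
    have "summable c" unfolding c_def using q by (intro summable_mult2 summable_mult summable_geometric) auto
    have "(\<integral>\<^sup>+x. ?h k x * indicator ?S x \<partial>lebesgue) \<le> ennreal (c k)" for k
    proof -
      have s: "0 \<le> \<epsilon> / 2 ^ Suc k" using \<epsilon> by simp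
      have s1: "\<epsilon> / 2 ^ Suc k \<le> 1"
      proof -
        have "\<epsilon> / 2 ^ Suc k \<le> 1 / 1" using \<epsilon> by (intro frac_le) (auto intro: order_trans[OF one_le_power[of 2 k]])
        then show ?thesis by simp
      qed
      have "(\<integral>\<^sup>+x. ?h k x * indicator ?S x \<partial>lebesgue) \<le>
          ennreal ((\<theta> ^ k * ?N) / (2 * q ^ k) + q ^ k / 2) * emeasure lebesgue ?B"
        using q by (intro tent_stage_slope_change[OF stage s s1 deficit_decay]) auto
      also have "(\<theta> ^ k * ?N) / (2 * q ^ k) + q ^ k / 2 = (?N + 1) / 2 * q ^ k"
      proof -
        have "\<theta> ^ k = q ^ k * q ^ k" using q(3) by (simp add: power2_eq_square flip: power_mult_distrib)
        then show ?thesis using q(1) by (simp add: field_simps)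
      qed
      also have "emeasure lebesgue ?B = ennreal (measure lebesgue ?B)"
        by (rule emeasure_eq_measure2) (simp add: emeasure_lborel_ball_finite)
      also have "ennreal ((?N + 1) / 2 * q ^ k) * ennreal (measure lebesgue ?B) = ennreal (c k)"
        unfolding c_def using q(1) by (subst ennreal_mult) auto
      finally show ?thesis .
    qed
    then have "(\<Sum>k. \<integral>\<^sup>+x. ?h k x * indicator ?S x \<partial>lebesgue) \<le> (\<Sum>k. ennreal (c k))"
      by (intro suminf_le) auto
    also have "\<dots> = ennreal (\<Sum>k. c k)" using c0 \<open>summable c\<close> by (rule suminf_ennreal2)
    finally have fin: "(\<Sum>k. \<integral>\<^sup>+x. ?h k x * indicator ?S x \<partial>lebesgue) \<noteq> \<infinity>"
      using ennreal_less_top[of "\<Sum>k. c k"] by (auto simp: top_unique)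
    have Sm: "?S \<in> sets lebesgue" using op by auto
    have dm: "(\<lambda>x. norm (pgrad (v (Suc k)) x - pgrad (v k) x)) \<in> borel_measurable lebesgue" for k
      using pgrad_measurable[of "v k"] pgrad_measurable[of "v (Suc k)"] by measurable
    have hm: "(\<lambda>x. ?h k x * indicator ?S x) \<in> borel_measurable lebesgue" for k
      using dm[of k] Sm by measurable
    have "(\<integral>\<^sup>+x. (\<Sum>k. ?h k x * indicator ?S x) \<partial>lebesgue) \<noteq> \<infinity>"
      unfolding nn_integral_suminf[of "\<lambda>k x. ?h k x * indicator ?S x" lebesgue, OF hm] by (rule fin)
    moreover have "(\<lambda>x. \<Sum>k. ?h k x * indicator ?S x) \<in> borel_measurable lebesgue" using hm by measurable
    ultimately have "AE x in lebesgue. (\<Sum>k. ?h k x * indicator ?S x) \<noteq> \<infinity>"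
      by (intro nn_integral_noteq_infinite)
    then show ?thesis
    proof eventually_elim
      case (elim x)
      show ?case
      proof
        assume x: "x \<in> ?S"
        have "(\<Sum>k. ?h k x) \<noteq> top" using elim x by simp
        then have "summable (\<lambda>k. norm (pgrad (v (Suc k)) x - pgrad (v k) x))"
          by (intro summable_suminf_not_top) auto
        then have "summable (\<lambda>k. pgrad (v (Suc k)) x - pgrad (v k) x)" by (rule summable_norm_cancel)
        then have "convergent (\<lambda>n. \<Sum>k<n. pgrad (v (Suc k)) x - pgrad (v k) x)" by (simp add: summable_iff_convergent)
        then have "convergent (\<lambda>n. pgrad (v n) x - pgrad (v 0) x)" by (simp only: sum_lessThan_telescope[of "\<lambda>k. pgrad (v k) x"])
        then obtain l where "(\<lambda>n. pgrad (v n) x - pgrad (v 0) x) \<longlonglongrightarrow> l" unfolding convergent_def by blast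
        from tendsto_add[OF this tendsto_const[of "pgrad (v 0) x"]]
        show "convergent (\<lambda>k. pgrad (v k) x)" unfolding convergent_def by (auto simp: algebra_simps)
      qed
    qed
  qed
  then have "AE x in lebesgue. \<forall>m. x \<in> \<Omega> \<inter> ball 0 (real m) \<longrightarrow> convergent (\<lambda>k. pgrad (v k) x)"
    unfolding AE_all_countable by blast
  then show ?thesis
  proof eventually_elim
    case (elim x)
    obtain m where "norm x < real m" using reals_Archimedean2 by blast
    then show ?case using elim by auto
  qed
qed

text \<open>The default \<open>mat 1\<close> makes \<open>Du\<close> orthogonal at every point of
  the space, so its norm and the energy-momentum values need no exceptional set.\<close>

definition Du where "Du x = (if lim (\<lambda>k. pgrad (v k) x) \<in> O_maps then lim (\<lambda>k. pgrad (v k) x) else mat 1)"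

lemma Du_measurable: "Du \<in> borel_measurable lebesgue"
proof -
  have l: "(\<lambda>x. lim (\<lambda>k. pgrad (v k) x)) \<in> borel_measurable lebesgue"
    by (intro borel_measurable_lim_metric pgrad_measurable)
  have "(\<lambda>M. if M \<in> O_maps then M else mat 1 :: real ^ 'n ^ 'n) \<in> borel_measurable borel"
    using borel_closed[OF closed_O_maps] by (intro measurable_If_set) auto
  from measurable_compose[OF l this] show ?thesis unfolding Du_def[abs_def] .
qed

lemma Du_in_O: "Du x \<in> O_maps"
  by (simp add: Du_def O_maps_def)

lemma Du_bound: "norm (Du x) \<le> real CARD('n)"
proof -
  have "(norm (Du x))\<^sup>2 = real CARD('n)"
    using Du_in_O[of x] by (simp add: power2_norm_eq_inner inner_matrix_eq_trace O_maps_def trace_I)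
  moreover have "real CARD('n) * 1 \<le> real CARD('n) * real CARD('n)" by (intro mult_left_mono) simp_all
  ultimately have "(norm (Du x))\<^sup>2 \<le> (real CARD('n))\<^sup>2" by (simp only: power2_eq_square mult_1_right)
  then show ?thesis by (rule power2_le_imp_le) simp
qed

lemma AE_Du: "AE x in lebesgue. x \<in> \<Omega> \<longrightarrow> Du x \<in> O_maps \<and> (\<lambda>k. pgrad (v k) x) \<longlonglongrightarrow> Du x"
proof -
  have "AE x in lebesgue. \<forall>k. x \<in> \<Omega> \<longrightarrow> deficit (pgrad (v k) x) \<le> \<theta> ^ k * real CARD('n)"
    unfolding AE_all_countable using deficit_decay by blast
  with convergent_pgrad show ?thesis
  proof eventually_elim
    case (elim x)
    show ?case
    proof
      assume x: "x \<in> \<Omega>"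
      let ?D = "lim (\<lambda>k. pgrad (v k) x)"
      have l: "(\<lambda>k. pgrad (v k) x) \<longlonglongrightarrow> ?D" using elim x by (simp add: convergent_LIMSEQ_iff)
      have con: "norm (?D *v h) \<le> norm h" for h
      proof -
        have "(\<lambda>k. norm (pgrad (v k) x *v h)) \<longlonglongrightarrow> norm (?D *v h)"
          by (intro tendsto_norm bounded_linear.tendsto[OF bounded_linear_matrix_vector_left] l)
        then show ?thesis by (rule LIMSEQ_le_const2) (use pgrad_contraction in auto)
      qed
      have dl: "(\<lambda>k. deficit (pgrad (v k) x)) \<longlonglongrightarrow> deficit ?D" unfolding deficit_def by (intro tendsto_intros l)
      have "(\<lambda>k. \<theta> ^ k * real CARD('n)) \<longlonglongrightarrow> 0 * real CARD('n)"
        using \<theta> by (intro tendsto_mult LIMSEQ_power_zero tendsto_const) auto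
      from LIMSEQ_le[OF dl this] have "deficit ?D \<le> 0 * real CARD('n)" using elim x by blast
      then have d0: "deficit ?D = 0" using deficit_nonneg[OF con] by simp
      have O: "?D \<in> O_maps" by (rule isometry_of_deficit_0[OF con d0])
      then have "Du x = ?D" by (simp add: Du_def)
      then show "Du x \<in> O_maps \<and> (\<lambda>k. pgrad (v k) x) \<longlonglongrightarrow> Du x" using O l by simp
    qed
  qed
qed

lemma u_continuous: "continuous_on \<Omega> u"
  by (rule short_continuous_on[OF op u_short])

text \<open>The integration by parts formula of each \<open>v k\<close> passes to the limit by
  dominated convergence: the maps converge pointwise, the gradients almost everywhere, and both are
  bounded uniformly on the support of the test function.\<close>

lemma u_weak_derivative: "weak_derivative \<Omega> u Du"
  unfolding weak_derivative_def
proof (intro conjI ballI allI)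
  have li: "locally_integrable_on f \<Omega>"
    if fm: "\<And>K. compact K \<Longrightarrow> K \<subseteq> \<Omega> \<Longrightarrow> f \<in> borel_measurable (lebesgue_on K)"
      and fb: "\<And>K. compact K \<Longrightarrow> K \<subseteq> \<Omega> \<Longrightarrow> \<exists>B. \<forall>x\<in>K. norm (f x) \<le> B" for f :: "real ^ 'n \<Rightarrow> 'b::euclidean_space"
    unfolding locally_integrable_on_def
  proof (intro allI impI)
    fix K assume "compact K \<and> K \<subseteq> \<Omega>"
    then have K: "compact K" "K \<subseteq> \<Omega>" by auto
    obtain B where B: "\<And>x. x \<in> K \<Longrightarrow> norm (f x) \<le> B" using fb[OF K] by blast
    show "f absolutely_integrable_on K"
    proof (rule measurable_bounded_by_integrable_imp_absolutely_integrable[OF fm[OF K]])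
      show "K \<in> sets lebesgue" using K(1) by (simp add: lmeasurable_compact fmeasurableD)
      show "(\<lambda>x. B) integrable_on K" using integrable_on_const[OF lmeasurable_compact[OF K(1)]] .
    qed (use B in auto)
  qed
  show "locally_integrable_on u \<Omega>"
  proof (rule li)
    fix K assume K: "compact K" "K \<subseteq> \<Omega>"
    have cK: "continuous_on K u" by (rule continuous_on_subset[OF u_continuous K(2)])
    then show "u \<in> borel_measurable (lebesgue_on K)"
      using K(1) by (intro continuous_imp_measurable_on_sets_lebesgue) (simp_all add: lmeasurable_compact fmeasurableD)
    show "\<exists>B. \<forall>x\<in>K. norm (u x) \<le> B"
      using compact_imp_bounded[OF compact_continuous_image[OF cK K(1)]] unfolding bounded_iff by blast
  qed
  show "locally_integrable_on Du \<Omega>"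
    using Du_bound measurable_restrict_space1[OF Du_measurable] by (intro li) auto
  fix \<psi> :: "real ^ 'n \<Rightarrow> real" and i j assume \<psi>: "\<psi> \<in> test_functions \<Omega>"
  let ?d = "\<lambda>x. frechet_derivative \<psi> (at x)" and ?e = "axis j 1 :: real ^ 'n"
  obtain K where K: "compact K" "K \<subseteq> \<Omega>" "\<And>x. x \<notin> K \<Longrightarrow> \<psi> x = 0"
    and d: "\<And>x. (\<psi> has_derivative ?d x) (at x)" "\<And>v. continuous_on UNIV (\<lambda>x. ?d x v)"
    by (rule test_function_props[OF \<psi>]) (rule that)
  have c\<psi>: "continuous_on UNIV \<psi>" using d(1) by (intro continuous_at_imp_continuous_on ballI has_derivative_continuous)
  have d0: "?d x h = 0" if "x \<notin> K" for x h
    using has_derivative_zero_off_compact_support[OF K(1) K(3) d(1) that] by simp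
  obtain B where B: "B \<ge> 0" "\<And>x. \<bar>\<psi> x\<bar> \<le> B"
    by (rule bounded_compact_support[OF K(1) c\<psi> K(3)]) (assumption | rule that)+
  obtain Bd where Bd: "Bd \<ge> 0" "\<And>x. \<bar>?d x ?e\<bar> \<le> Bd"
    by (rule bounded_compact_support[OF K(1) d(2) d0]) (assumption | rule that)+
  have "bounded (v 0 ` K)"
    using short_continuous_on[OF op short] K(1,2) continuous_on_subset by (intro compact_imp_bounded compact_continuous_image) blast+
  then obtain V where V: "\<And>x. x \<in> K \<Longrightarrow> norm (v 0 x) \<le> V" unfolding bounded_iff by blast
  have Vk: "norm (v k x) \<le> \<bar>V\<bar> + 1" if "x \<in> K" for k x
  proof -
    have "norm (v k x - v 0 x) \<le> \<epsilon> * bdist \<Omega> x" using cauchy_bound'[of 0 k x] by simp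
    also have "\<dots> \<le> 1 * 1" using \<epsilon> bdist_le_1 bdist_nonneg by (intro mult_mono) auto
    finally show ?thesis using V[OF that] norm_triangle_sub[of "v k x" "v 0 x"] by simp
  qed
  have indm: "integrable lebesgue (\<lambda>x. c * indicator K x)" for c :: real
    using lmeasurable_compact[OF K(1)] by (intro integrable_mult_right) (simp flip: lmeasurable_iff_integrable)
  have dm: "(\<lambda>x. ?d x ?e) \<in> borel_measurable lebesgue" by (rule continuous_imp_borel_measurable_lebesgue[OF d(2)])
  have \<psi>m: "\<psi> \<in> borel_measurable lebesgue" by (rule continuous_imp_borel_measurable_lebesgue[OF c\<psi>])
  have om: "(indicator \<Omega> :: _ \<Rightarrow> real) \<in> borel_measurable lebesgue" using op by (intro borel_measurable_indicator) auto
  have wm: "(\<lambda>x. indicator \<Omega> x * (w x $ i * ?d x ?e)) \<in> borel_measurable lebesgue" if "continuous_on \<Omega> w" for w :: "real ^ 'n \<Rightarrow> real ^ 'n"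
  proof -
    have "(\<lambda>x. indicator \<Omega> x * w x $ i) \<in> borel_measurable lebesgue"
      using that by (intro indicator_continuous_measurable[OF op] continuous_intros)
    then have "(\<lambda>x. (indicator \<Omega> x * w x $ i) * ?d x ?e) \<in> borel_measurable lebesgue" using dm by (rule borel_measurable_times)
    then show ?thesis by (simp only: mult.assoc)
  qed
  have gm: "(\<lambda>x. indicator \<Omega> x * (G x $ i $ j * \<psi> x)) \<in> borel_measurable lebesgue"
    if "G \<in> borel_measurable lebesgue" for G :: "real ^ 'n \<Rightarrow> real ^ 'n ^ 'n"
    using om borel_measurable_vec_component[OF borel_measurable_vec_component[OF that, of i], of j] \<psi>m
    by (intro borel_measurable_times)
  have L: "(\<lambda>k. LINT x|lebesgue. indicator \<Omega> x * (v k x $ i * ?d x ?e)) \<longlonglongrightarrow> (LINT x|lebesgue. indicator \<Omega> x * (u x $ i * ?d x ?e))"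
  proof (rule integral_dominated_convergence[OF wm[OF u_continuous] wm[OF short_continuous_on[OF op short]] indm AE_I2 AE_I2])
    show "(\<lambda>k. indicator \<Omega> x * (v k x $ i * ?d x ?e)) \<longlonglongrightarrow> indicator \<Omega> x * (u x $ i * ?d x ?e)" for x
      by (intro tendsto_intros v_tendsto)
    show "norm (indicator \<Omega> x * (v k x $ i * ?d x ?e)) \<le> ((\<bar>V\<bar> + 1) * Bd) * indicator K x" for k x
    proof (cases "x \<in> K")
      case True
      have "\<bar>v k x $ i\<bar> \<le> \<bar>V\<bar> + 1" using Vk[OF True, of k] component_le_norm_cart[of "v k x" i] by linarith
      then have "\<bar>v k x $ i\<bar> * \<bar>?d x ?e\<bar> \<le> (\<bar>V\<bar> + 1) * Bd" using Bd by (intro mult_mono) auto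
      then show ?thesis using True K(2) by (auto simp: abs_mult)
    qed (simp add: d0)
  qed
  have "(\<lambda>k. LINT x|lebesgue. indicator \<Omega> x * (pgrad (v k) x $ i $ j * \<psi> x)) \<longlonglongrightarrow>
      (LINT x|lebesgue. indicator \<Omega> x * (Du x $ i $ j * \<psi> x))"
  proof (rule integral_dominated_convergence[OF gm[OF Du_measurable] gm[OF pgrad_measurable] indm _ AE_I2])
    show "AE x in lebesgue. (\<lambda>k. indicator \<Omega> x * (pgrad (v k) x $ i $ j * \<psi> x)) \<longlonglongrightarrow> indicator \<Omega> x * (Du x $ i $ j * \<psi> x)"
      using AE_Du
    proof eventually_elim
      case (elim x)
      show ?case
      proof (cases "x \<in> \<Omega>")
        case True
        then show ?thesis using elim by (intro tendsto_intros) auto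
      qed simp
    qed
    show "norm (indicator \<Omega> x * (pgrad (v k) x $ i $ j * \<psi> x)) \<le> (1 * B) * indicator K x" for k x
    proof (cases "x \<in> K")
      case True
      have "\<bar>pgrad (v k) x $ i $ j\<bar> * \<bar>\<psi> x\<bar> \<le> 1 * B"
        using contraction_entry_le[OF pgrad_contraction] B by (intro mult_mono) auto
      then show ?thesis using True K(2) by (auto simp: abs_mult)
    qed (simp add: K(3))
  qed
  then have R: "(\<lambda>k. - (LINT x|lebesgue. indicator \<Omega> x * (pgrad (v k) x $ i $ j * \<psi> x))) \<longlonglongrightarrow>
      - (LINT x|lebesgue. indicator \<Omega> x * (Du x $ i $ j * \<psi> x))" by (rule tendsto_minus)
  have "(LINT x|lebesgue. indicator \<Omega> x * (v k x $ i * ?d x ?e)) = - (LINT x|lebesgue. indicator \<Omega> x * (pgrad (v k) x $ i $ j * \<psi> x))" for k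
    using piecewise_affine_integration_by_parts[OF op short sa \<psi>] unfolding integral_lebesgue_on[OF op] .
  then show "(LINT x|lebesgue_on \<Omega>. u x $ i * ?d x ?e) = - (LINT x|lebesgue_on \<Omega>. Du x $ i $ j * \<psi> x)"
    unfolding integral_lebesgue_on[OF op] using L R by (simp only: LIMSEQ_unique)
qed

end

section \<open>Absence of continuous derivatives\<close>

text \<open>Mean value inequality for \<open>g\<close> minus its linear part at \<open>x0\<close>,
  whose derivative is small near \<open>x0\<close> because the partial derivatives are
  continuous.\<close>

lemma C1_local_linear:
  fixes g :: "real ^ 'n \<Rightarrow> real ^ 'm"
  assumes V: "open V" "x0 \<in> V" and g: "Ck_on 1 g V" and \<theta>: "\<theta> > 0"
  obtains r R where "r > 0" "ball x0 r \<subseteq> V"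
    "\<And>x y. x \<in> ball x0 r \<Longrightarrow> y \<in> ball x0 r \<Longrightarrow> norm (g x - g y - R *v (x - y)) \<le> \<theta> * norm (x - y)"
proof -
  let ?D = "\<lambda>x. frechet_derivative g (at x)"
  have D: "(g has_derivative ?D x) (at x)" if "x \<in> V" for x
    using g that by (simp add: frechet_derivative_works)
  have cD: "continuous_on V (\<lambda>x. ?D x h)" for h using g by simp
  define B where "B x = (\<Sum>b\<in>Basis. norm (?D x b - ?D x0 b))" for x
  have "continuous_on V B" unfolding B_def by (intro continuous_intros cD)
  then have "isCont B x0" using V by (simp add: continuous_on_eq_continuous_at)
  moreover have "B x0 = 0" by (simp add: B_def)
  ultimately have "\<forall>\<^sub>F x in at x0. B x < \<theta>" using order_tendstoD(2)[of B "B x0" "at x0" \<theta>] \<theta> by (simp add: isCont_def)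
  then obtain r1 where r1: "r1 > 0" "\<And>x. x \<noteq> x0 \<Longrightarrow> dist x x0 < r1 \<Longrightarrow> B x < \<theta>" unfolding eventually_at by auto
  obtain r2 where r2: "r2 > 0" "ball x0 r2 \<subseteq> V" using V by (meson open_contains_ball)
  define r where "r = min r1 r2"
  have r: "r > 0" "ball x0 r \<subseteq> V" using r1(1) r2 by (auto simp: r_def)
  have Br: "B x \<le> \<theta>" if "x \<in> ball x0 r" for x
    using that r1(2)[of x] \<open>B x0 = 0\<close> \<theta> by (cases "x = x0") (auto simp: r_def dist_commute)
  have L0: "linear (?D x0)" using D[OF V(2)] by (rule has_derivative_linear)
  have on: "norm (?D x h - ?D x0 h) \<le> \<theta> * norm h" if x: "x \<in> ball x0 r" for x h
  proof -
    have L: "linear (\<lambda>h. ?D x h - ?D x0 h)"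
      using has_derivative_linear[OF D] L0 x r(2) by (intro linear_compose_sub) auto
    have "?D x h - ?D x0 h = (\<Sum>b\<in>Basis. (h \<bullet> b) *\<^sub>R (?D x b - ?D x0 b))"
      using linear_sum[OF L, of "\<lambda>b. (h \<bullet> b) *\<^sub>R b" Basis] linear_scale[OF L] by (simp add: euclidean_representation)
    also have "norm \<dots> \<le> (\<Sum>b\<in>Basis. norm h * norm (?D x b - ?D x0 b))"
      by (intro sum_norm_le) (auto intro!: mult_right_mono simp: Basis_le_norm)
    also have "\<dots> = B x * norm h" by (simp add: B_def sum_distrib_left mult.commute)
    also have "\<dots> \<le> \<theta> * norm h" using Br[OF x] by (intro mult_right_mono) auto
    finally show ?thesis .
  qed
  have R: "matrix (?D x0) *v h = ?D x0 h" for h using L0 by (simp add: matrix_works)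
  show ?thesis
  proof (rule that[OF r, of "matrix (?D x0)"])
    fix x y assume xy: "x \<in> ball x0 r" "y \<in> ball x0 r"
    have "norm ((g x - ?D x0 x) - (g y - ?D x0 y)) \<le> \<theta> * norm (x - y)"
    proof (rule differentiable_bound[OF convex_ball[of x0 r] _ _ xy])
      fix z assume z: "z \<in> ball x0 r"
      show "((\<lambda>x. g x - ?D x0 x) has_derivative (\<lambda>h. ?D z h - ?D x0 h)) (at z within ball x0 r)"
      proof -
        have zV: "z \<in> V" using z r(2) by blast
        have bl: "bounded_linear (?D x0)" using L0 by (simp add: linear_conv_bounded_linear)
        show ?thesis
          by (rule has_derivative_diff[OF has_derivative_at_withinI[OF D[OF zV]] bounded_linear_imp_has_derivative[OF bl]])
      qed
      show "onorm (\<lambda>h. ?D z h - ?D x0 h) \<le> \<theta>" by (rule onorm_le[OF on[OF z]])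
    qed
    moreover have "(g x - ?D x0 x) - (g y - ?D x0 y) = g x - g y - matrix (?D x0) *v (x - y)"
      unfolding R linear_diff[OF L0] by simp
    ultimately show "norm (g x - g y - matrix (?D x0) *v (x - y)) \<le> \<theta> * norm (x - y)" by simp
  qed
qed

lemma continuous_AE_imp_eq:
  fixes f g :: "'a::euclidean_space \<Rightarrow> 'b::real_normed_vector"
  assumes V: "open V" and c: "continuous_on V f" "continuous_on V g" and eq: "AE x in lebesgue_on V. f x = g x"
    and x: "x \<in> V"
  shows "f x = g x"
proof (rule ccontr)
  assume "f x \<noteq> g x"
  have "isCont (\<lambda>x. f x - g x) x"
    using continuous_on_diff[OF c] V x by (simp add: continuous_on_eq_continuous_at)
  then obtain r where r: "r > 0" "\<And>y. dist x y < r \<Longrightarrow> f y - g y \<noteq> 0"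
    using continuous_at_avoid[of x "\<lambda>x. f x - g x" 0] \<open>f x \<noteq> g x\<close> by auto
  obtain s where s: "s > 0" "ball x s \<subseteq> V" using V x by (meson open_contains_ball)
  have ae: "AE x in lebesgue. x \<in> V \<longrightarrow> f x = g x" using eq unfolding AE_lebesgue_on_iff[OF sets_lebesgue_open[OF V]] .
  have "min r s > 0" using r(1) s(1) by simp
  then obtain z where z: "norm (z - x) < min r s" "z \<in> V \<longrightarrow> f z = g z"
    by (rule AE_imp_ball_witness[OF ae]) (rule that)
  have "z \<in> ball x s" "dist x z < r" using z(1) by (simp_all add: dist_norm norm_minus_commute)
  then show False using r(2)[of z] s(2) z(2) by auto
qed

lemma frontier_point_in_direction:
  fixes C :: "'a::euclidean_space set"
  assumes "compact C" "p \<in> interior C" "norm e = 1"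
  obtains t where "t > 0" "p + t *\<^sub>R e \<in> C" "p + t *\<^sub>R e \<in> frontier C"
proof -
  obtain M where M: "M > 0" "\<And>x. x \<in> C \<Longrightarrow> norm x \<le> M" using compact_imp_bounded[OF assms(1)] unfolding bounded_pos by blast
  let ?y = "p + (norm p + M + 1) *\<^sub>R e"
  have p: "p \<in> C" using assms(2) interior_subset by blast
  have "norm ((norm p + M + 1) *\<^sub>R e) \<le> norm ?y + norm p" using norm_triangle_ineq4[of ?y p] by simp
  then have "norm ?y > M" using assms(3) M(1) by simp
  then have "?y \<notin> C" using M(2) by force
  obtain q where q: "q \<in> closed_segment p ?y" "q \<in> C" "q \<in> frontier C"
    by (rule segment_exit_point[OF compact_imp_closed[OF assms(1)] p \<open>?y \<notin> C\<close>]) (rule that)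
  obtain s where s: "0 \<le> s" "q = (1 - s) *\<^sub>R p + s *\<^sub>R ?y" using q(1) unfolding closed_segment_def by blast
  have q': "q = p + (s * (norm p + M + 1)) *\<^sub>R e" unfolding s(2) by (simp add: algebra_simps)
  have "s \<noteq> 0" using q(3) assms(2) q' by (auto simp: frontier_def)
  then have "s * (norm p + M + 1) > 0" using s(1) M(1) norm_ge_zero[of p] by (intro mult_pos_pos) linarith+
  then show ?thesis using that q(2,3) unfolding q' by blast
qed

context tent_sequence
begin

lemma cell_diameter: "C \<in> \<C> k \<Longrightarrow> x \<in> C \<Longrightarrow> y \<in> C \<Longrightarrow> norm (x - y) \<le> \<epsilon> / 2 ^ k / 4"
proof -
  assume "C \<in> \<C> k" "x \<in> C" "y \<in> C"
  then have "norm (x - y) \<le> \<epsilon> / 2 ^ Suc k / 2 * bdist \<Omega> x" by (rule tent_stageD(6)[OF stage])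
  also have "\<dots> \<le> \<epsilon> / 2 ^ Suc k / 2 * 1" using \<epsilon> bdist_le_1 by (intro mult_left_mono) auto
  finally show ?thesis by simp
qed

lemma AE_in_cells: "AE x in lebesgue. x \<in> \<Omega> \<longrightarrow> x \<in> \<Union>(\<C> k)"
  using AE_not_in_negligible[OF tent_stageD(3)[OF stage[of k]]] by eventually_elim simp

text \<open>A chord of a cell in direction \<open>e\<close> has both ends on the frontier, where the
  limit equals \<open>v k\<close>; its slope under \<open>u\<close> is thus the constant gradient of
  the cell applied to \<open>e\<close>. In this way near-linearity of \<open>u\<close> constrains
  the gradients of every late generation.\<close>

lemma slope_estimate:
  assumes lin: "\<And>x y. x \<in> ball x0 r \<Longrightarrow> y \<in> ball x0 r \<Longrightarrow> norm (u x - u y - R *v (x - y)) \<le> \<theta>' * norm (x - y)"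
    and r: "ball x0 r \<subseteq> \<Omega>" "\<epsilon> / 2 ^ k < r" and z: "z \<in> ball x0 (r / 2)" "strictly_affine_at (v k) z" and e: "norm e = 1"
  shows "norm ((pgrad (v k) z - R) *v e) \<le> \<theta>'"
proof -
  have r0: "r > 0" using r(2) \<epsilon> by (smt (verit) divide_pos_pos zero_less_power)
  obtain \<rho> c where \<rho>: "\<rho> > 0" "\<And>y. y \<in> ball z \<rho> \<Longrightarrow> strictly_affine_at (v k) y \<and> pgrad (v k) y = pgrad (v k) z"
    by (rule strictly_affine_at_pgrad[OF z(2)]) (assumption | rule that)+
  \<comment> \<open>\<open>z\<close> itself may lie in no cell; a nearby point \<open>z1\<close> of
    a cell has the same gradient, because \<open>v k\<close> is affine near
    \<open>z\<close>.\<close>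
  have "min \<rho> (r / 4) > 0" using \<rho>(1) r0 by simp
  then obtain z1 where z1: "norm (z1 - z) < min \<rho> (r / 4)" "z1 \<in> \<Omega> \<longrightarrow> z1 \<in> \<Union>(\<C> k)"
    by (rule AE_imp_ball_witness[OF AE_in_cells]) (rule that)
  have nz: "norm (z1 - x0) < 3 * r / 4"
    using z1(1) z(1) norm_triangle_ineq[of "z1 - z" "z - x0"] by (simp add: dist_norm norm_minus_commute)
  then have "z1 \<in> ball x0 r" using r0 by (simp add: dist_norm norm_minus_commute)
  then obtain C where C: "C \<in> \<C> k" "z1 \<in> C" using z1(2) r(1) by blast
  have Cb: "y \<in> ball x0 r" if "y \<in> C" for y
  proof -
    have "norm (y - z1) < r / 4" using cell_diameter[OF C(1) that C(2)] r(2) by simp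
    then show ?thesis using nz norm_triangle_ineq[of "y - z1" "z1 - x0"] by (simp add: dist_norm norm_minus_commute)
  qed
  have pc: "perturbed_cell (v k) (v (Suc k)) C" by (rule tent_stageD(5)[OF stage C(1)])
  obtain A where A: "\<forall>x\<in>C. strictly_affine_at (v k) x \<and> pgrad (v k) x = A \<and> (\<forall>y\<in>C. v k x - v k y = A *v (x - y))"
    using pc unfolding perturbed_cell_def by (elim conjE exE) (rule that)
  have Az: "A = pgrad (v k) z"
    using A C(2) \<rho>(2)[of z1] z1(1) by (auto simp: dist_norm norm_minus_commute)
  obtain p0 where p0: "p0 \<in> interior C" using perturbed_cellD(3)[OF pc] by blast
  obtain t where t: "t > 0" "p0 + t *\<^sub>R e \<in> C" "p0 + t *\<^sub>R e \<in> frontier C"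
    by (rule frontier_point_in_direction[OF perturbed_cellD(1)[OF pc] p0 e]) (rule that)
  have "norm (- e) = 1" using e by simp
  then obtain s where s: "s > 0" "p0 + s *\<^sub>R (- e) \<in> C" "p0 + s *\<^sub>R (- e) \<in> frontier C"
    by (rule frontier_point_in_direction[OF perturbed_cellD(1)[OF pc] p0]) (rule that)
  let ?p = "p0 + t *\<^sub>R e" and ?q = "p0 + s *\<^sub>R (- e)"
  have pq: "?p - ?q = (t + s) *\<^sub>R e" by (simp add: algebra_simps)
  have "u ?p - u ?q = A *v (?p - ?q)"
    using A t(2) s(2) u_eq_on_frontier[OF C(1)] t(3) s(3) by simp
  then have "norm (A *v (?p - ?q) - R *v (?p - ?q)) \<le> \<theta>' * norm (?p - ?q)"
    using lin[OF Cb[OF t(2)] Cb[OF s(2)]] by simp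
  then have "norm ((t + s) *\<^sub>R ((A - R) *v e)) \<le> \<theta>' * (t + s)"
    unfolding pq using e t(1) s(1) by (simp add: matrix_vector_mult_scaleR matrix_vector_mult_diff_rdistrib scaleR_diff_right)
  then show ?thesis using t(1) s(1) unfolding Az by (simp add: mult.commute)
qed

lemma u_nowhere_C1: "nowhere_C1 \<Omega> u"
  unfolding nowhere_C1_def
proof
  assume "\<exists>V g. open V \<and> V \<noteq> {} \<and> V \<subseteq> \<Omega> \<and> Ck_on 1 g V \<and> (AE x in lebesgue_on V. u x = g x)"
  then obtain V g x0 where V: "open V" "x0 \<in> V" "V \<subseteq> \<Omega>" and g: "Ck_on 1 g V" and eq: "AE x in lebesgue_on V. u x = g x"
    by blast
  have cg: "continuous_on V g"
    using g V(1) by (auto simp: continuous_on_eq_continuous_at differentiable_imp_continuous_within)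
  have ug: "u x = g x" if "x \<in> V" for x
    by (rule continuous_AE_imp_eq[OF V(1) continuous_on_subset[OF u_continuous V(3)] cg eq that])
  \<comment> \<open>The tolerance 1/4 will be used for two gradients, so they differ by at most 1/2
    in a unit direction, whereas every cell contains two that differ by at least 1.\<close>
  obtain r R where r: "r > 0" "ball x0 r \<subseteq> V"
    "\<And>x y. x \<in> ball x0 r \<Longrightarrow> y \<in> ball x0 r \<Longrightarrow> norm (g x - g y - R *v (x - y)) \<le> 1 / 4 * norm (x - y)"
    by (rule C1_local_linear[OF V(1,2) g, of "1/4"]) (simp | assumption | rule that)+
  have lin: "norm (u x - u y - R *v (x - y)) \<le> 1 / 4 * norm (x - y)" if "x \<in> ball x0 r" "y \<in> ball x0 r" for x y
    using r(3)[OF that] ug that r(2) by (metis subsetD)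
  have "\<forall>\<^sub>F k in sequentially. \<epsilon> / 2 ^ k < r" using order_tendstoD(2)[OF halving r(1)] .
  then obtain k where k: "\<And>m. m \<ge> k \<Longrightarrow> \<epsilon> / 2 ^ m < r" unfolding eventually_sequentially by blast
  have "r / 4 > 0" using r(1) by simp
  then obtain x1 where x1: "norm (x1 - x0) < r / 4" "x1 \<in> \<Omega> \<longrightarrow> x1 \<in> \<Union>(\<C> k)"
    by (rule AE_imp_ball_witness[OF AE_in_cells]) (rule that)
  have "x1 \<in> ball x0 r" using x1(1) r(1) by (simp add: dist_norm norm_minus_commute)
  then obtain C where C: "C \<in> \<C> k" "x1 \<in> C" using x1(2) r(2) V(3) by blast
  have Cb: "y \<in> ball x0 (r / 2)" if "y \<in> C" for y
  proof -
    have "norm (y - x1) < r / 4" using cell_diameter[OF C(1) that C(2)] k[of k] by simp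
    then show ?thesis using x1(1) norm_triangle_ineq[of "y - x1" "x1 - x0"] by (simp add: dist_norm norm_minus_commute)
  qed
  have "\<exists>x\<in>interior C. \<exists>y\<in>interior C. \<exists>e. norm e = 1 \<and> strictly_affine_at (v (Suc k)) x \<and> strictly_affine_at (v (Suc k)) y \<and>
      1 \<le> norm ((pgrad (v (Suc k)) x - pgrad (v (Suc k)) y) *v e)"
    using tent_stageD(5)[OF stage C(1)] by (simp add: perturbed_cell_def)
  then obtain x y e where xy: "x \<in> interior C" "y \<in> interior C" "norm e = 1" "strictly_affine_at (v (Suc k)) x"
    "strictly_affine_at (v (Suc k)) y" "1 \<le> norm ((pgrad (v (Suc k)) x - pgrad (v (Suc k)) y) *v e)" by blast
  have rO: "ball x0 r \<subseteq> \<Omega>" using r(2) V(3) by blast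
  have xyB: "x \<in> ball x0 (r / 2)" "y \<in> ball x0 (r / 2)" using Cb interior_subset xy(1,2) by blast+
  \<comment> \<open>The oscillation inside a cell of generation \<open>k\<close> is that of the next
    map, so the slope estimate is needed for \<open>Suc k\<close>.\<close>
  note sl = slope_estimate[OF lin rO k, of "Suc k" _ e]
  have "norm ((pgrad (v (Suc k)) x - R) *v e) \<le> 1 / 4" "norm ((pgrad (v (Suc k)) y - R) *v e) \<le> 1 / 4"
    using sl xyB xy by simp_all
  moreover have "(pgrad (v (Suc k)) x - pgrad (v (Suc k)) y) *v e = (pgrad (v (Suc k)) x - R) *v e - (pgrad (v (Suc k)) y - R) *v e"
    by (simp add: matrix_vector_mult_diff_rdistrib)
  ultimately show False
    using xy(6) norm_triangle_ineq4[of "(pgrad (v (Suc k)) x - R) *v e" "(pgrad (v (Suc k)) y - R) *v e"] by simp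
qed

end

section \<open>The energy-momentum equations\<close>

text \<open>The hull consists of contractions. An interior point can be enlarged by a factor 1 + s
  without leaving it, which yields the contraction constant 1 / (1 + s).\<close>

lemma interior_convex_hull_O_maps:
  fixes X :: "real ^ 'n ^ 'n"
  assumes "X \<in> interior (convex hull O_maps)"
  shows "\<exists>c<1. \<forall>h. norm (X *v h) \<le> c * norm h"
proof -
  let ?S = "{M :: real ^ 'n ^ 'n. \<forall>h. norm (M *v h) \<le> norm h}"
  have "O_maps \<subseteq> ?S"
  proof clarify
    fix M :: "real ^ 'n ^ 'n" and h assume "M \<in> O_maps"
    then have "orthogonal_matrix M" by (simp add: O_maps_def orthogonal_matrix)
    then show "norm (M *v h) \<le> norm h"
      by (simp add: orthogonal_transformation_matrix[of "(*v) M"] orthogonal_transformation_norm matrix_of_matrix_vector_mul)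
  qed
  moreover have "convex ?S"
    unfolding convex_def
  proof clarify
    fix M N :: "real ^ 'n ^ 'n" and s t :: real and h
    assume M: "\<forall>h. norm (M *v h) \<le> norm h" "\<forall>h. norm (N *v h) \<le> norm h" and st: "0 \<le> s" "0 \<le> t" "s + t = 1"
    have "norm ((s *\<^sub>R M + t *\<^sub>R N) *v h) \<le> s * norm (M *v h) + t * norm (N *v h)"
      using st norm_triangle_ineq[of "s *\<^sub>R (M *v h)" "t *\<^sub>R (N *v h)"]
      by (simp add: matrix_vector_mult_add_rdistrib scaleR_matrix_vector_assoc[symmetric])
    also have "\<dots> \<le> s * norm h + t * norm h" using M st by (intro add_mono mult_left_mono) auto
    finally show "norm ((s *\<^sub>R M + t *\<^sub>R N) *v h) \<le> norm h" using st(3) by (simp flip: distrib_right)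
  qed
  ultimately have sub: "convex hull O_maps \<subseteq> ?S" by (rule hull_minimal)
  obtain e where e: "e > 0" "ball X e \<subseteq> convex hull O_maps" using assms mem_interior by blast
  show ?thesis
  proof (cases "X = 0")
    case True
    then show ?thesis by (intro exI[of _ 0]) simp
  next
    case False
    define s where "s = e / (2 * norm X)"
    have s: "s > 0" using e(1) False by (simp add: s_def)
    have "dist X ((1 + s) *\<^sub>R X) = s * norm X" using s by (simp add: dist_norm scaleR_add_left)
    also have "\<dots> < e" using e(1) False by (simp add: s_def)
    finally have "(1 + s) *\<^sub>R X \<in> ?S" using e(2) sub by (meson mem_ball subset_iff)
    then have "(1 + s) * norm (X *v h) \<le> norm h" for h
      using s by (simp add: scaleR_matrix_vector_assoc[symmetric])
    then have "norm (X *v h) \<le> (1 / (1 + s)) * norm h" for h using s by (simp add: field_simps)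
    moreover have "1 / (1 + s) < 1" using s by simp
    ultimately show ?thesis by blast
  qed
qed

lemma O_maps_subset_GL_maps: "R \<in> O_maps \<Longrightarrow> R \<in> GL_maps"
proof -
  assume "R \<in> O_maps"
  then have "det (transpose R ** R) = 1" by (simp add: O_maps_def)
  then have "det R * det R = 1" unfolding det_mul det_transpose .
  then show "R \<in> GL_maps" by (auto simp: GL_maps_def)
qed

lemma O_maps_transpose: "R \<in> O_maps \<Longrightarrow> R ** transpose R = mat 1" "R \<in> O_maps \<Longrightarrow> transpose R \<in> O_maps"
proof -
  assume "R \<in> O_maps"
  then have "transpose R ** R = mat 1" by (simp add: O_maps_def)
  then show 1: "R ** transpose R = mat 1" by (simp add: matrix_left_right_inverse)
  then show "transpose R \<in> O_maps" by (simp add: O_maps_def)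
qed

lemma open_GL_maps: "open (GL_maps :: (real ^ 'n ^ 'n) set)"
proof -
  have "continuous_on UNIV (det :: real ^ 'n ^ 'n \<Rightarrow> real)" unfolding det_def by (intro continuous_intros)
  then show ?thesis unfolding GL_maps_def by (intro open_Collect_neq continuous_on_const)
qed

lemma gradient_eqI:
  assumes "GDERIV f x :> D"
  shows "gradient f x = D"
  unfolding gradient_def
proof (rule the_equality[where P = "\<lambda>D. GDERIV f x :> D", OF assms])
  fix D' assume "GDERIV f x :> D'"
  then have "(\<lambda>h. h \<bullet> D') = (\<lambda>h. h \<bullet> D)"
    using assms unfolding gderiv_def by (rule has_derivative_unique)
  then have "(D' - D) \<bullet> D' = (D' - D) \<bullet> D" by (rule fun_cong)
  then have "(D' - D) \<bullet> (D' - D) = 0" by (simp only: inner_diff_right diff_self)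
  then show "D' = D" by simp
qed

text \<open>Differentiating \<open>W (transpose R ** Y) = W Y\<close> at \<open>Y = R\<close> gives \<open>gradient W R = R ** gradient W (mat 1)\<close>.\<close>

lemma energy_momentum_O_maps:
  fixes W :: "real ^ 'n ^ 'n \<Rightarrow> real"
  assumes smooth: "Cinfinity_on W GL_maps"
    and inv: "\<And>X R. X \<in> GL_maps \<Longrightarrow> R \<in> O_maps \<Longrightarrow> W (R ** X) = W X"
    and R: "R \<in> O_maps"
  shows "energy_momentum W R = energy_momentum W (mat 1)"
proof -
  have I: "(mat 1 :: real ^ 'n ^ 'n) \<in> GL_maps" by (simp add: GL_maps_def)
  have "Ck_on (Suc 0) W GL_maps" using smooth unfolding Cinfinity_on_def by blast
  then have "W differentiable (at (mat 1))" using I by simp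
  then obtain W' where W': "(W has_derivative W') (at (mat 1))" unfolding differentiable_def by blast
  \<comment> \<open>Riesz representation of the derivative at the identity, that is, the gradient
    for the trace inner product.\<close>
  define D where "D = (\<Sum>b\<in>Basis. W' b *\<^sub>R b)"
  have W'D: "W' h = h \<bullet> D" for h
  proof -
    have "W' h = (\<Sum>b\<in>Basis. (h \<bullet> b) * W' b)"
      using linear_sum[OF has_derivative_linear[OF W'], of "\<lambda>b. (h \<bullet> b) *\<^sub>R b" Basis]
        linear_scale[OF has_derivative_linear[OF W']] by (simp add: euclidean_representation)
    then show ?thesis by (simp add: D_def inner_sum_right mult.commute)
  qed
  have "GDERIV W (mat 1) :> D" using W' unfolding gderiv_def W'D[abs_def] W'D .
  then have gI: "gradient W (mat 1) = D" by (rule gradient_eqI)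
  note RT = O_maps_transpose[OF R]
  have TR: "transpose R ** R = mat 1" using R by (simp add: O_maps_def)
  have bl: "bounded_linear (\<lambda>Y :: real ^ 'n ^ 'n. transpose R ** Y)"
    unfolding linear_conv_bounded_linear[symmetric]
  proof (rule linearI)
    show "transpose R ** (X + Y) = transpose R ** X + transpose R ** Y" for X Y :: "real ^ 'n ^ 'n" by (rule matrix_add_ldistrib)
    show "transpose R ** (c *\<^sub>R X) = c *\<^sub>R (transpose R ** X)" for c and X :: "real ^ 'n ^ 'n"
      by (simp add: vec_eq_iff matrix_matrix_mult_def sum_distrib_left mult_ac)
  qed
  have WR: "(W has_derivative W') (at (transpose R ** R))" using W' TR by simp
  have "((\<lambda>Y. W (transpose R ** Y)) has_derivative (\<lambda>h. W' (transpose R ** h))) (at R)"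
    by (rule has_derivative_compose[OF bounded_linear_imp_has_derivative[OF bl] WR])
  then have "(W has_derivative (\<lambda>h. W' (transpose R ** h))) (at R)"
    by (rule has_derivative_transform_within_open[OF _ open_GL_maps O_maps_subset_GL_maps[OF R]]) (rule inv[OF _ RT(2)])
  moreover have "W' (transpose R ** h) = h \<bullet> (R ** D)" for h
    unfolding W'D inner_matrix_eq_trace by (simp add: matrix_transpose_mul matrix_mul_assoc)
  ultimately have "GDERIV W R :> (R ** D)" unfolding gderiv_def by simp
  then have gR: "gradient W R = R ** D" by (rule gradient_eqI)
  have "W R = W (mat 1)" using inv[OF I R] by simp
  then show ?thesis unfolding energy_momentum_def gR gI by (simp add: matrix_mul_assoc TR)
qed

text \<open>Each entry of the Jacobian is a partial derivative of a compactly supported function and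
  integrates to 0 over the whole space; off \<Omega> the Jacobian vanishes.\<close>

lemma integral_jacobian_test_function:
  fixes \<eta> :: "real ^ 'n \<Rightarrow> real ^ 'n" and C :: "real ^ 'n ^ 'n"
  assumes op: "open \<Omega>" and \<eta>: "\<eta> \<in> test_functions \<Omega>"
  shows "has_bochner_integral (lebesgue_on \<Omega>) (\<lambda>x. C \<bullet> jacobian \<eta> (at x)) 0"
proof -
  let ?d = "\<lambda>x. frechet_derivative \<eta> (at x)"
  obtain K where K: "compact K" "K \<subseteq> \<Omega>" "\<And>x. x \<notin> K \<Longrightarrow> \<eta> x = 0"
    and d: "\<And>x. (\<eta> has_derivative ?d x) (at x)" "\<And>v. continuous_on UNIV (\<lambda>x. ?d x v)"
    by (rule test_function_props[OF \<eta>]) (rule that)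
  have J: "C \<bullet> jacobian \<eta> (at x) = (\<Sum>i\<in>UNIV. \<Sum>j\<in>UNIV. C $ i $ j * ?d x (axis j 1) $ i)" for x
    by (simp add: inner_vec_def jacobian_def matrix_def)
  have "integrable lebesgue (\<lambda>x. ?d x w $ i) \<and> (\<integral>x. ?d x w $ i \<partial>lebesgue) = 0" for w i
  proof -
    have 0: "\<eta> x $ i = 0" if "x \<notin> K" for x using K(3)[OF that] by simp
    have 1: "((\<lambda>x. \<eta> x $ i) has_derivative (\<lambda>h. ?d x h $ i)) (at x)" for x
      by (rule bounded_linear.has_derivative[OF bounded_linear_vec_nth d(1)])
    have 2: "continuous_on UNIV (\<lambda>x. ?d x h $ i)" for h by (intro continuous_intros d(2))
    show ?thesis using integral_test_derivative_zero[OF K(1) 0 1 2] by blast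
  qed
  then have "integrable lebesgue (\<lambda>x. C \<bullet> jacobian \<eta> (at x)) \<and> (\<integral>x. C \<bullet> jacobian \<eta> (at x) \<partial>lebesgue) = 0"
    unfolding J by simp
  moreover have "(\<lambda>x. indicator \<Omega> x *\<^sub>R (C \<bullet> jacobian \<eta> (at x))) = (\<lambda>x. C \<bullet> jacobian \<eta> (at x))"
  proof
    fix x show "indicator \<Omega> x *\<^sub>R (C \<bullet> jacobian \<eta> (at x)) = C \<bullet> jacobian \<eta> (at x)"
    proof (cases "x \<in> \<Omega>")
      case False
      then have "?d x = (\<lambda>v. 0)" using has_derivative_zero_off_compact_support[OF K(1) K(3) d(1)] K(2) by blast
      then show ?thesis unfolding J by simp
    qed simp
  qed
  moreover have "\<Omega> \<inter> space lebesgue \<in> sets lebesgue" using op by simp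
  ultimately show ?thesis
    by (simp only: has_bochner_integral_iff integrable_restrict_space integral_restrict_space simp_thms)
qed

section \<open>Boundary values and distinct solutions\<close>

lemma Ck_on_affine:
  fixes M :: "real ^ 'n ^ 'm"
  shows "Ck_on 1 (\<lambda>y. a + M *v (y - x)) V"
proof -
  have d: "((\<lambda>y. a + M *v (y - x)) has_derivative (*v) M) (at z)" for z
    by (rule has_derivative_affine[OF matrix_vector_mul_linear])
  then have "frechet_derivative (\<lambda>y. a + M *v (y - x)) (at z) = (*v) M" for z
    using frechet_derivative_at[OF d, symmetric] by simp
  then show ?thesis using d by (auto simp: differentiable_def)
qed

text \<open>Shows that a solution built from the affine approximation differs from it somewhere, so
  that the distance between them is a positive number which the next solution can undercut.\<close>

lemma not_nowhere_C1_if_strictly_affine: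
  fixes a :: "real ^ 'n \<Rightarrow> real ^ 'n"
  assumes op: "open \<Omega>" and ne: "\<Omega> \<noteq> {}" and sa: "AE x in lebesgue. x \<in> \<Omega> \<longrightarrow> strictly_affine_at a x"
    and eq: "\<And>x. x \<in> \<Omega> \<Longrightarrow> u x = a x"
  shows "\<not> nowhere_C1 \<Omega> u"
proof -
  obtain x0 r0 where r0: "r0 > 0" "ball x0 r0 \<subseteq> \<Omega>" using op ne by (meson ex_in_conv open_contains_ball)
  obtain x where x: "norm (x - x0) < r0" "x \<in> \<Omega> \<longrightarrow> strictly_affine_at a x"
    by (rule AE_imp_ball_witness[OF sa r0(1)]) (rule that)
  have xO: "x \<in> \<Omega>" using x(1) r0(2) by (auto simp: dist_norm norm_minus_commute)
  then have "strictly_affine_at a x" using x(2) by blast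
  then obtain r c where r: "r > 0" "\<And>y. y \<in> ball x r \<Longrightarrow> a y = a x + pgrad a x *v (y - x)"
    by (rule strictly_affine_at_pgrad) (assumption | rule that)+
  have "x \<in> ball x r \<inter> \<Omega>" using r(1) xO by simp
  then have V: "open (ball x r \<inter> \<Omega>)" "ball x r \<inter> \<Omega> \<noteq> {}" "ball x r \<inter> \<Omega> \<subseteq> \<Omega>" using op by (blast intro: open_Int)+
  have "AE y in lebesgue_on (ball x r \<inter> \<Omega>). u y = a x + pgrad a x *v (y - x)"
  proof (rule AE_I2)
    fix y assume "y \<in> space (lebesgue_on (ball x r \<inter> \<Omega>))"
    then have "y \<in> ball x r" "y \<in> \<Omega>" by simp_all
    then show "u y = a x + pgrad a x *v (y - x)" using eq[of y] r(2)[of y] by metis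
  qed
  then show ?thesis unfolding nowhere_C1_def not_not
    by (intro exI[of _ "ball x r \<inter> \<Omega>"] exI[of _ "\<lambda>y. a x + pgrad a x *v (y - x)"] conjI V Ck_on_affine)
qed

text \<open>The difference, extended by 0, is continuous across the boundary because it is dominated
  by a multiple of \<open>bdist\<close>, which tends to 0 there. The maps themselves need not extend
  continuously to the closure.\<close>

lemma equal_on_boundary_if_close:
  fixes u f \<phi> :: "real ^ 'n \<Rightarrow> real ^ 'n"
  assumes op: "open \<Omega>" and c: "continuous_on \<Omega> u" "continuous_on \<Omega> f"
    and close: "\<And>x. x \<in> \<Omega> \<Longrightarrow> norm (u x - f x) \<le> c0 * bdist \<Omega> x"
    and eq: "AE x in lebesgue_on \<Omega>. f x = \<phi> x"
  shows "equal_on_boundary \<Omega> u \<phi>"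
proof -
  define w where "w x = (if x \<in> \<Omega> then u x - f x else 0)" for x
  have wb: "norm (w x) \<le> \<bar>c0\<bar> * bdist \<Omega> x" for x
  proof (cases "x \<in> \<Omega>")
    case True
    have "c0 * bdist \<Omega> x \<le> \<bar>c0\<bar> * bdist \<Omega> x" using bdist_nonneg by (intro mult_right_mono) auto
    then show ?thesis using close[OF True] True by (simp add: w_def)
  qed (simp add: w_def bdist_nonneg)
  have "isCont w x" for x
  proof (cases "x \<in> \<Omega>")
    case True
    have "continuous_on \<Omega> w" using continuous_on_diff[OF c] by (rule continuous_on_eq) (simp add: w_def)
    then show ?thesis using op True by (simp add: continuous_on_eq_continuous_at)
  next
    case False
    have "isCont (bdist \<Omega>) x" using continuous_on_bdist[of UNIV \<Omega>] by (simp add: continuous_on_eq_continuous_at)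
    then have "(\<lambda>y. \<bar>c0\<bar> * bdist \<Omega> y) \<midarrow>x\<rightarrow> \<bar>c0\<bar> * bdist \<Omega> x" unfolding isCont_def by (intro tendsto_intros)
    then have "(\<lambda>y. \<bar>c0\<bar> * bdist \<Omega> y) \<midarrow>x\<rightarrow> 0" using bdist_outside[OF False] by simp
    then have "w \<midarrow>x\<rightarrow> 0" by (rule Lim_null_comparison[rotated]) (simp add: wb)
    then show ?thesis using False by (simp add: isCont_def w_def)
  qed
  then have cw: "continuous_on (closure \<Omega>) w" by (simp add: continuous_at_imp_continuous_on)
  have "AE x in lebesgue. x \<in> \<Omega> \<longrightarrow> f x = \<phi> x" using eq unfolding AE_lebesgue_on_iff[OF sets_lebesgue_open[OF op]] .
  then have "AE x in lebesgue_on \<Omega>. w x = u x - \<phi> x"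
    unfolding AE_lebesgue_on_iff[OF sets_lebesgue_open[OF op]] by eventually_elim (simp add: w_def)
  moreover have "\<forall>x\<in>frontier \<Omega>. w x = 0" using op by (simp add: w_def frontier_def interior_open)
  ultimately show ?thesis unfolding equal_on_boundary_def using cw by blast
qed

text \<open>The set \<Omega> must be nonempty, since over the empty set all functions agree almost
  everywhere. Functions stand for classes modulo null sets, so infinitude of the set of solutions is
  supplemented by difference modulo null sets.\<close>

theorem theorem0p1:
  fixes \<Omega> :: "(real ^ 'n) set"
    and W :: "real ^ 'n ^ 'n \<Rightarrow> real"
    and \<phi> :: "real ^ 'n \<Rightarrow> real ^ 'n"
    and D\<phi> :: "real ^ 'n \<Rightarrow> real ^ 'n ^ 'n"
  assumes "open \<Omega>" and "\<Omega> \<noteq> {}"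
    and "Cinfinity_on W GL_maps"
    and "\<And>X R. X \<in> GL_maps \<Longrightarrow> R \<in> O_maps \<Longrightarrow> W (R ** X) = W X"
    and "\<phi> \<in> W1_infinity \<Omega>"
    and "weak_derivative \<Omega> \<phi> D\<phi>"
    and "AE x in lebesgue_on \<Omega>. D\<phi> x \<in> interior (convex hull O_maps)"
  shows "\<exists>S. infinite S \<and>
    (\<forall>u\<in>S. u \<in> W1_infinity \<Omega> \<and> energy_momentum_solution \<Omega> W u \<and>
       equal_on_boundary \<Omega> u \<phi> \<and> nowhere_C1 \<Omega> u) \<and>
    (\<forall>u\<in>S. \<forall>v\<in>S. u \<noteq> v \<longrightarrow> \<not> (AE x in lebesgue_on \<Omega>. u x = v x))"
proof -
  note op = assms(1)
  have L: "\<phi> \<in> L_infinity \<Omega>" using assms(5) by (simp add: W1_infinity_def)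
  have ct: "AE x in lebesgue_on \<Omega>. \<exists>c<1. \<forall>h. norm (D\<phi> x *v h) \<le> c * norm h"
    using assms(7) by eventually_elim (rule interior_convex_hull_O_maps)
  obtain f K where f: "short_on \<Omega> f" "\<And>x. x \<in> \<Omega> \<Longrightarrow> norm (f x) \<le> K"
    "AE x in lebesgue_on \<Omega>. f x = \<phi> x" "AE x in lebesgue_on \<Omega>. strict_at f x"
    by (rule weak_contraction_representative[OF op assms(6) L ct]) (rule that)
  have st: "AE x in lebesgue. x \<in> \<Omega> \<longrightarrow> strict_at f x"
    using f(4) unfolding AE_lebesgue_on_iff[OF sets_lebesgue_open[OF op]] .
  \<comment> \<open>One approximation \<open>a\<close> serves for all solutions: its distance to
    \<open>f\<close> need not be small, only bounded by \<open>bdist\<close>, while the size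
    \<epsilon> of the tents added to it varies.\<close>
  obtain a where a: "short_on \<Omega> a" "\<And>x. x \<in> \<Omega> \<Longrightarrow> norm (a x - f x) \<le> 1 * bdist \<Omega> x"
    "AE x in lebesgue. x \<in> \<Omega> \<longrightarrow> strictly_affine_at a x"
    by (rule strictly_affine_approximation[OF op f(1) zero_less_one order_refl st]) (rule that)
  define sol where "sol u \<longleftrightarrow> u \<in> W1_infinity \<Omega> \<and> energy_momentum_solution \<Omega> W u \<and>
       equal_on_boundary \<Omega> u \<phi> \<and> nowhere_C1 \<Omega> u" for u
  have ex: "\<exists>u. sol u \<and> continuous_on \<Omega> u \<and> (\<forall>x\<in>\<Omega>. norm (u x - a x) \<le> \<epsilon>)" if \<epsilon>: "0 < \<epsilon>" "\<epsilon> \<le> 1" for \<epsilon>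
  proof -
    obtain v \<C> where ts: "tent_sequence \<Omega> \<epsilon> v \<C>" and v0: "v 0 = a"
      by (rule tent_sequence_exists[OF op \<epsilon> a(1,3)]) (rule that)
    interpret tent_sequence \<Omega> \<epsilon> v \<C> by (rule ts)
    have close: "norm (u x - a x) \<le> \<epsilon> * bdist \<Omega> x" for x using u_close[of x 0] v0 by simp
    have close1: "norm (u x - a x) \<le> \<epsilon>" for x
    proof -
      have "\<epsilon> * bdist \<Omega> x \<le> \<epsilon> * 1" using \<epsilon>(1) bdist_le_1 by (intro mult_left_mono) auto
      then show ?thesis using close[of x] by linarith
    qed
    have close2: "norm (u x - f x) \<le> 2 * bdist \<Omega> x" if "x \<in> \<Omega>" for x
    proof -
      have "norm (u x - f x) \<le> norm (u x - a x) + norm (a x - f x)"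
        using norm_triangle_ineq[of "u x - a x" "a x - f x"] by simp
      also have "\<dots> \<le> 1 * bdist \<Omega> x + 1 * bdist \<Omega> x"
        using a(2)[OF that] close[of x] mult_right_mono[OF \<epsilon>(2) bdist_nonneg[of \<Omega> x]] by linarith
      finally show ?thesis by simp
    qed
    have om: "\<Omega> \<in> sets lebesgue" using op by (rule sets_lebesgue_open)
    have "norm (u x) \<le> K + 2" if "x \<in> \<Omega>" for x
      using close2[OF that] f(2)[OF that] bdist_le_1[of \<Omega> x] norm_triangle_sub[of "u x" "f x"] by simp
    then have "AE x in lebesgue_on \<Omega>. norm (u x) \<le> K + 2" by (intro AE_I2) simp
    moreover have "u \<in> borel_measurable (lebesgue_on \<Omega>)"
      by (rule continuous_imp_measurable_on_sets_lebesgue[OF u_continuous om])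
    ultimately have "u \<in> L_infinity \<Omega>" unfolding L_infinity_def by blast
    moreover have "Du \<in> L_infinity \<Omega>"
      unfolding L_infinity_def using measurable_restrict_space1[OF Du_measurable] Du_bound by blast
    ultimately have "u \<in> W1_infinity \<Omega>" unfolding W1_infinity_def using u_weak_derivative by blast
    moreover have "energy_momentum_solution \<Omega> W u"
      unfolding energy_momentum_solution_def
    proof (intro exI[of _ Du] conjI ballI AE_I2)
      show "weak_derivative \<Omega> u Du" by (rule u_weak_derivative)
      show "Du x \<in> GL_maps" for x by (rule O_maps_subset_GL_maps[OF Du_in_O])
      fix \<eta> :: "real ^ 'n \<Rightarrow> real ^ 'n" assume \<eta>: "\<eta> \<in> test_functions \<Omega>"
      have "energy_momentum W (Du x) = energy_momentum W (mat 1)" for x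
        by (rule energy_momentum_O_maps[OF assms(3,4) Du_in_O])
      then show "has_bochner_integral (lebesgue_on \<Omega>) (\<lambda>x. energy_momentum W (Du x) \<bullet> jacobian \<eta> (at x)) 0"
        using integral_jacobian_test_function[OF op \<eta>] by simp
    qed
    moreover have "equal_on_boundary \<Omega> u \<phi>"
      by (rule equal_on_boundary_if_close[OF op u_continuous short_continuous_on[OF op f(1)] close2 f(3)])
    ultimately show ?thesis unfolding sol_def using u_nowhere_C1 u_continuous close1 by blast
  qed
  \<comment> \<open>The number stored with a solution is reached by its distance from
    \<open>a\<close> at some point of \<Omega>. The next solution stays within half of that number
    everywhere, so the two differ at that point, and by continuity on a set of positive
    measure.\<close>
  define P where "P k s \<longleftrightarrow> sol (fst s) \<and> continuous_on \<Omega> (fst s) \<and> 0 < snd s \<and> snd s \<le> 1 \<and>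
      (\<exists>x\<in>\<Omega>. norm (fst s x - a x) \<ge> snd s)" for k :: nat and s :: "(real ^ 'n \<Rightarrow> real ^ 'n) \<times> real"
  define R where "R k s s' \<longleftrightarrow> snd s' \<le> snd s \<and> (\<forall>x\<in>\<Omega>. norm (fst s' x - a x) \<le> snd s / 2)"
    for k :: nat and s s' :: "(real ^ 'n \<Rightarrow> real ^ 'n) \<times> real"
  have step: "\<exists>s'. P k s' \<and> snd s' \<le> \<delta> \<and> (\<forall>x\<in>\<Omega>. norm (fst s' x - a x) \<le> \<delta> / 2)" if \<delta>: "0 < \<delta>" "\<delta> \<le> 1" for \<delta> k
  proof -
    obtain u where u: "sol u" "continuous_on \<Omega> u" "\<forall>x\<in>\<Omega>. norm (u x - a x) \<le> \<delta> / 2" using ex[of "\<delta> / 2"] \<delta> by auto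
    have "\<exists>x\<in>\<Omega>. u x \<noteq> a x"
      using not_nowhere_C1_if_strictly_affine[OF op assms(2) a(3), of u] u(1) unfolding sol_def by blast
    then obtain x where x: "x \<in> \<Omega>" "u x \<noteq> a x" by blast
    have "norm (u x - a x) > 0" "norm (u x - a x) \<le> \<delta>" using x u(3) \<delta>(1) by fastforce+
    then have "P k (u, norm (u x - a x))" using u x \<delta> by (auto simp: P_def)
    then show ?thesis using u(3) \<open>norm (u x - a x) \<le> \<delta>\<close> by (intro exI[of _ "(u, norm (u x - a x))"]) simp
  qed
  have "\<exists>s. \<forall>k. P k (s k) \<and> R k (s k) (s (Suc k))"
  proof (rule dependent_nat_choice)
    show "\<exists>s. P 0 s" using step[of 1 0] by auto
    show "\<exists>s'. P (Suc k) s' \<and> R k s s'" if "P k s" for s k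
      using step[of "snd s" "Suc k"] that unfolding P_def[of k] R_def by auto
  qed
  then obtain s where s: "\<And>k. P k (s k)" "\<And>k. R k (s k) (s (Suc k))" by blast
  define U where "U k = fst (s k)" for k
  have U: "sol (U k)" "continuous_on \<Omega> (U k)" for k using s(1)[of k] by (auto simp: P_def U_def)
  have dec: "snd (s n) \<le> snd (s m)" if "m \<le> n" for m n
    using that by (induction n rule: dec_induct) (use s(2) R_def order_trans in blast)+
  have diff: "\<not> (AE x in lebesgue_on \<Omega>. U m x = U n x)" if mn: "m < n" for m n
  proof
    assume ae: "AE x in lebesgue_on \<Omega>. U m x = U n x"
    obtain x where x: "x \<in> \<Omega>" "norm (U m x - a x) \<ge> snd (s m)" "snd (s m) > 0"
      using s(1)[of m] by (auto simp: P_def U_def)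
    obtain j where j: "n = Suc j" "m \<le> j" using mn by (cases n) auto
    have "norm (U n x - a x) \<le> snd (s j) / 2" using s(2)[of j] x(1) by (simp add: R_def U_def j(1))
    also have "\<dots> \<le> snd (s m) / 2" using dec[OF j(2)] by simp
    finally show False using x(2,3) continuous_AE_imp_eq[OF op U(2) U(2) ae x(1)] by simp
  qed
  have diff': "\<not> (AE x in lebesgue_on \<Omega>. U m x = U n x)" if "m \<noteq> n" for m n
  proof (cases "m < n")
    case False
    then have "n < m" using that by simp
    from diff[OF this] show ?thesis by (simp add: eq_commute)
  qed (rule diff)
  have "inj U"
  proof (rule injI, rule ccontr)
    fix m n assume "U m = U n" "m \<noteq> n"
    then show False using diff'[of m n] by simp
  qed
  then have "infinite (range U)" by (rule range_inj_infinite)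
  show ?thesis
  proof (intro exI[of _ "range U"] conjI ballI impI)
    show "infinite (range U)" by fact
    show "u \<in> W1_infinity \<Omega>" "energy_momentum_solution \<Omega> W u" "equal_on_boundary \<Omega> u \<phi>" "nowhere_C1 \<Omega> u"
      if "u \<in> range U" for u
      using that U(1) unfolding sol_def by blast+
    fix u w assume uw: "u \<in> range U" "w \<in> range U" "u \<noteq> w"
    obtain m where m: "u = U m" using uw(1) by (rule rangeE)
    obtain n where n: "w = U n" using uw(2) by (rule rangeE)
    have "m \<noteq> n" using uw(3) m n by blast
    then show "\<not> (AE x in lebesgue_on \<Omega>. u x = w x)" unfolding m n by (rule diff')
  qed
qed

end
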